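(* Let $\Omega,\Omega_1,\Omega_2,\Gamma,S,b$, $V=H^1_0(\Omega)$, $H=L^2(\Omega)$, the operator $A$ with domain $D(A)\subset H$ and the nonlinearity $f:H\to H$ be as described in the context; in particular $f$ is Lipschitz and there is a constant $K>0$ such that $(u,f(u))\le K$ and $\|f(u)\|_{H}\le K$ for all $u\in H$. Let $u_0\in V$. Then for any $T>0$ the problem $$\frac{du}{dt}+Au=f(u)\quad\text{as an equality in } L^2(0,T;H),\qquad u(0)=u_0,$$ has a unique solution $u$ with $$u\in L^2(0,T;D(A)),\qquad \frac{du}{dt}\in L^2(0,T;H),$$ and $u\in C^0([0,T];V)$ (after possibly adjusting $u$ on a set of times of measure zero). Furthermore, for each $t\in[0,T]$ the map $u_0\mapsto u(t)$ belongs to $C^0(V;V)$, i.e. it is continuous from $V$ to $V$.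
   Context: Geometry: $N\ge 2$ is an integer, $\Omega\subset\mathbb{R}^N$ is an open domain with compact closure $\overline\Omega$ and boundary $S=\partial\Omega$. $\Gamma\subset\Omega$ is an $(N-1)$-dimensional surface dividing $\Omega$ into two open domains $\Omega_1,\Omega_2$, i.e. $\Gamma=\overline{\Omega}_1\cap\overline{\Omega}_2$, $\Omega=\Omega_1\cup\Omega_2\cup\Gamma$, with $\partial\Omega_1=\Gamma$ and $\partial\Omega_2=S\cup\Gamma$. Both $S$ and $\Gamma$ are of class $C^2$. Diffusion coefficient: $b:\overline{\Omega}_1\cup\Omega_2\to\mathbb{R}$ is given by $b(x)=b_1$ for $x\in\overline{\Omega}_1$ and $b(x)=b_2$ for $x\in\Omega_2$, where $b_1,b_2>0$ are constants. Spaces: $V=H^1_0(\Omega)$ with inner product $(u,v)_V=(u,v)_H+(\nabla u,\nabla v)_H$; $H=L^2(\Omega)$ with inner product $(\cdot,\cdot)$; $V^*$ is the dual of $V$, with duality pairing $\langle\cdot,\cdot\rangle$ between $V^*$ and $V$; $H$ is identified with its dual, so $V\subset H=H^*\subset V^*$. The time derivative $\frac{du}{dt}$ is the weak (distributional) derivative in $t$. Operator: first define the linear operator $A:V\to V^*$ by $\langle Au,v\rangle=a(u,v)$ for all $u,v\in V$, where $a(u,v)=\int_\Omega b\,\nabla u\cdot\nabla v\,dx$. It is bijective with bounded inverse. The operator $A$ is then regarded as an unbounded operator in $H$, namely the inverse of the compact operator $H\hookrightarrow V^*\xrightarrow{A^{-1}}V\hookrightarrow H$; its domain is thus $\{u\in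 V: Au\in H\}$. By the smoothness of the boundaries this domain is $$D(A)=\{u\in V:\ u|_{\Omega_i}\in H^2(\Omega_i)\ (i=1,2),\ [b\nabla u\cdot\nu]_\Gamma=0\},$$ where $\nu$ on $\Gamma$ is a unit normal vector field to $\Gamma$ and $[\cdot]_\Gamma$ denotes the difference on $\Gamma$ of the limiting values (traces) from $\Omega_2$ and from $\Omega_1$. $D(A)$ carries the inner product $(u,v)_{D(A)}=(Au,Av)$. Nonlinearity: $f:L^2(\Omega)\to L^2(\Omega)$ is Lipschitz and there is a constant $K>0$ with $(u,f(u))\le K$ and $\|f(u)\|_{L^2(\Omega)}\le K$ for all $u\in L^2(\Omega)$. *)

theory Defs
  imports "HOL-Analysis.Analysis"
begin

section \<open>The Hilbert space of square-integrable functions\<close>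

text \<open>
  The type \<open>'a L2\<close> is \<open>L\<^sup>2\<close> of the whole space: a.e.-classes of Borel square-integrable functions
  (every Lebesgue measurable function is a.e. equal to a Borel one, so nothing is lost). It is made
  an instance of the classes needed for the Bochner integral of \<open>L\<^sup>2\<close>-valued functions of time.
\<close>

definition sq_integrable :: "('a::euclidean_space \<Rightarrow> real) \<Rightarrow> bool" where
  "sq_integrable f \<longleftrightarrow> f \<in> borel_measurable lborel \<and> integrable lborel (\<lambda>x. (f x)\<^sup>2)"

lemma sq_integrable_measurable [measurable_dest]: "sq_integrable f \<Longrightarrow> f \<in> borel_measurable lborel"
  by (simp add: sq_integrable_def)

lemma sq_integrable_bound:
  assumes "sq_integrable g" "f \<in> borel_measurable lborel" "AE x in lborel. \<bar>f x\<bar> \<le> \<bar>g x\<bar>"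
  shows "sq_integrable f"
  unfolding sq_integrable_def
proof
  show "f \<in> borel_measurable lborel" by fact
  show "integrable lborel (\<lambda>x. (f x)\<^sup>2)"
  proof (rule Bochner_Integration.integrable_bound)
    show "integrable lborel (\<lambda>x. (g x)\<^sup>2)" using assms by (simp add: sq_integrable_def)
    show "(\<lambda>x. (f x)\<^sup>2) \<in> borel_measurable lborel" using assms(2) by measurable
    show "AE x in lborel. norm ((f x)\<^sup>2) \<le> norm ((g x)\<^sup>2)"
      using assms(3) by eventually_elim (simp add: abs_le_square_iff)
  qed
qed

lemma sq_integrable_mult:
  assumes "sq_integrable f" "sq_integrable g"
  shows "integrable lborel (\<lambda>x. f x * g x)"
proof (rule Bochner_Integration.integrable_bound)
  show "integrable lborel (\<lambda>x. (f x)\<^sup>2 + (g x)\<^sup>2)"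
    using assms by (simp add: sq_integrable_def)
  show "(\<lambda>x. f x * g x) \<in> borel_measurable lborel"
    using assms by (intro borel_measurable_times sq_integrable_measurable)
  have "\<bar>f x * g x\<bar> \<le> (f x)\<^sup>2 + (g x)\<^sup>2" for x
  proof -
    have "2 * (\<bar>f x\<bar> * \<bar>g x\<bar>) \<le> \<bar>f x\<bar>\<^sup>2 + \<bar>g x\<bar>\<^sup>2"
      using sum_squares_bound[of "\<bar>f x\<bar>" "\<bar>g x\<bar>"] by (simp add: mult.assoc)
    moreover have "0 \<le> \<bar>f x\<bar> * \<bar>g x\<bar>" by simp
    ultimately show ?thesis unfolding abs_mult power2_abs by linarith
  qed
  then show "AE x in lborel. norm (f x * g x) \<le> norm ((f x)\<^sup>2 + (g x)\<^sup>2)" by simp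
qed

lemma sq_integrable_zero: "sq_integrable (\<lambda>x. 0)"
  by (simp add: sq_integrable_def)

lemma sq_integrable_scale: "sq_integrable f \<Longrightarrow> sq_integrable (\<lambda>x. c * f x)"
  unfolding sq_integrable_def by (simp add: power_mult_distrib borel_measurable_times)

lemma sq_integrable_add:
  assumes "sq_integrable f" "sq_integrable g"
  shows "sq_integrable (\<lambda>x. f x + g x)"
  using assms sq_integrable_mult[OF assms] unfolding sq_integrable_def
  by (intro conjI borel_measurable_add) (simp_all add: power2_sum mult.assoc)

lemma sq_integrable_diff:
  assumes "sq_integrable f" "sq_integrable g"
  shows "sq_integrable (\<lambda>x. f x - g x)"
  using sq_integrable_add[OF assms(1) sq_integrable_scale[OF assms(2), of "-1"]] by simp

quotient_type (overloaded) 'a L2 = "'a::euclidean_space \<Rightarrow> real" / partial: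
  "\<lambda>f g. sq_integrable f \<and> sq_integrable g \<and> (AE x in lborel. f x = g x)"
  morphisms fun_of L2_of
proof (rule part_equivpI)
  show "\<exists>x::'a \<Rightarrow> real. sq_integrable x \<and> sq_integrable x \<and> (AE y in lborel. x y = x y)"
    using sq_integrable_zero by auto
  show "symp (\<lambda>f g::'a \<Rightarrow> real. sq_integrable f \<and> sq_integrable g \<and> (AE x in lborel. f x = g x))"
    by (simp add: symp_def eq_commute)
  show "transp (\<lambda>f g::'a \<Rightarrow> real. sq_integrable f \<and> sq_integrable g \<and> (AE x in lborel. f x = g x))"
    
  proof (rule transpI)
    fix f g h :: "'a \<Rightarrow> real"
    assume "sq_integrable f \<and> sq_integrable g \<and> (AE x in lborel. f x = g x)"
      and "sq_integrable g \<and> sq_integrable h \<and> (AE x in lborel. g x = h x)"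
    then have s: "sq_integrable f" "sq_integrable h"
      and *: "AE x in lborel. f x = g x" "AE x in lborel. g x = h x" by blast+
    from * have "AE x in lborel. f x = h x" by eventually_elim simp
    with s show "sq_integrable f \<and> sq_integrable h \<and> (AE x in lborel. f x = h x)" by blast
  qed
qed

lemma sq_integrable_fun_of [simp]: "sq_integrable (fun_of u)"
  using Quotient3_rep_reflp[OF Quotient3_L2] by blast

lemma fun_of_measurable [measurable]: "fun_of u \<in> borel_measurable lborel"
  using sq_integrable_fun_of sq_integrable_measurable by blast

lemma fun_of_L2_of: "sq_integrable f \<Longrightarrow> AE x in lborel. fun_of (L2_of f) x = f x"
  using rep_abs_rsp[OF Quotient3_L2, of f f] by (auto elim: eventually_mono)

lemma L2_eq_iff: "u = v \<longleftrightarrow> (AE x in lborel. fun_of u x = fun_of v x)"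
  using Quotient3_rel_rep[OF Quotient3_L2, of u v] by auto

lemma L2_of_eqI:
  assumes "sq_integrable f" "AE x in lborel. fun_of u x = f x"
  shows "u = L2_of f"
  unfolding L2_eq_iff using fun_of_L2_of[OF assms(1)] assms(2) by eventually_elim simp

instantiation L2 :: (euclidean_space) real_inner
begin

definition zero_L2 :: "'a L2" where "0 = L2_of (\<lambda>x. 0)"
definition plus_L2 :: "'a L2 \<Rightarrow> 'a L2 \<Rightarrow> 'a L2" where
  "u + v = L2_of (\<lambda>x. fun_of u x + fun_of v x)"
definition minus_L2 :: "'a L2 \<Rightarrow> 'a L2 \<Rightarrow> 'a L2" where
  "u - v = L2_of (\<lambda>x. fun_of u x - fun_of v x)"
definition uminus_L2 :: "'a L2 \<Rightarrow> 'a L2" where "- u = L2_of (\<lambda>x. - fun_of u x)"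
definition scaleR_L2 :: "real \<Rightarrow> 'a L2 \<Rightarrow> 'a L2" where
  "c *\<^sub>R u = L2_of (\<lambda>x. c * fun_of u x)"
definition inner_L2 :: "'a L2 \<Rightarrow> 'a L2 \<Rightarrow> real" where
  "u \<bullet> v = (\<integral>x. fun_of u x * fun_of v x \<partial>lborel)"
definition norm_L2 :: "'a L2 \<Rightarrow> real" where "norm (u::'a L2) = sqrt (u \<bullet> u)"
definition dist_L2 :: "'a L2 \<Rightarrow> 'a L2 \<Rightarrow> real" where "dist (u::'a L2) v = norm (u - v)"
definition sgn_L2 :: "'a L2 \<Rightarrow> 'a L2" where "sgn (u::'a L2) = inverse (norm u) *\<^sub>R u"
definition uniformity_L2 :: "('a L2 \<times> 'a L2) filter" where
  "uniformity = (INF e\<in>{0 <..}. principal {(u, v). dist (u::'a L2) v < e})"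
definition open_L2 :: "'a L2 set \<Rightarrow> bool" where
  "open (U::'a L2 set) \<longleftrightarrow> (\<forall>u\<in>U. \<forall>\<^sub>F (u', v) in uniformity. u' = u \<longrightarrow> v \<in> U)"

lemma AE_zero_L2: "AE x in lborel. fun_of (0::'a L2) x = 0"
  unfolding zero_L2_def by (rule fun_of_L2_of[OF sq_integrable_zero])
lemma AE_plus_L2: "AE x in lborel. fun_of (u + v :: 'a L2) x = fun_of u x + fun_of v x"
  unfolding plus_L2_def by (rule fun_of_L2_of) (simp add: sq_integrable_add)
lemma AE_minus_L2: "AE x in lborel. fun_of (u - v :: 'a L2) x = fun_of u x - fun_of v x"
  unfolding minus_L2_def by (rule fun_of_L2_of) (simp add: sq_integrable_diff)
lemma AE_uminus_L2: "AE x in lborel. fun_of (- u :: 'a L2) x = - fun_of u x"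
  unfolding uminus_L2_def 
  using fun_of_L2_of[OF sq_integrable_scale[OF sq_integrable_fun_of], of "-1" u] by simp
lemma AE_scaleR_L2: "AE x in lborel. fun_of (c *\<^sub>R u :: 'a L2) x = c * fun_of u x"
  unfolding scaleR_L2_def by (rule fun_of_L2_of) (simp add: sq_integrable_scale)

lemma inner_L2_cong:
  assumes "AE x in lborel. fun_of u x * fun_of v x = h x" "h \<in> borel_measurable lborel"
  shows "(u::'a L2) \<bullet> v = (\<integral>x. h x \<partial>lborel)"
  unfolding inner_L2_def by (rule integral_cong_AE) (use assms in auto)

instance
proof
  fix u v w :: "'a L2" and a b :: real
  show "u + v + w = u + (v + w)" unfolding L2_eq_iff
    using AE_plus_L2[of "u+v" w] AE_plus_L2[of u v] AE_plus_L2[of u "v+w"] AE_plus_L2[of v w]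
    by eventually_elim simp
  show "u + v = v + u" unfolding L2_eq_iff
    using AE_plus_L2[of u v] AE_plus_L2[of v u] by eventually_elim simp
  show "0 + u = u" unfolding L2_eq_iff
    using AE_plus_L2[of 0 u] AE_zero_L2 by eventually_elim simp
  show "- u + u = 0" unfolding L2_eq_iff
    using AE_plus_L2[of "-u" u] AE_zero_L2 AE_uminus_L2[of u] by eventually_elim simp
  show "u - v = u + - v" unfolding L2_eq_iff
    using AE_plus_L2[of u "-v"] AE_minus_L2[of u v] AE_uminus_L2[of v] by eventually_elim simp
  show "a *\<^sub>R (u + v) = a *\<^sub>R u + a *\<^sub>R v" unfolding L2_eq_iff
    using AE_scaleR_L2[of a "u+v"] AE_plus_L2[of u v] AE_plus_L2[of "a *\<^sub>R u" "a *\<^sub>R v"]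
      AE_scaleR_L2[of a u] AE_scaleR_L2[of a v] by eventually_elim (simp add: algebra_simps)
  show "(a + b) *\<^sub>R u = a *\<^sub>R u + b *\<^sub>R u" unfolding L2_eq_iff
    using AE_scaleR_L2[of "a+b" u] AE_plus_L2[of "a *\<^sub>R u" "b *\<^sub>R u"]
      AE_scaleR_L2[of a u] AE_scaleR_L2[of b u] by eventually_elim (simp add: algebra_simps)
  show "a *\<^sub>R b *\<^sub>R u = (a * b) *\<^sub>R u" unfolding L2_eq_iff
    using AE_scaleR_L2[of a "b *\<^sub>R u"] AE_scaleR_L2[of b u] AE_scaleR_L2[of "a*b" u]
    by eventually_elim simp
  show "1 *\<^sub>R u = u" unfolding L2_eq_iff
    using AE_scaleR_L2[of 1 u] by eventually_elim simp
  show "dist u v = norm (u - v)" by (rule dist_L2_def)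
  show "sgn u = inverse (norm u) *\<^sub>R u" by (rule sgn_L2_def)
  show "uniformity = (INF e\<in>{0 <..}. principal {(u, v). dist (u::'a L2) v < e})"
    by (rule uniformity_L2_def)
  show "open U \<longleftrightarrow> (\<forall>u\<in>U. \<forall>\<^sub>F (u', v) in uniformity. u' = u \<longrightarrow> v \<in> U)" for U :: "'a L2 set"
    by (rule open_L2_def)
  show "u \<bullet> v = v \<bullet> u" unfolding inner_L2_def by (simp add: mult.commute)
  have I: "integrable lborel (\<lambda>x. fun_of u x * fun_of v x)" for u v :: "'a L2"
    by (rule sq_integrable_mult) simp_all
  show "(u + v) \<bullet> w = u \<bullet> w + v \<bullet> w"
  proof -
    have "(u + v) \<bullet> w = (\<integral>x. fun_of u x * fun_of w x + fun_of v x * fun_of w x \<partial>lborel)"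
      by (rule inner_L2_cong) (use AE_plus_L2[of u v] in \<open>auto elim!: eventually_mono simp: algebra_simps\<close>)
    then show ?thesis unfolding inner_L2_def by (simp add: I)
  qed
  show "(a *\<^sub>R u) \<bullet> v = a * (u \<bullet> v)"
  proof -
    have "(a *\<^sub>R u) \<bullet> v = (\<integral>x. a * (fun_of u x * fun_of v x) \<partial>lborel)"
      by (rule inner_L2_cong) (use AE_scaleR_L2[of a u] in \<open>auto elim!: eventually_mono\<close>)
    then show ?thesis unfolding inner_L2_def by simp
  qed
  show "0 \<le> u \<bullet> u" unfolding inner_L2_def by simp
  have "u \<bullet> u = 0 \<longleftrightarrow> (AE x in lborel. fun_of u x * fun_of u x = 0)"
    unfolding inner_L2_def by (rule integral_nonneg_eq_0_iff_AE) (simp_all add: I)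
  also have "\<dots> \<longleftrightarrow> (AE x in lborel. fun_of u x = fun_of 0 x)"
  proof
    assume "AE x in lborel. fun_of u x * fun_of u x = 0"
    with AE_zero_L2 show "AE x in lborel. fun_of u x = fun_of 0 x" by eventually_elim simp
  next
    assume "AE x in lborel. fun_of u x = fun_of 0 x"
    with AE_zero_L2 show "AE x in lborel. fun_of u x * fun_of u x = 0" by eventually_elim simp
  qed
  finally show "u \<bullet> u = 0 \<longleftrightarrow> u = 0" by (simp add: L2_eq_iff)
  show "norm u = sqrt (u \<bullet> u)" by (rule norm_L2_def)
qed

end

lemma norm_L2_of: 
  assumes "sq_integrable f"
  shows "(norm (L2_of f))\<^sup>2 = (\<integral>x. (f x)\<^sup>2 \<partial>lborel)"
proof -
  have "(norm (L2_of f))\<^sup>2 = L2_of f \<bullet> L2_of f" by (simp add: power2_norm_eq_inner)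
  also have "\<dots> = (\<integral>x. (f x)\<^sup>2 \<partial>lborel)"
    by (rule inner_L2_cong)
      (use fun_of_L2_of[OF assms] assms in \<open>auto elim!: eventually_mono simp: power2_eq_square sq_integrable_def\<close>)
  finally show ?thesis .
qed

lemma norm_L2_fun: "(norm u)\<^sup>2 = (\<integral>x. (fun_of u x)\<^sup>2 \<partial>lborel)"
  unfolding power2_norm_eq_inner inner_L2_def by (simp add: power2_eq_square)

lemma L2_of_fun_of [simp]: "L2_of (fun_of u) = u"
  using L2_of_eqI[OF sq_integrable_fun_of, of u u] by simp

lemma L2_of_diff:
  assumes "sq_integrable f" "sq_integrable g"
  shows "L2_of f - L2_of g = L2_of (\<lambda>x. f x - g x)"
  by (rule L2_of_eqI[OF sq_integrable_diff[OF assms]])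
    (use AE_minus_L2[of "L2_of f" "L2_of g"] fun_of_L2_of[OF assms(1)] fun_of_L2_of[OF assms(2)]
      in \<open>eventually_elim, simp\<close>)

lemma L2_of_add:
  assumes "sq_integrable f" "sq_integrable g"
  shows "L2_of f + L2_of g = L2_of (\<lambda>x. f x + g x)"
  by (rule L2_of_eqI[OF sq_integrable_add[OF assms]])
    (use AE_plus_L2[of "L2_of f" "L2_of g"] fun_of_L2_of[OF assms(1)] fun_of_L2_of[OF assms(2)]
      in \<open>eventually_elim, simp\<close>)

lemma L2_of_scaleR:
  assumes "sq_integrable f"
  shows "c *\<^sub>R L2_of f = L2_of (\<lambda>x. c * f x)"
  by (rule L2_of_eqI[OF sq_integrable_scale[OF assms]])
    (use AE_scaleR_L2[of c "L2_of f"] fun_of_L2_of[OF assms(1)] in \<open>eventually_elim, simp\<close>)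

lemma sq_integrable_sum:
  "(\<And>i. i \<in> I \<Longrightarrow> sq_integrable (f i)) \<Longrightarrow> sq_integrable (\<lambda>x. \<Sum>i\<in>I. f i x)"
  by (induction I rule: infinite_finite_induct) (auto simp: sq_integrable_zero sq_integrable_add)

lemma L2_of_sum:
  "(\<And>i. i \<in> I \<Longrightarrow> sq_integrable (f i)) \<Longrightarrow> (\<Sum>i\<in>I. L2_of (f i)) = L2_of (\<lambda>x. \<Sum>i\<in>I. f i x)"
  by (induction I rule: infinite_finite_induct)
    (auto simp: zero_L2_def[symmetric] L2_of_add sq_integrable_sum)

lemma L2_dominated_convergence:
  assumes "sq_integrable g" "\<And>n. s n \<in> borel_measurable lborel" "f \<in> borel_measurable lborel"
    and "AE x in lborel. (\<lambda>n. s n x) \<longlonglongrightarrow> f x" "\<And>n. AE x in lborel. \<bar>s n x\<bar> \<le> g x"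
  shows "sq_integrable f" "\<And>n. sq_integrable (s n)" "(\<lambda>n. L2_of (s n)) \<longlonglongrightarrow> L2_of f"
proof -
  show s: "sq_integrable (s n)" for n
    
  proof (rule sq_integrable_bound[OF assms(1,2)])
    show "AE x in lborel. \<bar>s n x\<bar> \<le> \<bar>g x\<bar>" using assms(5)[of n] by eventually_elim linarith
  qed
  have all: "AE x in lborel. \<forall>n. \<bar>s n x\<bar> \<le> g x" using assms(5) by (simp add: AE_all_countable)
  have fg: "AE x in lborel. \<bar>f x\<bar> \<le> g x"
    using all assms(4)
  proof eventually_elim
    case (elim x)
    from tendsto_rabs[OF elim(2)] show ?case by (rule LIMSEQ_le_const2) (use elim in auto)
  qed
  show f: "sq_integrable f"
    
  proof (rule sq_integrable_bound[OF assms(1,3)])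
    show "AE x in lborel. \<bar>f x\<bar> \<le> \<bar>g x\<bar>" using fg by eventually_elim linarith
  qed
  have "(\<lambda>n. \<integral>x. (s n x - f x)\<^sup>2 \<partial>lborel) \<longlonglongrightarrow> (\<integral>x. 0 \<partial>(lborel :: 'a measure))"
  proof (rule integral_dominated_convergence)
    show "integrable lborel (\<lambda>x. (2 * g x)\<^sup>2)"
      using sq_integrable_scale[OF assms(1), of 2] by (simp add: sq_integrable_def)
    show "(\<lambda>x. (s i x - f x)\<^sup>2) \<in> borel_measurable lborel" for i
      using assms(2,3) by measurable
    show "AE x in lborel. (\<lambda>i. (s i x - f x)\<^sup>2) \<longlonglongrightarrow> 0"
      using assms(4) by eventually_elim (auto intro!: tendsto_eq_intros)
    show "AE x in lborel. norm ((s i x - f x)\<^sup>2) \<le> (2 * g x)\<^sup>2" for i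
      using all fg
    proof eventually_elim
      case (elim x)
      then have "\<bar>s i x\<bar> \<le> g x" by blast
      then have "\<bar>s i x - f x\<bar> \<le> \<bar>2 * g x\<bar>" using elim(2) by linarith
      then show ?case by (simp only: abs_le_square_iff) simp
    qed
  qed simp
  then have "(\<lambda>n. (norm (L2_of (s n) - L2_of f))\<^sup>2) \<longlonglongrightarrow> 0"
    using s f by (simp add: L2_of_diff norm_L2_of sq_integrable_diff)
  then have "(\<lambda>n. sqrt ((norm (L2_of (s n) - L2_of f))\<^sup>2)) \<longlonglongrightarrow> sqrt 0"
    by (rule tendsto_real_sqrt)
  then show "(\<lambda>n. L2_of (s n)) \<longlonglongrightarrow> L2_of f"
    by (simp add: LIM_zero_iff tendsto_norm_zero_iff)
qed

lemma norm_L2_le_iff: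
  assumes "0 \<le> e"
  shows "norm (u::'a::euclidean_space L2) \<le> e \<longleftrightarrow> (\<integral>\<^sup>+x. ennreal ((fun_of u x)\<^sup>2) \<partial>lborel) \<le> ennreal (e\<^sup>2)"
proof -
  have "(\<integral>\<^sup>+x. ennreal ((fun_of u x)\<^sup>2) \<partial>lborel) = ennreal ((norm u)\<^sup>2)"
    unfolding norm_L2_fun by (rule nn_integral_eq_integral)
      (use sq_integrable_fun_of[of u] in \<open>auto simp: sq_integrable_def\<close>)
  then show ?thesis using assms
    by (simp add: ennreal_le_iff abs_le_square_iff[symmetric])
qed

instance L2 :: (euclidean_space) banach
proof
  fix X :: "nat \<Rightarrow> 'a L2"
  assume C: "Cauchy X"
  have "\<exists>N. \<forall>m\<ge>N. \<forall>n\<ge>N. norm (X m - X n) < (1/2)^k" for k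
    using C[unfolded Cauchy_def, rule_format, of "(1/2)^k"] by (simp add: dist_norm)
  then obtain N where N: "\<And>k m n. m \<ge> N k \<Longrightarrow> n \<ge> N k \<Longrightarrow> norm (X m - X n) < (1/2)^k"
    by metis
  define r where "r k = (\<Sum>i\<le>k. N i) + k" for k
  have rN: "r k \<ge> N k" for k unfolding r_def by (simp add: sum.atMost_Suc_shift trans_le_add1 member_le_sum)
  have rmono: "r k \<le> r (Suc k)" for k unfolding r_def by simp
  have rk: "r k \<ge> k" for k unfolding r_def by simp
  define Y where "Y k = X (r k)" for k
  define d where "d k = L2_of (\<lambda>x. \<bar>fun_of (Y (Suc k)) x - fun_of (Y k) x\<bar>)" for k
  have sqd: "sq_integrable (\<lambda>x. \<bar>fun_of (Y (Suc k)) x - fun_of (Y k) x\<bar>)" for k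
    by (rule sq_integrable_bound[OF sq_integrable_diff[of "fun_of (Y (Suc k))" "fun_of (Y k)"]]) auto
  have nd: "norm (d k) \<le> (1/2)^k" for k
  proof -
    have "(norm (d k))\<^sup>2 = (norm (Y (Suc k) - Y k))\<^sup>2"
      using L2_of_diff[of "fun_of (Y (Suc k))" "fun_of (Y k)"]
      by (simp add: d_def norm_L2_of[OF sqd] norm_L2_of[OF sq_integrable_diff])
    then have "norm (d k) = norm (Y (Suc k) - Y k)" by simp
    also have "\<dots> < (1/2)^k" unfolding Y_def
      by (rule N) (use rN[of k] rmono[of k] in auto)
    finally show ?thesis by simp
  qed
  define D where "D n x = (\<Sum>k<n. \<bar>fun_of (Y (Suc k)) x - fun_of (Y k) x\<bar>)" for n x
  have sqD: "sq_integrable (D n)" for n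
    unfolding D_def by (rule sq_integrable_sum) (rule sqd)
  have nD: "(\<integral>\<^sup>+x. ennreal ((D n x)\<^sup>2) \<partial>lborel) \<le> ennreal 4" for n
  proof -
    have "L2_of (D n) = (\<Sum>k<n. d k)"
      unfolding d_def by (subst L2_of_sum) (auto simp: sqd D_def[abs_def])
    then have "norm (L2_of (D n)) \<le> (\<Sum>k<n. (1/2)^k)"
      by (simp add: sum_norm_le nd)
    also have "\<dots> \<le> 2" by (simp add: sum_gp_strict)
    finally have "(\<integral>\<^sup>+x. ennreal ((fun_of (L2_of (D n)) x)\<^sup>2) \<partial>lborel) \<le> ennreal (2\<^sup>2)"
      by (subst (asm) norm_L2_le_iff) auto
    also have "(\<integral>\<^sup>+x. ennreal ((fun_of (L2_of (D n)) x)\<^sup>2) \<partial>lborel) = (\<integral>\<^sup>+x. ennreal ((D n x)\<^sup>2) \<partial>lborel)"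
      by (rule nn_integral_cong_AE) (use fun_of_L2_of[OF sqD[of n]] in \<open>eventually_elim, simp\<close>)
    finally show ?thesis by simp
  qed
  have Dm [measurable]: "D n \<in> borel_measurable lborel" for n
    using sqD by (rule sq_integrable_measurable)
  have incD: "D n x \<le> D (Suc n) x" "0 \<le> D n x" for n x
    unfolding D_def by (simp_all add: sum_nonneg)
  have "(\<integral>\<^sup>+x. (SUP n. ennreal ((D n x)\<^sup>2)) \<partial>lborel) = (SUP n. \<integral>\<^sup>+x. ennreal ((D n x)\<^sup>2) \<partial>lborel)"
    by (rule nn_integral_monotone_convergence_SUP)
      (auto simp: incseq_Suc_iff le_fun_def incD intro!: ennreal_leI power_mono)
  also have "\<dots> \<le> ennreal 4" by (rule SUP_least) (rule nD)
  also have "\<dots> < \<infinity>" by simp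
  finally have fin: "AE x in lborel. (SUP n. ennreal ((D n x)\<^sup>2)) \<noteq> \<infinity>"
    by (intro nn_integral_noteq_infinite) auto
  have conv: "convergent (\<lambda>k. fun_of (Y k) x)" if fx: "(SUP n. ennreal ((D n x)\<^sup>2)) \<noteq> \<infinity>" for x
  proof -
    obtain c where c: "(SUP n. ennreal ((D n x)\<^sup>2)) = ennreal c" "c \<ge> 0"
      using fx by (cases "(SUP n. ennreal ((D n x)\<^sup>2))") auto
    have "(D n x)\<^sup>2 \<le> c" for n
    proof -
      have "ennreal ((D n x)\<^sup>2) \<le> ennreal c" unfolding c(1)[symmetric] by (rule SUP_upper) simp
      then show ?thesis using c(2) by simp
    qed
    then have "D n x \<le> sqrt c" for n by (simp add: real_le_rsqrt)
    then have "summable (\<lambda>k. \<bar>fun_of (Y (Suc k)) x - fun_of (Y k) x\<bar>)"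
      unfolding D_def by (intro summableI_nonneg_bounded[of _ "sqrt c"]) auto
    then have "summable (\<lambda>k. fun_of (Y (Suc k)) x - fun_of (Y k) x)"
      by (rule summable_rabs_cancel)
    then have "(\<lambda>n. \<Sum>k<n. fun_of (Y (Suc k)) x - fun_of (Y k) x) \<longlonglongrightarrow> (\<Sum>k. fun_of (Y (Suc k)) x - fun_of (Y k) x)"
      by (rule summable_LIMSEQ)
    then have "(\<lambda>n. fun_of (Y n) x - fun_of (Y 0) x) \<longlonglongrightarrow> (\<Sum>k. fun_of (Y (Suc k)) x - fun_of (Y k) x)"
      by (simp only: sum_lessThan_telescope[of "\<lambda>k. fun_of (Y k) x"])
    from tendsto_add[OF this tendsto_const[of "fun_of (Y 0) x"]]
    show ?thesis by (auto simp: convergent_def)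
  qed
  define f where "f x = lim (\<lambda>k. fun_of (Y k) x)" for x
  have fm [measurable]: "f \<in> borel_measurable lborel"
    unfolding f_def[abs_def] by (rule borel_measurable_lim_metric) simp
  have fl: "AE x in lborel. (\<lambda>k. fun_of (Y k) x) \<longlonglongrightarrow> f x"
    using fin by eventually_elim (use conv in \<open>simp add: f_def convergent_LIMSEQ_iff\<close>)
  have est: "(\<integral>\<^sup>+x. ennreal ((f x - fun_of (X n) x)\<^sup>2) \<partial>lborel) \<le> ennreal (((1/2)^k)\<^sup>2)" if n: "n \<ge> N k" for n k
  proof -
    have "(\<integral>\<^sup>+x. ennreal ((f x - fun_of (X n) x)\<^sup>2) \<partial>lborel)
        = (\<integral>\<^sup>+x. liminf (\<lambda>j. ennreal ((fun_of (Y j) x - fun_of (X n) x)\<^sup>2)) \<partial>lborel)"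
    proof (rule nn_integral_cong_AE, use fl in eventually_elim)
      case (elim x)
      have "(\<lambda>j. ennreal ((fun_of (Y j) x - fun_of (X n) x)\<^sup>2)) \<longlonglongrightarrow> ennreal ((f x - fun_of (X n) x)\<^sup>2)"
        by (intro tendsto_ennrealI tendsto_intros elim)
      from lim_imp_Liminf[OF _ this] show ?case by simp
    qed
    also have "\<dots> \<le> liminf (\<lambda>j. \<integral>\<^sup>+x. ennreal ((fun_of (Y j) x - fun_of (X n) x)\<^sup>2) \<partial>lborel)"
      by (rule nn_integral_liminf) simp
    also have "\<dots> \<le> limsup (\<lambda>j. \<integral>\<^sup>+x. ennreal ((fun_of (Y j) x - fun_of (X n) x)\<^sup>2) \<partial>lborel)"
      by (rule Liminf_le_Limsup) simp
    also have "\<dots> \<le> ennreal (((1/2)^k)\<^sup>2)"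
    proof (rule Limsup_bounded)
      show "\<forall>\<^sub>F j in sequentially. (\<integral>\<^sup>+x. ennreal ((fun_of (Y j) x - fun_of (X n) x)\<^sup>2) \<partial>lborel) \<le> ennreal (((1/2)^k)\<^sup>2)"
        using eventually_ge_at_top[of "N k"]
      proof eventually_elim
        case (elim j)
        have "norm (Y j - X n) \<le> (1/2)^k"
          unfolding Y_def using N[of k "r j" n] n elim rk[of j] by simp
        then have "(\<integral>\<^sup>+x. ennreal ((fun_of (Y j - X n) x)\<^sup>2) \<partial>lborel) \<le> ennreal (((1/2)^k)\<^sup>2)"
          by (subst (asm) norm_L2_le_iff) auto
        also have "(\<integral>\<^sup>+x. ennreal ((fun_of (Y j - X n) x)\<^sup>2) \<partial>lborel)
            = (\<integral>\<^sup>+x. ennreal ((fun_of (Y j) x - fun_of (X n) x)\<^sup>2) \<partial>lborel)"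
          by (rule nn_integral_cong_AE) (use AE_minus_L2[of "Y j" "X n"] in \<open>eventually_elim, simp\<close>)
        finally show ?case .
      qed
    qed
    finally show ?thesis .
  qed
  have sqdf: "sq_integrable (\<lambda>x. f x - fun_of (X n) x)" if n: "n \<ge> N k" for n k
    unfolding sq_integrable_def
  proof
    show "integrable lborel (\<lambda>x. (f x - fun_of (X n) x)\<^sup>2)"
    proof (rule integrableI_nonneg)
      have "(\<integral>\<^sup>+x. ennreal ((f x - fun_of (X n) x)\<^sup>2) \<partial>lborel) \<le> ennreal (((1/2)^k)\<^sup>2)"
        by (rule est[OF n])
      also have "\<dots> < \<infinity>" by simp
      finally show "(\<integral>\<^sup>+x. ennreal ((f x - fun_of (X n) x)\<^sup>2) \<partial>lborel) < \<infinity>" .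
    qed auto
  qed simp
  have sqf: "sq_integrable f"
    using sq_integrable_add[OF sqdf[of 0 "N 0"] sq_integrable_fun_of[of "X (N 0)"]]
      sq_integrable_add[OF sqdf[OF order_refl, of 0] sq_integrable_fun_of[of "X (N 0)"]] by simp
  have bd: "norm (L2_of f - X n) \<le> (1/2)^k" if n: "n \<ge> N k" for n k
  proof -
    have "L2_of f - X n = L2_of (\<lambda>x. f x - fun_of (X n) x)"
      using L2_of_diff[OF sqf sq_integrable_fun_of[of "X n"]] by simp
    moreover have "(\<integral>\<^sup>+x. ennreal ((fun_of (L2_of (\<lambda>x. f x - fun_of (X n) x)) x)\<^sup>2) \<partial>lborel)
        = (\<integral>\<^sup>+x. ennreal ((f x - fun_of (X n) x)\<^sup>2) \<partial>lborel)"
      by (rule nn_integral_cong_AE) (use fun_of_L2_of[OF sqdf[OF n]] in \<open>eventually_elim, simp\<close>)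
    ultimately show ?thesis using est[OF n] by (subst norm_L2_le_iff) auto
  qed
  have "X \<longlonglongrightarrow> L2_of f"
    unfolding lim_sequentially
  proof (intro allI impI)
    fix e :: real assume "e > 0"
    then obtain k where k: "(1/2)^k < e" using real_arch_pow_inv[of e "1/2"] by auto
    show "\<exists>no. \<forall>n\<ge>no. dist (X n) (L2_of f) < e"
      using bd[of k] k by (intro exI[of _ "N k"]) (force simp: dist_norm norm_minus_commute)
  qed
  then show "convergent X" by (auto simp: convergent_def)
qed

lemma L2_countable_dense:
  "\<exists>C :: 'a::euclidean_space L2 set. countable C \<and> closure C = UNIV"
proof -
  obtain B :: "'a set set" where B: "countable B" "topological_basis B"
    using ex_countable_basis by blast
  define G where "G = (\<lambda>F. \<Inter>F) ` {F. finite F \<and> F \<subseteq> B}"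
  have Gc: "countable G" unfolding G_def
    using countable_Collect_finite_subset[OF B(1)] by simp
  have Gint: "Int_stable G"
  proof (rule Int_stableI)
    fix a b assume "a \<in> G" "b \<in> G"
    then obtain F F' where *: "a = \<Inter>F" "b = \<Inter>F'" "finite F" "finite F'" "F \<subseteq> B" "F' \<subseteq> B"
      unfolding G_def by auto
    then have "a \<inter> b = \<Inter>(F \<union> F')" "finite (F \<union> F')" "F \<union> F' \<subseteq> B" by auto
    then show "a \<inter> b \<in> G" unfolding G_def by blast
  qed
  have GU: "UNIV \<in> G" unfolding G_def by (rule image_eqI[of _ _ "{}"]) auto
  have BG: "B \<subseteq> G"
  proof
    fix b assume "b \<in> B"
    then show "b \<in> G" unfolding G_def by (intro image_eqI[of _ _ "{b}"]) auto
  qed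
  have Gopen: "open g" if "g \<in> G" for g
    using that topological_basis_open[OF B(2)] unfolding G_def by (auto intro: open_Inter)
  have Gsig: "sets (borel :: 'a measure) = sigma_sets UNIV G"
  proof
    have "sets (borel::'a measure) = sigma_sets UNIV B"
      by (subst borel_eq_countable_basis[OF B]) simp
    also have "\<dots> \<subseteq> sigma_sets UNIV G" using BG by (rule sigma_sets_mono')
    finally show "sets (borel::'a measure) \<subseteq> sigma_sets UNIV G" .
    show "sigma_sets UNIV G \<subseteq> sets (borel::'a measure)"
    proof -
      have "G \<subseteq> sets (borel::'a measure)" using Gopen by auto
      from sets.sigma_sets_subset[OF this] show ?thesis by simp
    qed
  qed
  have bm [measurable]: "ball (0::'a) (real k) \<in> sets borel" for k by simp
  define I where "I A k = L2_of (indicator (A \<inter> ball 0 (real k)) :: 'a \<Rightarrow> real)" for A k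
  have sqI: "sq_integrable (indicator (A \<inter> ball 0 (real k)) :: 'a \<Rightarrow> real)"
    if [measurable]: "A \<in> sets borel" for A k
  proof -
    have "emeasure lborel (A \<inter> ball 0 (real k)) \<le> emeasure lborel (ball (0::'a) (real k))"
      by (rule emeasure_mono) auto
    also have "\<dots> < \<infinity>" using emeasure_bounded_finite[OF bounded_ball[of "0::'a" "real k"]] by simp
    finally have "integrable lborel (indicator (A \<inter> ball 0 (real k)) :: 'a \<Rightarrow> real)"
      by (intro integrable_real_indicator) auto
    moreover have "(indicator (A \<inter> ball 0 (real k)) x :: real)\<^sup>2 = indicator (A \<inter> ball 0 (real k)) x" for x
      by (simp add: indicator_def)
    ultimately show ?thesis unfolding sq_integrable_def by simp
  qed
  define D where "D = range (\<lambda>l::(rat \<times> nat \<times> nat) list.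
      sum_list (map (\<lambda>(q, i, k). real_of_rat q *\<^sub>R I (from_nat_into G i) k) l))"
  have Dc: "countable D" unfolding D_def by simp
  have D0: "0 \<in> D" unfolding D_def by (rule image_eqI[of _ _ "[]"]) auto
  have Dadd: "u + v \<in> D" if uv: "u \<in> D" "v \<in> D" for u v
  proof -
    obtain l l' where "u = sum_list (map (\<lambda>(q, i, k). real_of_rat q *\<^sub>R I (from_nat_into G i) k) l)"
      "v = sum_list (map (\<lambda>(q, i, k). real_of_rat q *\<^sub>R I (from_nat_into G i) k) l')"
      using uv unfolding D_def by blast
    then show ?thesis unfolding D_def by (intro image_eqI[of _ _ "l @ l'"]) auto
  qed
  have Dscale: "real_of_rat p *\<^sub>R u \<in> D" if u: "u \<in> D" for u p
  proof -
    obtain l where l: "u = sum_list (map (\<lambda>(q, i, k). real_of_rat q *\<^sub>R I (from_nat_into G i) k) l)"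
      using u unfolding D_def by blast
    have "real_of_rat p *\<^sub>R u = sum_list (map (\<lambda>(q, i, k). real_of_rat q *\<^sub>R I (from_nat_into G i) k)
        (map (\<lambda>(q, i, k). (p * q, i, k)) l))"
      unfolding l by (induction l) (auto simp: scaleR_add_right of_rat_mult)
    then show ?thesis unfolding D_def by blast
  qed
  have DI: "I g k \<in> D" if g: "g \<in> G" for g k
  proof -
    obtain i where "g = from_nat_into G i" using g Gc by (metis from_nat_into_surj)
    then show ?thesis unfolding D_def by (intro image_eqI[of _ _ "[(1, i, k)]"]) auto
  qed
  have Kadd: "u + v \<in> closure D" if uv: "u \<in> closure D" "v \<in> closure D" for u v
  proof -
    obtain a b where "\<And>n. a n \<in> D" "a \<longlonglongrightarrow> u" "\<And>n. b n \<in> D" "b \<longlonglongrightarrow> v"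
      using uv unfolding closure_sequential by blast
    then have "\<And>n. a n + b n \<in> D" "(\<lambda>n. a n + b n) \<longlonglongrightarrow> u + v"
      by (auto intro: Dadd tendsto_add)
    then show ?thesis unfolding closure_sequential by (intro exI[of _ "\<lambda>n. a n + b n"]) auto
  qed
  have Kscale: "c *\<^sub>R u \<in> closure D" if u: "u \<in> closure D" for c u
  proof -
    obtain a where a: "\<And>n. a n \<in> D" "a \<longlonglongrightarrow> u"
      using u unfolding closure_sequential by blast
    have "\<exists>q. \<bar>real_of_rat q - c\<bar> < inverse (real (Suc n))" for n
    proof -
      obtain q where "c < real_of_rat q" "real_of_rat q < c + inverse (real (Suc n))"
        using of_rat_dense[of c "c + inverse (real (Suc n))"] by auto
      then show ?thesis by (intro exI[of _ q]) auto
    qed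
    then obtain q where q: "\<And>n. \<bar>real_of_rat (q n) - c\<bar> < inverse (real (Suc n))" by metis
    have "(\<lambda>n. real_of_rat (q n) - c) \<longlonglongrightarrow> 0"
      by (rule Lim_null_comparison[OF _ LIMSEQ_inverse_real_of_nat])
        (use q in \<open>auto intro: always_eventually less_imp_le\<close>)
    then have "(\<lambda>n. real_of_rat (q n)) \<longlonglongrightarrow> c" by (rule LIM_zero_cancel)
    then have "(\<lambda>n. real_of_rat (q n) *\<^sub>R a n) \<longlonglongrightarrow> c *\<^sub>R u" using a(2) by (rule tendsto_scaleR)
    with Dscale[OF a(1)] show ?thesis unfolding closure_sequential
      by (intro exI[of _ "\<lambda>n. real_of_rat (q n) *\<^sub>R a n"]) auto
  qed
  have K0: "0 \<in> closure D" using D0 closure_subset by blast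
  have Kdiff: "u - v \<in> closure D" if uv: "u \<in> closure D" "v \<in> closure D" for u v
    using Kadd[OF uv(1) Kscale[OF uv(2), of "-1"]] by simp
  have Ksum_nat: "(\<Sum>i\<in>J. w i) \<in> closure D" if "\<And>i. i \<in> J \<Longrightarrow> w i \<in> closure D" for J :: "nat set" and w
    using that by (induction J rule: infinite_finite_induct) (auto simp: K0 Kadd)
  have Ksum_real: "(\<Sum>i\<in>J. w i) \<in> closure D" if "\<And>i. i \<in> J \<Longrightarrow> w i \<in> closure D" for J :: "real set" and w
    using that by (induction J rule: infinite_finite_induct) (auto simp: K0 Kadd)
  have KI: "I A k \<in> closure D" if A: "A \<in> sets borel" for A k
  proof -
    have "A \<in> sigma_sets UNIV G" using A Gsig by simp
    have GP: "G \<subseteq> Pow UNIV" by simp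
    from Gint GP \<open>A \<in> sigma_sets UNIV G\<close> show ?thesis
    proof (induction rule: sigma_sets_induct_disjoint)
      case (basic A)
      then show ?case using DI closure_subset by blast
    next
      case empty
      then show ?case using K0 by (simp add: I_def zero_L2_def indicator_def[abs_def])
    next
      case (compl A)
      then have [measurable]: "A \<in> sets borel" by (simp add: Gsig)
      have "I (UNIV - A) k = I UNIV k - I A k"
        unfolding I_def using sqI[of UNIV k]
        by (subst L2_of_diff) (auto simp: sqI intro!: arg_cong[of _ _ L2_of] simp: indicator_def fun_eq_iff)
      moreover have "I UNIV k \<in> closure D" using DI[OF GU] closure_subset by blast
      ultimately show ?case using compl Kdiff by simp
    next
      case (union A)
      then have [measurable]: "A i \<in> sets borel" for i using Gsig by auto
      have U: "(\<Union>i. A i) \<in> sets borel" by measurable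
      have eq: "(\<Sum>i<n. indicator (A i \<inter> ball 0 (real k)) x :: real) = indicator ((\<Union>i<n. A i) \<inter> ball 0 (real k)) x" for n x
      proof -
        have "(\<Union>i<n. A i) \<inter> ball 0 (real k) = (\<Union>i<n. A i \<inter> ball 0 (real k))" by auto
        moreover have "indicator (\<Union>i<n. A i \<inter> ball 0 (real k)) x = (\<Sum>i<n. indicator (A i \<inter> ball 0 (real k)) x :: real)"
          by (rule indicator_UN_disjoint)
            (use union(1) in \<open>auto simp: disjoint_family_on_def\<close>)
        ultimately show ?thesis by simp
      qed
      have L: "(\<lambda>n. L2_of (\<lambda>x. indicator ((\<Union>i<n. A i) \<inter> ball 0 (real k)) x :: real)) \<longlonglongrightarrow> I (\<Union>i. A i) k"
        unfolding I_def
      proof (rule L2_dominated_convergence(3)[where g = "indicator ((\<Union>i. A i) \<inter> ball 0 (real k))"])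
        show "sq_integrable (indicator ((\<Union>i. A i) \<inter> ball 0 (real k)) :: 'a \<Rightarrow> real)" by (rule sqI[OF U])
        show "AE x in lborel. (\<lambda>n. indicator ((\<Union>i<n. A i) \<inter> ball 0 (real k)) x :: real)
             \<longlonglongrightarrow> indicator ((\<Union>i. A i) \<inter> ball 0 (real k)) x"
        proof (rule AE_I2)
          fix x
          have "(\<lambda>n. indicator (\<Union>i<n. A i) x :: real) \<longlonglongrightarrow> indicator (\<Union>i. A i) x"
            by (rule LIMSEQ_indicator_UN)
          then have "(\<lambda>n. indicator (\<Union>i<n. A i) x * indicator (ball 0 (real k)) x :: real)
            \<longlonglongrightarrow> indicator (\<Union>i. A i) x * indicator (ball 0 (real k)) x"
            by (rule tendsto_mult) simp
          then show "(\<lambda>n. indicator ((\<Union>i<n. A i) \<inter> ball 0 (real k)) x :: real)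
             \<longlonglongrightarrow> indicator ((\<Union>i. A i) \<inter> ball 0 (real k)) x"
            by (simp add: indicator_inter_arith)
        qed
        show "(indicator ((\<Union>i. A i) \<inter> ball 0 (real k)) :: 'a \<Rightarrow> real) \<in> borel_measurable lborel"
          by measurable
        show "(\<lambda>x. indicator ((\<Union>i<n. A i) \<inter> ball 0 (real k)) x :: real) \<in> borel_measurable lborel" for n
          by measurable
      qed (auto simp: indicator_def)
      have "L2_of (\<lambda>x. indicator ((\<Union>i<n. A i) \<inter> ball 0 (real k)) x :: real) = (\<Sum>i<n. I (A i) k)" for n
        unfolding I_def by (subst L2_of_sum) (auto simp: sqI eq)
      then have "L2_of (\<lambda>x. indicator ((\<Union>i<n. A i) \<inter> ball 0 (real k)) x :: real) \<in> closure D" for n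
        using union Ksum_nat by simp
      then show ?case by (intro closed_sequentially[OF closed_closure _ L]) auto
    qed
  qed
  have "u \<in> closure D" for u
  proof -
    have um: "fun_of u \<in> borel_measurable borel" using fun_of_measurable[of u] by simp
    obtain s where s: "\<And>i. simple_function borel (s i)" "\<And>x. (\<lambda>i. s i x) \<longlonglongrightarrow> fun_of u x"
      "\<And>i x. norm (s i x) \<le> 2 * norm (fun_of u x)"
      using borel_measurable_implies_sequence_metric[OF um, of 0] by auto
    have sm [measurable]: "s i \<in> borel_measurable borel" for i
      using s(1) by (rule borel_measurable_simple_function)
    have fr: "finite (range (s n))" for n using simple_functionD(1)[OF s(1)[of n]] by simp
    have eq: "s n x * indicator (ball 0 (real n)) x
        = (\<Sum>y\<in>range (s n). y * indicator (s n -` {y} \<inter> ball 0 (real n)) x)" for n x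
    proof -
      have "(\<Sum>y\<in>range (s n). y * indicator (s n -` {y} \<inter> ball 0 (real n)) x)
        = (\<Sum>y\<in>range (s n). if y = s n x then y * indicator (ball 0 (real n)) x else 0)"
        by (rule sum.cong) (auto simp: indicator_def)
      also have "\<dots> = s n x * indicator (ball 0 (real n)) x" using fr[of n] by (simp add: sum.delta')
      finally show ?thesis ..
    qed
    have L: "(\<lambda>n. L2_of (\<lambda>x. s n x * indicator (ball 0 (real n)) x)) \<longlonglongrightarrow> L2_of (fun_of u)"
    proof (rule L2_dominated_convergence(3)[where g = "\<lambda>x. 2 * \<bar>fun_of u x\<bar>"])
      show "sq_integrable (\<lambda>x. 2 * \<bar>fun_of u x\<bar>)"
        by (rule sq_integrable_scale, rule sq_integrable_bound[OF sq_integrable_fun_of[of u]]) auto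
      show "AE x in lborel. (\<lambda>n. s n x * indicator (ball 0 (real n)) x) \<longlonglongrightarrow> fun_of u x"
      proof (rule AE_I2)
        fix x :: 'a
        obtain m where m: "norm x < real m" using reals_Archimedean2 by blast
        have "\<forall>\<^sub>F n in sequentially. s n x = s n x * indicator (ball 0 (real n)) x"
          using eventually_ge_at_top[of m] by eventually_elim (use m in \<open>auto simp: indicator_def\<close>)
        with s(2)[of x] show "(\<lambda>n. s n x * indicator (ball 0 (real n)) x) \<longlonglongrightarrow> fun_of u x"
          by (rule Lim_transform_eventually)
      qed
      show "AE x in lborel. \<bar>s n x * indicator (ball 0 (real n)) x\<bar> \<le> 2 * \<bar>fun_of u x\<bar>" for n
        using s(3) by (auto simp: indicator_def)
    qed auto
    have "L2_of (\<lambda>x. s n x * indicator (ball 0 (real n)) x) \<in> closure D" for n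
    proof -
      have b: "s n -` {y} \<in> sets borel" for y
        using measurable_sets[OF sm[of n], of "{y}"] by simp
      have "L2_of (\<lambda>x. s n x * indicator (ball 0 (real n)) x) = (\<Sum>y\<in>range (s n). y *\<^sub>R I (s n -` {y}) n)"
        unfolding I_def L2_of_scaleR[OF sqI[OF b]]
        by (subst L2_of_sum) (auto simp: eq sq_integrable_scale sqI b)
      also have "\<dots> \<in> closure D" by (intro Ksum_real Kscale KI b)
      finally show ?thesis .
    qed
    then have "L2_of (fun_of u) \<in> closure D" by (intro closed_sequentially[OF closed_closure _ L]) auto
    then show ?thesis by simp
  qed
  with Dc show ?thesis by blast
qed

instance L2 :: (euclidean_space) second_countable_topology
proof
  obtain C :: "'a L2 set" where C: "countable C" "closure C = UNIV"
    using L2_countable_dense by blast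
  define B where "B = (\<lambda>(c, q). ball c (real_of_rat q)) ` (C \<times> UNIV)"
  have "topological_basis B"
  proof (rule topological_basisI)
    fix b assume "b \<in> B" then show "open b" unfolding B_def by auto
  next
    fix U and u :: "'a L2" assume "open U" "u \<in> U"
    then obtain e where e: "e > 0" "ball u e \<subseteq> U" using openE by blast
    obtain q where q: "0 < real_of_rat q" "real_of_rat q < e / 2"
      using of_rat_dense[of 0 "e/2"] e by auto
    obtain c where c: "c \<in> C" "dist c u < real_of_rat q"
      using C(2) q(1) closure_approachable[of u C] by blast
    have "u \<in> ball c (real_of_rat q)" using c by simp
    moreover have "ball c (real_of_rat q) \<subseteq> U"
    proof
      fix v assume "v \<in> ball c (real_of_rat q)"
      then have "dist c v < real_of_rat q" by simp
      with c(2) q(2) have "dist u v < e" using dist_triangle3[of u v c] by simp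
      with e show "v \<in> U" by auto
    qed
    ultimately show "\<exists>B'\<in>B. u \<in> B' \<and> B' \<subseteq> U" unfolding B_def using c(1) by blast
  qed
  then have "open = generate_topology B"
    using topological_basis_imp_subbasis by blast
  moreover have "countable B" unfolding B_def using C(1) by simp
  ultimately show "\<exists>B::'a L2 set set. countable B \<and> open = generate_topology B" by blast
qed

section \<open>Smooth functions and hypersurfaces\<close>

definition partial_deriv :: "'a::euclidean_space \<Rightarrow> ('a \<Rightarrow> real) \<Rightarrow> 'a \<Rightarrow> real" where
  "partial_deriv i f x = frechet_derivative f (at x) i"

text \<open>Intended for open \<open>U\<close> only.\<close>

fun C_k_on :: "nat \<Rightarrow> ('a::euclidean_space \<Rightarrow> real) \<Rightarrow> 'a set \<Rightarrow> bool" where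
  "C_k_on 0 f U \<longleftrightarrow> continuous_on U f"
| "C_k_on (Suc k) f U \<longleftrightarrow>
     (\<forall>x\<in>U. f differentiable (at x)) \<and> (\<forall>i\<in>Basis. C_k_on k (partial_deriv i f) U)"

definition test_functions :: "'a::euclidean_space set \<Rightarrow> ('a \<Rightarrow> real) set" where
  "test_functions \<Omega> = {\<phi>. (\<forall>k. C_k_on k \<phi> UNIV) \<and>
     compact (closure {x. \<phi> x \<noteq> 0}) \<and> closure {x. \<phi> x \<noteq> 0} \<subseteq> \<Omega>}"

text \<open>
  A surface of class \<open>C\<^sup>2\<close> and codimension one, as local zero set of a \<open>C\<^sup>2\<close> function with nonvanishing
  gradient. No condition on the side of the surface is needed to get a \<open>C\<^sup>2\<close> boundary of a domain:
  a compact hypersurface without boundary separates the space, so a connected open set whose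
  whole frontier is such a surface lies locally on one side of it.
\<close>

definition C2_hypersurface :: "'a::euclidean_space set \<Rightarrow> bool" where
  "C2_hypersurface M \<longleftrightarrow> (\<forall>p\<in>M. \<exists>U \<psi>. open U \<and> p \<in> U \<and> C_k_on 2 \<psi> U \<and>
     (\<forall>x\<in>U. \<exists>i\<in>Basis. partial_deriv i \<psi> x \<noteq> 0) \<and> M \<inter> U = {x \<in> U. \<psi> x = 0})"

section \<open>Sobolev spaces\<close>

text \<open>
  \<open>L\<^sup>2(\<Omega>)\<close> is the closed subspace of the classes vanishing a.e. outside \<open>\<Omega>\<close>, i.e. functions on \<open>\<Omega>\<close> are
  extended by zero; its inner product is the one of the type.
\<close>

definition L2_on :: "'a::euclidean_space set \<Rightarrow> 'a L2 set" where
  "L2_on \<Omega> = {u. AE x in lborel. x \<notin> \<Omega> \<longrightarrow> fun_of u x = 0}"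

text \<open>Weak derivatives are taken in \<open>\<Omega>\<close> only, and then extended by zero outside \<open>\<Omega>\<close>.\<close>

definition is_weak_partial :: "'a::euclidean_space set \<Rightarrow> 'a \<Rightarrow> 'a L2 \<Rightarrow> 'a L2 \<Rightarrow> bool" where
  "is_weak_partial \<Omega> i u w \<longleftrightarrow> w \<in> L2_on \<Omega> \<and>
     (\<forall>\<phi>\<in>test_functions \<Omega>. (LINT x:\<Omega>|lborel. fun_of u x * partial_deriv i \<phi> x) =
        - (LINT x:\<Omega>|lborel. fun_of w x * \<phi> x))"

definition H1 :: "'a::euclidean_space set \<Rightarrow> 'a L2 set" where
  "H1 \<Omega> = {u \<in> L2_on \<Omega>. \<forall>i\<in>Basis. \<exists>w. is_weak_partial \<Omega> i u w}"

definition weak_partial :: "'a::euclidean_space set \<Rightarrow> 'a \<Rightarrow> 'a L2 \<Rightarrow> 'a L2" where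
  "weak_partial \<Omega> i u = (THE w. is_weak_partial \<Omega> i u w)"

definition inner_H1 :: "'a::euclidean_space set \<Rightarrow> 'a L2 \<Rightarrow> 'a L2 \<Rightarrow> real" where
  "inner_H1 \<Omega> u v = u \<bullet> v + (\<Sum>i\<in>Basis. weak_partial \<Omega> i u \<bullet> weak_partial \<Omega> i v)"

definition norm_H1 :: "'a::euclidean_space set \<Rightarrow> 'a L2 \<Rightarrow> real" where
  "norm_H1 \<Omega> u = sqrt (inner_H1 \<Omega> u u)"

definition H1_0 :: "'a::euclidean_space set \<Rightarrow> 'a L2 set" where
  "H1_0 \<Omega> = {u \<in> H1 \<Omega>. \<forall>\<epsilon>>0. \<exists>\<phi>\<in>test_functions \<Omega>. norm_H1 \<Omega> (u - L2_of \<phi>) < \<epsilon>}"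

section \<open>The diffusion operator\<close>

text \<open>
  The operator from \<open>V\<close> to its dual: \<open>diffusion_op \<Omega> b u\<close> is the functional \<open>v \<mapsto> a(u,v)\<close>, to be
  considered on \<open>v \<in> H1_0 \<Omega>\<close> only.
\<close>

definition diffusion_op ::
    "'a::euclidean_space set \<Rightarrow> ('a \<Rightarrow> real) \<Rightarrow> 'a L2 \<Rightarrow> ('a L2 \<Rightarrow> real)" where
  "diffusion_op \<Omega> b u = (\<lambda>v. LINT x:\<Omega>|lborel.
     b x * (\<Sum>i\<in>Basis. fun_of (weak_partial \<Omega> i u) x * fun_of (weak_partial \<Omega> i v) x))"

text \<open>
  The unbounded operator in \<open>H = L\<^sup>2(\<Omega>)\<close>: an element \<open>h\<close> of \<open>H\<close> is identified with the functional
  \<open>v \<mapsto> (h, v)\<close> on \<open>V\<close>, and the domain consists of the \<open>u \<in> V\<close> whose image is such a functional.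
\<close>

definition represents :: "'a::euclidean_space set \<Rightarrow> 'a L2 \<Rightarrow> ('a L2 \<Rightarrow> real) \<Rightarrow> bool" where
  "represents \<Omega> h F \<longleftrightarrow> h \<in> L2_on \<Omega> \<and> (\<forall>v\<in>H1_0 \<Omega>. F v = h \<bullet> v)"

definition domain_A :: "'a::euclidean_space set \<Rightarrow> ('a \<Rightarrow> real) \<Rightarrow> 'a L2 set" where
  "domain_A \<Omega> b = {u \<in> H1_0 \<Omega>. \<exists>h. represents \<Omega> h (diffusion_op \<Omega> b u)}"

definition op_A :: "'a::euclidean_space set \<Rightarrow> ('a \<Rightarrow> real) \<Rightarrow> 'a L2 \<Rightarrow> 'a L2" where
  "op_A \<Omega> b u = (THE h. represents \<Omega> h (diffusion_op \<Omega> b u))"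

definition norm_DA :: "'a::euclidean_space set \<Rightarrow> ('a \<Rightarrow> real) \<Rightarrow> 'a L2 \<Rightarrow> real" where
  "norm_DA \<Omega> b u = sqrt (op_A \<Omega> b u \<bullet> op_A \<Omega> b u)"

section \<open>Functions of time with values in a normed space\<close>

text \<open>
  \<open>V\<close> and \<open>D(A)\<close> are subspaces of the type \<open>'a L2\<close> with norms of their own, so the following notions
  take a subspace \<open>X\<close> and a norm \<open>nX\<close> on it. Membership in \<open>L\<^sup>2(0,T;X)\<close> means strong measurability
  (a.e. limit in the norm of \<open>X\<close> of \<open>X\<close>-valued simple functions) and square-integrability of the norm.
\<close>

definition L2_time :: "real \<Rightarrow> 'b::real_vector set \<Rightarrow> ('b \<Rightarrow> real) \<Rightarrow> (real \<Rightarrow> 'b) \<Rightarrow> bool" where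
  "L2_time T X nX u \<longleftrightarrow>
     (\<exists>s. (\<forall>k. simple_function (lebesgue_on {0<..<T}) (s k) \<and> s k ` {0<..<T} \<subseteq> X) \<and>
        (AE t in lebesgue_on {0<..<T}. u t \<in> X \<and> (\<lambda>k. nX (s k t - u t)) \<longlonglongrightarrow> 0)) \<and>
     integrable (lebesgue_on {0<..<T}) (\<lambda>t. (nX (u t))\<^sup>2)"

definition C0_time :: "real \<Rightarrow> 'b::real_vector set \<Rightarrow> ('b \<Rightarrow> real) \<Rightarrow> (real \<Rightarrow> 'b) \<Rightarrow> bool" where
  "C0_time T X nX u \<longleftrightarrow>
     (\<forall>t\<in>{0..T}. u t \<in> X \<and> ((\<lambda>s. nX (u s - u t)) \<longlongrightarrow> 0) (at t within {0..T}))"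

definition continuous_self_map :: "'b::real_vector set \<Rightarrow> ('b \<Rightarrow> real) \<Rightarrow> ('b \<Rightarrow> 'b) \<Rightarrow> bool" where
  "continuous_self_map X nX F \<longleftrightarrow>
     (\<forall>x\<in>X. F x \<in> X \<and> (\<forall>\<epsilon>>0. \<exists>\<delta>>0. \<forall>y\<in>X. nX (y - x) < \<delta> \<longrightarrow> nX (F y - F x) < \<epsilon>))"

definition weak_time_deriv ::
    "real \<Rightarrow> (real \<Rightarrow> 'b::{banach, second_countable_topology}) \<Rightarrow> (real \<Rightarrow> 'b) \<Rightarrow> bool" where
  "weak_time_deriv T u w \<longleftrightarrow>
     integrable (lebesgue_on {0<..<T}) u \<and> integrable (lebesgue_on {0<..<T}) w \<and>
     (\<forall>\<phi>\<in>test_functions {0<..<T}.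
        (\<integral>t. deriv \<phi> t *\<^sub>R u t \<partial>lebesgue_on {0<..<T}) =
        - (\<integral>t. \<phi> t *\<^sub>R w t \<partial>lebesgue_on {0<..<T}))"

section \<open>Solutions\<close>

text \<open>
  Only the a.e.-class of \<open>u\<close> on \<open>(0,T)\<close> matters. Since \<open>u\<close> and its weak derivative are in
  \<open>L\<^sup>2(0,T;H)\<close>, the class has a representative \<open>v\<close> that is continuous into \<open>H\<close> on \<open>[0,T]\<close>, and the
  initial condition refers to it.
\<close>

definition is_solution ::
    "'a::euclidean_space set \<Rightarrow> ('a \<Rightarrow> real) \<Rightarrow> ('a L2 \<Rightarrow> 'a L2) \<Rightarrow> real \<Rightarrow> 'a L2 \<Rightarrow>
     (real \<Rightarrow> 'a L2) \<Rightarrow> bool" where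
  "is_solution \<Omega> b f T u\<^sub>0 u \<longleftrightarrow>
     L2_time T (domain_A \<Omega> b) (norm_DA \<Omega> b) u \<and>
     (\<exists>u'. weak_time_deriv T u u' \<and> L2_time T (L2_on \<Omega>) norm u' \<and>
        (AE t in lebesgue_on {0<..<T}. u' t + op_A \<Omega> b (u t) = f (u t))) \<and>
     (\<exists>v. C0_time T (L2_on \<Omega>) norm v \<and> (AE t in lebesgue_on {0<..<T}. v t = u t) \<and> v 0 = u\<^sub>0)"

end

theory Submission
  imports Defs
begin

text \<open>
  Let \<open>V = H\<^sup>1\<^sub>0(\<Omega>)\<close> with the form \<open>a(u,v) = \<integral> b \<nabla>u \<cdot> \<nabla>v\<close>, and \<open>H = L\<^sup>2(\<Omega>)\<close>, the closure of \<open>V\<close>. Minimising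
  \<open>\<parallel>v\<parallel>\<^sup>2 + \<lambda> a(v,v) - 2(h,v)\<close> over \<open>V\<close> gives the resolvent \<open>J\<^sub>\<lambda> = (1 + \<lambda>A)\<^sup>-\<^sup>1\<close> and the bounded Yosida
  approximation \<open>A\<^sub>\<lambda> = (1 - J\<^sub>\<lambda>)/\<lambda>\<close>. The equations \<open>u' + A\<^sub>\<lambda>u = f(u)\<close> are solved by a contraction argument.
  Testing with \<open>A\<^sub>\<lambda>u\<close> bounds \<open>A\<^sub>\<lambda>u\<close> in \<open>L\<^sup>2(0,T;H)\<close> in terms of \<open>a(u\<^sub>0,u\<^sub>0)\<close>, and with it
  \<open>\<parallel>u\<^sub>\<lambda> - u\<^sub>\<mu>\<parallel>\<^sup>2 = O(\<lambda> + \<mu>)\<close> uniformly in time. Since \<open>\<parallel>A\<^sub>\<lambda>v\<parallel>\<close> increases as \<open>\<lambda>\<close> decreases, and is bounded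
  precisely for \<open>v \<in> D(A)\<close>, monotone convergence shows that the limit \<open>u\<close> lies in \<open>D(A)\<close> for almost every
  time, without weak compactness.

  Whenever \<open>u\<close>, \<open>u'\<close>, \<open>Au\<close> are square-integrable, \<open>J\<^sub>\<lambda>u\<close> is uniformly Cauchy for the form as \<open>\<lambda> \<rightarrow> 0\<close>. Hence \<open>u\<close>
  is continuous into \<open>V\<close> and \<open>a(u,u)\<close> has derivative \<open>2(Au,u')\<close>. Applied to a difference \<open>w\<close> of two
  solutions, together with Gronwall's inequality for \<open>\<parallel>w\<parallel>\<^sup>2\<close>, this bounds the \<open>V\<close>-norm of \<open>w(t)\<close> by that of
  \<open>w(0)\<close>, so that solutions are unique and depend Lipschitz continuously on \<open>u\<^sub>0\<close>.
\<close>

subsection \<open>Absolutely continuous paths\<close>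

text \<open>The form is not continuous on \<open>H\<close>, and a path is only the primitive of a
  square-integrable derivative, so \<open>a (u t) (u t)\<close> cannot be differentiated directly.
  Replacing \<open>u\<close> by \<open>J l u\<close> turns the form into the bounded pairing of
  \<open>Y l u\<close> with \<open>J l u\<close>, to which a product rule in integral form applies;
  no factor 1/l survives, because \<open>Y l u = J l (A u)\<close> on the domain and
  \<open>J l\<close> is a contraction. The same commutation handles the limit equation. The terms
  \<open>Yn n (v n t)\<close> are only known to be bounded in L2(0,T;H), so the approximate
  equations are smoothed by a second, fixed resolvent, passed to the limit, and the smoothing is
  removed last. The rate O(\<lambda> + \<mu>) comes from monotonicity at the resolvents: the
  difference of two approximations equals the difference of their resolvents up to \<lambda> and
  \<mu> times their Yosida terms. The form controls the gradient and not the L2 part of the norm of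
  \<open>V\<close>, so differences of solutions are estimated twice. Finally,
  \<open>is_solution\<close> sees a.e. classes only; a du Bois-Reymond argument links it to paths
  that are primitives.\<close>

text \<open>
  Reparametrising \<open>q\<close> by \<open>G\<close> makes it a function with vanishing derivative. With \<open>G\<close> the variation of
  \<open>x\<close> and \<open>y\<close>, this proves the product rule \<open>ac_bilinear\<close> without differentiation almost everywhere.
\<close>

lemma quadratic_increment_imp_constant:
  fixes q :: "real \<Rightarrow> 'b::real_normed_vector" and G :: "real \<Rightarrow> real"
  assumes T: "0 \<le> T" and G: "continuous_on {0..T} G"
    and q: "\<And>s t. 0 \<le> s \<Longrightarrow> s \<le> t \<Longrightarrow> t \<le> T \<Longrightarrow> norm (q t - q s) \<le> C * (G t - G s)\<^sup>2"
    and t: "t \<in> {0..T}"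
  shows "q t = q 0"
proof -
  have q': "norm (q t - q s) \<le> C * (G t - G s)\<^sup>2" if "s \<in> {0..T}" "t \<in> {0..T}" for s t
  proof (cases "s \<le> t")
    case True
    then show ?thesis using q that by auto
  next
    case False
    then have "norm (q s - q t) \<le> C * (G s - G t)\<^sup>2" using q that by auto
    then show ?thesis by (simp add: norm_minus_commute power2_commute)
  qed
  define p where "p y = (SOME s. s \<in> {0..T} \<and> G s = y)" for y
  define h where "h y = q (p y)" for y
  have p: "p y \<in> {0..T}" "G (p y) = y" if "y \<in> G ` {0..T}" for y
  proof -
    have "\<exists>s. s \<in> {0..T} \<and> G s = y" using that by auto
    from someI_ex[OF this] show "p y \<in> {0..T}" "G (p y) = y" unfolding p_def by blast+
  qed
  \<comment> \<open>Times with equal \<open>G\<close> have equal \<open>q\<close>, by the quadratic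
    bound itself, so the choice made by \<open>p\<close> is immaterial.\<close>
  have hq: "h (G s) = q s" if "s \<in> {0..T}" for s
    using q'[OF that p(1)[of "G s"]] p(2)[of "G s"] that by (simp add: h_def)
  have hh: "norm (h y - h z) \<le> C * (y - z)\<^sup>2" if "y \<in> G ` {0..T}" "z \<in> G ` {0..T}" for y z
    using q'[OF p(1)[OF that(2)] p(1)[OF that(1)]] p(2) that by (simp add: h_def)
  have cvx: "convex (G ` {0..T})"
    using connected_continuous_image[OF G] by (simp add: is_interval_connected_1 is_interval_convex_1[symmetric])
  have der: "(h has_derivative (\<lambda>_. 0)) (at z within G ` {0..T})" if z: "z \<in> G ` {0..T}" for z
    unfolding has_derivative_within
  proof (intro conjI)
    show "((\<lambda>y. (1 / norm (y - z)) *\<^sub>R (h y - (h z + 0))) \<longlongrightarrow> 0) (at z within G ` {0..T})"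
    proof (rule Lim_null_comparison)
      show "\<forall>\<^sub>F y in at z within G ` {0..T}. norm ((1 / norm (y - z)) *\<^sub>R (h y - (h z + 0))) \<le> \<bar>C\<bar> * \<bar>y - z\<bar>"
        unfolding eventually_at_filter
      proof (intro always_eventually allI impI)
        fix y assume y: "y \<noteq> z" "y \<in> G ` {0..T}"
        have "norm (h y - h z) \<le> \<bar>C\<bar> * (y - z)\<^sup>2"
          using hh[OF y(2) z] by (smt (verit) mult_right_mono zero_le_power2)
        then show "norm ((1 / norm (y - z)) *\<^sub>R (h y - (h z + 0))) \<le> \<bar>C\<bar> * \<bar>y - z\<bar>"
          using y(1) by (simp add: divide_simps power2_eq_square mult.assoc)
      qed
      have "((\<lambda>y. \<bar>C\<bar> * \<bar>y - z\<bar>) \<longlongrightarrow> \<bar>C\<bar> * \<bar>z - z\<bar>) (at z within G ` {0..T})"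
        by (intro tendsto_intros)
      then show "((\<lambda>y. \<bar>C\<bar> * \<bar>y - z\<bar>) \<longlongrightarrow> 0) (at z within G ` {0..T})" by simp
    qed
  qed auto
  obtain c where "\<And>y. y \<in> G ` {0..T} \<Longrightarrow> h y = c"
    using has_derivative_zero_constant[OF cvx der] by blast
  then show ?thesis using hq[OF t] hq[of 0] t T by auto
qed

text \<open>Absolute continuity in integral form, with the derivative as part of the data and
  determined only up to null sets. Half-open intervals make adjacent pieces disjoint, so that
  integrals split without endpoint corrections.\<close>

definition ac :: "real \<Rightarrow> (real \<Rightarrow> 'b::{banach, second_countable_topology}) \<Rightarrow> (real \<Rightarrow> 'b) \<Rightarrow> bool" where
  "ac T x x' \<longleftrightarrow> set_integrable lebesgue {0<..T} x' \<and>
     (\<forall>s t. 0 \<le> s \<longrightarrow> s \<le> t \<longrightarrow> t \<le> T \<longrightarrow> x t - x s = (LINT r:{s<..t}|lebesgue. x' r))"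

lemma ac_increment:
  "ac T x x' \<Longrightarrow> 0 \<le> s \<Longrightarrow> s \<le> t \<Longrightarrow> t \<le> T \<Longrightarrow> x t - x s = (LINT r:{s<..t}|lebesgue. x' r)"
  unfolding ac_def by blast

lemma set_integrable_Ioc_subset:
  fixes f :: "real \<Rightarrow> 'b::{banach, second_countable_topology}"
  assumes "set_integrable lebesgue {0<..T} f" "0 \<le> s" "t \<le> T"
  shows "set_integrable lebesgue {s<..t} f"
  by (rule set_integrable_subset[OF assms(1)]) (use assms in auto)

lemma set_integral_Ioc_split:
  fixes f :: "real \<Rightarrow> 'b::{banach, second_countable_topology}"
  assumes f: "set_integrable lebesgue {0<..T} f" and st: "0 \<le> s" "s \<le> t" "t \<le> T"
  shows "(LINT r:{0<..t}|lebesgue. f r) - (LINT r:{0<..s}|lebesgue. f r) = (LINT r:{s<..t}|lebesgue. f r)"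
proof -
  have "{0<..t} = {0<..s} \<union> {s<..t}" using st by auto
  moreover have "(LINT r:{0<..s} \<union> {s<..t}|lebesgue. f r)
      = (LINT r:{0<..s}|lebesgue. f r) + (LINT r:{s<..t}|lebesgue. f r)"
    by (rule set_integral_Un) (use st in \<open>auto intro: set_integrable_Ioc_subset[OF f]\<close>)
  ultimately show ?thesis by simp
qed

lemma ac_iff:
  "ac T x x' \<longleftrightarrow> set_integrable lebesgue {0<..T} x' \<and>
     (\<forall>t\<in>{0..T}. x t = x 0 + (LINT r:{0<..t}|lebesgue. x' r))" (is "?l \<longleftrightarrow> ?r")
proof
  assume l: ?l
  show ?r
  proof (intro conjI ballI)
    fix t assume "t \<in> {0..T}"
    then have "x t - x 0 = (LINT r:{0<..t}|lebesgue. x' r)" using ac_increment[OF l, of 0 t] by simp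
    then show "x t = x 0 + (LINT r:{0<..t}|lebesgue. x' r)" by (simp add: algebra_simps)
  qed (use l ac_def in blast)
next
  assume r: ?r
  show ?l unfolding ac_def
  proof (intro conjI allI impI)
    fix s t :: real assume st: "0 \<le> s" "s \<le> t" "t \<le> T"
    have "x t = x 0 + (LINT r:{0<..t}|lebesgue. x' r)" "x s = x 0 + (LINT r:{0<..s}|lebesgue. x' r)"
      by (rule bspec[OF conjunct2[OF r]], use st in simp)+
    then show "x t - x s = (LINT r:{s<..t}|lebesgue. x' r)"
      using set_integral_Ioc_split[OF conjunct1[OF r] st] by (simp add: algebra_simps)
  qed (use r in blast)
qed

lemma ac_integrable: "ac T x x' \<Longrightarrow> set_integrable lebesgue {0<..T} x'"
  unfolding ac_def by blast

lemma ac_eq: "ac T x x' \<Longrightarrow> 0 \<le> t \<Longrightarrow> t \<le> T \<Longrightarrow> x t = x 0 + (LINT r:{0<..t}|lebesgue. x' r)"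
  unfolding ac_iff by (meson atLeastAtMost_iff)

text \<open>The endpoint 0 is a null set, so this is the gauge integral over \<open>{0..t}\<close>,
  whose primitive is known to be continuous.\<close>

lemma continuous_on_indefinite_Ioc:
  fixes f :: "real \<Rightarrow> real"
  assumes f: "set_integrable lebesgue {0<..T} f"
  shows "continuous_on {0..T} (\<lambda>t. LINT r:{0<..t}|lebesgue. f r)"
proof -
  have "set_integrable lebesgue {0..T} f \<longleftrightarrow> set_integrable lebesgue {0<..T} f"
    by (rule set_integrable_discrete_difference[of "{0}"]) auto
  then have f': "f absolutely_integrable_on {0..T}" using f by simp
  have eq: "(LINT r:{0<..t}|lebesgue. f r) = integral {0..t} f" if "t \<in> {0..T}" for t
  proof -
    have "(LINT r:{0<..t}|lebesgue. f r) = (LINT r:{0..t}|lebesgue. f r)"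
      by (rule set_integral_discrete_difference[of "{0}"]) auto
    also have "\<dots> = integral {0..t} f"
      by (rule set_lebesgue_integral_eq_integral(2), rule set_integrable_subset[OF f']) (use that in auto)
    finally show ?thesis .
  qed
  have "continuous_on {0..T} (\<lambda>t. integral {0..t} f)"
    using set_lebesgue_integral_eq_integral(1)[OF f'] by (rule indefinite_integral_continuous_1)
  then show ?thesis by (rule continuous_on_eq) (simp only: eq)
qed

text \<open>The right side is the increment of the variation of \<open>x\<close>. It is both a
  modulus of continuity and the clock that \<open>quadratic_increment_imp_constant\<close>
  needs.\<close>

lemma ac_increment_bound:
  assumes x: "ac T x x'" and st: "0 \<le> s" "s \<le> t" "t \<le> T"
  shows "norm (x t - x s) \<le> (LINT r:{0<..t}|lebesgue. norm (x' r)) - (LINT r:{0<..s}|lebesgue. norm (x' r))"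
proof -
  have i: "set_integrable lebesgue {0<..T} x'" using x by (rule ac_integrable)
  have "norm (x t - x s) = norm (LINT r:{s<..t}|lebesgue. x' r)" using ac_increment[OF x st] by simp
  also have "\<dots> \<le> (LINT r:{s<..t}|lebesgue. norm (x' r))"
    by (rule set_integral_norm_bound) (use st in \<open>auto intro: set_integrable_Ioc_subset[OF i]\<close>)
  also have "\<dots> = (LINT r:{0<..t}|lebesgue. norm (x' r)) - (LINT r:{0<..s}|lebesgue. norm (x' r))"
    by (rule set_integral_Ioc_split[symmetric, OF set_integrable_norm[OF i] st])
  finally show ?thesis .
qed

lemma ac_continuous_on:
  assumes x: "ac T x x'"
  shows "continuous_on {0..T} x"
proof -
  let ?G = "\<lambda>t. LINT r:{0<..t}|lebesgue. norm (x' r)"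
  have i: "set_integrable lebesgue {0<..T} x'" using x by (rule ac_integrable)
  have G: "continuous_on {0..T} ?G"
    by (rule continuous_on_indefinite_Ioc[OF set_integrable_norm[OF i]])
  have d: "dist (x t) (x s) \<le> dist (?G t) (?G s)" if "s \<in> {0..T}" "t \<in> {0..T}" for s t
  proof (cases "s \<le> t")
    case True
    then show ?thesis using ac_increment_bound[OF x, of s t] that by (auto simp: dist_norm)
  next
    case False
    then show ?thesis using ac_increment_bound[OF x, of t s] that
      by (auto simp: dist_norm norm_minus_commute)
  qed
  show ?thesis unfolding continuous_on_iff
  proof (intro ballI allI impI)
    fix s e :: real assume s: "s \<in> {0..T}" "0 < e"
    then obtain d' where "d' > 0" "\<forall>t\<in>{0..T}. dist t s < d' \<longrightarrow> dist (?G t) (?G s) < e"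
      using G unfolding continuous_on_iff by metis
    then show "\<exists>d>0. \<forall>t\<in>{0..T}. dist t s < d \<longrightarrow> dist (x t) (x s) < e"
      using d[OF s(1)] by (meson order_le_less_trans)
  qed
qed

lemma set_integral_bounded_linear:
  assumes "bounded_linear B" "set_integrable M A f"
  shows "set_integrable M A (\<lambda>x. B (f x))" "(LINT x:A|M. B (f x)) = B (LINT x:A|M. f x)"
  using integrable_bounded_linear[OF assms(1), of M "\<lambda>x. indicator A x *\<^sub>R f x"]
    integral_bounded_linear[OF assms(1), of M "\<lambda>x. indicator A x *\<^sub>R f x"] assms(2)
  by (simp_all add: set_integrable_def set_lebesgue_integral_def linear_simps[OF assms(1)])

lemma ac_add:
  assumes x: "ac T x x'" and y: "ac T y y'"
  shows "ac T (\<lambda>t. x t + y t) (\<lambda>t. x' t + y' t)"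
  unfolding ac_iff
proof (intro conjI ballI)
  fix t assume "t \<in> {0..T}"
  then have t: "0 \<le> t" "t \<le> T" by auto
  note i = set_integrable_Ioc_subset[OF ac_integrable order_refl t(2)]
  show "x t + y t = x 0 + y 0 + (LINT r:{0<..t}|lebesgue. x' r + y' r)"
    unfolding set_integral_add(2)[OF i[OF x] i[OF y]] ac_eq[OF x t] ac_eq[OF y t] by simp
qed (intro set_integral_add(1) ac_integrable[OF x] ac_integrable[OF y])

lemma ac_bounded_linear:
  assumes B: "bounded_linear B" and x: "ac T x x'"
  shows "ac T (\<lambda>t. B (x t)) (\<lambda>t. B (x' t))"
  unfolding ac_iff
proof (intro conjI ballI)
  fix t assume "t \<in> {0..T}"
  then have t: "0 \<le> t" "t \<le> T" by auto
  show "B (x t) = B (x 0) + (LINT r:{0<..t}|lebesgue. B (x' r))"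
    unfolding set_integral_bounded_linear(2)[OF B set_integrable_Ioc_subset[OF ac_integrable[OF x] order_refl t(2)]]
      ac_eq[OF x t] by (rule linear_add[OF bounded_linear.linear[OF B]])
qed (rule set_integral_bounded_linear(1)[OF B ac_integrable[OF x]])

lemma ac_diff: "ac T x x' \<Longrightarrow> ac T y y' \<Longrightarrow> ac T (\<lambda>t. x t - y t) (\<lambda>t. x' t - y' t)"
  using ac_add[of T x x' "\<lambda>t. - y t" "\<lambda>t. - y' t"]
    ac_bounded_linear[OF bounded_linear_minus[OF bounded_linear_ident], of T y y'] by simp

lemma set_integrable_Ioc_continuous:
  fixes f :: "real \<Rightarrow> 'b::{banach, second_countable_topology}"
  assumes "continuous_on {0..T} f"
  shows "set_integrable lebesgue {0<..T} f"
proof -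
  have "set_integrable lborel {0..T} f" using assms by (rule borel_integrable_atLeastAtMost')
  then have "integrable lborel (\<lambda>x. indicator {0..T} x *\<^sub>R f x)" by (simp add: set_integrable_def)
  then have "set_integrable lebesgue {0..T} f" unfolding set_integrable_def
    by (subst integrable_completion) auto
  then show ?thesis by (rule set_integrable_subset) auto
qed

lemma ac_primitive:
  assumes "set_integrable lebesgue {0<..T} x'"
  shows "ac T (\<lambda>t. c + (LINT r:{0<..t}|lebesgue. x' r)) x'"
  unfolding ac_iff using assms by (simp add: set_lebesgue_integral_def)

text \<open>Measurability comes from extending both factors by zero: \<open>pr\<close> vanishes
  where they do, so the product is extended by zero as well. Continuity of \<open>x\<close> on a
  compact interval supplies the bound.\<close>

lemma set_integrable_bilinear:
  assumes p: "bounded_bilinear pr"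
    and x: "continuous_on {0..T} (x :: real \<Rightarrow> 'a::{banach, second_countable_topology})"
    and y: "set_integrable lebesgue {0<..T} (y :: real \<Rightarrow> 'b::{banach, second_countable_topology})"
  shows "set_integrable lebesgue {0<..T} (\<lambda>t. pr (x t) (y t) :: 'c::{banach, second_countable_topology})"
proof -
  interpret bounded_bilinear pr by fact
  obtain B where B: "B \<ge> 0" "\<And>t. t \<in> {0..T} \<Longrightarrow> norm (x t) \<le> B"
    using compact_imp_bounded[OF compact_continuous_image[OF x]]
    by (metis bounded_pos compact_Icc image_eqI less_imp_le)
  obtain K where K: "K \<ge> 0" "\<And>a b. norm (pr a b) \<le> norm a * norm b * K" using nonneg_bounded by blast
  have my: "(\<lambda>t. indicator {0<..T} t *\<^sub>R y t) \<in> borel_measurable lebesgue"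
    using y by (simp add: set_integrable_def borel_measurable_integrable)
  have mx: "(\<lambda>t. indicator {0<..T} t *\<^sub>R x t) \<in> borel_measurable lebesgue"
    using set_integrable_Ioc_continuous[OF x] by (simp add: set_integrable_def borel_measurable_integrable)
  have c: "continuous_on UNIV (\<lambda>z. pr (fst z) (snd z))" by (intro continuous_on continuous_intros)
  have "(\<lambda>t. pr (indicator {0<..T} t *\<^sub>R x t) (indicator {0<..T} t *\<^sub>R y t)) \<in> borel_measurable lebesgue"
    by (rule borel_measurable_continuous_Pair[OF mx my c])
  then have m: "set_borel_measurable lebesgue {0<..T} (\<lambda>t. pr (x t) (y t))"
    unfolding set_borel_measurable_def
    by (rule back_subst[of "\<lambda>f. f \<in> borel_measurable lebesgue"]) (auto simp: indicator_def zero_left)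
  have "set_integrable lebesgue {0<..T} (\<lambda>t. (B * K) * norm (y t))"
    by (intro set_integrable_mult_right set_integrable_norm y)
  then show ?thesis
  proof (rule set_integrable_bound)
    show "AE t in lebesgue. t \<in> {0<..T} \<longrightarrow> norm (pr (x t) (y t)) \<le> norm (B * K * norm (y t))"
    proof (intro AE_I2 impI)
      fix t assume "t \<in> {0<..T}"
      then have "norm (x t) * norm (y t) * K \<le> B * norm (y t) * K"
        by (intro mult_right_mono B(2) K(1)) auto
      then show "norm (pr (x t) (y t)) \<le> norm (B * K * norm (y t))"
        using K(2)[of "x t" "y t"] B(1) K(1) by (simp add: abs_mult mult_ac)
    qed
  qed (fact m)
qed

lemma set_integral_norm_le:
  fixes f :: "real \<Rightarrow> 'b::{banach, second_countable_topology}"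
  assumes "set_integrable M A f" "set_integrable M A g" "\<And>t. t \<in> A \<Longrightarrow> norm (f t) \<le> g t"
  shows "norm (LINT t:A|M. f t) \<le> (LINT t:A|M. g t)"
proof -
  have "norm (LINT t:A|M. f t) \<le> (LINT t:A|M. norm (f t))"
    by (rule set_integral_norm_bound[OF assms(1)])
  also have "\<dots> \<le> (LINT t:A|M. g t)"
    by (rule set_integral_mono) (use assms set_integrable_norm in auto)
  finally show ?thesis .
qed

text \<open>Let \<open>q\<close> be the product minus the candidate primitive. Its increment over
  \<open>{s<..t}\<close> is the integral of
  \<open>pr (x' r) (y t - y r) + pr (x s - x r) (y' r)\<close>: in each term one factor is bounded
  by the variation over the interval and the other integrates to at most that variation, which gives
  a quadratic bound.\<close>

lemma ac_bilinear:
  fixes x :: "real \<Rightarrow> 'a::{banach, second_countable_topology}"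
    and y :: "real \<Rightarrow> 'b::{banach, second_countable_topology}"
    and pr :: "'a \<Rightarrow> 'b \<Rightarrow> 'c::{banach, second_countable_topology}"
  assumes p: "bounded_bilinear pr" and T: "0 \<le> T" and x: "ac T x x'" and y: "ac T y y'"
  shows "ac T (\<lambda>t. pr (x t) (y t)) (\<lambda>t. pr (x' t) (y t) + pr (x t) (y' t))"
proof -
  interpret bounded_bilinear pr by fact
  interpret f: bounded_bilinear "\<lambda>b a. pr a b" by (rule flip)
  obtain K where K: "K \<ge> 0" "\<And>a b. norm (pr a b) \<le> norm a * norm b * K" using nonneg_bounded by blast
  define X where "X t = (LINT r:{0<..t}|lebesgue. norm (x' r))" for t
  define Y where "Y t = (LINT r:{0<..t}|lebesgue. norm (y' r))" for t
  define D where "D t = pr (x' t) (y t) + pr (x t) (y' t)" for t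
  have ix: "set_integrable lebesgue {0<..T} x'" and iy: "set_integrable lebesgue {0<..T} y'"
    using x y by (auto dest: ac_integrable)
  have i1: "set_integrable lebesgue {0<..T} (\<lambda>t. pr (x' t) (y t))"
    by (rule set_integrable_bilinear[OF flip ac_continuous_on[OF y] ix])
  have i2: "set_integrable lebesgue {0<..T} (\<lambda>t. pr (x t) (y' t))"
    by (rule set_integrable_bilinear[OF p ac_continuous_on[OF x] iy])
  have iD: "set_integrable lebesgue {0<..T} D" unfolding D_def by (rule set_integral_add(1)[OF i1 i2])
  define q where "q t = pr (x t) (y t) - (LINT r:{0<..t}|lebesgue. D r)" for t
  have mono: "X s \<le> X t" "Y s \<le> Y t" if "0 \<le> s" "s \<le> t" "t \<le> T" for s t
    using ac_increment_bound[OF x that] ac_increment_bound[OF y that] norm_ge_zero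
    unfolding X_def Y_def by (smt (verit))+
  have est: "norm (q t - q s) \<le> (2 * K) * ((X t + Y t) - (X s + Y s))\<^sup>2"
    if st: "0 \<le> s" "s \<le> t" "t \<le> T" for s t
  proof -
    let ?I = "{s<..t}"
    note sub = set_integrable_Ioc_subset[OF _ st(1) st(3)]
    have a: "(LINT r:?I|lebesgue. pr (x' r) (y t)) = pr (x t - x s) (y t)"
      using set_integral_bounded_linear(2)[OF bounded_linear_left sub[OF ix], of "y t"] ac_increment[OF x st]
      by simp
    have b: "(LINT r:?I|lebesgue. pr (x s) (y' r)) = pr (x s) (y t - y s)"
      using set_integral_bounded_linear(2)[OF bounded_linear_right sub[OF iy], of "x s"] ac_increment[OF y st]
      by simp
    have ia: "set_integrable lebesgue ?I (\<lambda>r. pr (x' r) (y t))"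
      using set_integral_bounded_linear(1)[OF bounded_linear_left sub[OF ix]] .
    have ib: "set_integrable lebesgue ?I (\<lambda>r. pr (x s) (y' r))"
      using set_integral_bounded_linear(1)[OF bounded_linear_right sub[OF iy]] .
    have e1: "q t - q s = (pr (x t - x s) (y t) + pr (x s) (y t - y s)) - (LINT r:?I|lebesgue. D r)"
      unfolding q_def set_integral_Ioc_split[OF iD st, symmetric] by (simp add: diff_left diff_right)
    also have "\<dots> = (LINT r:?I|lebesgue. (pr (x' r) (y t) + pr (x s) (y' r)) - D r)"
      using a b ia ib sub[OF iD] by (simp add: set_integral_diff set_integral_add)
    also have "\<dots> = (LINT r:?I|lebesgue. pr (x' r) (y t - y r) + pr (x s - x r) (y' r))"
      by (simp add: D_def diff_left diff_right algebra_simps)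
    finally have e: "q t - q s = (LINT r:?I|lebesgue. pr (x' r) (y t - y r) + pr (x s - x r) (y' r))" .
    have ii: "set_integrable lebesgue ?I (\<lambda>r. (pr (x' r) (y t) + pr (x s) (y' r)) - D r)"
      by (intro set_integral_diff(1) set_integral_add(1) ia ib sub[OF iD])
    then have ii: "set_integrable lebesgue ?I (\<lambda>r. pr (x' r) (y t - y r) + pr (x s - x r) (y' r))"
      by (simp add: D_def diff_left diff_right algebra_simps)
    let ?d = "(X t + Y t) - (X s + Y s)"
    have d0: "0 \<le> ?d" using mono[OF st] by simp
    have alg2: "(k * d) * d \<le> (2 * k) * d\<^sup>2" if "0 \<le> k" for k d :: real
      using mult_nonneg_nonneg[OF that zero_le_power2[of d]] by (simp add: power2_eq_square mult_ac)
    have alg: "a * d * K + d * b * K = (K * d) * (a + b)" for a b d :: real by (simp add: algebra_simps)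
    have ig: "set_integrable lebesgue ?I (\<lambda>r. (K * ?d) * (norm (x' r) + norm (y' r)))"
      by (intro set_integrable_mult_right set_integral_add(1) set_integrable_norm sub[OF ix] sub[OF iy])
    have "norm (q t - q s) \<le> (LINT r:?I|lebesgue. (K * ?d) * (norm (x' r) + norm (y' r)))"
      unfolding e
    proof (rule set_integral_norm_le[OF ii ig])
      fix r assume r: "r \<in> ?I"
      then have r': "0 \<le> s" "s \<le> r" "r \<le> T" "0 \<le> r" "r \<le> t" "t \<le> T" using st by auto
      have y1: "norm (y t - y r) \<le> ?d"
        using ac_increment_bound[OF y r'(4,5,6)] mono[OF r'(1-3)] mono[OF r'(4-6)] unfolding X_def[symmetric] Y_def[symmetric] by linarith
      have x1: "norm (x s - x r) \<le> ?d"
        using ac_increment_bound[OF x r'(1,2,3)] mono[OF r'(1-3)] mono[OF r'(4-6)] unfolding X_def[symmetric] Y_def[symmetric]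
        by (simp add: norm_minus_commute)
      have "norm (pr (x' r) (y t - y r) + pr (x s - x r) (y' r))
        \<le> norm (x' r) * norm (y t - y r) * K + norm (x s - x r) * norm (y' r) * K"
        by (rule norm_triangle_le) (intro add_mono K(2))
      also have "\<dots> \<le> norm (x' r) * ?d * K + ?d * norm (y' r) * K"
        by (intro add_mono mult_right_mono mult_left_mono x1 y1 K(1)) auto
      also have "\<dots> = (K * ?d) * (norm (x' r) + norm (y' r))"
        by (rule alg)
      finally show "norm (pr (x' r) (y t - y r) + pr (x s - x r) (y' r)) \<le> (K * ?d) * (norm (x' r) + norm (y' r))" .
    qed
    also have "\<dots> = (K * ?d) * ((LINT r:?I|lebesgue. norm (x' r)) + (LINT r:?I|lebesgue. norm (y' r)))"
      using set_integrable_norm[OF sub[OF ix]] set_integrable_norm[OF sub[OF iy]] by (simp add: set_integral_add)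
    also have "\<dots> = (K * ?d) * ?d"
      unfolding set_integral_Ioc_split[OF set_integrable_norm[OF ix] st, symmetric]
        set_integral_Ioc_split[OF set_integrable_norm[OF iy] st, symmetric] X_def Y_def by simp
    also have "\<dots> \<le> (2 * K) * ?d\<^sup>2" by (rule alg2[OF K(1)])
    finally show ?thesis .
  qed
  have G: "continuous_on {0..T} (\<lambda>t. X t + Y t)"
    unfolding X_def Y_def by (intro continuous_on_add continuous_on_indefinite_Ioc set_integrable_norm ix iy)
  show ?thesis unfolding ac_iff D_def[symmetric]
  proof (intro conjI iD ballI)
    fix t assume "t \<in> {0..T}"
    from quadratic_increment_imp_constant[OF T G est this]
    show "pr (x t) (y t) = pr (x 0) (y 0) + (LINT r:{0<..t}|lebesgue. D r)"
      unfolding q_def by (simp add: set_lebesgue_integral_def algebra_simps)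
  qed
qed

lemma ac_mono:
  fixes x :: "real \<Rightarrow> real"
  assumes x: "ac T x x'" and g: "set_integrable lebesgue {0<..T} g"
    and le: "AE t in lebesgue. t \<in> {0<..T} \<longrightarrow> x' t \<le> g t" and t: "0 \<le> t" "t \<le> T"
  shows "x t \<le> x 0 + (LINT r:{0<..t}|lebesgue. g r)"
proof -
  have "(LINT r:{0<..t}|lebesgue. x' r) \<le> (LINT r:{0<..t}|lebesgue. g r)"
    by (rule set_integral_mono_AE)
      (use le t in \<open>auto intro: set_integrable_Ioc_subset ac_integrable[OF x] g elim!: eventually_mono\<close>)
  then show ?thesis using ac_eq[OF x t] by simp
qed

lemma set_integral_Ioc_mono_upper:
  fixes g :: "real \<Rightarrow> real"
  assumes g: "set_integrable lebesgue {0<..T} g" "\<And>t. t \<in> {0<..T} \<Longrightarrow> 0 \<le> g t" and t: "0 \<le> t" "t \<le> T"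
  shows "(LINT r:{0<..t}|lebesgue. g r) \<le> (LINT r:{0<..T}|lebesgue. g r)"
proof -
  have "0 \<le> (LINT r:{t<..T}|lebesgue. g r)"
    unfolding set_lebesgue_integral_def by (rule Bochner_Integration.integral_nonneg) (use g(2) t in \<open>auto simp: indicator_def\<close>)
  then show ?thesis using set_integral_Ioc_split[OF g(1) t(1,2) order_refl] by simp
qed

lemma ac_C1:
  fixes f :: "real \<Rightarrow> real"
  assumes f: "\<And>t. (f has_real_derivative f' t) (at t)" and f': "continuous_on UNIV f'"
  shows "ac T f f'"
  unfolding ac_iff
proof (intro conjI ballI)
  have c: "continuous_on {0..t} f'" for t by (rule continuous_on_subset[OF f']) simp
  show i: "set_integrable lebesgue {0<..T} f'" by (rule set_integrable_Ioc_continuous[OF c])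
  fix t assume t: "t \<in> {0..T}"
  have "(f' has_integral (f t - f 0)) {0..t}"
    by (rule fundamental_theorem_of_calculus)
      (use t f in \<open>auto simp: has_real_derivative_iff_has_vector_derivative[symmetric] intro: has_field_derivative_at_within\<close>)
  then have "integral {0..t} f' = f t - f 0" by (rule integral_unique)
  moreover have "(LINT r:{0<..t}|lebesgue. f' r) = (LINT r:{0..t}|lebesgue. f' r)"
    by (rule set_integral_discrete_difference[of "{0}"]) auto
  moreover have "(LINT r:{0..t}|lebesgue. f' r) = integral {0..t} f'"
  proof (rule set_lebesgue_integral_eq_integral(2))
    have "set_integrable lebesgue {0..t} f' \<longleftrightarrow> set_integrable lebesgue {0<..t} f'"
      by (rule set_integrable_discrete_difference[of "{0}"]) auto
    then show "set_integrable lebesgue {0..t} f'" using set_integrable_Ioc_continuous[OF c] by blast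
  qed
  ultimately show "f t = f 0 + (LINT r:{0<..t}|lebesgue. f' r)" by linarith
qed

lemma ac_exp: "ac T (\<lambda>t. exp (c * t)) (\<lambda>t. c * exp (c * t))"
  by (rule ac_C1) (auto intro!: derivative_eq_intros continuous_intros)

text \<open>Integrating factor \<open>exp (- c * t)\<close>, with \<open>ac_bilinear\<close> as
  product rule. The weight on \<open>g\<close> is at most 1 and \<open>g\<close> is nonnegative, so
  the weight is dropped and the integral extended to \<open>T\<close>.\<close>

lemma gronwall_ac:
  fixes x :: "real \<Rightarrow> real"
  assumes T: "0 \<le> T" and c: "0 \<le> c" and x: "ac T x x'" and g: "set_integrable lebesgue {0<..T} g"
    and g0: "\<And>t. t \<in> {0<..T} \<Longrightarrow> 0 \<le> g t"
    and le: "AE t in lebesgue. t \<in> {0<..T} \<longrightarrow> x' t \<le> c * x t + g t" and t: "0 \<le> t" "t \<le> T"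
  shows "x t \<le> exp (c * t) * (x 0 + (LINT r:{0<..T}|lebesgue. g r))"
proof -
  let ?e = "\<lambda>t. exp (- c * t)"
  have e: "ac T ?e (\<lambda>t. - c * ?e t)" using ac_exp[of T "-c"] by simp
  have p: "ac T (\<lambda>t. ?e t * x t) (\<lambda>t. (- c * ?e t) * x t + ?e t * x' t)"
    by (rule ac_bilinear[OF bounded_bilinear_mult T e x])
  have "?e t * x t \<le> ?e 0 * x 0 + (LINT r:{0<..t}|lebesgue. g r)"
  proof (rule ac_mono[OF p g _ t])
    show "AE t in lebesgue. t \<in> {0<..T} \<longrightarrow> (- c * ?e t) * x t + ?e t * x' t \<le> g t"
      using le
    proof eventually_elim
      case (elim t)
      show ?case
      proof
        assume tT: "t \<in> {0<..T}"
        then have "?e t * x' t \<le> ?e t * (c * x t + g t)" using elim by (intro mult_left_mono) auto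
        moreover have "?e t * g t \<le> 1 * g t" using tT g0 c by (intro mult_right_mono) auto
        ultimately show "(- c * ?e t) * x t + ?e t * x' t \<le> g t" by (simp add: algebra_simps)
      qed
    qed
  qed
  also have "(LINT r:{0<..t}|lebesgue. g r) \<le> (LINT r:{0<..T}|lebesgue. g r)"
    by (rule set_integral_Ioc_mono_upper[OF g g0 t])
  finally have "exp (c * t) * (?e t * x t) \<le> exp (c * t) * (x 0 + (LINT r:{0<..T}|lebesgue. g r))"
    by (intro mult_left_mono) auto
  then show ?thesis by (simp add: mult.assoc[symmetric] exp_add[symmetric])
qed

subsection \<open>Resolvent and Yosida approximation of a closed form\<close>

text \<open>A fixed sequence of regularisation parameters: every limit below is taken by dominated
  or monotone convergence along a sequence.\<close>

definition eps :: "nat \<Rightarrow> real" where "eps n = inverse (real (Suc n))"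

lemma eps_pos: "0 < eps n" by (simp add: eps_def)

lemma eps_antimono: "m \<le> n \<Longrightarrow> eps n \<le> eps m"
  unfolding eps_def by (intro le_imp_inverse_le) auto

lemma eps_tendsto: "eps \<longlonglongrightarrow> 0"
  unfolding eps_def by (rule LIMSEQ_inverse_real_of_nat)

text \<open>A closed nonnegative symmetric form. Coercivity is not asked for, since the norm of the
  ambient space enters beside the form; \<open>complete_V\<close> is completeness of
  \<open>V\<close> for the sum of both, phrased without a norm on \<open>V\<close>. Density is
  replaced by working in the closure of \<open>V\<close>.\<close>

locale closed_form =
  fixes V :: "'h::{real_inner, banach, second_countable_topology} set" and a :: "'h \<Rightarrow> 'h \<Rightarrow> real"
  assumes subspace_V: "subspace V"
    and a_add: "u \<in> V \<Longrightarrow> v \<in> V \<Longrightarrow> w \<in> V \<Longrightarrow> a (u + v) w = a u w + a v w"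
    and a_scaleR: "u \<in> V \<Longrightarrow> v \<in> V \<Longrightarrow> a (c *\<^sub>R u) v = c * a u v"
    and a_sym: "u \<in> V \<Longrightarrow> v \<in> V \<Longrightarrow> a u v = a v u"
    and a_nonneg: "u \<in> V \<Longrightarrow> 0 \<le> a u u"
    and complete_V: "(\<And>n. x n \<in> V) \<Longrightarrow> Cauchy x \<Longrightarrow>
      (\<And>e. e > 0 \<Longrightarrow> \<exists>N. \<forall>m\<ge>N. \<forall>n\<ge>N. a (x m - x n) (x m - x n) < e) \<Longrightarrow>
      \<exists>l\<in>V. x \<longlonglongrightarrow> l \<and> (\<lambda>n. a (x n - l) (x n - l)) \<longlonglongrightarrow> 0"
begin

section \<open>Algebra and Cauchy-Schwarz inequality of the form\<close>

lemma V_add: "u \<in> V \<Longrightarrow> v \<in> V \<Longrightarrow> u + v \<in> V"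
  and V_diff: "u \<in> V \<Longrightarrow> v \<in> V \<Longrightarrow> u - v \<in> V"
  and V_scaleR: "u \<in> V \<Longrightarrow> c *\<^sub>R u \<in> V"
  and V_0: "0 \<in> V"
  using subspace_V by (auto simp: subspace_add subspace_diff subspace_scale subspace_0)

lemma a_diff: "u \<in> V \<Longrightarrow> v \<in> V \<Longrightarrow> w \<in> V \<Longrightarrow> a (u - v) w = a u w - a v w"
  using a_add[of u "- 1 *\<^sub>R v" w] a_scaleR[of v w "-1"] V_scaleR[of v "-1"] by simp

lemma a_add_right: "u \<in> V \<Longrightarrow> v \<in> V \<Longrightarrow> w \<in> V \<Longrightarrow> a w (u + v) = a w u + a w v"
  using a_add[of u v w] a_sym V_add by metis

lemma a_diff_right: "u \<in> V \<Longrightarrow> v \<in> V \<Longrightarrow> w \<in> V \<Longrightarrow> a w (u - v) = a w u - a w v"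
  using a_diff[of u v w] a_sym V_diff by metis

lemma a_scaleR_right: "u \<in> V \<Longrightarrow> v \<in> V \<Longrightarrow> a u (c *\<^sub>R v) = c * a u v"
  using a_scaleR[of v u c] a_sym V_scaleR by metis

lemmas V_ops = V_add V_diff V_scaleR V_0
lemmas a_ops = a_add a_diff a_add_right a_diff_right a_scaleR a_scaleR_right

lemma a_diff_diff: "u \<in> V \<Longrightarrow> v \<in> V \<Longrightarrow> a (u - v) (u - v) = a u u - 2 * a u v + a v v"
  using a_sym[of u v] by (simp add: V_ops a_ops)

lemma a_add_add_le: "u \<in> V \<Longrightarrow> v \<in> V \<Longrightarrow> a (u + v) (u + v) \<le> 2 * a u u + 2 * a v v"
  using a_nonneg[of "u - v"] a_sym[of u v] by (simp add: V_ops a_ops)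

lemma a_minus_commute: "u \<in> V \<Longrightarrow> v \<in> V \<Longrightarrow> a (u - v) (u - v) = a (v - u) (v - u)"
  using a_sym[of u v] by (simp add: V_ops a_ops)

lemma a_le_half: "u \<in> V \<Longrightarrow> v \<in> V \<Longrightarrow> a u v \<le> (a u u + a v v) / 2"
  using a_nonneg[of "u - v"] a_diff_diff[of u v] by (simp add: V_ops)

lemma nonneg_quadratic_imp_zero:
  fixes \<alpha> N :: real
  assumes N: "0 \<le> N" and q: "\<And>t. 0 \<le> 2 * t * \<alpha> + t\<^sup>2 * N"
  shows "\<alpha> = 0"
proof -
  \<comment> \<open>The minimiser would be \<open>t = - \<alpha> / N\<close>; using
    \<open>N + 1\<close> avoids a separate case for \<open>N = 0\<close>.\<close>
  have "0 \<le> 2 * (- (\<alpha> / (N + 1))) * \<alpha> + (- (\<alpha> / (N + 1)))\<^sup>2 * N" by (rule q)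
  then have "0 \<le> (N + 1)\<^sup>2 * (2 * (- (\<alpha> / (N + 1))) * \<alpha> + (- (\<alpha> / (N + 1)))\<^sup>2 * N)"
    by (intro mult_nonneg_nonneg) auto
  also have "\<dots> = - (\<alpha>\<^sup>2 * (N + 2))"
    using N by (simp add: divide_simps) (simp add: power2_eq_square algebra_simps)
  finally have "\<alpha>\<^sup>2 * (N + 2) \<le> 0" by simp
  then show ?thesis using N by (simp add: mult_le_0_iff)
qed

lemma a_Cauchy_Schwarz: "u \<in> V \<Longrightarrow> v \<in> V \<Longrightarrow> (a u v)\<^sup>2 \<le> a u u * a v v"
proof -
  assume uv: "u \<in> V" "v \<in> V"
  have q: "0 \<le> a u u - 2 * t * a u v + t\<^sup>2 * a v v" for t
    using a_nonneg[of "u - t *\<^sub>R v"] a_sym[of u v] uv by (simp add: V_ops a_ops power2_eq_square algebra_simps)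
  show ?thesis
  proof (cases "a v v = 0")
    case True
    have "a u v = 0"
    proof (rule ccontr)
      assume n: "a u v \<noteq> 0"
      \<comment> \<open>The form may degenerate. The quadratic in \<open>q\<close> is then affine in
        \<open>t\<close>, and this \<open>t\<close> gives it the value -1.\<close>
      have "0 \<le> a u u - 2 * ((a u u + 1) / (2 * a u v)) * a u v"
        using q[of "(a u u + 1) / (2 * a u v)"] True by simp
      then show False using n by simp
    qed
    then show ?thesis using True by simp
  next
    case False
    then have pos: "a v v > 0" using a_nonneg[OF uv(2)] by simp
    have "0 \<le> a u u - 2 * (a u v / a v v) * a u v + (a u v / a v v)\<^sup>2 * a v v" by (rule q)
    also have "\<dots> = a u u - (a u v)\<^sup>2 / a v v" using pos by (simp add: power2_eq_square)
    finally have "(a u v)\<^sup>2 / a v v \<le> a u u" by simp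
    then show ?thesis using pos by (simp only: pos_divide_le_eq)
  qed
qed

lemma a_tendsto:
  assumes x: "\<And>n. x n \<in> V" and l: "l \<in> V" and lim: "(\<lambda>n. a (x n - l) (x n - l)) \<longlonglongrightarrow> 0" and v: "v \<in> V"
  shows "(\<lambda>n. a (x n) v) \<longlonglongrightarrow> a l v"
proof -
  have "(\<lambda>n. sqrt (a (x n - l) (x n - l) * a v v)) \<longlonglongrightarrow> sqrt (0 * a v v)"
    by (intro tendsto_intros lim)
  then have "(\<lambda>n. sqrt (a (x n - l) (x n - l) * a v v)) \<longlonglongrightarrow> 0" by simp
  moreover have "norm (a (x n) v - a l v) \<le> sqrt (a (x n - l) (x n - l) * a v v)" for n
  proof -
    have "(a (x n) v - a l v)\<^sup>2 \<le> a (x n - l) (x n - l) * a v v"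
      using a_Cauchy_Schwarz[OF V_diff[OF x[of n] l] v] unfolding a_diff[OF x[of n] l v] .
    from real_sqrt_le_mono[OF this] show ?thesis by simp
  qed
  ultimately have "(\<lambda>n. a (x n) v - a l v) \<longlonglongrightarrow> 0"
    by (rule Lim_null_comparison[OF always_eventually[OF allI], rotated])
  then show ?thesis by (rule LIM_zero_cancel)
qed

text \<open>Uniqueness of limits in norm identifies the limit supplied by \<open>complete_V\<close>
  with the given one. This is how membership in \<open>V\<close> is obtained for elements known only
  as limits in norm.\<close>

lemma V_limit:
  assumes x: "\<And>n. x n \<in> V" "x \<longlonglongrightarrow> u"
    and c: "\<And>e. e > 0 \<Longrightarrow> \<exists>N. \<forall>m\<ge>N. \<forall>n\<ge>N. a (x m - x n) (x m - x n) < e"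
  shows "u \<in> V" "(\<lambda>n. a (x n - u) (x n - u)) \<longlonglongrightarrow> 0"
proof -
  obtain l where l: "l \<in> V" "x \<longlonglongrightarrow> l" "(\<lambda>n. a (x n - l) (x n - l)) \<longlonglongrightarrow> 0"
    using complete_V[OF x(1) LIMSEQ_imp_Cauchy[OF x(2)] c] by blast
  then have "l = u" using x(2) LIMSEQ_unique by blast
  with l show "u \<in> V" "(\<lambda>n. a (x n - u) (x n - u)) \<longlonglongrightarrow> 0" by auto
qed

text \<open>Direct method without weak compactness: the parallelogram identity makes a minimising
  sequence Cauchy both in norm and for the form. The variational inequality is written along that
  sequence, with error 1/(n+1), and then passed to the limit.\<close>

lemma resolvent_exists:
  assumes l: "0 < l"
  shows "\<exists>z\<in>V. \<forall>v\<in>V. z \<bullet> v + l * a z v = h \<bullet> v"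
proof -
  define Q where "Q v = v \<bullet> v + l * a v v - 2 * (h \<bullet> v)" for v
  have lower: "- (h \<bullet> h) \<le> Q v" if "v \<in> V" for v
  proof -
    have "0 \<le> (v - h) \<bullet> (v - h)" "0 \<le> l * a v v" using a_nonneg[OF that] l by auto
    then show ?thesis by (simp add: Q_def inner_diff inner_commute)
  qed
  have bb: "bdd_below (Q ` V)" by (rule bdd_belowI2) (rule lower)
  define m where "m = Inf (Q ` V)"
  have m: "m \<le> Q v" if "v \<in> V" for v unfolding m_def using that bb by (simp add: cInf_lower)
  have "\<exists>v\<in>V. Q v < m + inverse (real (Suc n))" for n
    using cInf_lessD[of "Q ` V" "m + inverse (real (Suc n))"] V_0 by (auto simp: m_def)
  then obtain x :: "nat \<Rightarrow> 'h" where x: "\<And>n. x n \<in> V" "\<And>n. Q (x n) < m + inverse (real (Suc n))" by metis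
  \<comment> \<open>The midpoint of two near-minimisers cannot go below the infimum, so they must be
    close to each other.\<close>
  have par: "(u - v) \<bullet> (u - v) + l * a (u - v) (u - v) \<le> 2 * Q u + 2 * Q v - 4 * m"
    if uv: "u \<in> V" "v \<in> V" for u v
  proof -
    have "m \<le> Q ((1/2) *\<^sub>R (u + v))" by (rule m) (use uv in \<open>simp add: V_ops\<close>)
    moreover have "(u - v) \<bullet> (u - v) + l * a (u - v) (u - v)
       = 2 * Q u + 2 * Q v - 4 * Q ((1/2) *\<^sub>R (u + v))"
      using uv a_sym[of u v] by (simp add: Q_def V_ops a_ops inner_add inner_diff inner_commute algebra_simps)
    ultimately show ?thesis by linarith
  qed
  have small: "(x i - x j) \<bullet> (x i - x j) + l * a (x i - x j) (x i - x j) < 4 * inverse (real (Suc N))"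
    if "N \<le> i" "N \<le> j" for i j N
  proof -
    have "inverse (real (Suc i)) \<le> inverse (real (Suc N))" "inverse (real (Suc j)) \<le> inverse (real (Suc N))"
      using that by (auto intro!: le_imp_inverse_le)
    then show ?thesis using par[OF x(1) x(1), of i j] x(2)[of i] x(2)[of j] by linarith
  qed
  have an: "0 \<le> l * a (x i - x j) (x i - x j)" for i j
    using l a_nonneg[OF V_diff[OF x(1) x(1)]] by simp
  have ex: "\<exists>N. 4 * inverse (real (Suc N)) < e" if "e > 0" for e :: real
    using reals_Archimedean[of "e / 4"] that by (auto simp: mult.commute)
  have "Cauchy x"
  proof (rule CauchyI)
    fix e :: real assume "e > 0"
    then obtain N where N: "4 * inverse (real (Suc N)) < e\<^sup>2" using ex[of "e\<^sup>2"] by auto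
    have "norm (x i - x j) < e" if "N \<le> i" "N \<le> j" for i j
    proof -
      have "(norm (x i - x j))\<^sup>2 < e\<^sup>2"
        using small[OF that] an[of i j] N by (simp add: power2_norm_eq_inner)
      then show ?thesis using \<open>e > 0\<close> by (simp add: power2_less_imp_less)
    qed
    then show "\<exists>M. \<forall>m\<ge>M. \<forall>n\<ge>M. norm (x m - x n) < e" by blast
  qed
  moreover have "\<exists>N. \<forall>m\<ge>N. \<forall>n\<ge>N. a (x m - x n) (x m - x n) < e" if e: "e > 0" for e
  proof -
    obtain N where N: "4 * inverse (real (Suc N)) < l * e" using ex[OF mult_pos_pos[OF l e]] by blast
    have "a (x i - x j) (x i - x j) < e" if "N \<le> i" "N \<le> j" for i j
    proof -
      have "l * a (x i - x j) (x i - x j) < l * e"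
        using small[OF that] N inner_ge_zero[of "x i - x j"] by linarith
      then show ?thesis using l by simp
    qed
    then show ?thesis by blast
  qed
  ultimately obtain z where z: "z \<in> V" "x \<longlonglongrightarrow> z" "(\<lambda>n. a (x n - z) (x n - z)) \<longlonglongrightarrow> 0"
    using complete_V[of x, OF x(1)] by blast
  have "z \<bullet> v + l * a z v = h \<bullet> v" if v: "v \<in> V" for v
  proof -
    have "z \<bullet> v + l * a z v - h \<bullet> v = 0"
    proof (rule nonneg_quadratic_imp_zero)
      show "0 \<le> v \<bullet> v + l * a v v" using l a_nonneg[OF v] by simp
      fix t :: real
      have "0 \<le> 2 * t * (x n \<bullet> v + l * a (x n) v - h \<bullet> v) + t\<^sup>2 * (v \<bullet> v + l * a v v) + inverse (real (Suc n))" for n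
      proof -
        have "m \<le> Q (x n + t *\<^sub>R v)" by (rule m) (use x(1) v in \<open>simp add: V_ops\<close>)
        moreover have "Q (x n + t *\<^sub>R v)
          = Q (x n) + 2 * t * (x n \<bullet> v + l * a (x n) v - h \<bullet> v) + t\<^sup>2 * (v \<bullet> v + l * a v v)"
          using x(1)[of n] v a_sym[OF x(1)[of n] v]
          by (simp add: Q_def V_ops a_ops inner_add inner_commute algebra_simps power2_eq_square)
        ultimately show ?thesis using x(2)[of n] by linarith
      qed
      moreover have "(\<lambda>n. 2 * t * (x n \<bullet> v + l * a (x n) v - h \<bullet> v) + t\<^sup>2 * (v \<bullet> v + l * a v v) + inverse (real (Suc n)))
        \<longlonglongrightarrow> 2 * t * (z \<bullet> v + l * a z v - h \<bullet> v) + t\<^sup>2 * (v \<bullet> v + l * a v v) + 0"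
        by (intro tendsto_intros z(2) a_tendsto[OF x(1) z(1) z(3) v] LIMSEQ_inverse_real_of_nat)
      ultimately show "0 \<le> 2 * t * (z \<bullet> v + l * a z v - h \<bullet> v) + t\<^sup>2 * (v \<bullet> v + l * a v v)"
        using LIMSEQ_le_const by fastforce
    qed
    then show ?thesis by simp
  qed
  with z(1) show ?thesis by blast
qed

text \<open>Defined for every \<open>h\<close> of the type and not just for \<open>h\<close> in the
  closure of \<open>V\<close>, so that \<open>J l\<close> is a bounded linear map of the whole type
  when \<open>l\<close> is positive.\<close>

definition J :: "real \<Rightarrow> 'h \<Rightarrow> 'h" where
  "J l h = (SOME z. z \<in> V \<and> (\<forall>v\<in>V. z \<bullet> v + l * a z v = h \<bullet> v))"

definition Y :: "real \<Rightarrow> 'h \<Rightarrow> 'h" where "Y l h = (1 / l) *\<^sub>R (h - J l h)"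

lemma
  assumes "0 < l"
  shows J_in_V: "J l h \<in> V" and J_eq: "v \<in> V \<Longrightarrow> J l h \<bullet> v + l * a (J l h) v = h \<bullet> v"
  using someI_ex[of "\<lambda>z. z \<in> V \<and> (\<forall>v\<in>V. z \<bullet> v + l * a z v = h \<bullet> v)"] resolvent_exists[OF assms, of h]
  unfolding J_def by blast+

text \<open>Testing the difference with itself. The algebra of resolvents rests on this: each
  identity is proved by exhibiting a solution of the defining equation.\<close>

lemma J_unique:
  assumes l: "0 < l" and z: "z \<in> V" "\<And>v. v \<in> V \<Longrightarrow> z \<bullet> v + l * a z v = h \<bullet> v"
  shows "J l h = z"
proof -
  let ?d = "J l h - z"
  have d: "?d \<in> V" using z J_in_V[OF l] by (simp add: V_ops)
  have "?d \<bullet> ?d + l * a ?d ?d = 0"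
    using J_eq[OF l d, of h] z(2)[OF d] z(1) J_in_V[OF l] d by (simp add: a_diff inner_diff_left algebra_simps)
  moreover have "0 \<le> l * a ?d ?d" using l a_nonneg[OF d] by simp
  ultimately have "?d \<bullet> ?d \<le> 0" by linarith
  then have "?d \<bullet> ?d = 0" using inner_ge_zero[of ?d] by (rule antisym)
  then show ?thesis by simp
qed

lemma h_eq: "0 < l \<Longrightarrow> h = J l h + l *\<^sub>R Y l h"
  by (simp add: Y_def)

text \<open>The weak form of \<open>A (J l h) = Y l h\<close>, available before \<open>A\<close> is
  defined.\<close>

lemma a_J: "0 < l \<Longrightarrow> v \<in> V \<Longrightarrow> a (J l h) v = Y l h \<bullet> v"
  using J_eq[of l v h] by (simp add: Y_def inner_diff_left field_simps)

lemma a_JJ_nonneg: "0 < l \<Longrightarrow> 0 \<le> Y l h \<bullet> J l h"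
  using a_J[OF _ J_in_V, of l l h h] a_nonneg[OF J_in_V, of l h] by simp

lemma J_add:
  assumes l: "0 < l"
  shows "J l (g + h) = J l g + J l h"
proof (rule J_unique[OF l])
  fix v assume v: "v \<in> V"
  show "(J l g + J l h) \<bullet> v + l * a (J l g + J l h) v = (g + h) \<bullet> v"
    using J_eq[OF l v, of g] J_eq[OF l v, of h] a_add[OF J_in_V[OF l] J_in_V[OF l] v, of g h]
    by (simp add: inner_add_left algebra_simps)
qed (simp add: V_ops J_in_V l)

lemma J_scaleR:
  assumes l: "0 < l"
  shows "J l (c *\<^sub>R h) = c *\<^sub>R J l h"
proof (rule J_unique[OF l])
  fix v assume v: "v \<in> V"
  have "c * (J l h \<bullet> v + l * a (J l h) v) = c * (h \<bullet> v)" unfolding J_eq[OF l v] ..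
  then show "(c *\<^sub>R J l h) \<bullet> v + l * a (c *\<^sub>R J l h) v = (c *\<^sub>R h) \<bullet> v"
    using a_scaleR[OF J_in_V[OF l] v, of c h] by (simp add: algebra_simps)
qed (simp add: V_ops J_in_V l)

lemma norm_J_le:
  assumes l: "0 < l"
  shows "norm (J l h) \<le> norm h"
proof -
  have "0 \<le> l * a (J l h) (J l h)" using l a_nonneg[OF J_in_V[OF l]] by simp
  then have "(norm (J l h))\<^sup>2 \<le> h \<bullet> J l h"
    using J_eq[OF l J_in_V[OF l], of h h] unfolding power2_norm_eq_inner by linarith
  also have "\<dots> \<le> norm h * norm (J l h)" by (rule norm_cauchy_schwarz)
  finally have "norm (J l h) * norm (J l h) \<le> norm h * norm (J l h)" by (simp only: power2_eq_square)
  then show ?thesis by (cases "norm (J l h) = 0") (simp_all only: norm_ge_zero mult_le_cancel_right, auto)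
qed

lemma bounded_linear_J: "0 < l \<Longrightarrow> bounded_linear (J l)"
  by (rule bounded_linear_intro[of _ 1]) (auto simp: J_add J_scaleR norm_J_le)

lemma bounded_linear_Y: "0 < l \<Longrightarrow> bounded_linear (Y l)"
  unfolding Y_def
  by (intro bounded_linear_const_scaleR bounded_linear_sub bounded_linear_ident bounded_linear_J)

lemma J_diff: "0 < l \<Longrightarrow> J l (g - h) = J l g - J l h"
  using bounded_linear_J linear_diff bounded_linear.linear by blast

lemma Y_diff: "0 < l \<Longrightarrow> Y l (g - h) = Y l g - Y l h"
  using bounded_linear_Y linear_diff bounded_linear.linear by blast

lemma norm_Y_le:
  assumes l: "0 < l"
  shows "norm (Y l h) \<le> (2 / l) * norm h"
proof -
  have "norm (h - J l h) \<le> 2 * norm h" using norm_triangle_ineq4[of h "J l h"] norm_J_le[OF l, of h] by linarith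
  then have "(1 / l) * norm (h - J l h) \<le> (1 / l) * (2 * norm h)" using l by (intro mult_left_mono) auto
  then show ?thesis using l by (simp add: Y_def del: scaleR_right_diff_distrib)
qed

lemma J_sym: "0 < l \<Longrightarrow> J l g \<bullet> h = g \<bullet> J l h"
  using J_eq[of l "J l g" h] J_eq[of l "J l h" g] a_sym[of "J l g" "J l h"]
  by (simp add: J_in_V inner_commute)

lemma Y_sym: "0 < l \<Longrightarrow> Y l g \<bullet> h = g \<bullet> Y l h"
  using J_sym[of l g h] by (simp add: Y_def inner_diff_left inner_diff_right)

lemma Y_inner_self: "0 < l \<Longrightarrow> Y l h \<bullet> h = Y l h \<bullet> J l h + l * (Y l h \<bullet> Y l h)"
  by (subst (2) h_eq[of l h]) (auto simp: inner_add_right)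

lemma Y_nonneg: "0 < l \<Longrightarrow> 0 \<le> Y l h \<bullet> h"
  using Y_inner_self[of l h] a_JJ_nonneg[of l h] by (simp add: add_nonneg_nonneg)

text \<open>The commutation \<open>Y l z = J l (A z)\<close>, with \<open>A z = h\<close> in weak
  form so that it also covers \<open>z = J m g\<close>.\<close>

lemma Y_eq_J:
  assumes l: "0 < l" and z: "z \<in> V" "\<And>v. v \<in> V \<Longrightarrow> a z v = h \<bullet> v"
  shows "Y l z = J l h"
proof -
  have "J l (z + l *\<^sub>R h) = z" by (rule J_unique[OF l z(1)]) (simp add: z(2) inner_add_left)
  then have "z - J l z = l *\<^sub>R J l h" using l by (simp add: J_add J_scaleR algebra_simps)
  then show ?thesis using l by (simp add: Y_def)
qed

lemma Y_J: "0 < l \<Longrightarrow> 0 < m \<Longrightarrow> Y m (J l h) = J m (Y l h)"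
  by (rule Y_eq_J) (auto simp: J_in_V a_J)

text \<open>Read the equation of \<open>J l u\<close> with parameter \<open>m\<close> in place of
  \<open>l\<close>: \<open>J l u\<close> is the \<open>m\<close>-resolvent of
  \<open>u - (l - m) *\<^sub>R Y l u\<close>.\<close>

lemma resolvent_identity:
  assumes l: "0 < l" and m: "0 < m"
  shows "Y m u - Y l u = (l - m) *\<^sub>R Y m (Y l u)"
proof -
  have "J m (J l u + m *\<^sub>R Y l u) = J l u"
    by (rule J_unique[OF m J_in_V[OF l]]) (simp add: a_J[OF l] inner_add_left)
  moreover have "J l u + m *\<^sub>R Y l u = u - (l - m) *\<^sub>R Y l u"
    by (subst (3) h_eq[OF l, of u]) (simp add: algebra_simps)
  ultimately have "Y m (u - (l - m) *\<^sub>R Y l u) = (1 / m) *\<^sub>R (J l u + m *\<^sub>R Y l u - J l u)"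
    by (simp add: Y_def)
  then have "Y m (u - (l - m) *\<^sub>R Y l u) = Y l u" using m by simp
  then have "Y m u - (l - m) *\<^sub>R Y m (Y l u) = Y l u"
    by (simp add: linear_diff[OF bounded_linear.linear[OF bounded_linear_Y[OF m]]]
        linear_scale[OF bounded_linear.linear[OF bounded_linear_Y[OF m]]])
  then show ?thesis by (simp add: algebra_simps)
qed

section \<open>Monotone dependence of resolvent and Yosida approximation on the parameter\<close>

context
  fixes l m :: real and u :: 'h
  assumes m: "0 < m" and ml: "m \<le> l"
begin

private lemma l: "0 < l" using m ml by simp

text \<open>Positivity of \<open>Y m\<close> at the vector \<open>Y l u\<close>, seen through the
  resolvent identity. The monotonicity statements of this context rest on it.\<close>

lemma Y_inner_Y_ge: "Y l u \<bullet> Y l u \<le> Y l u \<bullet> Y m u"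
proof -
  have "Y l u \<bullet> (Y m u - Y l u) = (l - m) * (Y m (Y l u) \<bullet> Y l u)"
    unfolding resolvent_identity[OF l m] by (simp add: inner_commute)
  also have "\<dots> \<ge> 0" using ml Y_nonneg[OF m] by (intro mult_nonneg_nonneg) auto
  finally show ?thesis by (simp add: inner_diff_right)
qed

lemma Y_inner_diff: "Y m u \<bullet> u - Y l u \<bullet> u = (l - m) * (Y l u \<bullet> Y m u)"
  using arg_cong[OF resolvent_identity[OF l m, of u], of "\<lambda>x. x \<bullet> u"] Y_sym[OF m, of "Y l u" u]
  by (simp add: inner_diff_left)

text \<open>Quantitative monotonicity: once the increasing norms are bounded, the vectors themselves
  are Cauchy. This takes the place of a weak limit.\<close>

lemma Y_diff_norm_le: "(norm (Y l u - Y m u))\<^sup>2 \<le> (norm (Y m u))\<^sup>2 - (norm (Y l u))\<^sup>2"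
  using Y_inner_Y_ge by (simp add: power2_norm_eq_inner inner_diff inner_commute)

lemma norm_Y_antimono: "norm (Y l u) \<le> norm (Y m u)"
proof (rule power2_le_imp_le)
  show "(norm (Y l u))\<^sup>2 \<le> (norm (Y m u))\<^sup>2"
    using Y_diff_norm_le zero_le_power2[of "norm (Y l u - Y m u)"] by linarith
qed simp

lemma Y_form_antimono: "Y l u \<bullet> u \<le> Y m u \<bullet> u"
proof -
  have "0 \<le> (l - m) * (Y l u \<bullet> Y m u)"
    using Y_inner_Y_ge ml inner_ge_zero[of "Y l u"] by (intro mult_nonneg_nonneg) linarith+
  then show ?thesis using Y_inner_diff by linarith
qed

lemma a_J_diff: "a (J l u - J m u) (J l u - J m u) = (Y l u - Y m u) \<bullet> (J l u - J m u)"
  using l m by (simp add: a_diff V_ops J_in_V a_J inner_diff_left)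

text \<open>The counterpart for the form: if \<open>Y l u \<bullet> u\<close> stays bounded as
  \<open>l\<close> decreases, the resolvents of \<open>u\<close> are Cauchy for \<open>a\<close>.
  With p, L, M the mixed and the two pure products, the claim reduces to 2mp \<le> lL + mM, which
  follows from 2p \<le> L + M and m \<le> l.\<close>

lemma a_J_diff_le: "a (J l u - J m u) (J l u - J m u) \<le> Y m u \<bullet> u - Y l u \<bullet> u"
proof -
  let ?p = "Y l u \<bullet> Y m u" and ?L = "Y l u \<bullet> Y l u" and ?M = "Y m u \<bullet> Y m u"
  have e: "J l u - J m u = m *\<^sub>R Y m u - l *\<^sub>R Y l u"
    using l m by (simp add: Y_def)
  have "a (J l u - J m u) (J l u - J m u) = m * ?p - l * ?L - m * ?M + l * ?p"
    unfolding a_J_diff unfolding e by (simp add: inner_diff_left inner_diff_right inner_commute[of "Y m u" "Y l u"] algebra_simps)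
  moreover have "2 * ?p \<le> ?L + ?M"
    using inner_ge_zero[of "Y l u - Y m u"]
    by (simp add: inner_diff_left inner_diff_right inner_commute[of "Y m u" "Y l u"])
  then have "m * (2 * ?p) \<le> m * (?L + ?M)" using m by (intro mult_left_mono) auto
  moreover have "m * ?L \<le> l * ?L" using ml by (intro mult_right_mono) auto
  ultimately show ?thesis unfolding Y_inner_diff by (simp add: algebra_simps)
qed

end

lemma Y_form_le: "0 < l \<Longrightarrow> u \<in> V \<Longrightarrow> Y l u \<bullet> u \<le> a u u"
proof -
  assume l: "0 < l" and u: "u \<in> V"
  have "a (J l u) u \<le> (a (J l u) (J l u) + a u u) / 2" by (rule a_le_half[OF J_in_V[OF l] u])
  moreover have "a (J l u) (J l u) \<le> Y l u \<bullet> u"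
    using Y_inner_self[OF l, of u] a_J[OF l J_in_V[OF l], of u u] l by simp
  ultimately show ?thesis using a_J[OF l u, of u] by simp
qed

text \<open>A rate on \<open>V\<close>. Since resolvents are contractions, density spreads the
  convergence, though not the rate, to the closure of \<open>V\<close>.\<close>

lemma norm_J_diff_le:
  assumes l: "0 < l" and v: "v \<in> V"
  shows "(norm (J l v - v))\<^sup>2 \<le> l * a v v"
proof -
  have j: "J l v \<in> V" "J l v - v \<in> V" using v J_in_V[OF l] by (auto simp: V_ops)
  have "(norm (J l v - v))\<^sup>2 = l * (a (J l v) v - a (J l v) (J l v))"
    using J_eq[OF l j(2), of v] j(1) v
    by (simp add: power2_norm_eq_inner a_diff_right inner_diff_left algebra_simps)
  also have "\<dots> \<le> l * a v v"
    using a_le_half[OF j(1) v] a_nonneg[OF j(1)] a_nonneg[OF v] l by (intro mult_left_mono) auto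
  finally show ?thesis .
qed

section \<open>The closure \<open>H\<close> of \<open>V\<close> and the operator in
  \<open>H\<close>\<close>

definition H :: "'h set" where "H = closure V"

abbreviation "Jn n \<equiv> J (eps n)"
abbreviation "Yn n \<equiv> Y (eps n)"

lemma Jn_tendsto:
  assumes h: "h \<in> H"
  shows "(\<lambda>n. Jn n h) \<longlonglongrightarrow> h"
  unfolding lim_sequentially
proof (intro allI impI)
  fix e :: real assume e: "e > 0"
  obtain v where v: "v \<in> V" "dist v h < e / 3"
    using h e unfolding H_def closure_approachable by (metis zero_less_divide_iff zero_less_numeral)
  have "(\<lambda>n. eps n * a v v) \<longlonglongrightarrow> 0 * a v v"
    by (intro tendsto_intros eps_tendsto)
  then have "\<forall>\<^sub>F n in sequentially. eps n * a v v < (e / 3)\<^sup>2"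
    by (rule order_tendstoD) (use e in simp)
  then obtain N where N: "\<And>n. n \<ge> N \<Longrightarrow> eps n * a v v < (e / 3)\<^sup>2"
    by (auto simp: eventually_sequentially)
  have "dist (Jn n h) h < e" if "n \<ge> N" for n
  proof -
    note p = eps_pos[of n]
    have "(norm (Jn n v - v))\<^sup>2 < (e / 3)\<^sup>2"
      using norm_J_diff_le[OF p v(1)] N[OF that] by (rule order_le_less_trans)
    then have "norm (Jn n v - v) < e / 3" by (rule power2_less_imp_less) (use e in simp)
    moreover have "norm (Jn n (h - v)) \<le> norm (h - v)" by (rule norm_J_le[OF p])
    moreover have "norm (h - v) < e / 3" using v(2) by (simp add: dist_norm norm_minus_commute)
    moreover have "norm (Jn n h - h) = norm (Jn n (h - v) + (Jn n v - v) - (h - v))"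
      unfolding J_diff[OF p] by simp
    ultimately show ?thesis
      using norm_triangle_ineq4[of "Jn n (h - v) + (Jn n v - v)" "h - v"]
        norm_triangle_ineq[of "Jn n (h - v)" "Jn n v - v"]
      unfolding dist_norm by linarith
  qed
  then show "\<exists>no. \<forall>n\<ge>no. dist (Jn n h) h < e" by blast
qed

lemma V_subset_H: "V \<subseteq> H" unfolding H_def by (rule closure_subset)

lemma J_in_H: "0 < l \<Longrightarrow> J l h \<in> H" using J_in_V V_subset_H by blast

lemma closed_H: "closed H" unfolding H_def by simp

lemma H_add: "g \<in> H \<Longrightarrow> h \<in> H \<Longrightarrow> g + h \<in> H"
  and H_scaleR: "h \<in> H \<Longrightarrow> c *\<^sub>R h \<in> H"
proof -
  have lim: "x \<in> H" if "\<And>n. y n \<in> V" "y \<longlonglongrightarrow> x" for x y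
    using closed_sequentially[OF closed_H, of y x] that V_subset_H by blast
  show "g + h \<in> H" if "g \<in> H" "h \<in> H"
    by (rule lim[of "\<lambda>n. Jn n g + Jn n h"]) (auto intro!: V_add J_in_V eps_pos tendsto_add Jn_tendsto that)
  show "c *\<^sub>R h \<in> H" if "h \<in> H"
    by (rule lim[of "\<lambda>n. c *\<^sub>R Jn n h"]) (auto intro!: V_scaleR J_in_V eps_pos tendsto_intros Jn_tendsto that)
qed

lemma H_diff: "g \<in> H \<Longrightarrow> h \<in> H \<Longrightarrow> g - h \<in> H"
  using H_add[of g "-1 *\<^sub>R h"] H_scaleR[of h "-1"] by simp

lemma H_ext:
  assumes "g \<in> H" "h \<in> H" "\<And>v. v \<in> V \<Longrightarrow> g \<bullet> v = h \<bullet> v"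
  shows "g = h"
proof -
  have "(\<lambda>n. (g - h) \<bullet> Jn n (g - h)) \<longlonglongrightarrow> (g - h) \<bullet> (g - h)"
    by (intro tendsto_intros Jn_tendsto H_diff assms)
  moreover have "(g - h) \<bullet> Jn n (g - h) = 0" for n
    using assms(3)[OF J_in_V[OF eps_pos]] by (simp add: inner_diff_left)
  ultimately have "(g - h) \<bullet> (g - h) = 0" by (simp add: LIMSEQ_const_iff)
  then show ?thesis by simp
qed

lemma Cauchy_of_monotone_bounded:
  fixes q :: "nat \<Rightarrow> real"
  assumes "\<And>m n. m \<le> n \<Longrightarrow> q m \<le> q n" "\<And>n. q n \<le> C"
  shows "\<And>e. e > 0 \<Longrightarrow> \<exists>N. \<forall>m\<ge>N. \<forall>n\<ge>N. \<bar>q m - q n\<bar> < e"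
proof -
  have "convergent q"
  proof -
    have "incseq q" unfolding incseq_def using assms(1) by blast
    then obtain L where "q \<longlonglongrightarrow> L" by (rule incseq_convergent[of q C]) (use assms(2) in auto)
    then show ?thesis by (rule convergentI)
  qed
  then have "Cauchy q" by (rule convergent_Cauchy)
  then show "\<And>e. e > 0 \<Longrightarrow> \<exists>N. \<forall>m\<ge>N. \<forall>n\<ge>N. \<bar>q m - q n\<bar> < e"
    unfolding Cauchy_iff real_norm_def by blast
qed

lemma a_Jn_tendsto:
  assumes u: "u \<in> V"
  shows "(\<lambda>n. a (Jn n u - u) (Jn n u - u)) \<longlonglongrightarrow> 0"
proof (rule V_limit(2))
  show "(\<lambda>n. Jn n u) \<longlonglongrightarrow> u" using u V_subset_H by (intro Jn_tendsto) auto
  fix e :: real assume "e > 0"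
  then obtain N where N: "\<forall>m\<ge>N. \<forall>n\<ge>N. \<bar>Yn m u \<bullet> u - Yn n u \<bullet> u\<bar> < e"
    using Cauchy_of_monotone_bounded[of "\<lambda>n. Yn n u \<bullet> u" "a u u",
        OF Y_form_antimono[OF eps_pos eps_antimono] Y_form_le[OF eps_pos u]] by blast
  have "a (Jn m u - Jn n u) (Jn m u - Jn n u) < e" if "m \<ge> N" "n \<ge> N" for m n
  proof -
    have *: "a (Jn m u - Jn n u) (Jn m u - Jn n u) \<le> \<bar>Yn m u \<bullet> u - Yn n u \<bullet> u\<bar>" if "m \<le> n" for m n
      using a_J_diff_le[OF eps_pos eps_antimono[OF that], of u] by simp
    have "a (Jn m u - Jn n u) (Jn m u - Jn n u) \<le> \<bar>Yn m u \<bullet> u - Yn n u \<bullet> u\<bar>"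
    proof (cases "m \<le> n")
      case True
      then show ?thesis by (rule *)
    next
      case False
      then show ?thesis using *[of n m] a_minus_commute[OF J_in_V J_in_V, OF eps_pos eps_pos, of m u n u]
        by (simp only: abs_minus_commute)
    qed
    also have "\<dots> < e" using N that by blast
    finally show ?thesis .
  qed
  then show "\<exists>N. \<forall>m\<ge>N. \<forall>n\<ge>N. a (Jn m u - Jn n u) (Jn m u - Jn n u) < e" by blast
qed (simp add: J_in_V eps_pos)

text \<open>\<open>dom\<close> and \<open>A\<close> have the shape of \<open>domain_A\<close> and
  \<open>op_A\<close>, with which they coincide once \<open>H\<close> is identified with
  \<open>L2_on\<close>. The description in \<open>A\<close> is unique because elements of
  \<open>H\<close> are determined by their pairings with \<open>V\<close>, see
  \<open>H_ext\<close>.\<close>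

definition dom :: "'h set" where "dom = {u \<in> V. \<exists>h\<in>H. \<forall>v\<in>V. a u v = h \<bullet> v}"
definition A :: "'h \<Rightarrow> 'h" where "A u = (THE h. h \<in> H \<and> (\<forall>v\<in>V. a u v = h \<bullet> v))"

lemma domI:
  assumes "u \<in> V" "h \<in> H" "\<And>v. v \<in> V \<Longrightarrow> a u v = h \<bullet> v"
  shows "u \<in> dom" "A u = h"
proof -
  show "u \<in> dom" unfolding dom_def using assms by blast
  show "A u = h" unfolding A_def
    by (rule the_equality) (use assms H_ext in \<open>blast, metis\<close>)
qed

lemma domD:
  assumes "u \<in> dom"
  shows "u \<in> V" "A u \<in> H" "v \<in> V \<Longrightarrow> a u v = A u \<bullet> v"
proof -
  obtain h where h: "u \<in> V" "h \<in> H" "\<And>v. v \<in> V \<Longrightarrow> a u v = h \<bullet> v" using assms unfolding dom_def by blast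
  then show "u \<in> V" "A u \<in> H" "v \<in> V \<Longrightarrow> a u v = A u \<bullet> v" using domI(2)[OF h] by auto
qed

lemma dom_diff: "u \<in> dom \<Longrightarrow> v \<in> dom \<Longrightarrow> u - v \<in> dom"
  and A_diff: "u \<in> dom \<Longrightarrow> v \<in> dom \<Longrightarrow> A (u - v) = A u - A v"
proof -
  assume uv: "u \<in> dom" "v \<in> dom"
  have "u - v \<in> V" "A u - A v \<in> H" "a (u - v) w = (A u - A v) \<bullet> w" if "w \<in> V" for w
    using domD[OF uv(1)] domD[OF uv(2)] that by (auto simp: V_ops H_diff a_diff inner_diff_left)
  from domI[OF this] V_0 show "u - v \<in> dom" "A (u - v) = A u - A v" by blast+
qed

lemma J_in_dom: "0 < l \<Longrightarrow> h \<in> H \<Longrightarrow> J l h \<in> dom"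
  and A_J: "0 < l \<Longrightarrow> h \<in> H \<Longrightarrow> A (J l h) = Y l h"
proof -
  assume l: "0 < l" and h: "h \<in> H"
  have "Y l h \<in> H" unfolding Y_def by (intro H_scaleR H_diff h J_in_H l)
  from domI[OF J_in_V[OF l] this a_J[OF l]] show "J l h \<in> dom" "A (J l h) = Y l h" by blast+
qed

lemma Y_A: "0 < l \<Longrightarrow> u \<in> dom \<Longrightarrow> Y l u = J l (A u)"
  using Y_eq_J[of l u "A u"] domD[of u] by blast

text \<open>Domain elements are resolvent values. This allows approximation inside
  \<open>dom\<close> by approximating \<open>u + A u\<close> in \<open>H\<close>.\<close>

lemma J_A: "u \<in> dom \<Longrightarrow> J 1 (u + A u) = u"
  by (rule J_unique) (use domD[of u] in \<open>auto simp: inner_add_left\<close>)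

lemma Yn_tendsto: "u \<in> dom \<Longrightarrow> (\<lambda>n. Yn n u) \<longlonglongrightarrow> A u"
  using Jn_tendsto[OF domD(2)] Y_A eps_pos by simp

text \<open>The regularity criterion behind existence. Bounded increasing norms make
  \<open>Yn n u\<close> Cauchy, with limit \<open>h\<close>. The form of a difference of resolvents
  is the pairing of the two differences, so \<open>Jn n u\<close> is Cauchy for \<open>a\<close> and
  \<open>u\<close> lies in \<open>V\<close>; the limit of \<open>a_J\<close> then reads
  \<open>A u = h\<close>.\<close>

lemma domI_bounded:
  assumes u: "u \<in> H" and C: "\<And>n. norm (Yn n u) \<le> C"
  shows "u \<in> dom"
proof -
  note p = eps_pos
  have ord: "(norm (Yn m u))\<^sup>2 \<le> (norm (Yn n u))\<^sup>2" if "m \<le> n" for m n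
    using norm_Y_antimono[OF p eps_antimono[OF that]] by (intro power_mono) auto
  have bd: "(norm (Yn n u))\<^sup>2 \<le> C\<^sup>2" for n by (intro power_mono C) auto
  have d: "(norm (Yn m u - Yn n u))\<^sup>2 \<le> \<bar>(norm (Yn m u))\<^sup>2 - (norm (Yn n u))\<^sup>2\<bar>" for m n
  proof (cases "m \<le> n")
    case True
    then show ?thesis using Y_diff_norm_le[OF p eps_antimono[OF True], of u] by simp
  next
    case False
    then have "n \<le> m" by simp
    then show ?thesis using Y_diff_norm_le[OF p eps_antimono[OF \<open>n \<le> m\<close>], of u]
      by (simp add: norm_minus_commute)
  qed
  have Cau: "\<exists>N. \<forall>m\<ge>N. \<forall>n\<ge>N. norm (Yn m u - Yn n u) < e" if e: "e > 0" for e
  proof -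
    obtain N where N: "\<forall>m\<ge>N. \<forall>n\<ge>N. \<bar>(norm (Yn m u))\<^sup>2 - (norm (Yn n u))\<^sup>2\<bar> < e\<^sup>2"
      using Cauchy_of_monotone_bounded[of "\<lambda>n. (norm (Yn n u))\<^sup>2", OF ord bd, of "e\<^sup>2"] zero_less_power[OF e, of 2] by blast
    have "norm (Yn m u - Yn n u) < e" if "m \<ge> N" "n \<ge> N" for m n
    proof (rule power2_less_imp_less)
      show "(norm (Yn m u - Yn n u))\<^sup>2 < e\<^sup>2" using d[of m n] N that by (meson order_le_less_trans)
    qed (use \<open>e > 0\<close> in simp)
    then show ?thesis by blast
  qed
  then have "Cauchy (\<lambda>n. Yn n u)" by (intro CauchyI) auto
  then obtain h where h: "(\<lambda>n. Yn n u) \<longlonglongrightarrow> h" using Cauchy_convergent convergent_def by blast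
  have YH: "Yn n u \<in> H" for n unfolding Y_def by (intro H_scaleR H_diff u J_in_H p)
  have hH: "h \<in> H" using closed_sequentially[OF closed_H _ h] YH by blast
  have lim: "(\<lambda>n. Jn n u) \<longlonglongrightarrow> u" by (rule Jn_tendsto[OF u])
  have aC: "\<exists>N. \<forall>m\<ge>N. \<forall>n\<ge>N. a (Jn m u - Jn n u) (Jn m u - Jn n u) < e" if e: "e > 0" for e
  proof -
    \<comment> \<open>The \<open>+ 1\<close> keeps the denominator positive when
      \<open>u = 0\<close>.\<close>
    obtain N where N: "\<forall>m\<ge>N. \<forall>n\<ge>N. norm (Yn m u - Yn n u) < e / (2 * norm u + 1)"
      using Cau[of "e / (2 * norm u + 1)"] e by (metis add_nonneg_pos divide_pos_pos mult_nonneg_nonneg norm_ge_zero zero_le_numeral zero_less_one)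
    have "a (Jn m u - Jn n u) (Jn m u - Jn n u) < e" if mn: "m \<ge> N" "n \<ge> N" for m n
    proof -
      have "a (Jn m u - Jn n u) (Jn m u - Jn n u) = (Yn m u - Yn n u) \<bullet> (Jn m u - Jn n u)"
        by (simp add: a_diff V_ops J_in_V a_J inner_diff_left eps_pos)
      also have "\<dots> \<le> norm (Yn m u - Yn n u) * norm (Jn m u - Jn n u)" by (rule norm_cauchy_schwarz)
      also have "norm (Jn m u - Jn n u) \<le> 2 * norm u"
        using norm_triangle_ineq4[of "Jn m u" "Jn n u"] norm_J_le[OF p, of m u] norm_J_le[OF p, of n u] by linarith
      then have "norm (Yn m u - Yn n u) * norm (Jn m u - Jn n u) \<le> norm (Yn m u - Yn n u) * (2 * norm u + 1)"
        by (intro mult_left_mono) auto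
      also have "\<dots> < e / (2 * norm u + 1) * (2 * norm u + 1)"
        by (rule mult_strict_right_mono) (use N mn in \<open>auto simp: add_nonneg_pos\<close>)
      also have "\<dots> = e" by (simp add: add_nonneg_eq_0_iff)
      finally show ?thesis .
    qed
    then show ?thesis by blast
  qed
  have uV: "u \<in> V" and av: "(\<lambda>n. a (Jn n u - u) (Jn n u - u)) \<longlonglongrightarrow> 0"
    using V_limit[OF J_in_V[OF p] lim aC] by blast+
  have "a u v = h \<bullet> v" if v: "v \<in> V" for v
  proof (rule LIMSEQ_unique)
    show "(\<lambda>n. a (Jn n u) v) \<longlonglongrightarrow> a u v" by (rule a_tendsto[OF J_in_V[OF p] uV av v])
    have "(\<lambda>n. Yn n u \<bullet> v) \<longlonglongrightarrow> h \<bullet> v" by (intro tendsto_intros h)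
    then show "(\<lambda>n. a (Jn n u) v) \<longlonglongrightarrow> h \<bullet> v" by (simp add: a_J[OF p v])
  qed
  then show ?thesis using domI(1)[OF uV hH] by blast
qed

end

subsection \<open>Square-integrable paths and the energy identity\<close>

lemma set_borel_measurable_continuous_comp:
  fixes f :: "'a \<Rightarrow> 'b::{second_countable_topology, real_normed_vector}"
    and h :: "'b \<Rightarrow> 'c::{second_countable_topology, real_normed_vector}"
  assumes f: "set_borel_measurable M S f" and S: "S \<in> sets M" and h: "continuous_on UNIV h"
  shows "set_borel_measurable M S (\<lambda>x. h (f x))"
proof -
  have f': "(\<lambda>x. indicator S x *\<^sub>R f x) \<in> borel_measurable M"
    using f unfolding set_borel_measurable_def .
  have "(\<lambda>x. h (indicator S x *\<^sub>R f x)) \<in> borel_measurable M"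
    by (rule measurable_compose[OF f' borel_measurable_continuous_onI[OF h]])
  then have "(\<lambda>x. indicator S x *\<^sub>R h (indicator S x *\<^sub>R f x)) \<in> borel_measurable M"
    by (intro borel_measurable_scaleR borel_measurable_indicator S)
  also have "(\<lambda>x. indicator S x *\<^sub>R h (indicator S x *\<^sub>R f x)) = (\<lambda>x. indicator S x *\<^sub>R h (f x))"
    by (rule ext) (simp add: indicator_def)
  finally show ?thesis unfolding set_borel_measurable_def .
qed

lemma set_borel_measurable_add:
  fixes f g :: "'a \<Rightarrow> 'b::{second_countable_topology, real_normed_vector}"
  assumes "set_borel_measurable M S f" "set_borel_measurable M S g"
  shows "set_borel_measurable M S (\<lambda>x. f x + g x)"
  using borel_measurable_add[OF assms[unfolded set_borel_measurable_def]]
  unfolding set_borel_measurable_def scaleR_add_right .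

lemma set_borel_measurable_inner:
  fixes f g :: "'a \<Rightarrow> 'b::{second_countable_topology, real_inner}"
  assumes "set_borel_measurable M S f" "set_borel_measurable M S g"
  shows "set_borel_measurable M S (\<lambda>x. f x \<bullet> g x)"
proof -
  have "(\<lambda>x. (indicator S x *\<^sub>R f x) \<bullet> (indicator S x *\<^sub>R g x)) \<in> borel_measurable M"
    by (rule borel_measurable_inner) (use assms in \<open>simp_all only: set_borel_measurable_def\<close>)
  also have "(\<lambda>x. (indicator S x *\<^sub>R f x) \<bullet> (indicator S x *\<^sub>R g x)) = (\<lambda>x. indicator S x *\<^sub>R (f x \<bullet> g x))"
    by (rule ext) (simp add: indicator_def)
  finally show ?thesis unfolding set_borel_measurable_def .
qed

lemma set_integrable_imp_set_borel_measurable: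
  "set_integrable M S f \<Longrightarrow> set_borel_measurable M S f"
  unfolding set_integrable_def set_borel_measurable_def by (rule borel_measurable_integrable)

lemma set_dominated_convergence:
  fixes f :: "'a \<Rightarrow> 'b::{banach, second_countable_topology}" and w :: "'a \<Rightarrow> real"
  assumes w: "set_integrable M S w" and s: "\<And>i. set_borel_measurable M S (s i)"
    and f: "set_borel_measurable M S f"
    and lim: "AE x in M. x \<in> S \<longrightarrow> (\<lambda>i. s i x) \<longlonglongrightarrow> f x"
    and le: "\<And>i. AE x in M. x \<in> S \<longrightarrow> norm (s i x) \<le> w x"
  shows "(\<lambda>i. LINT x:S|M. s i x) \<longlonglongrightarrow> (LINT x:S|M. f x)"
  unfolding set_lebesgue_integral_def
proof (rule integral_dominated_convergence)
  show "integrable M (\<lambda>x. indicator S x *\<^sub>R w x)" using w unfolding set_integrable_def .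
  show "AE x in M. (\<lambda>i. indicator S x *\<^sub>R s i x) \<longlonglongrightarrow> indicator S x *\<^sub>R f x"
    using lim
  proof eventually_elim
    case (elim x)
    then show ?case by (cases "x \<in> S") simp_all
  qed
  show "AE x in M. norm (indicator S x *\<^sub>R s i x) \<le> indicator S x *\<^sub>R w x" for i
    using le[of i]
  proof eventually_elim
    case (elim x)
    then show ?case by (cases "x \<in> S") simp_all
  qed
qed (use s f in \<open>simp_all only: set_borel_measurable_def\<close>)

lemma set_integrable_const_Ioc: "set_integrable lebesgue {0<..T::real} (\<lambda>_. c :: real)"
  by (intro set_integrable_Ioc_continuous continuous_intros)

lemma set_integral_const_Ioc: "0 \<le> T \<Longrightarrow> (LINT r:{0<..T::real}|lebesgue. c) = T * (c::real)"
  unfolding set_lebesgue_integral_def by simp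

lemma set_integral_const_le:
  fixes g :: "real \<Rightarrow> real"
  assumes g: "set_integrable lebesgue {0<..T} g" and le: "AE r in lebesgue. r \<in> {0<..T} \<longrightarrow> g r \<le> c"
    and c: "0 \<le> c" and t: "0 \<le> t" "t \<le> T"
  shows "(LINT r:{0<..t}|lebesgue. g r) \<le> T * c"
proof -
  have "(LINT r:{0<..t}|lebesgue. g r) \<le> (LINT r:{0<..t}|lebesgue. c)"
    by (rule set_integral_mono_AE[OF set_integrable_Ioc_subset[OF g order_refl t(2)] set_integrable_const_Ioc])
      (use le t in \<open>auto elim!: eventually_mono\<close>)
  also have "\<dots> = t * c" by (rule set_integral_const_Ioc[OF t(1)])
  also have "\<dots> \<le> T * c" by (rule mult_right_mono[OF t(2) c])
  finally show ?thesis .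
qed

lemma norm_add_sq_le: "(norm (x + y))\<^sup>2 \<le> 2 * (norm x)\<^sup>2 + 2 * (norm (y :: 'b::real_normed_vector))\<^sup>2"
proof -
  have "(norm (x + y))\<^sup>2 \<le> (norm x + norm y)\<^sup>2" by (intro power_mono norm_triangle_ineq) simp
  also have "\<dots> \<le> 2 * (norm x)\<^sup>2 + 2 * (norm y)\<^sup>2"
    using zero_le_power2[of "norm x - norm y"] by (simp add: power2_sum power2_diff)
  finally show ?thesis .
qed

lemma norm_le_1_plus_sq: "norm x \<le> 1 + (norm x)\<^sup>2"
proof -
  have "2 * norm x \<le> 1 + (norm x)\<^sup>2" using zero_le_power2[of "norm x - 1"] unfolding power2_diff by simp
  then show ?thesis using norm_ge_zero[of x] by linarith
qed

text \<open>Measurability is required separately, as it does not follow from integrability of the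
  squared norm. The value space is second countable, so Borel measurability is already strong
  measurability.\<close>

definition sqi :: "real \<Rightarrow> (real \<Rightarrow> 'b::{real_normed_vector, second_countable_topology}) \<Rightarrow> bool" where
  "sqi T f \<longleftrightarrow> set_borel_measurable lebesgue {0<..T} f \<and>
     set_integrable lebesgue {0<..T} (\<lambda>t. (norm (f t))\<^sup>2)"

lemma sqi_measurable: "sqi T f \<Longrightarrow> set_borel_measurable lebesgue {0<..T} f"
  and sqi_norm: "sqi T f \<Longrightarrow> set_integrable lebesgue {0<..T} (\<lambda>t. (norm (f t))\<^sup>2)"
  by (simp_all only: sqi_def)

lemma sqi_bound:
  fixes f :: "real \<Rightarrow> 'b::{real_normed_vector, second_countable_topology}"
  assumes w: "set_integrable lebesgue {0<..T} w" and f: "set_borel_measurable lebesgue {0<..T} f"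
    and le: "AE t in lebesgue. t \<in> {0<..T} \<longrightarrow> (norm (f t))\<^sup>2 \<le> w t"
  shows "sqi T f"
  unfolding sqi_def
proof
  show "set_integrable lebesgue {0<..T} (\<lambda>t. (norm (f t))\<^sup>2)"
  proof (rule set_integrable_bound[OF w])
    show "set_borel_measurable lebesgue {0<..T} (\<lambda>t. (norm (f t))\<^sup>2)"
      by (rule set_borel_measurable_continuous_comp[OF f]) (simp, intro continuous_intros)
    show "AE t in lebesgue. t \<in> {0<..T} \<longrightarrow> norm ((norm (f t))\<^sup>2) \<le> norm (w t)"
      using le
    proof eventually_elim
      case (elim t)
      have "norm ((norm (f t))\<^sup>2) = (norm (f t))\<^sup>2" by simp
      also have "(norm (f t))\<^sup>2 \<le> norm (w t)" if "t \<in> {0<..T}"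
        using elim that unfolding real_norm_def by (meson abs_ge_self order_trans)
      finally show ?case by blast
    qed
  qed
qed (fact f)

lemma sqi_add:
  fixes f g :: "real \<Rightarrow> 'b::{real_normed_vector, second_countable_topology}"
  assumes "sqi T f" "sqi T g"
  shows "sqi T (\<lambda>t. f t + g t)"
proof (rule sqi_bound)
  show "set_integrable lebesgue {0<..T} (\<lambda>t. 2 * (norm (f t))\<^sup>2 + 2 * (norm (g t))\<^sup>2)"
    by (intro set_integral_add(1) set_integrable_mult_right sqi_norm assms)
  show "AE t in lebesgue. t \<in> {0<..T} \<longrightarrow> (norm (f t + g t))\<^sup>2 \<le> 2 * (norm (f t))\<^sup>2 + 2 * (norm (g t))\<^sup>2"
    by (rule AE_I2, rule impI, rule norm_add_sq_le)
qed (intro set_borel_measurable_add sqi_measurable assms)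

lemma sqi_bounded_linear:
  fixes f :: "real \<Rightarrow> 'b::{real_normed_vector, second_countable_topology}"
    and B :: "'b \<Rightarrow> 'c::{real_normed_vector, second_countable_topology}"
  assumes f: "sqi T f" and B: "bounded_linear B"
  shows "sqi T (\<lambda>t. B (f t))"
proof -
  obtain K where K: "\<And>x. norm (B x) \<le> norm x * K" using bounded_linear.bounded[OF B] by blast
  have "(norm (B x))\<^sup>2 \<le> K\<^sup>2 * (norm x)\<^sup>2" for x
    using power_mono[OF K norm_ge_zero, of x 2] by (simp only: power_mult_distrib mult.commute)
  note le = this
  show ?thesis
  proof (rule sqi_bound)
    show "set_integrable lebesgue {0<..T} (\<lambda>t. K\<^sup>2 * (norm (f t))\<^sup>2)"
      by (rule set_integrable_mult_right) (rule sqi_norm[OF f])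
    show "set_borel_measurable lebesgue {0<..T} (\<lambda>t. B (f t))"
      by (rule set_borel_measurable_continuous_comp[OF sqi_measurable[OF f] _ linear_continuous_on[OF B]]) simp
    show "AE t in lebesgue. t \<in> {0<..T} \<longrightarrow> (norm (B (f t)))\<^sup>2 \<le> K\<^sup>2 * (norm (f t))\<^sup>2"
      by (rule AE_I2, rule impI, rule le)
  qed
qed

lemma sqi_diff:
  fixes f g :: "real \<Rightarrow> 'b::{real_normed_vector, second_countable_topology}"
  assumes "sqi T f" "sqi T g"
  shows "sqi T (\<lambda>t. f t - g t)"
  using sqi_add[OF assms(1) sqi_bounded_linear[OF assms(2) bounded_linear_minus[OF bounded_linear_ident]]] by simp

lemma sqi_continuous:
  fixes f :: "real \<Rightarrow> 'b::{banach, second_countable_topology}"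
  assumes "continuous_on {0..T} f"
  shows "sqi T f"
  unfolding sqi_def
  by (intro conjI set_integrable_imp_set_borel_measurable set_integrable_Ioc_continuous continuous_intros assms)

lemma sqi_integrable:
  fixes f :: "real \<Rightarrow> 'b::{banach, second_countable_topology}"
  assumes f: "sqi T f"
  shows "set_integrable lebesgue {0<..T} f"
proof (rule set_integrable_bound)
  show "set_integrable lebesgue {0<..T} (\<lambda>t. 1 + (norm (f t))\<^sup>2)"
    by (intro set_integral_add(1) set_integrable_const_Ioc sqi_norm f)
  have le: "norm x \<le> norm (1 + (norm x)\<^sup>2)" for x :: 'b
    using norm_le_1_plus_sq[of x] unfolding real_norm_def by linarith
  show "AE t in lebesgue. t \<in> {0<..T} \<longrightarrow> norm (f t) \<le> norm (1 + (norm (f t))\<^sup>2)"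
    by (rule AE_I2, rule impI, rule le)
qed (rule sqi_measurable[OF f])

lemma two_inner_le: "2 * (x \<bullet> y) \<le> (norm x)\<^sup>2 + (norm y)\<^sup>2"
  using inner_ge_zero[of "x - y"]
  by (simp add: power2_norm_eq_inner inner_diff_left inner_diff_right inner_commute[of y x])

lemma norm_diff_sq_le:
  "(norm (x - y))\<^sup>2 \<le> 2 * (norm (x - z))\<^sup>2 + 2 * (norm (y - z :: 'b::real_normed_vector))\<^sup>2"
  using norm_add_sq_le[of "x - z" "z - y"] by (simp add: norm_minus_commute)

lemma sqi_inner:
  fixes f g :: "real \<Rightarrow> 'b::{real_inner, second_countable_topology}"
  assumes f: "sqi T f" and g: "sqi T g"
  shows "set_integrable lebesgue {0<..T} (\<lambda>t. f t \<bullet> g t)"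
proof (rule set_integrable_bound)
  show "set_integrable lebesgue {0<..T} (\<lambda>t. (norm (f t))\<^sup>2 + (norm (g t))\<^sup>2)"
    by (rule set_integral_add(1)[OF sqi_norm[OF f] sqi_norm[OF g]])
  have le: "norm (x \<bullet> y) \<le> norm ((norm x)\<^sup>2 + (norm y)\<^sup>2)" for x y :: 'b
  proof -
    have "\<bar>x \<bullet> y\<bar> \<le> (norm x)\<^sup>2 + (norm y)\<^sup>2"
      using two_inner_le[of x y] two_inner_le[of "-x" y] zero_le_power2[of "norm x"] zero_le_power2[of "norm y"]
      unfolding norm_minus_cancel inner_minus_left by linarith
    then show ?thesis by simp
  qed
  show "AE t in lebesgue. t \<in> {0<..T} \<longrightarrow> norm (f t \<bullet> g t) \<le> norm ((norm (f t))\<^sup>2 + (norm (g t))\<^sup>2)"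
    by (rule AE_I2, rule impI, rule le)
  show "set_borel_measurable lebesgue {0<..T} (\<lambda>t. f t \<bullet> g t)"
    by (rule set_borel_measurable_inner[OF sqi_measurable[OF f] sqi_measurable[OF g]])
qed

section \<open>Convergence of resolvents along paths\<close>

context closed_form
begin

lemma J_diff_norm_sq_le: "0 < l \<Longrightarrow> (norm (J l h - h))\<^sup>2 \<le> 4 * (norm h)\<^sup>2"
proof -
  assume l: "0 < l"
  have "norm (J l h - h) \<le> 2 * norm h"
    using norm_triangle_ineq4[of "J l h" h] norm_J_le[OF l, of h] by linarith
  then have "(norm (J l h - h))\<^sup>2 \<le> (2 * norm h)\<^sup>2" by (intro power_mono) auto
  then show ?thesis by (simp only: power_mult_distrib) simp
qed

text \<open>\<open>Jn n\<close> commutes with the integral and has values in \<open>V\<close>, so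
  the integral is a limit of elements of the closed set \<open>H\<close>.\<close>

lemma H_set_integral:
  assumes f: "set_integrable M S f" and H: "AE x in M. x \<in> S \<longrightarrow> f x \<in> H"
  shows "(LINT x:S|M. f x) \<in> H"
proof -
  note J' = set_integral_bounded_linear[OF bounded_linear_J[OF eps_pos] f]
  have "(\<lambda>n. LINT x:S|M. Jn n (f x)) \<longlonglongrightarrow> (LINT x:S|M. f x)"
  proof (rule set_dominated_convergence[OF set_integrable_norm[OF f]])
    show "AE x in M. x \<in> S \<longrightarrow> (\<lambda>n. Jn n (f x)) \<longlonglongrightarrow> f x"
      using H
    proof eventually_elim
      case (elim x)
      then show ?case using Jn_tendsto by blast
    qed
    show "AE x in M. x \<in> S \<longrightarrow> norm (Jn n (f x)) \<le> norm (f x)" for n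
      by (rule AE_I2, rule impI, rule norm_J_le[OF eps_pos])
    show "set_borel_measurable M S (\<lambda>x. Jn n (f x))" for n
      by (rule set_integrable_imp_set_borel_measurable[OF J'(1)])
  qed (rule set_integrable_imp_set_borel_measurable[OF f])
  then show ?thesis unfolding J'(2)
    by (rule closed_sequentially[OF closed_H, rotated]) (rule J_in_H[OF eps_pos])
qed

text \<open>Pointwise convergence dominated by \<open>4 * (norm (y t))\<^sup>2\<close>. Applied to
  \<open>A u\<close> and \<open>u'\<close>, it makes the convergence of resolvents along a path
  uniform in time.\<close>

lemma Jn_tendsto_sq:
  assumes y: "sqi T y" and H: "AE t in lebesgue. t \<in> {0<..T} \<longrightarrow> y t \<in> H"
  shows "(\<lambda>n. LINT t:{0<..T}|lebesgue. (norm (Jn n (y t) - y t))\<^sup>2) \<longlonglongrightarrow> 0"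
    and "set_integrable lebesgue {0<..T} (\<lambda>t. (norm (Jn n (y t) - y t))\<^sup>2)"
proof -
  have s: "sqi T (\<lambda>t. Jn n (y t) - y t)" for n
    by (intro sqi_diff sqi_bounded_linear[OF y] bounded_linear_J eps_pos y)
  then show "set_integrable lebesgue {0<..T} (\<lambda>t. (norm (Jn n (y t) - y t))\<^sup>2)" by (rule sqi_norm)
  have "(\<lambda>n. LINT t:{0<..T}|lebesgue. (norm (Jn n (y t) - y t))\<^sup>2) \<longlonglongrightarrow> (LINT t:{0<..T}|lebesgue. 0)"
  proof (rule set_dominated_convergence)
    show "set_integrable lebesgue {0<..T} (\<lambda>t. 4 * (norm (y t))\<^sup>2)"
      by (intro set_integrable_mult_right sqi_norm y)
    show "AE t in lebesgue. t \<in> {0<..T} \<longrightarrow> (\<lambda>n. (norm (Jn n (y t) - y t))\<^sup>2) \<longlonglongrightarrow> 0"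
      using H
    proof eventually_elim
      case (elim t)
      show ?case
      proof
        assume "t \<in> {0<..T}"
        then have "(\<lambda>n. Jn n (y t)) \<longlonglongrightarrow> y t" using elim Jn_tendsto by blast
        then have "(\<lambda>n. (norm (Jn n (y t) - y t))\<^sup>2) \<longlonglongrightarrow> (norm (y t - y t))\<^sup>2"
          by (intro tendsto_intros)
        then show "(\<lambda>n. (norm (Jn n (y t) - y t))\<^sup>2) \<longlonglongrightarrow> 0" by simp
      qed
    qed
    show "AE t in lebesgue. t \<in> {0<..T} \<longrightarrow> norm ((norm (Jn n (y t) - y t))\<^sup>2) \<le> 4 * (norm (y t))\<^sup>2" for n
      using J_diff_norm_sq_le[OF eps_pos] by simp
    show "set_borel_measurable lebesgue {0<..T} (\<lambda>t. (norm (Jn n (y t) - y t))\<^sup>2)" for n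
      by (rule set_integrable_imp_set_borel_measurable[OF sqi_norm[OF s]])
  qed (simp add: set_borel_measurable_def)
  then show "(\<lambda>n. LINT t:{0<..T}|lebesgue. (norm (Jn n (y t) - y t))\<^sup>2) \<longlonglongrightarrow> 0" by simp
qed

lemma a_self_tendsto:
  assumes x: "\<And>n. x n \<in> V" and l: "l \<in> V" and lim: "(\<lambda>n. a (x n - l) (x n - l)) \<longlonglongrightarrow> 0"
  shows "(\<lambda>n. a (x n) (x n)) \<longlonglongrightarrow> a l l"
proof -
  have "(\<lambda>n. a (x n - l) (x n - l) + 2 * a (x n) l - a l l) \<longlonglongrightarrow> 0 + 2 * a l l - a l l"
    by (intro tendsto_intros lim a_tendsto[OF x l lim l])
  moreover have "a (x n - l) (x n - l) + 2 * a (x n) l - a l l = a (x n) (x n)" for n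
    using a_diff_diff[OF x l, of n] by simp
  ultimately show ?thesis by simp
qed

section \<open>Paths with square-integrable \<open>u'\<close> and \<open>A u\<close>: continuity
  into \<open>V\<close> and energy identity\<close>

context
  fixes T :: real and u u' y :: "real \<Rightarrow> 'h"
  assumes T: "0 \<le> T" and u: "ac T u u'" and su': "sqi T u'" and sy: "sqi T y"
    and eq: "AE t in lebesgue. t \<in> {0<..T} \<longrightarrow> u t \<in> dom \<and> A (u t) = y t \<and> u' t \<in> H"
    and u0: "u 0 \<in> V"
begin

lemma path_in_H: "t \<in> {0..T} \<Longrightarrow> u t \<in> H"
proof -
  assume "t \<in> {0..T}"
  then have t: "0 \<le> t" "t \<le> T" by auto
  have "(LINT r:{0<..t}|lebesgue. u' r) \<in> H"
    by (rule H_set_integral[OF set_integrable_Ioc_subset[OF ac_integrable[OF u] order_refl t(2)]])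
      (use eq t in \<open>auto elim!: eventually_mono\<close>)
  then show ?thesis unfolding ac_eq[OF u t] using u0 V_subset_H by (blast intro: H_add)
qed

lemma y_in_H: "AE t in lebesgue. t \<in> {0<..T} \<longrightarrow> y t \<in> H"
  using eq by eventually_elim (metis domD(2))

lemma u'_in_H: "AE t in lebesgue. t \<in> {0<..T} \<longrightarrow> u' t \<in> H"
  using eq by eventually_elim blast

text \<open>Uniform Cauchy property for the form. The form of \<open>Jn m u - Jn n u\<close> is a
  bounded quadratic expression in \<open>u\<close>, so it is absolutely continuous in time; its
  derivative pairs the differences of resolvents of \<open>A u\<close> and of \<open>u'\<close>,
  which are small in L2(0,T;H).\<close>

lemma resolvent_path_bound:
  "\<exists>B. B \<longlonglongrightarrow> 0 \<and>
    (\<forall>m n. \<forall>t\<in>{0..T}. a (Jn m (u t) - Jn n (u t)) (Jn m (u t) - Jn n (u t)) \<le> B m + B n)"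
proof -
  define c where "c n t = 2 * (norm (Jn n (y t) - y t))\<^sup>2 + 2 * (norm (Jn n (u' t) - u' t))\<^sup>2" for n t
  define b where "b n = (LINT t:{0<..T}|lebesgue. c n t)" for n
  \<comment> \<open>The form at time 0 plus the integral of its derivative. Each difference between
    the indices \<open>m\<close> and \<open>n\<close> is split at the limit, whence the factors 2
    here and in \<open>c\<close>.\<close>
  define B where "B n = 2 * a (Jn n (u 0) - u 0) (Jn n (u 0) - u 0) + b n" for n
  note ny = Jn_tendsto_sq[OF sy y_in_H] and nu = Jn_tendsto_sq[OF su' u'_in_H]
  have ic: "set_integrable lebesgue {0<..T} (c n)" for n
    unfolding c_def by (intro set_integral_add(1) set_integrable_mult_right ny(2) nu(2))
  have b: "b n = 2 * (LINT t:{0<..T}|lebesgue. (norm (Jn n (y t) - y t))\<^sup>2)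
      + 2 * (LINT t:{0<..T}|lebesgue. (norm (Jn n (u' t) - u' t))\<^sup>2)" for n
    unfolding b_def c_def
    by (subst set_integral_add(2)) (intro set_integrable_mult_right ny(2) nu(2) set_integral_mult_right arg_cong2[of _ _ _ _ "(+)"])+
  have "B \<longlonglongrightarrow> 2 * 0 + (2 * 0 + 2 * 0)"
    unfolding B_def b by (intro tendsto_intros ny(1) nu(1) a_Jn_tendsto[OF u0])
  then have B0: "B \<longlonglongrightarrow> 0" by simp
  have "a (Jn m (u t) - Jn n (u t)) (Jn m (u t) - Jn n (u t)) \<le> B m + B n" if "t \<in> {0..T}" for m n t
  proof -
    have t: "0 \<le> t" "t \<le> T" using that by auto
    \<comment> \<open>Bounded maps with \<open>a (x2 g) (x2 h) = x1 g \<bullet> x2 h\<close>;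
      symmetry of \<open>a\<close> lets the two halves of the derivative be merged.\<close>
    define x1 where "x1 t = Yn m t - Yn n t" for t
    define x2 where "x2 t = Jn m t - Jn n t" for t
    have E: "a (x2 h) (x2 h) = x1 h \<bullet> x2 h" for h
      unfolding x1_def x2_def by (simp add: a_diff V_ops J_in_V a_J inner_diff_left eps_pos)
    have Esym: "x1 g \<bullet> x2 h = x1 h \<bullet> x2 g" for g h
    proof -
      have "a (x2 g) (x2 h) = x1 g \<bullet> x2 h" for g h
        unfolding x1_def x2_def by (simp add: a_diff V_ops J_in_V a_J inner_diff_left eps_pos)
      moreover have "x2 h \<in> V" for h unfolding x2_def by (intro V_diff J_in_V eps_pos)
      ultimately show ?thesis using a_sym by metis
    qed
    have b1: "bounded_linear x1" unfolding x1_def by (intro bounded_linear_sub bounded_linear_Y eps_pos)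
    have b2: "bounded_linear x2" unfolding x2_def by (intro bounded_linear_sub bounded_linear_J eps_pos)
    have acE: "ac T (\<lambda>t. x1 (u t) \<bullet> x2 (u t)) (\<lambda>t. x1 (u' t) \<bullet> x2 (u t) + x1 (u t) \<bullet> x2 (u' t))"
      by (rule ac_bilinear[OF bounded_bilinear_inner T ac_bounded_linear[OF b1 u] ac_bounded_linear[OF b2 u]])
    have icc: "set_integrable lebesgue {0<..T} (\<lambda>t. c m t + c n t)" by (rule set_integral_add(1)[OF ic ic])
    have "x1 (u t) \<bullet> x2 (u t) \<le> x1 (u 0) \<bullet> x2 (u 0) + (LINT r:{0<..t}|lebesgue. c m r + c n r)"
    proof (rule ac_mono[OF acE icc _ t])
      show "AE t in lebesgue. t \<in> {0<..T} \<longrightarrow> x1 (u' t) \<bullet> x2 (u t) + x1 (u t) \<bullet> x2 (u' t) \<le> c m t + c n t"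
        using eq
      proof eventually_elim
        case (elim r)
        show ?case
        proof
          assume "r \<in> {0<..T}"
          then have d: "u r \<in> dom" "A (u r) = y r" using elim by blast+
          \<comment> \<open>On the domain the Yosida terms are resolvents of \<open>A u\<close>,
            hence no factor \<open>1 / eps n\<close> appears.\<close>
          then have "x1 (u r) = x2 (y r)" unfolding x1_def x2_def using Y_A[OF eps_pos] by metis
          then have "x1 (u' r) \<bullet> x2 (u r) + x1 (u r) \<bullet> x2 (u' r) = 2 * (x2 (y r) \<bullet> x2 (u' r))"
            unfolding Esym[of "u' r"] by simp
          also have "\<dots> \<le> (norm (x2 (y r)))\<^sup>2 + (norm (x2 (u' r)))\<^sup>2" by (rule two_inner_le)
          also have "\<dots> \<le> c m r + c n r"
            using norm_diff_sq_le[of "Jn m (y r)" "Jn n (y r)" "y r"] norm_diff_sq_le[of "Jn m (u' r)" "Jn n (u' r)" "u' r"]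
            unfolding x2_def c_def by linarith
          finally show "x1 (u' r) \<bullet> x2 (u r) + x1 (u r) \<bullet> x2 (u' r) \<le> c m r + c n r" .
        qed
      qed
    qed
    also have "(LINT r:{0<..t}|lebesgue. c m r + c n r) \<le> (LINT r:{0<..T}|lebesgue. c m r + c n r)"
      by (rule set_integral_Ioc_mono_upper[OF icc _ t]) (simp add: c_def)
    also have "\<dots> = b m + b n" unfolding b_def by (rule set_integral_add(2)[OF ic ic])
    also have "x1 (u 0) \<bullet> x2 (u 0)
        \<le> 2 * a (Jn m (u 0) - u 0) (Jn m (u 0) - u 0) + 2 * a (Jn n (u 0) - u 0) (Jn n (u 0) - u 0)"
    proof -
      have v: "Jn k (u 0) - u 0 \<in> V" "u 0 - Jn k (u 0) \<in> V" for k using u0 J_in_V[OF eps_pos] V_diff by blast+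
      have "(Jn m (u 0) - u 0) + (u 0 - Jn n (u 0)) = x2 (u 0)" by (simp add: x2_def)
      then show ?thesis
        using a_add_add_le[OF v(1)[of m] v(2)[of n]] a_minus_commute[OF u0 J_in_V[OF eps_pos], of n "u 0"]
        unfolding E[symmetric] by simp
    qed
    finally have "a (x2 (u t)) (x2 (u t)) \<le> B m + B n" unfolding E B_def by linarith
    then show ?thesis unfolding x2_def .
  qed
  with B0 show ?thesis by blast
qed

lemma path_in_V: "t \<in> {0..T} \<Longrightarrow> u t \<in> V"
  and resolvent_path_tendsto: "t \<in> {0..T} \<Longrightarrow> (\<lambda>n. a (Jn n (u t) - u t) (Jn n (u t) - u t)) \<longlonglongrightarrow> 0"
proof -
  assume t: "t \<in> {0..T}"
  obtain B where B: "B \<longlonglongrightarrow> 0"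
    "\<And>m n t. t \<in> {0..T} \<Longrightarrow> a (Jn m (u t) - Jn n (u t)) (Jn m (u t) - Jn n (u t)) \<le> B m + B n"
    using resolvent_path_bound by blast
  have "\<exists>N. \<forall>m\<ge>N. \<forall>n\<ge>N. a (Jn m (u t) - Jn n (u t)) (Jn m (u t) - Jn n (u t)) < e" if e: "e > 0" for e
  proof -
    have "\<forall>\<^sub>F n in sequentially. B n < e / 2" using B(1) by (rule order_tendstoD) (use e in simp)
    then obtain N where N: "\<And>n. n \<ge> N \<Longrightarrow> B n < e / 2" unfolding eventually_sequentially by blast
    have "a (Jn m (u t) - Jn n (u t)) (Jn m (u t) - Jn n (u t)) < e" if "m \<ge> N" "n \<ge> N" for m n
      using B(2)[OF t, of m n] N[OF that(1)] N[OF that(2)] by linarith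
    then show ?thesis by blast
  qed
  from V_limit[OF J_in_V[OF eps_pos] Jn_tendsto[OF path_in_H[OF t]] this]
  show "u t \<in> V" "(\<lambda>n. a (Jn n (u t) - u t) (Jn n (u t) - u t)) \<longlonglongrightarrow> 0" by blast+
qed

text \<open>A uniform limit of continuous paths. For fixed \<open>n\<close>, \<open>Jn n\<close> is
  continuous from \<open>H\<close> into \<open>V\<close>, because \<open>a (Jn n h) (Jn n h)\<close>
  is at most \<open>(2 / eps n) * (norm h)\<^sup>2\<close>; and \<open>u\<close> is close to
  \<open>Jn n u\<close> for the form, uniformly in time.\<close>

lemma path_V_continuous:
  assumes t: "t \<in> {0..T}"
  shows "((\<lambda>s. a (u s - u t) (u s - u t)) \<longlongrightarrow> 0) (at t within {0..T})"
proof (rule tendstoI)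
  fix e :: real assume e: "e > 0"
  obtain B where B: "B \<longlonglongrightarrow> 0"
    "\<And>m n t. t \<in> {0..T} \<Longrightarrow> a (Jn m (u t) - Jn n (u t)) (Jn m (u t) - Jn n (u t)) \<le> B m + B n"
    using resolvent_path_bound by blast
  \<comment> \<open>Let \<open>m\<close> tend to infinity in \<open>resolvent_path_bound\<close>,
    after splitting at \<open>Jn m (u s)\<close>.\<close>
  have near: "a (u s - Jn n (u s)) (u s - Jn n (u s)) \<le> 2 * B n" if s: "s \<in> {0..T}" for s n
  proof -
    have v: "u s - Jn m (u s) \<in> V" "Jn m (u s) - Jn n (u s) \<in> V" for m
      using path_in_V[OF s] J_in_V[OF eps_pos] V_diff by blast+
    have le: "a (u s - Jn n (u s)) (u s - Jn n (u s)) \<le> 2 * a (Jn m (u s) - u s) (Jn m (u s) - u s) + 2 * (B m + B n)" for m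
      using a_add_add_le[OF v(1)[of m] v(2)[of m]] B(2)[OF s, of m n]
        a_minus_commute[OF path_in_V[OF s] J_in_V[OF eps_pos], of m "u s"] by simp
    have lim: "(\<lambda>m. 2 * a (Jn m (u s) - u s) (Jn m (u s) - u s) + 2 * (B m + B n)) \<longlonglongrightarrow> 2 * 0 + 2 * (0 + B n)"
      by (intro tendsto_intros resolvent_path_tendsto[OF s] B(1))
    have "a (u s - Jn n (u s)) (u s - Jn n (u s)) \<le> 2 * 0 + 2 * (0 + B n)"
      by (rule LIMSEQ_le_const[OF lim]) (intro exI[of _ 0] allI impI le)
    then show ?thesis by simp
  qed
  \<comment> \<open>The two splittings below give at most \<open>12 * B n\<close> plus four times
    the form of \<open>Jn n (u s - u t)\<close>, that is less than 12e/32 + 4e/8.\<close>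
  have "\<forall>\<^sub>F n in sequentially. B n < e / 32" using B(1) by (rule order_tendstoD) (use e in simp)
  then obtain n where n: "B n < e / 32" unfolding eventually_sequentially by blast
  let ?j = "eps n"
  have c: "((\<lambda>s. norm (u s - u t)) \<longlongrightarrow> norm (u t - u t)) (at t within {0..T})"
    by (intro tendsto_intros) (use ac_continuous_on[OF u] t in \<open>simp add: continuous_on_def\<close>)
  have "((\<lambda>s. (2 / ?j) * (norm (u s - u t))\<^sup>2) \<longlongrightarrow> (2 / ?j) * (norm (u t - u t))\<^sup>2) (at t within {0..T})"
    by (intro tendsto_mult tendsto_power tendsto_const c)
  then have "((\<lambda>s. (2 / ?j) * (norm (u s - u t))\<^sup>2) \<longlongrightarrow> 0) (at t within {0..T})" by simp
  then have "\<forall>\<^sub>F s in at t within {0..T}. (2 / ?j) * (norm (u s - u t))\<^sup>2 < e / 8"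
    by (rule order_tendstoD) (use e in simp)
  moreover have "\<forall>\<^sub>F s in at t within {0..T}. s \<in> {0..T}" by (simp add: eventually_at_filter)
  ultimately show "\<forall>\<^sub>F s in at t within {0..T}. dist (a (u s - u t) (u s - u t)) 0 < e"
  proof eventually_elim
    case (elim s)
    let ?p = "u s - Jn n (u s)" and ?q = "Jn n (u s - u t)" and ?r = "u t - Jn n (u t)"
    have v: "?p \<in> V" "?q \<in> V" "?r \<in> V" "?q - ?r \<in> V"
      using path_in_V[OF elim(2)] path_in_V[OF t] J_in_V[OF eps_pos] V_diff by blast+
    have "a ?q ?q = Yn n (u s - u t) \<bullet> ?q" by (rule a_J[OF eps_pos v(2)])
    also have "\<dots> \<le> norm (Yn n (u s - u t)) * norm ?q" by (rule norm_cauchy_schwarz)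
    also have "\<dots> \<le> ((2 / ?j) * norm (u s - u t)) * norm (u s - u t)"
      by (intro mult_mono norm_Y_le norm_J_le eps_pos) (use eps_pos[of n] in auto)
    finally have q: "a ?q ?q < e / 8" using elim(1) by (simp add: power2_eq_square)
    have pq: "?p + (?q - ?r) = u s - u t" unfolding J_diff[OF eps_pos] by simp
    have 1: "a (u s - u t) (u s - u t) \<le> 2 * a ?p ?p + 2 * a (?q - ?r) (?q - ?r)"
      using a_add_add_le[OF v(1,4)] unfolding pq .
    have 2: "a (?q - ?r) (?q - ?r) \<le> 2 * a ?q ?q + 2 * a ?r ?r"
      using a_add_add_le[OF v(2,3)] a_diff_diff[OF v(2,3)] a_nonneg[OF V_add[OF v(2,3)]] v a_sym[OF v(2,3)]
      by (simp add: a_add a_add_right V_ops)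
    have "a (u s - u t) (u s - u t) < e"
      using 1 2 near[OF elim(2), of n] near[OF t, of n] q n e by linarith
    then show ?case using a_nonneg[OF V_diff[OF path_in_V[OF elim(2)] path_in_V[OF t]]] by simp
  qed
qed

text \<open>True for \<open>Jn n u\<close> by the product rule, and then passed to the limit. Since
  \<open>Yn n (u r) = Jn n (y r)\<close> for almost every time and resolvents are contractions, the
  integrand is dominated by \<open>(norm (y r))\<^sup>2 + (norm (u' r))\<^sup>2\<close> for all
  \<open>n\<close>.\<close>

lemma energy_identity:
  assumes t: "t \<in> {0..T}"
  shows "a (u t) (u t) = a (u 0) (u 0) + (LINT r:{0<..t}|lebesgue. 2 * (y r \<bullet> u' r))"
proof -
  have t': "0 \<le> t" "t \<le> T" "0 \<in> {0..T}" using t by auto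
  have j: "a (Jn n h) (Jn n h) = Yn n h \<bullet> Jn n h" for n h by (rule a_J[OF eps_pos J_in_V[OF eps_pos]])
  have e: "a (Jn n (u t)) (Jn n (u t))
    = a (Jn n (u 0)) (Jn n (u 0)) + (LINT r:{0<..t}|lebesgue. 2 * (Yn n (u r) \<bullet> Jn n (u' r)))" for n
  proof -
    have "ac T (\<lambda>t. Yn n (u t) \<bullet> Jn n (u t)) (\<lambda>t. Yn n (u' t) \<bullet> Jn n (u t) + Yn n (u t) \<bullet> Jn n (u' t))"
      by (rule ac_bilinear[OF bounded_bilinear_inner T ac_bounded_linear[OF bounded_linear_Y[OF eps_pos] u]
            ac_bounded_linear[OF bounded_linear_J[OF eps_pos] u]])
    moreover have "Yn n (u' t) \<bullet> Jn n (u t) + Yn n (u t) \<bullet> Jn n (u' t) = 2 * (Yn n (u t) \<bullet> Jn n (u' t))" for t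
    proof -
      have "Yn n g \<bullet> Jn n h = a (Jn n g) (Jn n h)" for g h by (rule a_J[OF eps_pos J_in_V[OF eps_pos], symmetric])
      then show ?thesis using a_sym[OF J_in_V[OF eps_pos] J_in_V[OF eps_pos], of n "u' t" n "u t"] by simp
    qed
    ultimately have "ac T (\<lambda>t. Yn n (u t) \<bullet> Jn n (u t)) (\<lambda>t. 2 * (Yn n (u t) \<bullet> Jn n (u' t)))" by simp
    from ac_eq[OF this t'(1,2)] show ?thesis unfolding j .
  qed
  have lim: "(\<lambda>n. LINT r:{0<..t}|lebesgue. 2 * (Yn n (u r) \<bullet> Jn n (u' r)))
      \<longlonglongrightarrow> (LINT r:{0<..t}|lebesgue. 2 * (y r \<bullet> u' r))"
  proof (rule set_dominated_convergence)
    have sub: "set_borel_measurable lebesgue {0<..t} f" if "set_integrable lebesgue {0<..T} f" for f :: "real \<Rightarrow> real"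
      by (rule set_integrable_imp_set_borel_measurable[OF set_integrable_Ioc_subset[OF that order_refl t'(2)]])
    show "set_integrable lebesgue {0<..t} (\<lambda>r. (norm (y r))\<^sup>2 + (norm (u' r))\<^sup>2)"
      by (rule set_integrable_Ioc_subset[OF set_integral_add(1)[OF sqi_norm[OF sy] sqi_norm[OF su']] order_refl t'(2)])
    have su: "sqi T u" by (rule sqi_continuous[OF ac_continuous_on[OF u]])
    show "set_borel_measurable lebesgue {0<..t} (\<lambda>r. 2 * (Yn n (u r) \<bullet> Jn n (u' r)))" for n
      by (rule sub, rule set_integrable_mult_right, rule sqi_inner[OF sqi_bounded_linear[OF su bounded_linear_Y[OF eps_pos]]
            sqi_bounded_linear[OF su' bounded_linear_J[OF eps_pos]]])
    show "set_borel_measurable lebesgue {0<..t} (\<lambda>r. 2 * (y r \<bullet> u' r))"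
      by (rule sub, rule set_integrable_mult_right, rule sqi_inner[OF sy su'])
    show "AE r in lebesgue. r \<in> {0<..t} \<longrightarrow> (\<lambda>n. 2 * (Yn n (u r) \<bullet> Jn n (u' r))) \<longlonglongrightarrow> 2 * (y r \<bullet> u' r)"
      using eq
    proof eventually_elim
      case (elim r)
      show ?case
      proof
        assume "r \<in> {0<..t}"
        then have "r \<in> {0<..T}" using t by simp
        then have d: "u r \<in> dom" "A (u r) = y r" "u' r \<in> H" using elim by blast+
        show "(\<lambda>n. 2 * (Yn n (u r) \<bullet> Jn n (u' r))) \<longlonglongrightarrow> 2 * (y r \<bullet> u' r)"
          unfolding d(2)[symmetric] by (intro tendsto_intros Yn_tendsto[OF d(1)] Jn_tendsto[OF d(3)])
      qed
    qed
    show "AE r in lebesgue. r \<in> {0<..t} \<longrightarrow> norm (2 * (Yn n (u r) \<bullet> Jn n (u' r))) \<le> (norm (y r))\<^sup>2 + (norm (u' r))\<^sup>2" for n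
      using eq
    proof eventually_elim
      case (elim r)
      show ?case
      proof
        assume "r \<in> {0<..t}"
        then have "r \<in> {0<..T}" using t by simp
        then have "u r \<in> dom" "A (u r) = y r" using elim by blast+
        then have Y: "Yn n (u r) = Jn n (y r)" using Y_A[OF eps_pos] by metis
        have "norm (2 * (Jn n (y r) \<bullet> Jn n (u' r))) \<le> (norm (Jn n (y r)))\<^sup>2 + (norm (Jn n (u' r)))\<^sup>2"
          using two_inner_le[of "Jn n (y r)" "Jn n (u' r)"] two_inner_le[of "- Jn n (y r)" "Jn n (u' r)"]
          unfolding real_norm_def norm_minus_cancel inner_minus_left by linarith
        also have "\<dots> \<le> (norm (y r))\<^sup>2 + (norm (u' r))\<^sup>2"
          by (intro add_mono power_mono norm_J_le eps_pos norm_ge_zero)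
        finally show "norm (2 * (Yn n (u r) \<bullet> Jn n (u' r))) \<le> (norm (y r))\<^sup>2 + (norm (u' r))\<^sup>2" unfolding Y .
      qed
    qed
  qed
  have "(\<lambda>n. a (Jn n (u t)) (Jn n (u t))) \<longlonglongrightarrow> a (u 0) (u 0) + (LINT r:{0<..t}|lebesgue. 2 * (y r \<bullet> u' r))"
    unfolding e by (intro tendsto_add lim a_self_tendsto[OF J_in_V[OF eps_pos] u0 a_Jn_tendsto[OF u0]])
  moreover have "(\<lambda>n. a (Jn n (u t)) (Jn n (u t))) \<longlonglongrightarrow> a (u t) (u t)"
    by (rule a_self_tendsto[OF J_in_V[OF eps_pos] path_in_V[OF t] resolvent_path_tendsto[OF t]])
  ultimately show ?thesis using LIMSEQ_unique by blast
qed

end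

text \<open>\<open>u\<close> is the representative defined at every time. The path \<open>y\<close>
  stands for \<open>A u\<close>: carrying it as data records its measurability, which is not evident
  for a composition with \<open>A\<close>.\<close>

definition strong_solution :: "real \<Rightarrow> ('h \<Rightarrow> 'h) \<Rightarrow> (real \<Rightarrow> 'h) \<Rightarrow> (real \<Rightarrow> 'h) \<Rightarrow> (real \<Rightarrow> 'h) \<Rightarrow> bool" where
  "strong_solution T F u u' y \<longleftrightarrow> ac T u u' \<and> sqi T u' \<and> sqi T y \<and>
     (AE t in lebesgue. t \<in> {0<..T} \<longrightarrow> u t \<in> dom \<and> A (u t) = y t \<and> u' t = F (u t) - y t)"

text \<open>In the first estimate \<open>A\<close> is dropped by monotonicity, which leaves Gronwall
  with rate \<open>2 * L\<close>. In the second, the energy identity has the integrand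
  \<open>2 * (x r \<bullet> w' r)\<close>, at most \<open>L\<^sup>2 * (norm (w r))\<^sup>2\<close>;
  inserting the first estimate and integrating over \<open>[0,T]\<close> gives the constant.\<close>

lemma strong_solution_difference:
  assumes T: "0 \<le> T" and L: "L-lipschitz_on H F" and F: "F ` H \<subseteq> H"
    and u: "strong_solution T F u u' y" "u 0 \<in> V" and v: "strong_solution T F v v' z" "v 0 \<in> V"
    and t: "t \<in> {0..T}"
  shows "(norm (u t - v t))\<^sup>2 \<le> exp (2 * L * T) * (norm (u 0 - v 0))\<^sup>2"
    and "a (u t - v t) (u t - v t) \<le> a (u 0 - v 0) (u 0 - v 0) + T * L\<^sup>2 * exp (2 * L * T) * (norm (u 0 - v 0))\<^sup>2"
proof -
  have L0: "0 \<le> L" using L by (rule lipschitz_on_nonneg)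
  define w where "w t = u t - v t" for t
  define w' where "w' t = u' t - v' t" for t
  define x where "x t = y t - z t" for t
  have w: "ac T w w'" unfolding w_def w'_def using u v unfolding strong_solution_def by (blast intro: ac_diff)
  have sw': "sqi T w'" and sx: "sqi T x"
    unfolding w'_def x_def using u v unfolding strong_solution_def by (blast intro: sqi_diff)+
  have eq': "AE t in lebesgue. t \<in> {0<..T} \<longrightarrow> w t \<in> dom \<and> A (w t) = x t \<and> w' t \<in> H \<and> norm (w' t + x t) \<le> L * norm (w t)"
    using u(1)[unfolded strong_solution_def, THEN conjunct2, THEN conjunct2, THEN conjunct2]
      v(1)[unfolded strong_solution_def, THEN conjunct2, THEN conjunct2, THEN conjunct2]
  proof eventually_elim
    case (elim t)
    show ?case
    proof
      assume "t \<in> {0<..T}"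
      then have *: "u t \<in> dom" "A (u t) = y t" "u' t = F (u t) - y t" "v t \<in> dom" "A (v t) = z t" "v' t = F (v t) - z t"
        using elim by blast+
      have H: "u t \<in> H" "v t \<in> H" "y t \<in> H" "z t \<in> H"
        using domD(1,2)[OF *(1)] domD(1,2)[OF *(4)] V_subset_H unfolding *(2,5) by blast+
      have H': "F (u t) \<in> H" "F (v t) \<in> H" using H(1,2) F by blast+
      have "w' t + x t = F (u t) - F (v t)" unfolding w'_def x_def *(3,6) by simp
      then have "norm (w' t + x t) \<le> L * norm (w t)"
        using lipschitz_onD[OF L H(1,2)] unfolding w_def by (simp add: dist_norm)
      moreover have "w' t \<in> H" unfolding w'_def *(3,6) by (intro H_diff H H')
      moreover have "w t \<in> dom" "A (w t) = x t"
        unfolding w_def x_def using dom_diff[OF *(1,4)] A_diff[OF *(1,4)] *(2,5) by auto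
      ultimately show "w t \<in> dom \<and> A (w t) = x t \<and> w' t \<in> H \<and> norm (w' t + x t) \<le> L * norm (w t)" by blast
    qed
  qed
  then have eq: "AE t in lebesgue. t \<in> {0<..T} \<longrightarrow> w t \<in> dom \<and> A (w t) = x t \<and> w' t \<in> H"
    by eventually_elim blast
  have w0: "w 0 \<in> V" unfolding w_def by (rule V_diff[OF u(2) v(2)])
  have est: "(norm (w t))\<^sup>2 \<le> exp (2 * L * T) * (norm (w 0))\<^sup>2" if "t \<in> {0..T}" for t
  proof -
    have t: "0 \<le> t" "t \<le> T" using that by auto
    have g: "w t \<bullet> w t \<le> exp ((2 * L) * t) * (w 0 \<bullet> w 0 + (LINT r:{0<..T}|lebesgue. 0))"
    proof (rule gronwall_ac[OF T _ ac_bilinear[OF bounded_bilinear_inner T w w] set_integrable_const_Ioc _ _ t])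
      show "AE t in lebesgue. t \<in> {0<..T} \<longrightarrow> w' t \<bullet> w t + w t \<bullet> w' t \<le> (2 * L) * (w t \<bullet> w t) + 0"
        using eq'
      proof eventually_elim
        case (elim t)
        show ?case
        proof
          assume "t \<in> {0<..T}"
          then have d: "w t \<in> dom" "A (w t) = x t" "norm (w' t + x t) \<le> L * norm (w t)" using elim by blast+
          have "x t \<bullet> w t = a (w t) (w t)" using domD(3)[OF d(1) domD(1)[OF d(1)]] d(2) by simp
          then have "0 \<le> x t \<bullet> w t" using a_nonneg[OF domD(1)[OF d(1)]] by simp
          then have "w' t \<bullet> w t \<le> (w' t + x t) \<bullet> w t" by (simp add: inner_add_left)
          also have "\<dots> \<le> norm (w' t + x t) * norm (w t)" by (rule norm_cauchy_schwarz)
          also have "\<dots> \<le> (L * norm (w t)) * norm (w t)" by (rule mult_right_mono[OF d(3) norm_ge_zero])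
          also have "\<dots> = L * (w t \<bullet> w t)" by (simp add: power2_norm_eq_inner[symmetric] power2_eq_square)
          finally show "w' t \<bullet> w t + w t \<bullet> w' t \<le> (2 * L) * (w t \<bullet> w t) + 0"
            by (simp add: inner_commute)
        qed
      qed
    qed (use L0 in auto)
    also have "\<dots> = exp ((2 * L) * t) * (norm (w 0))\<^sup>2" by (simp add: power2_norm_eq_inner)
    also have "\<dots> \<le> exp (2 * L * T) * (norm (w 0))\<^sup>2"
      by (intro mult_right_mono) (use t L0 in \<open>auto intro: mult_left_mono\<close>)
    finally show ?thesis by (simp add: power2_norm_eq_inner)
  qed
  show "(norm (u t - v t))\<^sup>2 \<le> exp (2 * L * T) * (norm (u 0 - v 0))\<^sup>2" using est[OF t] unfolding w_def .
  have "a (w t) (w t) = a (w 0) (w 0) + (LINT r:{0<..t}|lebesgue. 2 * (x r \<bullet> w' r))"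
    by (rule energy_identity[OF T w sw' sx eq w0 t])
  also have "(LINT r:{0<..t}|lebesgue. 2 * (x r \<bullet> w' r)) \<le> T * (L\<^sup>2 * (exp (2 * L * T) * (norm (w 0))\<^sup>2))"
  proof (rule set_integral_const_le)
    show "set_integrable lebesgue {0<..T} (\<lambda>r. 2 * (x r \<bullet> w' r))"
      by (intro set_integrable_mult_right sqi_inner sx sw')
    show "AE r in lebesgue. r \<in> {0<..T} \<longrightarrow> 2 * (x r \<bullet> w' r) \<le> L\<^sup>2 * (exp (2 * L * T) * (norm (w 0))\<^sup>2)"
      using eq'
    proof eventually_elim
      case (elim r)
      show ?case
      proof
        assume r: "r \<in> {0<..T}"
        let ?d = "w' r + x r"
        \<comment> \<open>Here \<open>?d\<close> is the difference of the nonlinear terms. Young's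
          inequality absorbs its product with \<open>x r\<close> into the dissipation
          \<open>- 2 * (norm (x r))\<^sup>2\<close>.\<close>
        have "2 * (x r \<bullet> w' r) = 2 * (x r \<bullet> ?d) - 2 * (norm (x r))\<^sup>2"
          by (simp add: inner_add_right power2_norm_eq_inner)
        also have "\<dots> \<le> (norm ?d)\<^sup>2" using two_inner_le[of "x r" ?d] zero_le_power2[of "norm (x r)"] by linarith
        also have "\<dots> \<le> (L * norm (w r))\<^sup>2" by (rule power_mono) (use elim r in blast, simp)
        also have "\<dots> = L\<^sup>2 * (norm (w r))\<^sup>2" by (rule power_mult_distrib)
        also have "\<dots> \<le> L\<^sup>2 * (exp (2 * L * T) * (norm (w 0))\<^sup>2)"
          by (rule mult_left_mono[OF est]) (use r in auto)
        finally show "2 * (x r \<bullet> w' r) \<le> L\<^sup>2 * (exp (2 * L * T) * (norm (w 0))\<^sup>2)" .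
      qed
    qed
  qed (use t in auto)
  finally show "a (u t - v t) (u t - v t) \<le> a (u 0 - v 0) (u 0 - v 0) + T * L\<^sup>2 * exp (2 * L * T) * (norm (u 0 - v 0))\<^sup>2"
    unfolding w_def mult.assoc by linarith
qed

end

subsection \<open>Existence by Yosida approximation\<close>

lemma clamp_bcontfun:
  fixes h :: "real \<Rightarrow> 'b::metric_space"
  assumes T: "0 \<le> T" and h: "continuous_on {0..T} h"
  shows "(\<lambda>t. h (max 0 (min T t))) \<in> bcontfun"
proof -
  have c: "max 0 (min T t) \<in> {0..T}" for t using T by auto
  have "continuous_on UNIV (\<lambda>t. h (max 0 (min T t)))"
    by (rule continuous_on_compose2[OF h]) (use c in \<open>auto intro!: continuous_intros\<close>)
  moreover have "bounded (range (\<lambda>t. h (max 0 (min T t))))"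
    by (rule bounded_subset[OF compact_imp_bounded[OF compact_continuous_image[OF h compact_Icc]]])
      (use c in blast)
  ultimately show ?thesis unfolding bcontfun_def by blast
qed

text \<open>
  The fixed point is sought as \<open>e\<^sup>-\<^sup>k\<^sup>t u(t)\<close> with \<open>k > L\<close>, which makes the integral operator a contraction on
  all of \<open>[0,T]\<close>; bounded continuous functions on \<open>[0,T]\<close> are extended to the line by clamping \<open>t\<close>.
\<close>

lemma picard_lindeloef_invariant:
  fixes G :: "'h::{banach, second_countable_topology} \<Rightarrow> 'h"
  assumes T: "0 \<le> T" and S: "closed S" and L: "L-lipschitz_on S G" and u0: "u0 \<in> S"
    and inv: "\<And>x t. continuous_on {0..T} x \<Longrightarrow> (\<forall>r\<in>{0..T}. x r \<in> S) \<Longrightarrow> t \<in> {0..T} \<Longrightarrow>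
      u0 + (LINT r:{0<..t}|lebesgue. G (x r)) \<in> S"
  shows "\<exists>u. ac T u (\<lambda>t. G (u t)) \<and> u 0 = u0 \<and> (\<forall>t\<in>{0..T}. u t \<in> S)"
proof -
  have L0: "0 \<le> L" using L by (rule lipschitz_on_nonneg)
  define k where "k = L + 1"
  have k: "0 < k" using L0 unfolding k_def by simp
  define W where "W x r = exp (k * r) *\<^sub>R apply_bcontfun x r" for x :: "real \<Rightarrow>\<^sub>C 'h" and r
  define P where "P x t = u0 + (LINT r:{0<..t}|lebesgue. G (W x r))" for x t
  \<comment> \<open>\<open>G\<close> is controlled on \<open>S\<close> only, so the contraction acts
    on the closed set of paths staying in \<open>S\<close>; \<open>inv\<close> says that the
    integral operator preserves it.\<close>
  define X where "X = {x. \<forall>r\<in>{0..T}. W x r \<in> S}"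
  define \<Phi> where "\<Phi> x = Bcontfun (\<lambda>t. exp (- (k * max 0 (min T t))) *\<^sub>R P x (max 0 (min T t)))" for x
  have cl: "max 0 (min T t) \<in> {0..T}" for t using T by auto
  have cW: "continuous_on {0..T} (W x)" for x
    unfolding W_def by (intro continuous_intros) auto
  have cG: "continuous_on {0..T} (\<lambda>r. G (W x r))" if "x \<in> X" for x
    by (rule continuous_on_compose2[OF lipschitz_on_continuous_on[OF L] cW]) (use that in \<open>auto simp: X_def\<close>)
  have iG: "set_integrable lebesgue {0<..T} (\<lambda>r. G (W x r))" if "x \<in> X" for x
    by (rule set_integrable_Ioc_continuous[OF cG[OF that]])
  have acP: "ac T (P x) (\<lambda>r. G (W x r))" if "x \<in> X" for x
    unfolding P_def by (rule ac_primitive[OF iG[OF that]])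
  have app: "apply_bcontfun (\<Phi> x) t = exp (- (k * max 0 (min T t))) *\<^sub>R P x (max 0 (min T t))" if "x \<in> X" for x t
    unfolding \<Phi>_def
    by (subst Bcontfun_inverse[OF clamp_bcontfun[OF T]])
      (intro continuous_intros ac_continuous_on[OF acP[OF that]], rule refl)
  have W\<Phi>: "W (\<Phi> x) t = P x t" if "x \<in> X" "t \<in> {0..T}" for x t
  proof -
    have "max 0 (min T t) = t" using that by auto
    then show ?thesis unfolding W_def app[OF that(1)] by (simp add: exp_minus)
  qed
  have \<Phi>X: "\<Phi> ` X \<subseteq> X"
  proof (rule image_subsetI)
    fix x assume x: "x \<in> X"
    have "W (\<Phi> x) t \<in> S" if "t \<in> {0..T}" for t
      unfolding W\<Phi>[OF x that] P_def by (rule inv[OF cW _ that]) (use x in \<open>simp add: X_def\<close>)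
    then show "\<Phi> x \<in> X" unfolding X_def by blast
  qed
  have "closed X"
    unfolding closed_sequential_limits
  proof (intro allI impI)
    fix xs l assume *: "(\<forall>n. xs n \<in> X) \<and> xs \<longlonglongrightarrow> l"
    have "W l r \<in> S" if r: "r \<in> {0..T}" for r
    proof (rule closed_sequentially[OF S])
      show "W (xs n) r \<in> S" for n using * r unfolding X_def by blast
      have "(\<lambda>n. apply_bcontfun (xs n) r) \<longlonglongrightarrow> apply_bcontfun l r"
        by (rule metric_tendsto_imp_tendsto[of xs l]) (use * in \<open>auto intro!: always_eventually dist_bounded\<close>)
      then show "(\<lambda>n. W (xs n) r) \<longlonglongrightarrow> W l r" unfolding W_def by (intro tendsto_intros)
    qed
    then show "l \<in> X" unfolding X_def by blast
  qed
  then have cX: "complete X" by (simp add: complete_eq_closed)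
  have "Bcontfun (\<lambda>t. exp (- (k * max 0 (min T t))) *\<^sub>R u0) \<in> X"
  proof -
    have "W (Bcontfun (\<lambda>t. exp (- (k * max 0 (min T t))) *\<^sub>R u0)) r = u0" if "r \<in> {0..T}" for r
    proof -
      have "max 0 (min T r) = r" using that by auto
      moreover have "apply_bcontfun (Bcontfun (\<lambda>t. exp (- (k * max 0 (min T t))) *\<^sub>R u0)) r = exp (- (k * max 0 (min T r))) *\<^sub>R u0"
        by (subst Bcontfun_inverse[OF clamp_bcontfun[OF T]]) (intro continuous_intros, rule refl)
      ultimately show ?thesis unfolding W_def by (simp add: exp_minus)
    qed
    then show ?thesis unfolding X_def using u0 by simp
  qed
  then have ne: "X \<noteq> {}" by blast
  \<comment> \<open>Integrating \<open>L * exp (k * r)\<close> up to \<tau> gives at most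
    \<open>(L / k) * exp (k * \<tau>)\<close>, and the weight cancels the exponential. The factor is
    below 1 because \<open>k = L + 1\<close>.\<close>
  have con: "dist (\<Phi> x) (\<Phi> y) \<le> (L / k) * dist x y" if xy: "x \<in> X" "y \<in> X" for x y
  proof (rule dist_bound)
    fix t
    define \<tau> where "\<tau> = max 0 (min T t)"
    have \<tau>: "0 \<le> \<tau>" "\<tau> \<le> T" using cl[of t] unfolding \<tau>_def by auto
    let ?c = "L / k * dist x y"
    have ie: "set_integrable lebesgue {0<..T} (\<lambda>r. ?c * (k * exp (k * r)))"
      by (intro set_integrable_mult_right ac_integrable[OF ac_exp])
    have "P x \<tau> - P y \<tau> = (LINT r:{0<..\<tau>}|lebesgue. G (W x r)) - (LINT r:{0<..\<tau>}|lebesgue. G (W y r))"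
      unfolding P_def by simp
    also have "\<dots> = (LINT r:{0<..\<tau>}|lebesgue. G (W x r) - G (W y r))"
      by (rule set_integral_diff(2)[symmetric]; rule set_integrable_Ioc_subset[OF iG order_refl \<tau>(2)]; rule xy)
    finally have "norm (P x \<tau> - P y \<tau>) = norm (LINT r:{0<..\<tau>}|lebesgue. G (W x r) - G (W y r))" by simp
    also have "\<dots> \<le> (LINT r:{0<..\<tau>}|lebesgue. ?c * (k * exp (k * r)))"
    proof (rule set_integral_norm_le)
      show "set_integrable lebesgue {0<..\<tau>} (\<lambda>r. G (W x r) - G (W y r))"
        by (rule set_integrable_Ioc_subset[OF set_integral_diff(1)[OF iG[OF xy(1)] iG[OF xy(2)]] order_refl \<tau>(2)])
      show "set_integrable lebesgue {0<..\<tau>} (\<lambda>r. ?c * (k * exp (k * r)))"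
        by (rule set_integrable_Ioc_subset[OF ie order_refl \<tau>(2)])
      fix r assume "r \<in> {0<..\<tau>}"
      then have r: "r \<in> {0..T}" using \<tau> by auto
      have "norm (G (W x r) - G (W y r)) \<le> L * dist (W x r) (W y r)"
        using lipschitz_onD[OF L, of "W x r" "W y r"] xy r unfolding X_def by (simp add: dist_norm)
      also have "dist (W x r) (W y r) = exp (k * r) * dist (apply_bcontfun x r) (apply_bcontfun y r)"
        unfolding W_def by (simp add: dist_norm scaleR_diff_right[symmetric])
      also have "L * \<dots> \<le> L * (exp (k * r) * dist x y)"
        by (intro mult_left_mono dist_bounded L0) auto
      also have "\<dots> = ?c * (k * exp (k * r))" using k by simp
      finally show "norm (G (W x r) - G (W y r)) \<le> ?c * (k * exp (k * r))" .
    qed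
    also have "\<dots> = ?c * (LINT r:{0<..\<tau>}|lebesgue. k * exp (k * r))" by (rule set_integral_mult_right)
    also have "(LINT r:{0<..\<tau>}|lebesgue. k * exp (k * r)) = exp (k * \<tau>) - 1"
      using ac_eq[OF ac_exp \<tau>, of k] by simp
    also have "?c * (exp (k * \<tau>) - 1) \<le> ?c * exp (k * \<tau>)"
      by (intro mult_left_mono mult_nonneg_nonneg) (use L0 k in auto)
    finally have le: "norm (P x \<tau> - P y \<tau>) \<le> ?c * exp (k * \<tau>)" .
    have "dist (apply_bcontfun (\<Phi> x) t) (apply_bcontfun (\<Phi> y) t) = exp (- (k * \<tau>)) * norm (P x \<tau> - P y \<tau>)"
      unfolding app[OF xy(1)] app[OF xy(2)] \<tau>_def[symmetric] by (simp add: dist_norm scaleR_diff_right[symmetric])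
    also have "\<dots> \<le> exp (- (k * \<tau>)) * (?c * exp (k * \<tau>))" by (rule mult_left_mono[OF le]) simp
    also have "\<dots> = ?c" by (simp add: exp_minus)
    finally show "dist (apply_bcontfun (\<Phi> x) t) (apply_bcontfun (\<Phi> y) t) \<le> ?c" .
  qed
  have "\<exists>!x\<in>X. \<Phi> x = x"
    by (rule Banach_fix[OF cX ne _ _ \<Phi>X con]) (use L0 k in \<open>auto simp: k_def\<close>)
  then obtain x where x: "x \<in> X" "\<Phi> x = x" by blast
  have WP: "W x t = P x t" if "t \<in> {0..T}" for t using W\<Phi>[OF x(1) that] unfolding x(2) .
  have P0: "P x 0 = u0" unfolding P_def by (simp add: set_lebesgue_integral_def)
  have W0: "W x 0 = u0" using WP[of 0] P0 T by simp
  have "ac T (W x) (\<lambda>t. G (W x t))"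
    unfolding ac_iff
  proof (intro conjI ballI iG[OF x(1)])
    fix t assume "t \<in> {0..T}"
    then show "W x t = W x 0 + (LINT r:{0<..t}|lebesgue. G (W x r))" unfolding W0 using WP P_def by metis
  qed
  then show ?thesis using W0 x(1) unfolding X_def by blast
qed

lemma Cauchy_of_square_bound:
  fixes x :: "nat \<Rightarrow> 'b::{real_normed_vector, complete_space}"
  assumes B: "B \<longlonglongrightarrow> 0" and x: "\<And>m n. (norm (x m - x n))\<^sup>2 \<le> B m + B n"
  shows "x \<longlonglongrightarrow> lim x" "(norm (x n - lim x))\<^sup>2 \<le> B n"
proof -
  have "Cauchy x"
  proof (rule CauchyI)
    fix e :: real assume e: "e > 0"
    have "\<forall>\<^sub>F n in sequentially. B n < e\<^sup>2 / 2" using B by (rule order_tendstoD) (use e in simp)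
    then obtain N where N: "\<And>n. n \<ge> N \<Longrightarrow> B n < e\<^sup>2 / 2" unfolding eventually_sequentially by blast
    have "norm (x m - x n) < e" if "m \<ge> N" "n \<ge> N" for m n
    proof (rule power2_less_imp_less)
      show "(norm (x m - x n))\<^sup>2 < e\<^sup>2" using x[of m n] N[OF that(1)] N[OF that(2)] by linarith
    qed (use e in simp)
    then show "\<exists>M. \<forall>m\<ge>M. \<forall>n\<ge>M. norm (x m - x n) < e" by blast
  qed
  then have "convergent x" by (rule Cauchy_convergent)
  then show l: "x \<longlonglongrightarrow> lim x" by (simp only: convergent_LIMSEQ_iff)
  have r: "(\<lambda>m. B m + B n) \<longlonglongrightarrow> 0 + B n" by (intro tendsto_intros B)
  have s: "(\<lambda>m. (norm (x n - x m))\<^sup>2) \<longlonglongrightarrow> (norm (x n - lim x))\<^sup>2" by (intro tendsto_intros l)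
  have "(norm (x n - lim x))\<^sup>2 \<le> 0 + B n"
    by (rule LIMSEQ_le[OF s r]) (use x[of n] in \<open>simp only: add.commute, blast\<close>)
  then show "(norm (x n - lim x))\<^sup>2 \<le> B n" by simp
qed

lemma eps_le_1: "eps n \<le> 1"
  using eps_antimono[of 0 n] by (simp add: eps_def)

context closed_form
begin

text \<open>Split \<open>x - y\<close> into the difference of the resolvents, against which the
  pairing is a value of the form and so nonnegative, and
  \<open>l *\<^sub>R Y l x - m *\<^sub>R Y m y\<close>. In the latter only the mixed term, with
  coefficient \<open>l + m\<close>, can have the wrong sign.\<close>

lemma yosida_monotone:
  assumes l: "0 < l" and m: "0 < m"
  shows "- ((Y l x - Y m y) \<bullet> (x - y)) \<le> (l + m) * ((norm (Y l x))\<^sup>2 + (norm (Y m y))\<^sup>2)"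
proof -
  let ?\<alpha> = "Y l x" and ?\<beta> = "Y m y"
  have j: "J l x - J m y \<in> V" by (intro V_diff J_in_V l m)
  have xy: "x - y = (J l x - J m y) + (l *\<^sub>R ?\<alpha> - m *\<^sub>R ?\<beta>)"
    using l m by (simp add: Y_def)
  have "(?\<alpha> - ?\<beta>) \<bullet> (J l x - J m y) = a (J l x - J m y) (J l x - J m y)"
    using a_diff[OF J_in_V[OF l] J_in_V[OF m] j, of x y] a_J[OF l j, of x] a_J[OF m j, of y]
    by (simp only: inner_diff_left)
  then have 1: "0 \<le> (?\<alpha> - ?\<beta>) \<bullet> (J l x - J m y)" using a_nonneg[OF j] by simp
  have 2: "(?\<alpha> - ?\<beta>) \<bullet> (l *\<^sub>R ?\<alpha> - m *\<^sub>R ?\<beta>) = l * (norm ?\<alpha>)\<^sup>2 + m * (norm ?\<beta>)\<^sup>2 - (l + m) * (?\<alpha> \<bullet> ?\<beta>)"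
    by (simp add: power2_norm_eq_inner inner_diff_left inner_diff_right inner_commute[of ?\<beta> ?\<alpha>] algebra_simps)
  have "?\<alpha> \<bullet> ?\<beta> \<le> (norm ?\<alpha>)\<^sup>2 + (norm ?\<beta>)\<^sup>2"
    using two_inner_le[of ?\<alpha> ?\<beta>] zero_le_power2[of "norm ?\<alpha>"] zero_le_power2[of "norm ?\<beta>"] by linarith
  then have 3: "(l + m) * (?\<alpha> \<bullet> ?\<beta>) \<le> (l + m) * ((norm ?\<alpha>)\<^sup>2 + (norm ?\<beta>)\<^sup>2)"
    using l m by (intro mult_left_mono) auto
  have 4: "0 \<le> l * (norm ?\<alpha>)\<^sup>2" "0 \<le> m * (norm ?\<beta>)\<^sup>2" using l m by auto
  have "(?\<alpha> - ?\<beta>) \<bullet> (x - y) = (?\<alpha> - ?\<beta>) \<bullet> (J l x - J m y) + (?\<alpha> - ?\<beta>) \<bullet> (l *\<^sub>R ?\<alpha> - m *\<^sub>R ?\<beta>)"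
    unfolding xy by (rule inner_add_right)
  then show ?thesis using 1 2 3 4 by linarith
qed

context
  fixes T L K :: real and F :: "'h \<Rightarrow> 'h" and u0 :: 'h
  assumes T: "0 \<le> T" and L: "L-lipschitz_on H F" and F: "F ` H \<subseteq> H"
    and K: "\<And>h. h \<in> H \<Longrightarrow> norm (F h) \<le> K" and u0: "u0 \<in> V"
begin

private lemma u0H: "u0 \<in> H" using u0 V_subset_H by blast
private lemma L0: "0 \<le> L" using L by (rule lipschitz_on_nonneg)
private lemma F_H: "h \<in> H \<Longrightarrow> F h \<in> H" using F by blast
private lemma Y_H: "h \<in> H \<Longrightarrow> Yn n h \<in> H" unfolding Y_def by (intro H_scaleR H_diff J_in_H eps_pos)

text \<open>The right side is Lipschitz with constant \<open>L + 2 / eps n\<close>, but only on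
  \<open>H\<close>, whence the invariant version of Picard-Lindeloef; \<open>H\<close> is invariant
  since integrals of \<open>H\<close>-valued paths stay in \<open>H\<close>.\<close>

lemma yosida_solution: "\<exists>u. ac T u (\<lambda>t. F (u t) - Yn n (u t)) \<and> u 0 = u0 \<and> (\<forall>t\<in>{0..T}. u t \<in> H)"
proof -
  have lip: "(L + 2 / eps n)-lipschitz_on H (\<lambda>h. F h - Yn n h)"
  proof (rule lipschitz_onI)
    fix x y assume xy: "x \<in> H" "y \<in> H"
    have "norm (F x - F y) \<le> L * norm (x - y)" using lipschitz_onD[OF L xy] by (simp only: dist_norm)
    moreover have "norm (Yn n x - Yn n y) \<le> (2 / eps n) * norm (x - y)"
      using norm_Y_le[OF eps_pos, of n "x - y"] by (simp only: Y_diff[OF eps_pos])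
    moreover have "norm ((F x - F y) - (Yn n x - Yn n y)) \<le> norm (F x - F y) + norm (Yn n x - Yn n y)"
      by (rule norm_triangle_ineq4)
    moreover have "norm ((F x - Yn n x) - (F y - Yn n y)) = norm ((F x - F y) - (Yn n x - Yn n y))"
      by (rule arg_cong[where f = norm]) simp
    ultimately show "dist (F x - Yn n x) (F y - Yn n y) \<le> (L + 2 / eps n) * dist x y"
      unfolding dist_norm distrib_right by linarith
  qed (use L0 eps_pos[of n] in simp)
  show ?thesis
  proof (rule picard_lindeloef_invariant[OF T closed_H lip u0H])
    fix x t assume x: "continuous_on {0..T} x" "\<forall>r\<in>{0..T}. x r \<in> H" and t: "t \<in> {0..T}"
    have c: "continuous_on {0..T} (\<lambda>r. F (x r) - Yn n (x r))"
      by (rule continuous_on_compose2[OF lipschitz_on_continuous_on[OF lip] x(1)]) (use x(2) in blast)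
    have "(LINT r:{0<..t}|lebesgue. F (x r) - Yn n (x r)) \<in> H"
    proof (rule H_set_integral)
      show "set_integrable lebesgue {0<..t} (\<lambda>r. F (x r) - Yn n (x r))"
        by (rule set_integrable_Ioc_subset[OF set_integrable_Ioc_continuous[OF c]]) (use t in auto)
      have "F (x r) - Yn n (x r) \<in> H" if "r \<in> {0<..t}" for r
      proof -
        have "x r \<in> H" using x(2) that t by simp
        then show ?thesis by (intro H_diff F_H Y_H)
      qed
      then show "AE r in lebesgue. r \<in> {0<..t} \<longrightarrow> F (x r) - Yn n (x r) \<in> H" by (intro AE_I2 impI)
    qed
    then show "u0 + (LINT r:{0<..t}|lebesgue. F (x r) - Yn n (x r)) \<in> H" by (rule H_add[OF u0H])
  qed
qed

text \<open>Three limits: \<open>v n\<close> converges uniformly to \<open>u\<close>; monotone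
  convergence in \<open>m\<close> puts \<open>u t\<close> into the domain for almost every time; and
  the equation is recovered after smoothing with \<open>Jn m\<close>, first letting \<open>n\<close>
  and then \<open>m\<close> tend to infinity.\<close>

lemma strong_solution_exists: "\<exists>u u' y. strong_solution T F u u' y \<and> u 0 = u0"
proof -
  obtain v where v: "\<And>n. ac T (v n) (\<lambda>t. F (v n t) - Yn n (v n t))" "\<And>n. v n 0 = u0"
    "\<And>n t. t \<in> {0..T} \<Longrightarrow> v n t \<in> H"
    using yosida_solution by metis
  \<comment> \<open>Along \<open>v n\<close>, the derivative of
    \<open>Yn n (v n t) \<bullet> v n t\<close> is at most
    \<open>K\<^sup>2 - (norm (Yn n (v n t)))\<^sup>2\<close> by Young's inequality, and the initial
    value is at most \<open>a u0 u0\<close>.\<close>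
  define M where "M = a u0 u0 + T * K\<^sup>2"
  have M0: "0 \<le> M" unfolding M_def using a_nonneg[OF u0] T by (intro add_nonneg_nonneg mult_nonneg_nonneg) auto
  have cF: "continuous_on {0..T} (\<lambda>t. F (x t))" if "continuous_on {0..T} x" "\<And>t. t \<in> {0..T} \<Longrightarrow> x t \<in> H" for x
    by (rule continuous_on_compose2[OF lipschitz_on_continuous_on[OF L] that(1)]) (use that(2) in blast)
  have cv: "continuous_on {0..T} (v n)" for n by (rule ac_continuous_on[OF v(1)])
  have cY: "continuous_on {0..T} (\<lambda>t. Yn m (x t))" if "continuous_on {0..T} x" for m x
    by (rule bounded_linear.continuous_on[OF bounded_linear_Y[OF eps_pos] that])
  have cJ: "continuous_on {0..T} (\<lambda>t. Jn m (x t))" if "continuous_on {0..T} x" for m x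
    by (rule bounded_linear.continuous_on[OF bounded_linear_J[OF eps_pos] that])
  have sY: "set_integrable lebesgue {0<..T} (\<lambda>t. (norm (Yn m (x t)))\<^sup>2)" if "continuous_on {0..T} x" for m x
    by (intro set_integrable_Ioc_continuous continuous_intros cY that)
  have Yv: "(LINT t:{0<..T}|lebesgue. (norm (Yn n (v n t)))\<^sup>2) \<le> M" for n
  proof -
    let ?v' = "\<lambda>t. F (v n t) - Yn n (v n t)"
    have q: "ac T (\<lambda>t. Yn n (v n t) \<bullet> v n t) (\<lambda>t. Yn n (?v' t) \<bullet> v n t + Yn n (v n t) \<bullet> ?v' t)"
      by (rule ac_bilinear[OF bounded_bilinear_inner T ac_bounded_linear[OF bounded_linear_Y[OF eps_pos] v(1)] v(1)])
    have ig: "set_integrable lebesgue {0<..T} (\<lambda>t. K\<^sup>2 - (norm (Yn n (v n t)))\<^sup>2)"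
      by (rule set_integral_diff(1)[OF set_integrable_const_Ioc sY[OF cv]])
    have "Yn n (v n T) \<bullet> v n T \<le> Yn n (v n 0) \<bullet> v n 0 + (LINT t:{0<..T}|lebesgue. K\<^sup>2 - (norm (Yn n (v n t)))\<^sup>2)"
    proof (rule ac_mono[OF q ig _ T order_refl])
      have "Yn n (?v' t) \<bullet> v n t + Yn n (v n t) \<bullet> ?v' t \<le> K\<^sup>2 - (norm (Yn n (v n t)))\<^sup>2" if "t \<in> {0<..T}" for t
      proof -
        have vH: "v n t \<in> H" using v(3) that by simp
        let ?y = "Yn n (v n t)"
        have "Yn n (?v' t) \<bullet> v n t = ?y \<bullet> ?v' t"
          using Y_sym[OF eps_pos, of n "v n t" "?v' t"] inner_commute[of "Yn n (?v' t)" "v n t"] by linarith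
        moreover have "?y \<bullet> ?v' t = ?y \<bullet> F (v n t) - (norm ?y)\<^sup>2"
          by (simp add: inner_diff_right power2_norm_eq_inner)
        moreover have "2 * (?y \<bullet> F (v n t)) \<le> (norm ?y)\<^sup>2 + (norm (F (v n t)))\<^sup>2" by (rule two_inner_le)
        moreover have "(norm (F (v n t)))\<^sup>2 \<le> K\<^sup>2" by (intro power_mono K vH norm_ge_zero)
        ultimately show ?thesis by linarith
      qed
      then show "AE t in lebesgue. t \<in> {0<..T} \<longrightarrow> Yn n (?v' t) \<bullet> v n t + Yn n (v n t) \<bullet> ?v' t \<le> K\<^sup>2 - (norm (Yn n (v n t)))\<^sup>2"
        by (intro AE_I2 impI)
    qed
    also have "(LINT t:{0<..T}|lebesgue. K\<^sup>2 - (norm (Yn n (v n t)))\<^sup>2)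
        = T * K\<^sup>2 - (LINT t:{0<..T}|lebesgue. (norm (Yn n (v n t)))\<^sup>2)"
      by (subst set_integral_diff(2)[OF set_integrable_const_Ioc sY[OF cv]]) (simp only: set_integral_const_Ioc[OF T])
    finally show ?thesis
      using Y_nonneg[OF eps_pos, of n "v n T"] Y_form_le[OF eps_pos u0, of n] unfolding M_def v(2) by linarith
  qed
  \<comment> \<open>Gronwall's factor times the integral of the source \<open>g\<close> below:
    \<open>2 * (eps n + eps m)\<close> multiplies two terms with integrals at most
    \<open>M\<close>.\<close>
  define C where "C = exp (2 * L * T) * (4 * M)"
  have C0: "0 \<le> C" unfolding C_def using M0 by simp
  have diff: "(norm (v n t - v m t))\<^sup>2 \<le> C * eps n + C * eps m" if t: "t \<in> {0..T}" for n m t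
  proof -
    have t': "0 \<le> t" "t \<le> T" using t by auto
    define w where "w t = v n t - v m t" for t
    define w' where "w' t = (F (v n t) - Yn n (v n t)) - (F (v m t) - Yn m (v m t))" for t
    define g where "g t = (2 * (eps n + eps m)) * ((norm (Yn n (v n t)))\<^sup>2 + (norm (Yn m (v m t)))\<^sup>2)" for t
    have w: "ac T w w'" unfolding w_def w'_def by (rule ac_diff[OF v(1) v(1)])
    have e0: "0 \<le> eps n + eps m" using eps_pos[of n] eps_pos[of m] by linarith
    have ig: "set_integrable lebesgue {0<..T} g"
      unfolding g_def by (rule set_integrable_mult_right, rule set_integral_add(1)[OF sY[OF cv] sY[OF cv]])
    have "w t \<bullet> w t \<le> exp ((2 * L) * t) * (w 0 \<bullet> w 0 + (LINT r:{0<..T}|lebesgue. g r))"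
    proof (rule gronwall_ac[OF T _ ac_bilinear[OF bounded_bilinear_inner T w w] ig _ _ t'])
      show "0 \<le> 2 * L" using L0 by simp
      show "0 \<le> g t" for t unfolding g_def using eps_pos[of n] eps_pos[of m] by (intro mult_nonneg_nonneg add_nonneg_nonneg) auto
      have "w' t \<bullet> w t + w t \<bullet> w' t \<le> (2 * L) * (w t \<bullet> w t) + g t" if "t \<in> {0<..T}" for t
      proof -
        have H: "v n t \<in> H" "v m t \<in> H" using v(3) that by simp_all
        have "(F (v n t) - F (v m t)) \<bullet> w t \<le> norm (F (v n t) - F (v m t)) * norm (w t)" by (rule norm_cauchy_schwarz)
        also have "\<dots> \<le> (L * norm (w t)) * norm (w t)"
          by (rule mult_right_mono) (use lipschitz_onD[OF L H] in \<open>simp_all add: dist_norm w_def\<close>)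
        also have "\<dots> = L * (w t \<bullet> w t)" by (simp add: power2_norm_eq_inner[symmetric] power2_eq_square)
        finally have 1: "(F (v n t) - F (v m t)) \<bullet> w t \<le> L * (w t \<bullet> w t)" .
        have 2: "- ((Yn n (v n t) - Yn m (v m t)) \<bullet> w t) \<le> (eps n + eps m) * ((norm (Yn n (v n t)))\<^sup>2 + (norm (Yn m (v m t)))\<^sup>2)"
          unfolding w_def by (rule yosida_monotone[OF eps_pos eps_pos])
        have 3: "w' t \<bullet> w t = (F (v n t) - F (v m t)) \<bullet> w t - (Yn n (v n t) - Yn m (v m t)) \<bullet> w t"
          unfolding w'_def by (simp add: inner_diff_left)
        have 4: "w t \<bullet> w' t = w' t \<bullet> w t" by (rule inner_commute)
        show ?thesis using 1 2 unfolding 4 g_def 3 mult.assoc by linarith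
      qed
      then show "AE t in lebesgue. t \<in> {0<..T} \<longrightarrow> w' t \<bullet> w t + w t \<bullet> w' t \<le> (2 * L) * (w t \<bullet> w t) + g t"
        by (intro AE_I2 impI)
    qed
    also have "w 0 \<bullet> w 0 = 0" unfolding w_def v(2) by simp
    also have "(LINT r:{0<..T}|lebesgue. g r) = (2 * (eps n + eps m)) *
        ((LINT r:{0<..T}|lebesgue. (norm (Yn n (v n r)))\<^sup>2) + (LINT r:{0<..T}|lebesgue. (norm (Yn m (v m r)))\<^sup>2))"
      unfolding g_def set_integral_mult_right by (simp only: set_integral_add(2)[OF sY[OF cv] sY[OF cv]])
    also have "exp ((2 * L) * t) * (0 + \<dots>) \<le> exp (2 * L * T) * (0 + (2 * (eps n + eps m)) * (M + M))"
    proof (rule mult_mono)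
      let ?I = "(LINT r:{0<..T}|lebesgue. (norm (Yn n (v n r)))\<^sup>2) + (LINT r:{0<..T}|lebesgue. (norm (Yn m (v m r)))\<^sup>2)"
      have "(2 * L) * t \<le> (2 * L) * T" using L0 t' by (intro mult_left_mono) auto
      then show "exp ((2 * L) * t) \<le> exp (2 * L * T)" by simp
      have "?I \<le> M + M" by (intro add_mono Yv)
      then have "(2 * (eps n + eps m)) * ?I \<le> (2 * (eps n + eps m)) * (M + M)"
        by (rule mult_left_mono) (use e0 in simp)
      then show "0 + (2 * (eps n + eps m)) * ?I \<le> 0 + (2 * (eps n + eps m)) * (M + M)" by simp
      have "0 \<le> ?I" unfolding set_lebesgue_integral_def
        by (intro add_nonneg_nonneg Bochner_Integration.integral_nonneg) auto
      then have "0 \<le> (2 * (eps n + eps m)) * ?I" by (rule mult_nonneg_nonneg[rotated]) (use e0 in simp)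
      then show "0 \<le> 0 + (2 * (eps n + eps m)) * ?I" by simp
    qed simp
    finally show ?thesis
      unfolding w_def C_def by (simp add: power2_norm_eq_inner algebra_simps)
  qed
  define u where "u t = lim (\<lambda>n. v n t)" for t
  have Ce: "(\<lambda>n. C * eps n) \<longlonglongrightarrow> 0"
    using tendsto_mult[OF tendsto_const eps_tendsto, of C] by simp
  have vu: "(\<lambda>n. v n t) \<longlonglongrightarrow> u t" and vu2: "(norm (v n t - u t))\<^sup>2 \<le> C * eps n" if "t \<in> {0..T}" for t n
    using Cauchy_of_square_bound[OF Ce diff[OF that]] unfolding u_def by blast+
  have cu: "continuous_on {0..T} u"
  proof (rule uniform_limit_theorem)
    show "\<forall>\<^sub>F n in sequentially. continuous_on {0..T} (v n)" by (intro always_eventually allI cv)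
    show "uniform_limit {0..T} v u sequentially"
    proof (rule uniform_limitI)
      fix e :: real assume e: "e > 0"
      have "\<forall>\<^sub>F n in sequentially. C * eps n < e\<^sup>2" using Ce by (rule order_tendstoD) (use e in simp)
      then show "\<forall>\<^sub>F n in sequentially. \<forall>t\<in>{0..T}. dist (v n t) (u t) < e"
      proof eventually_elim
        case (elim n)
        show ?case
        proof
          fix t assume "t \<in> {0..T}"
          then have "(norm (v n t - u t))\<^sup>2 < e\<^sup>2" using vu2[of t n] elim by linarith
          then show "dist (v n t) (u t) < e" unfolding dist_norm by (rule power2_less_imp_less) (use e in simp)
        qed
      qed
    qed
  qed simp
  have uH: "u t \<in> H" if "t \<in> {0..T}" for t
    by (rule closed_sequentially[OF closed_H _ vu[OF that]]) (rule v(3)[OF that])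
  have u_0: "u 0 = u0" using vu[of 0] T unfolding v(2) by (simp add: LIMSEQ_const_iff)
  have vb: "(norm (v n t))\<^sup>2 \<le> 2 * C + 2 * (norm (u t))\<^sup>2" if "t \<in> {0..T}" for n t
  proof -
    have "C * eps n \<le> C * 1" by (rule mult_left_mono[OF eps_le_1 C0])
    then show ?thesis using norm_diff_sq_le[of "v n t" 0 "u t"] vu2[OF that, of n] by simp
  qed
  \<comment> \<open>Depends badly on \<open>m\<close>, but \<open>m\<close> stays fixed while
    \<open>n\<close> tends to infinity, so it serves as a dominating function.\<close>
  have Yb: "(norm (Yn m (v n t)))\<^sup>2 \<le> (2 / eps m)\<^sup>2 * (2 * C + 2 * (norm (u t))\<^sup>2)" if "t \<in> {0..T}" for m n t
  proof -
    have "(norm (Yn m (v n t)))\<^sup>2 \<le> ((2 / eps m) * norm (v n t))\<^sup>2" by (intro power_mono norm_Y_le eps_pos norm_ge_zero)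
    also have "\<dots> = (2 / eps m)\<^sup>2 * (norm (v n t))\<^sup>2" by (rule power_mult_distrib)
    also have "\<dots> \<le> (2 / eps m)\<^sup>2 * (2 * C + 2 * (norm (u t))\<^sup>2)" by (rule mult_left_mono[OF vb[OF that]]) simp
    finally show ?thesis .
  qed
  have ib: "set_integrable lebesgue {0<..T} (\<lambda>t. (2 / eps m)\<^sup>2 * (2 * C + 2 * (norm (u t))\<^sup>2))" for m
    by (intro set_integrable_Ioc_continuous continuous_intros cu)
  have sbm: "set_borel_measurable lebesgue {0<..T} x" if "continuous_on {0..T} x" for x :: "real \<Rightarrow> 'z::{banach, second_countable_topology}"
    by (rule set_integrable_imp_set_borel_measurable[OF set_integrable_Ioc_continuous[OF that]])
  have Yvu: "(\<lambda>n. Yn m (v n t)) \<longlonglongrightarrow> Yn m (u t)" if "t \<in> {0..T}" for m t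
    by (rule bounded_linear.tendsto[OF bounded_linear_Y[OF eps_pos] vu[OF that]])
  \<comment> \<open>For \<open>n\<close> beyond \<open>m\<close>, antitonicity in the parameter
    bounds \<open>Yn m (v n t)\<close> by \<open>Yn n (v n t)\<close>, whose square integral is at
    most \<open>M\<close>. The bound survives the limit in \<open>n\<close> with \<open>m\<close>
    fixed and does not depend on \<open>m\<close>.\<close>
  have Yu: "(LINT t:{0<..T}|lebesgue. (norm (Yn m (u t)))\<^sup>2) \<le> M" for m
  proof (rule LIMSEQ_le_const2)
    show "(\<lambda>n. LINT t:{0<..T}|lebesgue. (norm (Yn m (v n t)))\<^sup>2) \<longlonglongrightarrow> (LINT t:{0<..T}|lebesgue. (norm (Yn m (u t)))\<^sup>2)"
    proof (rule set_dominated_convergence[OF ib[of m]])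
      show "set_borel_measurable lebesgue {0<..T} (\<lambda>t. (norm (Yn m (v n t)))\<^sup>2)" for n
        by (rule set_integrable_imp_set_borel_measurable[OF sY[OF cv]])
      show "set_borel_measurable lebesgue {0<..T} (\<lambda>t. (norm (Yn m (u t)))\<^sup>2)"
        by (rule set_integrable_imp_set_borel_measurable[OF sY[OF cu]])
      have "(\<lambda>n. (norm (Yn m (v n t)))\<^sup>2) \<longlonglongrightarrow> (norm (Yn m (u t)))\<^sup>2" if "t \<in> {0<..T}" for t
        by (intro tendsto_power tendsto_norm Yvu) (use that in simp)
      then show "AE t in lebesgue. t \<in> {0<..T} \<longrightarrow> (\<lambda>n. (norm (Yn m (v n t)))\<^sup>2) \<longlonglongrightarrow> (norm (Yn m (u t)))\<^sup>2"
        by (intro AE_I2 impI)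
      have "norm ((norm (Yn m (v n t)))\<^sup>2) \<le> (2 / eps m)\<^sup>2 * (2 * C + 2 * (norm (u t))\<^sup>2)" if "t \<in> {0<..T}" for n t
        using Yb[of t m n] that by simp
      then show "AE t in lebesgue. t \<in> {0<..T} \<longrightarrow> norm ((norm (Yn m (v n t)))\<^sup>2) \<le> (2 / eps m)\<^sup>2 * (2 * C + 2 * (norm (u t))\<^sup>2)" for n
        by (intro AE_I2 impI)
    qed
    have "(LINT t:{0<..T}|lebesgue. (norm (Yn m (v n t)))\<^sup>2) \<le> M" if "m \<le> n" for n
    proof -
      have "(LINT t:{0<..T}|lebesgue. (norm (Yn m (v n t)))\<^sup>2) \<le> (LINT t:{0<..T}|lebesgue. (norm (Yn n (v n t)))\<^sup>2)"
        by (rule set_integral_mono[OF sY[OF cv] sY[OF cv]])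
          (intro power_mono norm_Y_antimono eps_pos eps_antimono that norm_ge_zero)
      then show ?thesis using Yv[of n] by linarith
    qed
    then show "\<exists>N. \<forall>n\<ge>N. (LINT t:{0<..T}|lebesgue. (norm (Yn m (v n t)))\<^sup>2) \<le> M" by blast
  qed
  \<comment> \<open>Extended nonnegative values, so that the monotone limit exists everywhere; its
    finite integral then makes it finite almost everywhere.\<close>
  define \<phi> where "\<phi> m t = ennreal (indicator {0<..T} t *\<^sub>R (norm (Yn m (u t)))\<^sup>2)" for m t
  have i\<phi>: "integrable lebesgue (\<lambda>t. indicator {0<..T} t *\<^sub>R (norm (Yn m (u t)))\<^sup>2)" for m
    using sY[OF cu] unfolding set_integrable_def .
  have m\<phi>: "\<phi> m \<in> borel_measurable lebesgue" for m
    unfolding \<phi>_def by (rule measurable_compose[OF borel_measurable_integrable[OF i\<phi>] measurable_ennreal])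
  have n\<phi>: "(\<integral>\<^sup>+t. \<phi> m t \<partial>lebesgue) \<le> ennreal M" for m
  proof -
    have "(\<integral>\<^sup>+t. \<phi> m t \<partial>lebesgue) = ennreal (LINT t:{0<..T}|lebesgue. (norm (Yn m (u t)))\<^sup>2)"
      unfolding \<phi>_def set_lebesgue_integral_def by (rule nn_integral_eq_integral[OF i\<phi>]) simp
    then show ?thesis using Yu[of m] by (simp add: ennreal_leI)
  qed
  have inc: "incseq \<phi>"
    unfolding incseq_def le_fun_def \<phi>_def
    by (intro allI impI ennreal_leI scaleR_left_mono power_mono norm_Y_antimono eps_pos eps_antimono norm_ge_zero) auto
  have nS: "(\<integral>\<^sup>+t. (SUP m. \<phi> m t) \<partial>lebesgue) \<le> ennreal M"
    unfolding nn_integral_monotone_convergence_SUP[OF inc m\<phi>] by (rule SUP_least) (rule n\<phi>)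
  have mS: "(\<lambda>t. SUP m. \<phi> m t) \<in> borel_measurable lebesgue"
    by (rule borel_measurable_SUP) (auto intro: m\<phi>)
  have "AE t in lebesgue. (SUP m. \<phi> m t) \<noteq> \<infinity>"
    by (rule nn_integral_noteq_infinite[OF mS]) (use nS in \<open>auto simp: top_unique\<close>)
  then have udom: "AE t in lebesgue. t \<in> {0<..T} \<longrightarrow> u t \<in> dom"
  proof eventually_elim
    case (elim t)
    show ?case
    proof
      assume t: "t \<in> {0<..T}"
      obtain c where c: "(SUP m. \<phi> m t) = ennreal c" "0 \<le> c" using elim by (cases "SUP m. \<phi> m t") auto
      have "norm (Yn m (u t)) \<le> sqrt c" for m
      proof -
        have "\<phi> m t \<le> ennreal c" unfolding c(1)[symmetric] by (rule SUP_upper) simp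
        then have "(norm (Yn m (u t)))\<^sup>2 \<le> c" unfolding \<phi>_def using t c(2) by simp
        then show ?thesis by (rule real_le_rsqrt)
      qed
      then show "u t \<in> dom" using t by (intro domI_bounded uH) auto
    qed
  qed
  \<comment> \<open>A limit of measurable functions, hence measurable even where it does not
    converge; it equals \<open>A (u t)\<close> almost everywhere on the time interval.\<close>
  define y where "y t = lim (\<lambda>m. indicator {0<..T} t *\<^sub>R Yn m (u t))" for t
  have ym: "y \<in> borel_measurable lebesgue"
    unfolding y_def by (rule borel_measurable_lim_metric) (use sbm[OF cY[OF cu]] in \<open>simp only: set_borel_measurable_def\<close>)
  have y: "AE t in lebesgue. t \<in> {0<..T} \<longrightarrow> u t \<in> dom \<and> A (u t) = y t"
    using udom
  proof eventually_elim
    case (elim t)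
    show ?case
    proof
      assume t: "t \<in> {0<..T}"
      then have d: "u t \<in> dom" using elim by blast
      have "(\<lambda>m. indicator {0<..T} t *\<^sub>R Yn m (u t)) \<longlonglongrightarrow> A (u t)" using Yn_tendsto[OF d] t by simp
      then have "y t = A (u t)" unfolding y_def by (rule limI)
      with d show "u t \<in> dom \<and> A (u t) = y t" by (simp only: simp_thms)
    qed
  qed
  have Yy: "(\<lambda>m. Yn m (u t)) \<longlonglongrightarrow> y t" "norm (Yn m (u t)) \<le> norm (y t)" if "u t \<in> dom" "A (u t) = y t" for t m
    using Yn_tendsto[OF that(1)] norm_J_le[OF eps_pos, of m "A (u t)"] Y_A[OF eps_pos that(1), of m]
    unfolding that(2) by (simp_all only:)
  have ymS: "set_borel_measurable lebesgue {0<..T} y"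
    unfolding set_borel_measurable_def by (intro borel_measurable_scaleR borel_measurable_indicator ym) simp
  have sy: "sqi T y"
    unfolding sqi_def set_integrable_def
  proof (intro conjI ymS integrableI_bounded)
    have yn: "(\<lambda>t. norm (y t)) \<in> borel_measurable lebesgue" using ym by measurable
    show mm: "(\<lambda>t. indicator {0<..T} t *\<^sub>R (norm (y t))\<^sup>2) \<in> borel_measurable lebesgue"
      by (intro borel_measurable_scaleR borel_measurable_indicator borel_measurable_power yn) simp
    have "(\<integral>\<^sup>+t. ennreal (norm (indicator {0<..T} t *\<^sub>R (norm (y t))\<^sup>2)) \<partial>lebesgue) \<le> (\<integral>\<^sup>+t. (SUP m. \<phi> m t) \<partial>lebesgue)"
    proof (rule nn_integral_mono_AE)
      show "AE t in lebesgue. ennreal (norm (indicator {0<..T} t *\<^sub>R (norm (y t))\<^sup>2)) \<le> (SUP m. \<phi> m t)"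
        using y
      proof eventually_elim
        case (elim t)
        show ?case
        proof (cases "t \<in> {0<..T}")
          case True
          then have d: "u t \<in> dom" "A (u t) = y t" using elim by blast+
          have "(\<lambda>m. \<phi> m t) \<longlonglongrightarrow> ennreal (indicator {0<..T} t *\<^sub>R (norm (y t))\<^sup>2)"
            unfolding \<phi>_def by (intro tendsto_ennrealI tendsto_scaleR tendsto_const tendsto_power tendsto_norm Yy(1)[OF d])
          then have "ennreal (indicator {0<..T} t *\<^sub>R (norm (y t))\<^sup>2) \<le> (SUP m. \<phi> m t)"
            by (rule LIMSEQ_le_const2) (intro exI[of _ 0] allI impI SUP_upper, simp)
          then show ?thesis using True by simp
        qed simp
      qed
    qed
    also have "\<dots> < \<infinity>" using nS by (rule order_le_less_trans) simp
    finally show "(\<integral>\<^sup>+t. ennreal (norm (indicator {0<..T} t *\<^sub>R (norm (y t))\<^sup>2)) \<partial>lebesgue) < \<infinity>" .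
  qed
  define u' where "u' t = F (u t) - y t" for t
  have su': "sqi T u'" unfolding u'_def by (rule sqi_diff[OF sqi_continuous[OF cF[OF cu uH]] sy])
  \<comment> \<open>The equation smoothed by \<open>Jn m\<close>. With \<open>z = v n r\<close>,
    \<open>Jn m (Yn n z) = Yn m (Jn n z) = Yn m z - eps n *\<^sub>R Yn m (Yn n z)\<close>: the first
    term converges with \<open>v n\<close>, the second is an error of order
    \<open>eps n\<close>.\<close>
  have Jeq: "Jn m (u t) = Jn m u0 + (LINT r:{0<..t}|lebesgue. Jn m (F (u r)) - Yn m (u r))" if t: "t \<in> {0..T}" for m t
  proof (rule LIMSEQ_unique)
    have t': "0 \<le> t" "t \<le> T" using t by auto
    show "(\<lambda>n. Jn m (v n t)) \<longlonglongrightarrow> Jn m (u t)"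
      by (rule bounded_linear.tendsto[OF bounded_linear_J[OF eps_pos] vu[OF t]])
    have iYY: "set_integrable lebesgue {0<..t} (\<lambda>r. Yn m (Yn n (v n r)))" for n
      by (rule set_integrable_Ioc_subset[OF set_integrable_Ioc_continuous[OF cY[OF cY[OF cv]]] order_refl t'(2)])
    have cR: "continuous_on {0..T} (\<lambda>r. Jn m (F (v n r)) - Yn m (v n r))" for n
      by (intro continuous_on_diff cJ cY cF cv v(3))
    have iR: "set_integrable lebesgue {0<..t} (\<lambda>r. Jn m (F (v n r)) - Yn m (v n r))" for n
      by (rule set_integrable_Ioc_subset[OF set_integrable_Ioc_continuous[OF cR] order_refl t'(2)])
    have e: "Jn m (v n t) = Jn m u0 + ((LINT r:{0<..t}|lebesgue. Jn m (F (v n r)) - Yn m (v n r))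
        + eps n *\<^sub>R (LINT r:{0<..t}|lebesgue. Yn m (Yn n (v n r))))" for n
    proof -
      have "Jn m (F x - Yn n z) = (Jn m (F x) - Yn m z) + eps n *\<^sub>R Yn m (Yn n z)" for x z
      proof -
        have "Jn m (Yn n z) = Yn m (Jn n z)" by (rule Y_J[OF eps_pos eps_pos, symmetric])
        also have "Jn n z = z - eps n *\<^sub>R Yn n z" using eps_pos[of n] by (simp add: Y_def)
        also have "Yn m \<dots> = Yn m z - eps n *\<^sub>R Yn m (Yn n z)"
          unfolding Y_diff[OF eps_pos] linear_scale[OF bounded_linear.linear[OF bounded_linear_Y[OF eps_pos]]] ..
        finally show ?thesis unfolding J_diff[OF eps_pos] by simp
      qed
      then have "(LINT r:{0<..t}|lebesgue. Jn m (F (v n r) - Yn n (v n r)))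
        = (LINT r:{0<..t}|lebesgue. (Jn m (F (v n r)) - Yn m (v n r)) + eps n *\<^sub>R Yn m (Yn n (v n r)))" by simp
      also have "\<dots> = (LINT r:{0<..t}|lebesgue. Jn m (F (v n r)) - Yn m (v n r))
          + (LINT r:{0<..t}|lebesgue. eps n *\<^sub>R Yn m (Yn n (v n r)))"
        by (rule set_integral_add(2)[OF iR]) (rule set_integrable_scaleR_right, rule iYY)
      also have "(LINT r:{0<..t}|lebesgue. eps n *\<^sub>R Yn m (Yn n (v n r))) = eps n *\<^sub>R (LINT r:{0<..t}|lebesgue. Yn m (Yn n (v n r)))"
        by (rule set_integral_scaleR_right)
      finally show ?thesis using ac_eq[OF ac_bounded_linear[OF bounded_linear_J[OF eps_pos] v(1)] t', of m n] unfolding v(2) by simp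
    qed
    have A1: "(\<lambda>n. LINT r:{0<..t}|lebesgue. Jn m (F (v n r)) - Yn m (v n r))
        \<longlonglongrightarrow> (LINT r:{0<..t}|lebesgue. Jn m (F (u r)) - Yn m (u r))"
    proof (rule set_dominated_convergence)
      show "set_integrable lebesgue {0<..t} (\<lambda>r. K + (1 + (2 / eps m)\<^sup>2 * (2 * C + 2 * (norm (u r))\<^sup>2)))"
        by (rule set_integrable_Ioc_subset[OF set_integral_add(1)[OF set_integrable_const_Ioc set_integral_add(1)[OF set_integrable_const_Ioc ib]] order_refl t'(2)])
      show "set_borel_measurable lebesgue {0<..t} (\<lambda>r. Jn m (F (v n r)) - Yn m (v n r))" for n
        by (rule set_integrable_imp_set_borel_measurable[OF iR])
      have "continuous_on {0..T} (\<lambda>r. Jn m (F (u r)) - Yn m (u r))"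
        by (intro continuous_on_diff cJ cY cF cu uH)
      then show "set_borel_measurable lebesgue {0<..t} (\<lambda>r. Jn m (F (u r)) - Yn m (u r))"
        by (rule set_integrable_imp_set_borel_measurable[OF set_integrable_Ioc_subset[OF set_integrable_Ioc_continuous order_refl t'(2)]])
      have "(\<lambda>n. Jn m (F (v n r)) - Yn m (v n r)) \<longlonglongrightarrow> Jn m (F (u r)) - Yn m (u r)" if "r \<in> {0<..t}" for r
      proof -
        have r: "r \<in> {0..T}" using that t by simp
        have "(\<lambda>n. F (v n r)) \<longlonglongrightarrow> F (u r)"
          by (rule continuous_on_tendsto_compose[OF lipschitz_on_continuous_on[OF L] vu[OF r] uH[OF r]])
            (simp add: v(3)[OF r])
        then show ?thesis by (intro tendsto_diff Yvu[OF r] bounded_linear.tendsto[OF bounded_linear_J[OF eps_pos]])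
      qed
      then show "AE r in lebesgue. r \<in> {0<..t} \<longrightarrow> (\<lambda>n. Jn m (F (v n r)) - Yn m (v n r)) \<longlonglongrightarrow> Jn m (F (u r)) - Yn m (u r)"
        by (intro AE_I2 impI)
      have "norm (Jn m (F (v n r)) - Yn m (v n r)) \<le> K + (1 + (2 / eps m)\<^sup>2 * (2 * C + 2 * (norm (u r))\<^sup>2))"
        if "r \<in> {0<..t}" for n r
      proof -
        have r: "r \<in> {0..T}" using that t by simp
        have "norm (Jn m (F (v n r))) \<le> K" using norm_J_le[OF eps_pos, of m "F (v n r)"] K[OF v(3)[OF r], of n] by linarith
        moreover have "norm (Jn m (F (v n r)) - Yn m (v n r)) \<le> norm (Jn m (F (v n r))) + norm (Yn m (v n r))"
          by (rule norm_triangle_ineq4)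
        ultimately show ?thesis using Yb[OF r, of m n] norm_le_1_plus_sq[of "Yn m (v n r)"] by linarith
      qed
      then show "AE r in lebesgue. r \<in> {0<..t} \<longrightarrow> norm (Jn m (F (v n r)) - Yn m (v n r))
          \<le> K + (1 + (2 / eps m)\<^sup>2 * (2 * C + 2 * (norm (u r))\<^sup>2))" for n
        by (intro AE_I2 impI)
    qed
    \<comment> \<open>A factor \<open>eps n\<close> times an integral bounded independently of
      \<open>n\<close>; \<open>norm_le_1_plus_sq\<close> passes from the square integral to the
      integral of the norm.\<close>
    have A2: "(\<lambda>n. eps n *\<^sub>R (LINT r:{0<..t}|lebesgue. Yn m (Yn n (v n r)))) \<longlonglongrightarrow> 0"
    proof (rule Lim_null_comparison[OF always_eventually[OF allI]])
      fix n
      have i1: "set_integrable lebesgue {0<..T} (\<lambda>r. (2 / eps m) * (1 + (norm (Yn n (v n r)))\<^sup>2))"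
        by (intro set_integrable_mult_right set_integral_add(1) set_integrable_const_Ioc sY cv)
      have "norm (LINT r:{0<..t}|lebesgue. Yn m (Yn n (v n r))) \<le> (LINT r:{0<..t}|lebesgue. (2 / eps m) * (1 + (norm (Yn n (v n r)))\<^sup>2))"
      proof (rule set_integral_norm_le[OF iYY set_integrable_Ioc_subset[OF i1 order_refl t'(2)]])
        fix r
        let ?z = "Yn n (v n r)"
        have "norm ?z \<le> 1 + (norm ?z)\<^sup>2" by (rule norm_le_1_plus_sq)
        then have "(2 / eps m) * norm ?z \<le> (2 / eps m) * (1 + (norm ?z)\<^sup>2)"
          by (rule mult_left_mono) (use eps_pos[of m] in simp)
        then show "norm (Yn m ?z) \<le> (2 / eps m) * (1 + (norm ?z)\<^sup>2)" using norm_Y_le[OF eps_pos, of m ?z] by linarith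
      qed
      also have "\<dots> \<le> (LINT r:{0<..T}|lebesgue. (2 / eps m) * (1 + (norm (Yn n (v n r)))\<^sup>2))"
        by (rule set_integral_Ioc_mono_upper[OF i1 _ t']) (use eps_pos[of m] in simp)
      also have "\<dots> = (2 / eps m) * (T * 1 + (LINT r:{0<..T}|lebesgue. (norm (Yn n (v n r)))\<^sup>2))"
        unfolding set_integral_mult_right set_integral_add(2)[OF set_integrable_const_Ioc sY[OF cv]]
          set_integral_const_Ioc[OF T] ..
      also have "\<dots> \<le> (2 / eps m) * (T * 1 + M)"
        by (intro mult_left_mono add_left_mono Yv) (use eps_pos[of m] in simp)
      finally have "norm (LINT r:{0<..t}|lebesgue. Yn m (Yn n (v n r))) \<le> (2 / eps m) * (T * 1 + M)" .
      from mult_left_mono[OF this less_imp_le[OF eps_pos[of n]]]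
      show "norm (eps n *\<^sub>R (LINT r:{0<..t}|lebesgue. Yn m (Yn n (v n r)))) \<le> eps n * ((2 / eps m) * (T * 1 + M))"
        using eps_pos[of n] by simp
    next
      show "(\<lambda>n. eps n * ((2 / eps m) * (T * 1 + M))) \<longlonglongrightarrow> 0"
        using tendsto_mult[OF eps_tendsto tendsto_const, of "(2 / eps m) * (T * 1 + M)"] by simp
    qed
    have "(\<lambda>n. Jn m (v n t)) \<longlonglongrightarrow> Jn m u0 + ((LINT r:{0<..t}|lebesgue. Jn m (F (u r)) - Yn m (u r)) + 0)"
      unfolding e by (intro tendsto_add tendsto_const A1 A2)
    then show "(\<lambda>n. Jn m (v n t)) \<longlonglongrightarrow> Jn m u0 + (LINT r:{0<..t}|lebesgue. Jn m (F (u r)) - Yn m (u r))" by simp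
  qed
  \<comment> \<open>Now the smoothing is removed. As \<open>norm (Yn m (u r))\<close> is at most
    \<open>norm (y r)\<close> almost everywhere, \<open>K + norm (y r)\<close> dominates for all
    \<open>m\<close>.\<close>
  have ueq: "u t = u 0 + (LINT r:{0<..t}|lebesgue. u' r)" if t: "t \<in> {0..T}" for t
  proof (rule LIMSEQ_unique)
    have t': "0 \<le> t" "t \<le> T" using t by auto
    show "(\<lambda>m. Jn m (u t)) \<longlonglongrightarrow> u t" by (rule Jn_tendsto[OF uH[OF t]])
    have "(\<lambda>m. LINT r:{0<..t}|lebesgue. Jn m (F (u r)) - Yn m (u r)) \<longlonglongrightarrow> (LINT r:{0<..t}|lebesgue. u' r)"
    proof (rule set_dominated_convergence)
      show "set_integrable lebesgue {0<..t} (\<lambda>r. K + norm (y r))"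
        by (rule set_integrable_Ioc_subset[OF set_integral_add(1)[OF set_integrable_const_Ioc set_integrable_norm[OF sqi_integrable[OF sy]]] order_refl t'(2)])
      have "continuous_on {0..T} (\<lambda>r. Jn m (F (u r)) - Yn m (u r))" for m
        by (intro continuous_on_diff cJ cY cF cu uH)
      then show "set_borel_measurable lebesgue {0<..t} (\<lambda>r. Jn m (F (u r)) - Yn m (u r))" for m
        by (rule set_integrable_imp_set_borel_measurable[OF set_integrable_Ioc_subset[OF set_integrable_Ioc_continuous order_refl t'(2)]])
      show "set_borel_measurable lebesgue {0<..t} u'"
        by (rule set_integrable_imp_set_borel_measurable[OF set_integrable_Ioc_subset[OF sqi_integrable[OF su'] order_refl t'(2)]])
      show "AE r in lebesgue. r \<in> {0<..t} \<longrightarrow> (\<lambda>m. Jn m (F (u r)) - Yn m (u r)) \<longlonglongrightarrow> u' r"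
        using y
      proof eventually_elim
        case (elim r)
        show ?case
        proof
          assume "r \<in> {0<..t}"
          then have r: "r \<in> {0<..T}" "r \<in> {0..T}" using t by simp_all
          then have d: "u r \<in> dom" "A (u r) = y r" using elim by blast+
          show "(\<lambda>m. Jn m (F (u r)) - Yn m (u r)) \<longlonglongrightarrow> u' r"
            unfolding u'_def by (intro tendsto_diff Jn_tendsto F_H uH r(2) Yy(1)[OF d])
        qed
      qed
      show "AE r in lebesgue. r \<in> {0<..t} \<longrightarrow> norm (Jn m (F (u r)) - Yn m (u r)) \<le> K + norm (y r)" for m
        using y
      proof eventually_elim
        case (elim r)
        show ?case
        proof
          assume "r \<in> {0<..t}"
          then have r: "r \<in> {0<..T}" "r \<in> {0..T}" using t by simp_all
          then have d: "u r \<in> dom" "A (u r) = y r" using elim by blast+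
          show "norm (Jn m (F (u r)) - Yn m (u r)) \<le> K + norm (y r)"
            using norm_triangle_ineq4[of "Jn m (F (u r))" "Yn m (u r)"] Yy(2)[OF d, of m]
              norm_J_le[OF eps_pos, of m "F (u r)"] K[OF uH[OF r(2)]] by linarith
        qed
      qed
    qed
    then show "(\<lambda>m. Jn m (u t)) \<longlonglongrightarrow> u 0 + (LINT r:{0<..t}|lebesgue. u' r)"
      unfolding Jeq[OF t] u_0 by (intro tendsto_add Jn_tendsto u0H)
  qed
  have "ac T u u'" unfolding ac_iff by (intro conjI ballI sqi_integrable[OF su'] ueq)
  moreover have "AE t in lebesgue. t \<in> {0<..T} \<longrightarrow> u t \<in> dom \<and> A (u t) = y t \<and> u' t = F (u t) - y t"
    using y by eventually_elim (simp only: u'_def, blast)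
  ultimately have "strong_solution T F u u' y" unfolding strong_solution_def using su' sy by blast
  with u_0 show ?thesis by blast
qed

end

end

subsection \<open>Test functions\<close>

lemma partial_deriv_eq: "(f has_derivative f') (at x) \<Longrightarrow> partial_deriv i f x = f' i"
  unfolding partial_deriv_def using frechet_derivative_at by metis

text \<open>\<open>C_k_on\<close> recurses through \<open>frechet_derivative\<close>. This rule and
  \<open>C_k_on_SucD\<close> trade it for a derivative of known shape, so that closure under the
  usual operations becomes an induction over all functions at once.\<close>

lemma C_k_on_SucI:
  assumes "\<And>x. (f has_derivative f' x) (at x)" "\<And>i. i \<in> Basis \<Longrightarrow> C_k_on k (\<lambda>x. f' x i) UNIV"
  shows "C_k_on (Suc k) f UNIV"
proof -
  have "partial_deriv i f = (\<lambda>x. f' x i)" for i by (rule ext) (rule partial_deriv_eq[OF assms(1)])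
  then show ?thesis using assms by (auto simp: differentiable_def)
qed

lemma C_k_on_SucD:
  assumes "C_k_on (Suc k) f UNIV"
  shows "(f has_derivative frechet_derivative f (at x)) (at x)"
    and "i \<in> Basis \<Longrightarrow> C_k_on k (\<lambda>x. frechet_derivative f (at x) i) UNIV"
proof -
  show "(f has_derivative frechet_derivative f (at x)) (at x)"
    using assms by (simp add: frechet_derivative_works[symmetric])
  have "partial_deriv i f = (\<lambda>x. frechet_derivative f (at x) i)" for i
    by (rule ext) (rule partial_deriv_def)
  then show "i \<in> Basis \<Longrightarrow> C_k_on k (\<lambda>x. frechet_derivative f (at x) i) UNIV" using assms by simp
qed

lemma C_k_on_pred: "C_k_on (Suc k) f UNIV \<Longrightarrow> C_k_on k f UNIV"
proof (induction k arbitrary: f)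
  case 0
  then have "f differentiable (at x)" for x by simp
  then show ?case by (simp add: differentiable_imp_continuous_on differentiable_on_def differentiable_at_withinI)
next
  case (Suc k)
  show ?case
    by (rule C_k_on_SucI[OF C_k_on_SucD(1)[OF Suc.prems]], rule Suc.IH, rule C_k_on_SucD(2)[OF Suc.prems])
qed

lemma C_k_on_const: "C_k_on k (\<lambda>x. c) UNIV"
proof (induction k arbitrary: c)
  case (Suc k)
  show ?case by (rule C_k_on_SucI[OF has_derivative_const]) (rule Suc.IH)
qed simp

lemma C_k_on_add: "C_k_on k f UNIV \<Longrightarrow> C_k_on k g UNIV \<Longrightarrow> C_k_on k (\<lambda>x. f x + g x) UNIV"
proof (induction k arbitrary: f g)
  case 0
  then show ?case by (auto intro: continuous_on_add)
next
  case (Suc k)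
  show ?case
    by (rule C_k_on_SucI[OF has_derivative_add[OF C_k_on_SucD(1)[OF Suc.prems(1)] C_k_on_SucD(1)[OF Suc.prems(2)]]])
      (intro Suc.IH C_k_on_SucD(2)[OF Suc.prems(1)] C_k_on_SucD(2)[OF Suc.prems(2)])
qed

lemma C_k_on_mult: "C_k_on k f UNIV \<Longrightarrow> C_k_on k g UNIV \<Longrightarrow> C_k_on k (\<lambda>x. f x * g x) UNIV"
proof (induction k arbitrary: f g)
  case 0
  then show ?case by (auto intro: continuous_on_mult)
next
  case (Suc k)
  show ?case
    by (rule C_k_on_SucI[OF has_derivative_mult[OF C_k_on_SucD(1)[OF Suc.prems(1)] C_k_on_SucD(1)[OF Suc.prems(2)]]])
      (intro C_k_on_add Suc.IH C_k_on_SucD(2)[OF Suc.prems(1)] C_k_on_SucD(2)[OF Suc.prems(2)]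
        C_k_on_pred[OF Suc.prems(1)] C_k_on_pred[OF Suc.prems(2)])
qed

lemma C_k_on_prod: "(\<And>i. i \<in> I \<Longrightarrow> C_k_on k (f i) UNIV) \<Longrightarrow> C_k_on k (\<lambda>x. \<Prod>i\<in>I. f i x) UNIV"
  by (induction I rule: infinite_finite_induct) (simp_all add: C_k_on_const C_k_on_mult)

lemma C_k_on_affine_comp:
  fixes h :: "real \<Rightarrow> real"
  shows "C_k_on k h UNIV \<Longrightarrow> C_k_on k (\<lambda>x. h (c + d * (x \<bullet> j))) UNIV"
proof (induction k arbitrary: h)
  case 0
  then show ?case
    by (auto intro!: continuous_on_compose2[of UNIV h] continuous_intros)
next
  case (Suc k)
  have l: "((\<lambda>x. c + d * (x \<bullet> j)) has_derivative (\<lambda>y. d * (y \<bullet> j))) (at x)" for x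
    by (auto intro!: derivative_eq_intros)
  have lin: "frechet_derivative h (at z) y = frechet_derivative h (at z) 1 * y" for z y
    using linear_scale[OF has_derivative_linear[OF C_k_on_SucD(1)[OF Suc.prems]], of z y 1]
    by (simp add: mult.commute)
  have der: "((\<lambda>x. h (c + d * (x \<bullet> j))) has_derivative
     (\<lambda>y. frechet_derivative h (at (c + d * (x \<bullet> j))) 1 * (d * (y \<bullet> j)))) (at x)" for x
    using has_derivative_compose[OF l C_k_on_SucD(1)[OF Suc.prems], of x] unfolding lin[of _ "d * _"] .
  show ?case
  proof (rule C_k_on_SucI[OF der])
    fix i :: 'a
    show "C_k_on k (\<lambda>x. frechet_derivative h (at (c + d * (x \<bullet> j))) 1 * (d * (i \<bullet> j))) UNIV"
      by (intro C_k_on_mult C_k_on_const Suc.IH C_k_on_SucD(2)[OF Suc.prems]) simp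
  qed
qed

lemma C_k_on_real_SucI:
  fixes f :: "real \<Rightarrow> real"
  assumes "\<And>x. (f has_real_derivative f' x) (at x)" "C_k_on k f' UNIV"
  shows "C_k_on (Suc k) f UNIV"
  by (rule C_k_on_SucI[OF assms(1)[unfolded has_field_derivative_def]]) (use assms(2) in simp)

text \<open>The factor \<open>x\<^sup>-\<^sup>m\<close> makes the family closed under differentiation.\<close>

definition bump :: "nat \<Rightarrow> real \<Rightarrow> real" where
  "bump m x = (if x > 0 then exp (- (1 / x)) / x ^ m else 0)"

text \<open>The single term of order \<open>Suc m\<close> in the series of
  \<open>exp (1 / x)\<close> already beats the factor \<open>1 / x ^ m\<close>, with one power of
  \<open>x\<close> to spare. Used with \<open>Suc m\<close>, it gives derivative 0 at the
  origin.\<close>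

lemma bump_le: "0 < x \<Longrightarrow> bump m x \<le> fact (Suc m) * x"
proof -
  assume x: "0 < x"
  have "(1 / x) ^ Suc m / fact (Suc m) \<le> exp (1 / x)"
  proof -
    have "(\<Sum>n\<in>{Suc m}. (1 / x) ^ n /\<^sub>R fact n) \<le> (\<Sum>n. (1 / x) ^ n /\<^sub>R fact n)"
      by (rule sum_le_suminf[OF summable_exp_generic]) (use x in auto)
    then show ?thesis by (simp add: exp_def divide_inverse mult.commute)
  qed
  then have "exp (- (1 / x)) * ((1 / x) ^ Suc m / fact (Suc m)) \<le> exp (- (1 / x)) * exp (1 / x)"
    by (rule mult_left_mono) simp
  also have "\<dots> = 1" by (simp add: exp_minus)
  finally have "(exp (- (1 / x)) * (1 / x) ^ Suc m) / fact (Suc m) \<le> 1" by (simp only: times_divide_eq_right)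
  then have "exp (- (1 / x)) * (1 / x) ^ Suc m \<le> 1 * fact (Suc m)"
    by (simp only: pos_divide_le_eq[OF fact_gt_zero])
  then have "exp (- (1 / x)) * (1 / x) ^ Suc m \<le> fact (Suc m)" by (simp only: mult_1_left)
  then have "exp (- (1 / x)) * (1 / x) ^ Suc m * x \<le> fact (Suc m) * x" by (rule mult_right_mono) (use x in simp)
  moreover have "exp (- (1 / x)) * (1 / x) ^ Suc m * x = bump m x"
    using x by (simp add: bump_def power_one_over)
  ultimately show ?thesis by simp
qed

lemma bump_nonneg: "0 \<le> bump m x" unfolding bump_def by simp

lemma bump_Suc: "bump m x = bump (Suc m) x * x"
  unfolding bump_def by simp

lemma bump_has_derivative: "(bump m has_real_derivative bump (m + 2) x + (- real m) * bump (m + 1) x) (at x)"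
proof (cases x "0 :: real" rule: linorder_cases)
  case less
  have "((\<lambda>x. 0) has_real_derivative 0) (at x)" by simp
  then have "(bump m has_real_derivative 0) (at x)"
    by (rule DERIV_cong_ev[THEN iffD1, rotated 3, OF _ refl _ refl])
      (use eventually_nhds_in_open[of "{..<0}" x] less in \<open>auto elim!: eventually_mono simp: bump_def\<close>)
  then show ?thesis using less by (simp add: bump_def)
next
  case greater
  have "((\<lambda>x. exp (- (1 / x)) / x ^ m) has_real_derivative bump (m + 2) x + (- real m) * bump (m + 1) x) (at x)"
    using greater
    by (cases m) (auto intro!: derivative_eq_intros simp: bump_def divide_simps, simp_all add: field_simps power2_eq_square,
        metis Suc_pred gr0I power_Suc)
  then show ?thesis
    by (rule DERIV_cong_ev[THEN iffD1, rotated 3, OF _ refl _ refl])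
      (use eventually_nhds_in_open[of "{0<..}" x] greater in \<open>auto elim!: eventually_mono simp: bump_def\<close>)
next
  case equal
  have "(bump m has_real_derivative 0) (at 0)"
    unfolding has_field_derivative_iff
  proof (rule Lim_null_comparison)
    show "\<forall>\<^sub>F y in at 0. norm ((bump m y - bump m 0) / (y - 0)) \<le> fact (Suc (Suc m)) * \<bar>y\<bar>"
    proof (rule always_eventually, rule allI)
      fix y :: real
      show "norm ((bump m y - bump m 0) / (y - 0)) \<le> fact (Suc (Suc m)) * \<bar>y\<bar>"
      proof (cases "y > 0")
        case True
        then have "norm ((bump m y - bump m 0) / (y - 0)) = bump (Suc m) y"
          using bump_Suc[of m y] bump_nonneg[of "Suc m" y] by (simp add: bump_def[of m 0])
        then show ?thesis using bump_le[OF True, of "Suc m"] True by simp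
      next
        case False
        then have "bump m y - bump m 0 = 0" by (simp add: bump_def)
        then show ?thesis by (simp only: div_0 norm_zero) simp
      qed
    qed
    have "((\<lambda>y. fact (Suc (Suc m)) * \<bar>y\<bar>) \<longlongrightarrow> fact (Suc (Suc m)) * \<bar>0\<bar>) (at (0::real))" by (intro tendsto_intros)
    then show "((\<lambda>y. fact (Suc (Suc m)) * \<bar>y\<bar>) \<longlongrightarrow> 0) (at (0::real))" by simp
  qed
  then show ?thesis using equal by (simp add: bump_def)
qed

lemma C_k_on_bump: "C_k_on k (bump m) UNIV"
proof (induction k arbitrary: m)
  case 0
  have "continuous_on UNIV (bump m)"
    by (rule DERIV_continuous_on) (rule has_field_derivative_at_within[OF bump_has_derivative])
  then show ?case by simp
next
  case (Suc k)
  show ?case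
    by (rule C_k_on_real_SucI[OF bump_has_derivative]) (intro C_k_on_add C_k_on_mult C_k_on_const Suc.IH)
qed

lemma bump_0_le_1: "bump 0 x \<le> 1" unfolding bump_def by simp

lemma bump_pos_iff: "bump m x \<noteq> 0 \<longleftrightarrow> 0 < x" unfolding bump_def by simp

text \<open>Each factor is exp(-1/((n+1)d)), with d the distance to one face, cut off to 0 beyond
  it; letting n grow therefore yields the indicator of the open box. The arguments are written in
  the shape of \<open>C_k_on_affine_comp\<close>.\<close>

definition box_bump :: "nat \<Rightarrow> 'a::euclidean_space \<Rightarrow> 'a \<Rightarrow> 'a \<Rightarrow> real" where
  "box_bump n a b x = (\<Prod>i\<in>Basis. bump 0 (- real (Suc n) * (a \<bullet> i) + real (Suc n) * (x \<bullet> i)) *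
     bump 0 (real (Suc n) * (b \<bullet> i) + - real (Suc n) * (x \<bullet> i)))"

lemma C_k_on_box_bump: "C_k_on k (box_bump n a b) UNIV"
  unfolding box_bump_def by (intro C_k_on_prod C_k_on_mult C_k_on_affine_comp C_k_on_bump)

lemma box_bump_bounds: "0 \<le> box_bump n a b x" "box_bump n a b x \<le> 1"
  unfolding box_bump_def
  by (intro prod_nonneg prod_le_1 conjI mult_nonneg_nonneg mult_le_one bump_nonneg bump_0_le_1 ballI)+

lemma box_bump_arg:
  "0 < - real (Suc n) * s + real (Suc n) * t \<longleftrightarrow> s < t" "0 < real (Suc n) * t + - real (Suc n) * s \<longleftrightarrow> s < t"
proof -
  have "- real (Suc n) * s + real (Suc n) * t = real (Suc n) * (t - s)"
    "real (Suc n) * t + - real (Suc n) * s = real (Suc n) * (t - s)" by (simp_all add: algebra_simps)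
  then show "0 < - real (Suc n) * s + real (Suc n) * t \<longleftrightarrow> s < t" "0 < real (Suc n) * t + - real (Suc n) * s \<longleftrightarrow> s < t"
    by (simp_all only: zero_less_mult_iff) auto
qed

lemma box_bump_nonzero_iff: "box_bump n a b x \<noteq> 0 \<longleftrightarrow> x \<in> box a b"
proof -
  have "box_bump n a b x \<noteq> 0 \<longleftrightarrow> (\<forall>i\<in>Basis. a \<bullet> i < x \<bullet> i \<and> x \<bullet> i < b \<bullet> i)"
    unfolding box_bump_def prod_zero_iff[OF finite_Basis] mult_eq_0_iff
    using bump_pos_iff box_bump_arg by (metis (no_types, lifting))
  then show ?thesis by (simp only: mem_box)
qed

lemma box_bump_tendsto: "(\<lambda>n. box_bump n a b x) \<longlonglongrightarrow> indicator (box a b) x"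
proof (cases "x \<in> box a b")
  case True
  have b: "(\<lambda>n. bump 0 (real (Suc n) * t)) \<longlonglongrightarrow> 1" if t: "0 < t" for t
  proof -
    have "(\<lambda>n. exp (- (inverse (real (Suc n)) * (1 / t)))) \<longlonglongrightarrow> exp (- (0 * (1 / t)))"
      by (intro tendsto_intros LIMSEQ_inverse_real_of_nat)
    moreover have "exp (- (inverse (real (Suc n)) * (1 / t))) = bump 0 (real (Suc n) * t)" for n
      using t by (simp add: bump_def inverse_eq_divide)
    ultimately show ?thesis by simp
  qed
  have "(\<lambda>n. box_bump n a b x) \<longlonglongrightarrow> (\<Prod>i\<in>(Basis::'a set). 1 * 1)"
    unfolding box_bump_def
  proof (intro tendsto_prod tendsto_mult)
    fix i :: 'a assume i: "i \<in> Basis"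
    have "0 < x \<bullet> i - a \<bullet> i" "0 < b \<bullet> i - x \<bullet> i" using True i by (auto simp: mem_box)
    from b[OF this(1)] b[OF this(2)]
    show "(\<lambda>n. bump 0 (- real (Suc n) * (a \<bullet> i) + real (Suc n) * (x \<bullet> i))) \<longlonglongrightarrow> 1"
      "(\<lambda>n. bump 0 (real (Suc n) * (b \<bullet> i) + - real (Suc n) * (x \<bullet> i))) \<longlonglongrightarrow> 1"
      by (simp_all add: algebra_simps)
  qed
  then show ?thesis using True by simp
next
  case False
  then have "box_bump n a b x = 0" for n using box_bump_nonzero_iff by blast
  then show ?thesis using False by simp
qed

lemma box_bump_test_function:
  assumes "cbox a b \<subseteq> \<Omega>"
  shows "box_bump n a b \<in> test_functions \<Omega>"
proof -
  have "closure {x. box_bump n a b x \<noteq> 0} \<subseteq> cbox a b"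
    by (rule closure_minimal) (use box_subset_cbox in \<open>auto simp: box_bump_nonzero_iff\<close>)
  moreover from this have "compact (closure {x. box_bump n a b x \<noteq> 0})"
    by (meson bounded_cbox bounded_subset closed_closure compact_eq_bounded_closed)
  ultimately show ?thesis using assms unfolding test_functions_def by (auto intro: C_k_on_box_bump)
qed

section \<open>Calculus of test functions\<close>

lemma test_functionD:
  assumes "\<phi> \<in> test_functions \<Omega>"
  shows "C_k_on k \<phi> UNIV" "compact (closure {x. \<phi> x \<noteq> 0})" "closure {x. \<phi> x \<noteq> 0} \<subseteq> \<Omega>"
    "\<phi> differentiable (at x)" "continuous_on UNIV \<phi>" "\<phi> x \<noteq> 0 \<Longrightarrow> x \<in> \<Omega>"
proof -
  have C: "C_k_on k \<phi> UNIV" for k using assms unfolding test_functions_def by blast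
  show "C_k_on k \<phi> UNIV" "compact (closure {x. \<phi> x \<noteq> 0})" "closure {x. \<phi> x \<noteq> 0} \<subseteq> \<Omega>"
    using assms unfolding test_functions_def by blast+
  then show "\<phi> x \<noteq> 0 \<Longrightarrow> x \<in> \<Omega>" using closure_subset[of "{x. \<phi> x \<noteq> 0}"] by blast
  show "\<phi> differentiable (at x)" using C[of 1] by simp
  show "continuous_on UNIV \<phi>" using C[of 0] by simp
qed

lemma test_functionI:
  assumes "\<And>k. C_k_on k \<psi> UNIV" "\<phi> \<in> test_functions \<Omega>" "{x. \<psi> x \<noteq> 0} \<subseteq> closure {x. \<phi> x \<noteq> 0}"
  shows "\<psi> \<in> test_functions \<Omega>"
proof -
  have "closure {x. \<psi> x \<noteq> 0} \<subseteq> closure {x. \<phi> x \<noteq> 0}" by (rule closure_minimal[OF assms(3)]) simp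
  moreover from this have "compact (closure {x. \<psi> x \<noteq> 0})"
    using compact_imp_bounded[OF test_functionD(2)[OF assms(2)]]
    by (meson bounded_subset closed_closure compact_eq_bounded_closed)
  ultimately show ?thesis using assms(1) test_functionD(3)[OF assms(2)] unfolding test_functions_def by blast
qed

lemma test_function_mult:
  assumes "\<phi> \<in> test_functions \<Omega>" "\<psi> \<in> test_functions \<Omega>'"
  shows "(\<lambda>x. \<phi> x * \<psi> x) \<in> test_functions \<Omega>"
proof (rule test_functionI[OF _ assms(1)])
  show "C_k_on k (\<lambda>x. \<phi> x * \<psi> x) UNIV" for k using assms by (intro C_k_on_mult test_functionD(1))
  show "{x. \<phi> x * \<psi> x \<noteq> 0} \<subseteq> closure {x. \<phi> x \<noteq> 0}" using closure_subset[of "{x. \<phi> x \<noteq> 0}"] by auto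
qed

lemma test_function_scale: "\<phi> \<in> test_functions \<Omega> \<Longrightarrow> (\<lambda>x. c * \<phi> x) \<in> test_functions \<Omega>"
proof (rule test_functionI)
  assume "\<phi> \<in> test_functions \<Omega>"
  then show "C_k_on k (\<lambda>x. c * \<phi> x) UNIV" for k by (intro C_k_on_mult C_k_on_const test_functionD(1))
  show "{x. c * \<phi> x \<noteq> 0} \<subseteq> closure {x. \<phi> x \<noteq> 0}" using closure_subset[of "{x. \<phi> x \<noteq> 0}"] by auto
qed

lemma test_function_add:
  assumes "\<phi> \<in> test_functions \<Omega>" "\<psi> \<in> test_functions \<Omega>"
  shows "(\<lambda>x. \<phi> x + \<psi> x) \<in> test_functions \<Omega>"
proof -
  let ?K = "closure {x. \<phi> x \<noteq> 0} \<union> closure {x. \<psi> x \<noteq> 0}"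
  have K: "compact ?K" by (intro compact_Un test_functionD(2)[OF assms(1)] test_functionD(2)[OF assms(2)])
  have sub: "closure {x. \<phi> x + \<psi> x \<noteq> 0} \<subseteq> ?K"
  proof (rule closure_minimal)
    have "{x. \<phi> x + \<psi> x \<noteq> 0} \<subseteq> {x. \<phi> x \<noteq> 0} \<union> {x. \<psi> x \<noteq> 0}" by auto
    also have "\<dots> \<subseteq> ?K" by (intro Un_mono closure_subset)
    finally show "{x. \<phi> x + \<psi> x \<noteq> 0} \<subseteq> ?K" .
  qed (intro closed_Un closed_closure)
  have "compact (closure {x. \<phi> x + \<psi> x \<noteq> 0})"
    using compact_imp_bounded[OF K] sub by (meson bounded_subset closed_closure compact_eq_bounded_closed)
  moreover have "C_k_on k (\<lambda>x. \<phi> x + \<psi> x) UNIV" for k using assms by (intro C_k_on_add test_functionD(1))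
  ultimately show ?thesis
    using sub test_functionD(3)[OF assms(1)] test_functionD(3)[OF assms(2)] unfolding test_functions_def by blast
qed

lemma partial_deriv_zero_outside:
  assumes "x \<notin> closure {x. \<phi> x \<noteq> 0}"
  shows "partial_deriv i \<phi> x = 0"
proof -
  have "((\<lambda>x. 0 :: real) has_derivative (\<lambda>_. 0)) (at x)" by simp
  then have "(\<phi> has_derivative (\<lambda>_. 0)) (at x)"
    by (rule has_derivative_transform_within_open[of _ _ _ UNIV "- closure {x. \<phi> x \<noteq> 0}"])
      (use assms closure_subset[of "{x. \<phi> x \<noteq> 0}"] in auto)
  then show ?thesis by (rule partial_deriv_eq)
qed

lemma test_function_partial_deriv:
  assumes \<phi>: "\<phi> \<in> test_functions \<Omega>" and i: "i \<in> Basis"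
  shows "partial_deriv i \<phi> \<in> test_functions \<Omega>"
proof (rule test_functionI[OF _ \<phi>])
  show "C_k_on k (partial_deriv i \<phi>) UNIV" for k
    using test_functionD(1)[OF \<phi>, of "Suc k"] i by simp
  show "{x. partial_deriv i \<phi> x \<noteq> 0} \<subseteq> closure {x. \<phi> x \<noteq> 0}" using partial_deriv_zero_outside by blast
qed

lemma partial_deriv_mult:
  assumes "\<phi> differentiable (at x)" "\<psi> differentiable (at x)"
  shows "partial_deriv i (\<lambda>x. \<phi> x * \<psi> x) x = \<phi> x * partial_deriv i \<psi> x + partial_deriv i \<phi> x * \<psi> x"
  using partial_deriv_eq[OF has_derivative_mult[OF assms[unfolded frechet_derivative_works]]]
  unfolding partial_deriv_def .

lemma test_function_measurable: "\<phi> \<in> test_functions \<Omega> \<Longrightarrow> \<phi> \<in> borel_measurable lborel"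
  using borel_measurable_continuous_onI[OF test_functionD(5)] by simp

lemma test_function_integrable: "\<phi> \<in> test_functions \<Omega> \<Longrightarrow> integrable lborel \<phi>"
proof -
  assume \<phi>: "\<phi> \<in> test_functions \<Omega>"
  let ?K = "closure {x. \<phi> x \<noteq> 0}"
  have "integrable lborel (\<lambda>x. indicator ?K x *\<^sub>R \<phi> x)"
    by (rule borel_integrable_compact[OF test_functionD(2)[OF \<phi>]])
      (rule continuous_on_subset[OF test_functionD(5)[OF \<phi>]], simp)
  moreover have "indicator ?K x *\<^sub>R \<phi> x = \<phi> x" for x
    using closure_subset[of "{x. \<phi> x \<noteq> 0}"] by (cases "\<phi> x = 0") (auto simp: indicator_def)
  ultimately show ?thesis by (simp only:)
qed

lemma test_function_sq_integrable: "\<phi> \<in> test_functions \<Omega> \<Longrightarrow> sq_integrable \<phi>"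
  unfolding sq_integrable_def
  using test_function_measurable test_function_integrable[OF test_function_mult[of \<phi> \<Omega> \<phi> \<Omega>]]
  by (auto simp: power2_eq_square)

lemma test_function_bounded: "\<phi> \<in> test_functions \<Omega> \<Longrightarrow> \<exists>B. \<forall>x. \<bar>\<phi> x\<bar> \<le> B"
proof -
  assume \<phi>: "\<phi> \<in> test_functions \<Omega>"
  let ?K = "closure {x. \<phi> x \<noteq> 0}"
  have "compact (\<phi> ` ?K)"
    by (rule compact_continuous_image[OF continuous_on_subset[OF test_functionD(5)[OF \<phi>]] test_functionD(2)[OF \<phi>]]) simp
  then obtain B where B: "B > 0" "\<And>y. y \<in> \<phi> ` ?K \<Longrightarrow> \<bar>y\<bar> \<le> B" using compact_imp_bounded bounded_pos real_norm_def by metis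
  have "\<bar>\<phi> x\<bar> \<le> B" for x
    using B closure_subset[of "{x. \<phi> x \<noteq> 0}"] by (cases "\<phi> x = 0") auto
  then show ?thesis by blast
qed

lemma integral_translate:
  fixes f :: "'a::euclidean_space \<Rightarrow> real"
  assumes "f \<in> borel_measurable borel"
  shows "(\<integral>x. f (c + x) \<partial>lborel) = (\<integral>x. f x \<partial>lborel)"
proof -
  have "(\<integral>x. f x \<partial>lborel) = (\<integral>x. f x \<partial>(distr lborel borel ((+) c)))" unfolding lborel_distr_plus ..
  also have "\<dots> = (\<integral>x. f (c + x) \<partial>lborel)" by (rule integral_distr) (use assms in auto)
  finally show ?thesis ..
qed

lemma integrable_translate:
  fixes f :: "'a::euclidean_space \<Rightarrow> real"
  assumes "integrable lborel f"
  shows "integrable lborel (\<lambda>x. f (c + x))"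
proof -
  have "integrable (distr lborel borel ((+) c)) f" using assms unfolding lborel_distr_plus .
  then show ?thesis by (rule integrable_distr[rotated]) auto
qed

text \<open>Difference quotients integrate to 0 by translation invariance. The mean value theorem
  bounds them by the supremum of the derivative, on a ball of radius \<open>R + 1\<close> since the
  steps are at most 1, and dominated convergence gives the derivative; no iterated integrals
  occur.\<close>

lemma integral_partial_deriv_zero:
  fixes \<phi> :: "'a::euclidean_space \<Rightarrow> real"
  assumes \<phi>: "\<phi> \<in> test_functions \<Omega>" and i: "i \<in> Basis"
  shows "(\<integral>x. partial_deriv i \<phi> x \<partial>lborel) = 0"
proof -
  let ?d = "partial_deriv i \<phi>" and ?K = "closure {x. \<phi> x \<noteq> 0}"
  define q where "q n x = real (Suc n) * (\<phi> (inverse (real (Suc n)) *\<^sub>R i + x) - \<phi> x)" for n x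
  have d: "((\<lambda>t. \<phi> (t *\<^sub>R i + x)) has_real_derivative ?d (t *\<^sub>R i + x)) (at t)" for t x
  proof -
    let ?f' = "frechet_derivative \<phi> (at (t *\<^sub>R i + x))"
    have D: "(\<phi> has_derivative ?f') (at (t *\<^sub>R i + x))"
      using test_functionD(4)[OF \<phi>] by (simp only: frechet_derivative_works)
    have "((\<lambda>t. t *\<^sub>R i + x) has_derivative (\<lambda>s. s *\<^sub>R i)) (at t)" by (auto intro!: derivative_eq_intros)
    from has_derivative_compose[OF this D]
    have "((\<lambda>t. \<phi> (t *\<^sub>R i + x)) has_derivative (\<lambda>s. ?f' (s *\<^sub>R i))) (at t)" .
    moreover have "?f' (s *\<^sub>R i) = ?d (t *\<^sub>R i + x) * s" for s
      unfolding partial_deriv_def linear_scale[OF has_derivative_linear[OF D]] by simp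
    ultimately show ?thesis unfolding has_field_derivative_def by (simp only:)
  qed
  obtain B where B: "\<And>x. \<bar>?d x\<bar> \<le> B" using test_function_bounded[OF test_function_partial_deriv[OF \<phi> i]] by blast
  obtain R where R: "\<And>x. x \<in> ?K \<Longrightarrow> norm x \<le> R"
    using compact_imp_bounded[OF test_functionD(2)[OF \<phi>]] unfolding bounded_iff by blast
  have i1: "norm i = 1" using i by simp
  have mvt: "\<exists>t\<in>{0..1}. q n x = ?d (t *\<^sub>R i + x)" for n x
  proof -
    have "0 < inverse (real (Suc n))" by simp
    from MVT2[OF this, of "\<lambda>t. \<phi> (t *\<^sub>R i + x)" "\<lambda>t. ?d (t *\<^sub>R i + x)"] d
    obtain t where t: "0 < t" "t < inverse (real (Suc n))"
      "\<phi> (inverse (real (Suc n)) *\<^sub>R i + x) - \<phi> (0 *\<^sub>R i + x) = (inverse (real (Suc n)) - 0) * ?d (t *\<^sub>R i + x)" by blast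
    have "real (Suc n) * (inverse (real (Suc n)) * z) = z" for z :: real
      by (simp del: of_nat_Suc)
    then have "q n x = ?d (t *\<^sub>R i + x)" unfolding q_def using t(3) by simp
    moreover have "inverse (real (Suc n)) \<le> 1" by (simp add: inverse_le_1_iff)
    ultimately show ?thesis using t(1,2) by (intro bexI[of _ t]) auto
  qed
  have qb: "norm (q n x) \<le> B * indicator (cball 0 (R + 1)) x" for n x
  proof -
    obtain t where t: "t \<in> {0..1}" "q n x = ?d (t *\<^sub>R i + x)" using mvt by blast
    show ?thesis
    proof (cases "x \<in> cball 0 (R + 1)")
      case True
      then show ?thesis using B[of "t *\<^sub>R i + x"] t(2) by simp
    next
      case False
      have "norm x \<le> norm (t *\<^sub>R i + x) + norm (t *\<^sub>R i)" using norm_triangle_ineq4[of "t *\<^sub>R i + x" "t *\<^sub>R i"] by simp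
      then have "norm (t *\<^sub>R i + x) > R" using False t(1) i1 by simp
      then have "t *\<^sub>R i + x \<notin> ?K" using R by fastforce
      then show ?thesis using partial_deriv_zero_outside t(2) False by simp
    qed
  qed
  have mq: "q n \<in> borel_measurable lborel" for n
    unfolding q_def using test_function_measurable[OF \<phi>] by measurable
  have iq: "(\<integral>x. q n x \<partial>lborel) = 0" for n
    unfolding q_def using integrable_translate[OF test_function_integrable[OF \<phi>]] test_function_integrable[OF \<phi>]
      integral_translate[of \<phi>] test_function_measurable[OF \<phi>] by simp
  have "(\<lambda>n. \<integral>x. q n x \<partial>lborel) \<longlonglongrightarrow> (\<integral>x. ?d x \<partial>lborel)"
  proof (rule integral_dominated_convergence)
    show "integrable lborel (\<lambda>x::'a. B * indicator (cball 0 (R + 1)) x :: real)"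
      by (intro integrable_mult_right integrable_real_indicator) (use emeasure_compact_finite[OF compact_cball[of "0::'a" "R + 1"]] in auto)
    show "AE x in lborel. (\<lambda>n. q n x) \<longlonglongrightarrow> ?d x"
    proof (rule AE_I2)
      fix x
      have "((\<lambda>t. (\<phi> (t *\<^sub>R i + x) - \<phi> (0 *\<^sub>R i + x)) / (t - 0)) \<longlongrightarrow> ?d (0 *\<^sub>R i + x)) (at 0)"
        using d[of x 0] unfolding has_field_derivative_iff .
      moreover have "filterlim (\<lambda>n. inverse (real (Suc n))) (at 0) sequentially"
        by (intro filterlim_atI LIMSEQ_inverse_real_of_nat always_eventually) auto
      ultimately have "(\<lambda>n. (\<phi> (inverse (real (Suc n)) *\<^sub>R i + x) - \<phi> (0 *\<^sub>R i + x)) / (inverse (real (Suc n)) - 0)) \<longlonglongrightarrow> ?d (0 *\<^sub>R i + x)"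
        by (rule filterlim_compose)
      then show "(\<lambda>n. q n x) \<longlonglongrightarrow> ?d x" unfolding q_def by (simp add: divide_inverse mult.commute)
    qed
    show "AE x in lborel. norm (q n x) \<le> B * indicator (cball 0 (R + 1)) x" for n
      by (rule AE_I2) (rule qb)
    show "?d \<in> borel_measurable lborel" by (rule test_function_measurable[OF test_function_partial_deriv[OF \<phi> i]])
  qed (rule mq)
  then show ?thesis unfolding iq by (simp add: LIMSEQ_const_iff)
qed

lemma test_function_inner:
  assumes \<phi>: "\<phi> \<in> test_functions \<Omega>"
  shows "(LINT x:\<Omega>|lborel. fun_of u x * \<phi> x) = u \<bullet> L2_of \<phi>"
proof -
  have "u \<bullet> L2_of \<phi> = (\<integral>x. fun_of u x * \<phi> x \<partial>lborel)"
    by (rule inner_L2_cong)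
      (use fun_of_L2_of[OF test_function_sq_integrable[OF \<phi>]] test_function_measurable[OF \<phi>] in \<open>auto elim!: eventually_mono\<close>)
  also have "\<dots> = (LINT x:\<Omega>|lborel. fun_of u x * \<phi> x)"
    unfolding set_lebesgue_integral_def
    by (rule Bochner_Integration.integral_cong[OF refl]) (use test_functionD(6)[OF \<phi>] in \<open>auto simp: indicator_def\<close>)
  finally show ?thesis ..
qed

text \<open>The fundamental lemma of the calculus of variations. Smooth box functions give zero
  integral over every box inside the domain, a Dynkin argument extends this to Borel subsets of a
  box, the sets where \<open>w\<close> has a sign give \<open>w = 0\<close> almost everywhere on the
  box, and countably many boxes cover the domain.\<close>

lemma L2_on_eq_0I:
  fixes w :: "'a::euclidean_space L2"
  assumes \<Omega>: "open \<Omega>" and w: "w \<in> L2_on \<Omega>"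
    and test: "\<And>\<phi>. \<phi> \<in> test_functions \<Omega> \<Longrightarrow> w \<bullet> L2_of \<phi> = 0"
  shows "w = 0"
proof -
  let ?w = "fun_of w"
  have sqi: "sq_integrable (indicator (S \<inter> cbox a b) :: 'a \<Rightarrow> real)" if [measurable]: "S \<in> sets borel" for S a b
  proof -
    have "emeasure lborel (S \<inter> cbox a b) \<le> emeasure lborel (cbox a b)" by (rule emeasure_mono) auto
    also have "\<dots> < \<infinity>" using emeasure_compact_finite[OF compact_cbox] by simp
    finally have "integrable lborel (indicator (S \<inter> cbox a b) :: 'a \<Rightarrow> real)"
      by (intro integrable_real_indicator) auto
    moreover have "(indicator (S \<inter> cbox a b) x :: real)\<^sup>2 = indicator (S \<inter> cbox a b) x" for x
      by (simp add: indicator_def)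
    ultimately show ?thesis unfolding sq_integrable_def by simp
  qed
  have sqb: "sq_integrable (indicator (S \<inter> box a b) :: 'a \<Rightarrow> real)" if S: "S \<in> sets borel" for S a b
  proof -
    have "(S \<inter> box a b) \<inter> cbox a b = S \<inter> box a b" using box_subset_cbox by blast
    moreover have "S \<inter> box a b \<in> sets borel" using S by auto
    ultimately show ?thesis using sqi[of "S \<inter> box a b" a b] by simp
  qed
  have int: "integrable lborel (\<lambda>x. ?w x * indicator (S \<inter> box a b) x)" if "S \<in> sets borel" for S a b
    by (rule sq_integrable_mult[OF sq_integrable_fun_of sqb[OF that]])
  have box0: "(\<integral>x. ?w x * indicator (box a b) x \<partial>lborel) = 0" if ab: "cbox a b \<subseteq> \<Omega>" for a b
  proof (rule LIMSEQ_unique)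
    show "(\<lambda>n. \<integral>x. ?w x * box_bump n a b x \<partial>lborel) \<longlonglongrightarrow> (\<integral>x. ?w x * indicator (box a b) x \<partial>lborel)"
    proof (rule integral_dominated_convergence)
      show "integrable lborel (\<lambda>x. \<bar>?w x * indicator (UNIV \<inter> box a b) x\<bar>)" by (intro integrable_abs int) simp
      show "AE x in lborel. (\<lambda>n. ?w x * box_bump n a b x) \<longlonglongrightarrow> ?w x * indicator (box a b) x"
        by (intro AE_I2 tendsto_mult tendsto_const box_bump_tendsto)
      show "AE x in lborel. norm (?w x * box_bump n a b x) \<le> \<bar>?w x * indicator (UNIV \<inter> box a b) x\<bar>" for n
      proof (rule AE_I2)
        fix x
        show "norm (?w x * box_bump n a b x) \<le> \<bar>?w x * indicator (UNIV \<inter> box a b) x\<bar>"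
        proof (cases "x \<in> box a b")
          case True
          have "\<bar>?w x\<bar> * box_bump n a b x \<le> \<bar>?w x\<bar> * 1" by (intro mult_left_mono box_bump_bounds) simp
          then show ?thesis using True box_bump_bounds(1)[of n a b x] by (simp add: abs_mult)
        next
          case False
          then have "box_bump n a b x = 0" using box_bump_nonzero_iff by blast
          then show ?thesis by simp
        qed
      qed
      show "(\<lambda>x. ?w x * box_bump n a b x) \<in> borel_measurable lborel" for n
        using test_function_measurable[OF box_bump_test_function[OF ab]] by (intro borel_measurable_times fun_of_measurable)
    qed simp
    have "(\<integral>x. ?w x * box_bump n a b x \<partial>lborel) = w \<bullet> L2_of (box_bump n a b)" for n
    proof (rule inner_L2_cong[symmetric])
      show "AE x in lborel. ?w x * fun_of (L2_of (box_bump n a b)) x = ?w x * box_bump n a b x"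
        using fun_of_L2_of[OF test_function_sq_integrable[OF box_bump_test_function[OF ab, of n]]]
        by eventually_elim simp
    qed (intro borel_measurable_times fun_of_measurable test_function_measurable[OF box_bump_test_function[OF ab]])
    then show "(\<lambda>n. \<integral>x. ?w x * box_bump n a b x \<partial>lborel) \<longlonglongrightarrow> 0"
      using test[OF box_bump_test_function[OF ab]] by simp
  qed
  have bor0: "(\<integral>x. ?w x * indicator (S \<inter> box a b) x \<partial>lborel) = 0" if ab: "cbox a b \<subseteq> \<Omega>" and S: "S \<in> sets borel" for a b S
  proof -
    let ?G = "range (\<lambda>(a, b). box a b :: 'a set)"
    have G: "sets (borel :: 'a measure) = sigma_sets UNIV ?G" unfolding borel_eq_box by (rule sets_measure_of) simp
    have "Int_stable ?G"
    proof (rule Int_stableI)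
      fix s t assume "s \<in> ?G" "t \<in> ?G"
      then obtain a b c d where st: "s = box a b" "t = box c d" by auto
      have "box p q \<in> ?G" for p q by (rule range_eqI[of _ _ "(p, q)"]) simp
      then show "s \<inter> t \<in> ?G" unfolding st box_Int_box by blast
    qed
    moreover have "?G \<subseteq> Pow UNIV" by simp
    moreover have "S \<in> sigma_sets UNIV ?G" using S G by simp
    ultimately show ?thesis
    proof (induction rule: sigma_sets_induct_disjoint)
      case (basic S)
      then obtain c d where S: "S = box c d" by auto
      have "cbox (\<Sum>i\<in>Basis. max (c \<bullet> i) (a \<bullet> i) *\<^sub>R i) (\<Sum>i\<in>Basis. min (d \<bullet> i) (b \<bullet> i) *\<^sub>R i) \<subseteq> \<Omega>"
        unfolding Int_interval[symmetric] using ab by blast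
      from box0[OF this] show ?case unfolding S box_Int_box .
    next
      case empty
      then show ?case by simp
    next
      case (compl S)
      then have S: "S \<in> sets borel" using G by simp
      have "?w x * indicator ((UNIV - S) \<inter> box a b) x = ?w x * indicator (UNIV \<inter> box a b) x - ?w x * indicator (S \<inter> box a b) x" for x
        by (simp add: indicator_def)
      then have "(\<integral>x. ?w x * indicator ((UNIV - S) \<inter> box a b) x \<partial>lborel)
         = (\<integral>x. ?w x * indicator (UNIV \<inter> box a b) x \<partial>lborel) - (\<integral>x. ?w x * indicator (S \<inter> box a b) x \<partial>lborel)"
        using int[OF S] int[of UNIV] by simp
      then show ?case using compl box0[OF ab] by simp
    next
      case (union S)
      have S: "S i \<in> sets borel" for i using union(2) G by auto
      let ?g = "\<lambda>x. ?w x * indicator (UNIV \<inter> box a b) x"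
      have si: "set_integrable lborel (S i) ?g" for i
        unfolding set_integrable_def using int[of UNIV] S by (intro integrable_mult_indicator) auto
      have eq: "(\<integral>x. ?w x * indicator (Z \<inter> box a b) x \<partial>lborel) = (LINT x:Z|lborel. ?g x)" for Z
        unfolding set_lebesgue_integral_def
        by (rule Bochner_Integration.integral_cong[OF refl]) (simp add: indicator_def)
      have US: "set_integrable lborel (\<Union>i. S i) ?g"
        unfolding set_integrable_def using int[of UNIV] S by (intro integrable_mult_indicator) auto
      have "(LINT x:(\<Union>i. S i)|lborel. ?g x) = (\<Sum>i. (LINT x:S i|lborel. ?g x))"
        by (rule lebesgue_integral_countable_add[OF _ _ US]) (use S union(1) in \<open>auto simp: disjoint_family_on_def\<close>)
      then show ?case unfolding eq using union(3) unfolding eq by simp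
    qed
  qed
  have AE_box: "AE x in lborel. x \<in> box a b \<longrightarrow> ?w x = 0" if ab: "cbox a b \<subseteq> \<Omega>" for a b
  proof -
    \<comment> \<open>The values 1 and -1 of \<open>s\<close> exclude positive and negative values
      of \<open>w\<close> respectively.\<close>
    have zero: "AE x in lborel. x \<in> box a b \<longrightarrow> \<not> s * ?w x > 0" for s :: real
    proof -
      let ?S = "{x. s * ?w x > 0}"
      have S: "?S \<in> sets borel"
        using borel_measurable_times[OF borel_measurable_const fun_of_measurable, of s w]
        by (simp add: borel_measurable_iff_greater)
      have i: "integrable lborel (\<lambda>x. s * (?w x * indicator (?S \<inter> box a b) x))" by (intro integrable_mult_right int S)
      have nn: "AE x in lborel. 0 \<le> s * (?w x * indicator (?S \<inter> box a b) x)" by (intro AE_I2) (simp add: indicator_def)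
      have "(\<integral>x. s * (?w x * indicator (?S \<inter> box a b) x) \<partial>lborel) = 0" using bor0[OF ab S] by simp
      then have "AE x in lborel. s * (?w x * indicator (?S \<inter> box a b) x) = 0"
        unfolding integral_nonneg_eq_0_iff_AE[OF i nn] .
      then show ?thesis by eventually_elim (auto simp: indicator_def split: if_splits)
    qed
    from zero[of 1] zero[of "-1"] show ?thesis by eventually_elim auto
  qed
  let ?F = "{box a b |a b. cbox a b \<subseteq> \<Omega>}"
  obtain F' where F': "F' \<subseteq> ?F" "countable F'" "\<Union>F' = \<Union>?F"
    by (rule Lindelof[of ?F]) (auto intro: open_box)
  have "\<Omega> \<subseteq> \<Union>?F"
  proof
    fix x assume "x \<in> \<Omega>"
    then obtain a b where "x \<in> box a b" "cbox a b \<subseteq> \<Omega>" using \<Omega> open_contains_cbox by metis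
    then show "x \<in> \<Union>?F" by blast
  qed
  then have cov: "\<Omega> \<subseteq> \<Union>F'" unfolding F'(3) .
  have "AE x in lborel. \<forall>B\<in>F'. x \<in> B \<longrightarrow> ?w x = 0"
    unfolding AE_ball_countable[OF F'(2)] using F'(1) AE_box by blast
  moreover have "AE x in lborel. x \<notin> \<Omega> \<longrightarrow> ?w x = 0" using w unfolding L2_on_def by simp
  ultimately have "AE x in lborel. ?w x = 0" by eventually_elim (use cov in blast)
  then show ?thesis unfolding L2_eq_iff using AE_zero_L2 by eventually_elim simp
qed

text \<open>Integration by parts without boundary terms: the product of two test functions is a test
  function, so the integral of its partial derivative vanishes.\<close>

lemma is_weak_partial_test_function:
  assumes \<phi>: "\<phi> \<in> test_functions \<Omega>" and i: "i \<in> Basis"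
  shows "is_weak_partial \<Omega> i (L2_of \<phi>) (L2_of (partial_deriv i \<phi>))"
proof -
  let ?d = "partial_deriv i \<phi>"
  note td = test_function_partial_deriv[OF \<phi> i]
  have inner: "L2_of f \<bullet> L2_of g = (\<integral>x. f x * g x \<partial>lborel)" if "f \<in> test_functions \<Omega>" "g \<in> test_functions \<Omega>" for f g
  proof (rule inner_L2_cong)
    show "AE x in lborel. fun_of (L2_of f) x * fun_of (L2_of g) x = f x * g x"
      using fun_of_L2_of[OF test_function_sq_integrable[OF that(1)]] fun_of_L2_of[OF test_function_sq_integrable[OF that(2)]]
      by eventually_elim simp
  qed (intro borel_measurable_times test_function_measurable[OF that(1)] test_function_measurable[OF that(2)])
  show ?thesis unfolding is_weak_partial_def
  proof (intro conjI ballI)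
    show "L2_of ?d \<in> L2_on \<Omega>"
      unfolding L2_on_def mem_Collect_eq
      using fun_of_L2_of[OF test_function_sq_integrable[OF td]]
      by eventually_elim (use test_functionD(6)[OF td] in auto)
    fix \<psi> assume \<psi>: "\<psi> \<in> test_functions \<Omega>"
    note tp = test_function_partial_deriv[OF \<psi> i]
    have "(\<integral>x. \<phi> x * partial_deriv i \<psi> x + ?d x * \<psi> x \<partial>lborel) = (\<integral>x. partial_deriv i (\<lambda>x. \<phi> x * \<psi> x) x \<partial>lborel)"
      by (rule Bochner_Integration.integral_cong[OF refl])
        (rule partial_deriv_mult[symmetric, OF test_functionD(4)[OF \<phi>] test_functionD(4)[OF \<psi>]])
    also have "\<dots> = 0" by (rule integral_partial_deriv_zero[OF test_function_mult[OF \<phi> \<psi>] i])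
    finally have "L2_of \<phi> \<bullet> L2_of (partial_deriv i \<psi>) + L2_of ?d \<bullet> L2_of \<psi> = 0"
      unfolding inner[OF \<phi> tp] inner[OF td \<psi>]
      using test_function_integrable[OF test_function_mult[OF \<phi> tp]] test_function_integrable[OF test_function_mult[OF td \<psi>]] by simp
    then show "(LINT x:\<Omega>|lborel. fun_of (L2_of \<phi>) x * partial_deriv i \<psi> x) = - (LINT x:\<Omega>|lborel. fun_of (L2_of ?d) x * \<psi> x)"
      unfolding test_function_inner[OF tp] test_function_inner[OF \<psi>] by simp
  qed
qed

subsection \<open>Sobolev spaces and the diffusion form\<close>

lemma subspace_L2_on: "subspace (L2_on \<Omega>)"
proof (rule subspaceI)
  show "0 \<in> L2_on \<Omega>" unfolding L2_on_def mem_Collect_eq using AE_zero_L2 by eventually_elim simp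
  fix u v :: "'a L2" and c :: real
  assume u: "u \<in> L2_on \<Omega>"
  show "c *\<^sub>R u \<in> L2_on \<Omega>"
    using u AE_scaleR_L2[of c u] unfolding L2_on_def mem_Collect_eq by eventually_elim simp
  assume v: "v \<in> L2_on \<Omega>"
  show "u + v \<in> L2_on \<Omega>"
    using u v AE_plus_L2[of u v] unfolding L2_on_def mem_Collect_eq by eventually_elim simp
qed

text \<open>Makes weighted integrals into inner products, so that the diffusion form inherits
  linearity and continuity from the Hilbert space. Meaningful for bounded measurable
  weights.\<close>

definition mulL :: "('a::euclidean_space \<Rightarrow> real) \<Rightarrow> 'a L2 \<Rightarrow> 'a L2" where
  "mulL \<beta> u = L2_of (\<lambda>x. \<beta> x * fun_of u x)"

context
  fixes \<beta> :: "'a::euclidean_space \<Rightarrow> real" and C :: real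
  assumes m: "\<beta> \<in> borel_measurable lborel" and C: "\<And>x. \<bar>\<beta> x\<bar> \<le> C"
begin

lemma sq_integrable_mulL: "sq_integrable (\<lambda>x. \<beta> x * fun_of u x)"
proof (rule sq_integrable_bound)
  show "sq_integrable (\<lambda>x. C * fun_of u x)" by (rule sq_integrable_scale) simp
  show "(\<lambda>x. \<beta> x * fun_of u x) \<in> borel_measurable lborel" using m by (intro borel_measurable_times fun_of_measurable)
  have "\<bar>\<beta> x * fun_of u x\<bar> \<le> \<bar>C * fun_of u x\<bar>" for x
    using C[of x] unfolding abs_mult by (intro mult_right_mono) auto
  then show "AE x in lborel. \<bar>\<beta> x * fun_of u x\<bar> \<le> \<bar>C * fun_of u x\<bar>" by simp
qed

lemma inner_mulL: "mulL \<beta> u \<bullet> v = (\<integral>x. \<beta> x * fun_of u x * fun_of v x \<partial>lborel)"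
proof (rule inner_L2_cong)
  show "AE x in lborel. fun_of (mulL \<beta> u) x * fun_of v x = \<beta> x * fun_of u x * fun_of v x"
    unfolding mulL_def using fun_of_L2_of[OF sq_integrable_mulL, of u] by eventually_elim simp
qed (use m in \<open>intro borel_measurable_times fun_of_measurable\<close>)

lemma mulL_sym: "mulL \<beta> u \<bullet> v = mulL \<beta> v \<bullet> u"
  unfolding inner_mulL by (rule Bochner_Integration.integral_cong[OF refl]) simp

lemma mulL_add: "mulL \<beta> (u + v) \<bullet> w = mulL \<beta> u \<bullet> w + mulL \<beta> v \<bullet> w"
  unfolding mulL_sym[of _ w] by (rule inner_add_right)

lemma mulL_scaleR: "mulL \<beta> (c *\<^sub>R u) \<bullet> w = c * (mulL \<beta> u \<bullet> w)"
  unfolding mulL_sym[of _ w] by (rule inner_scaleR_right)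

lemma integrable_mulL: "integrable lborel (\<lambda>x. \<beta> x * fun_of u x * fun_of v x)"
  by (rule sq_integrable_mult[OF sq_integrable_mulL sq_integrable_fun_of])

lemma mulL_bounds:
  assumes u: "u \<in> L2_on \<Omega>" and c: "\<And>x. x \<in> \<Omega> \<Longrightarrow> c0 \<le> \<beta> x" "\<And>x. x \<in> \<Omega> \<Longrightarrow> \<beta> x \<le> c1"
  shows "c0 * (norm u)\<^sup>2 \<le> mulL \<beta> u \<bullet> u" "mulL \<beta> u \<bullet> u \<le> c1 * (norm u)\<^sup>2"
proof -
  have i: "integrable lborel (\<lambda>x. k * (fun_of u x)\<^sup>2)" for k
    using sq_integrable_fun_of[of u] unfolding sq_integrable_def by (intro integrable_mult_right) blast
  have e: "k * (norm u)\<^sup>2 = (\<integral>x. k * (fun_of u x)\<^sup>2 \<partial>lborel)" for k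
    unfolding norm_L2_fun by (rule integral_mult_right_zero[symmetric])
  have u': "AE x in lborel. x \<notin> \<Omega> \<longrightarrow> fun_of u x = 0" using u unfolding L2_on_def by simp
  show "c0 * (norm u)\<^sup>2 \<le> mulL \<beta> u \<bullet> u" unfolding e inner_mulL
  proof (rule integral_mono_AE[OF i integrable_mulL])
    show "AE x in lborel. c0 * (fun_of u x)\<^sup>2 \<le> \<beta> x * fun_of u x * fun_of u x" using u'
    proof eventually_elim
      case (elim x)
      have "c0 * (fun_of u x)\<^sup>2 \<le> \<beta> x * (fun_of u x)\<^sup>2" if "x \<in> \<Omega>"
        by (rule mult_right_mono[OF c(1)[OF that]]) simp
      then show ?case using elim by (cases "x \<in> \<Omega>") (simp_all add: power2_eq_square mult.assoc)
    qed
  qed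
  show "mulL \<beta> u \<bullet> u \<le> c1 * (norm u)\<^sup>2" unfolding e inner_mulL
  proof (rule integral_mono_AE[OF integrable_mulL i])
    show "AE x in lborel. \<beta> x * fun_of u x * fun_of u x \<le> c1 * (fun_of u x)\<^sup>2" using u'
    proof eventually_elim
      case (elim x)
      have "\<beta> x * (fun_of u x)\<^sup>2 \<le> c1 * (fun_of u x)\<^sup>2" if "x \<in> \<Omega>"
        by (rule mult_right_mono[OF c(2)[OF that]]) simp
      then show ?case using elim by (cases "x \<in> \<Omega>") (simp_all add: power2_eq_square mult.assoc)
    qed
  qed
qed

end

lemma test_function_L2_on: "\<phi> \<in> test_functions \<Omega> \<Longrightarrow> L2_of \<phi> \<in> L2_on \<Omega>"
  unfolding L2_on_def mem_Collect_eq
  using fun_of_L2_of[OF test_function_sq_integrable[of \<phi> \<Omega>]]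
  by (auto elim!: eventually_mono dest: test_functionD(6))

section \<open>Weak derivatives and Sobolev spaces on an open set\<close>

context
  fixes \<Omega> :: "'a::euclidean_space set"
  assumes \<Omega>: "open \<Omega>"
begin

text \<open>Pairing with the part of \<open>l\<close> outside the domain is continuous and vanishes
  along the sequence; in the limit the square of \<open>l\<close> has integral 0 there.\<close>

lemma closed_L2_on: "closed (L2_on \<Omega>)"
  unfolding closed_sequential_limits
proof (intro allI impI)
  fix xs l assume *: "(\<forall>n. xs n \<in> L2_on \<Omega>) \<and> xs \<longlonglongrightarrow> l"
  define \<beta> :: "'a \<Rightarrow> real" where "\<beta> = indicator (- \<Omega>)"
  have m: "\<beta> \<in> borel_measurable lborel" unfolding \<beta>_def using \<Omega> by (intro borel_measurable_indicator) auto
  have C: "\<bar>\<beta> x\<bar> \<le> 1" for x unfolding \<beta>_def by (simp add: indicator_def)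
  have "mulL \<beta> (xs n) \<bullet> l = 0" for n
  proof -
    have "AE x in lborel. \<beta> x * fun_of (xs n) x * fun_of l x = 0"
      using * unfolding L2_on_def \<beta>_def by (auto elim!: eventually_mono simp: indicator_def)
    then show ?thesis unfolding inner_mulL[OF m C] by (simp add: integral_eq_zero_AE)
  qed
  then have "xs n \<bullet> mulL \<beta> l = 0" for n using mulL_sym[OF m C, of "xs n" l] by (simp add: inner_commute)
  moreover have "(\<lambda>n. xs n \<bullet> mulL \<beta> l) \<longlonglongrightarrow> l \<bullet> mulL \<beta> l" using * by (intro tendsto_intros) blast
  ultimately have "mulL \<beta> l \<bullet> l = 0" by (simp add: LIMSEQ_const_iff inner_commute)
  then have "(\<integral>x. \<beta> x * fun_of l x * fun_of l x \<partial>lborel) = 0" unfolding inner_mulL[OF m C] .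
  moreover have "AE x in lborel. 0 \<le> \<beta> x * fun_of l x * fun_of l x"
    unfolding \<beta>_def by (rule AE_I2) (simp add: indicator_def)
  ultimately have "AE x in lborel. \<beta> x * fun_of l x * fun_of l x = 0"
    using integral_nonneg_eq_0_iff_AE[OF integrable_mulL[OF m C, of l l]] by blast
  then show "l \<in> L2_on \<Omega>"
    unfolding L2_on_def mem_Collect_eq \<beta>_def by eventually_elim (auto simp: indicator_def)
qed

text \<open>As identities between inner products, weak derivatives pass directly to linear
  combinations and to limits in norm.\<close>

lemma is_weak_partial_iff:
  assumes i: "i \<in> Basis"
  shows "is_weak_partial \<Omega> i u w \<longleftrightarrow> w \<in> L2_on \<Omega> \<and>
    (\<forall>\<phi>\<in>test_functions \<Omega>. u \<bullet> L2_of (partial_deriv i \<phi>) = - (w \<bullet> L2_of \<phi>))"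
  unfolding is_weak_partial_def
  by (rule arg_cong2[where f = "(\<and>)", OF refl], rule ball_cong[OF refl])
    (simp only: test_function_inner test_function_inner[OF test_function_partial_deriv[OF _ i]])

text \<open>Two weak derivatives agree against all test functions and vanish outside the domain, so
  \<open>L2_on_eq_0I\<close> applies. This justifies the description in
  \<open>weak_partial\<close>.\<close>

lemma weak_partial_eq:
  assumes i: "i \<in> Basis" and w: "is_weak_partial \<Omega> i u w"
  shows "weak_partial \<Omega> i u = w"
  unfolding weak_partial_def
proof (rule the_equality)
  show "is_weak_partial \<Omega> i u w" by (rule w)
  fix w' assume w': "is_weak_partial \<Omega> i u w'"
  have "w' - w = 0"
  proof (rule L2_on_eq_0I[OF \<Omega>])
    show "w' - w \<in> L2_on \<Omega>" using w w' subspace_diff[OF subspace_L2_on] unfolding is_weak_partial_def by blast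
    fix \<phi> assume "\<phi> \<in> test_functions \<Omega>"
    then show "(w' - w) \<bullet> L2_of \<phi> = 0"
      using w w' unfolding is_weak_partial_iff[OF i] inner_diff_left by (metis add.inverse_inverse eq_iff_diff_eq_0)
  qed
  then show "w' = w" by simp
qed

lemma is_weak_partial_add:
  assumes "i \<in> Basis" "is_weak_partial \<Omega> i u w" "is_weak_partial \<Omega> i u' w'"
  shows "is_weak_partial \<Omega> i (u + u') (w + w')"
  using assms(2,3) unfolding is_weak_partial_iff[OF assms(1)]
  by (simp add: subspace_add[OF subspace_L2_on] inner_add_left)

lemma is_weak_partial_scaleR:
  assumes "i \<in> Basis" "is_weak_partial \<Omega> i u w"
  shows "is_weak_partial \<Omega> i (c *\<^sub>R u) (c *\<^sub>R w)"
  using assms(2) unfolding is_weak_partial_iff[OF assms(1)]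
  by (simp add: subspace_scale[OF subspace_L2_on])

lemma is_weak_partial_limit:
  assumes i: "i \<in> Basis" and p: "\<And>n. is_weak_partial \<Omega> i (u n) (w n)" and u: "u \<longlonglongrightarrow> u'" and w: "w \<longlonglongrightarrow> w'"
  shows "is_weak_partial \<Omega> i u' w'"
  unfolding is_weak_partial_iff[OF i]
proof (intro conjI ballI)
  show "w' \<in> L2_on \<Omega>" by (rule closed_sequentially[OF closed_L2_on _ w]) (use p is_weak_partial_def in blast)
  fix \<phi> assume \<phi>: "\<phi> \<in> test_functions \<Omega>"
  have "(\<lambda>n. u n \<bullet> L2_of (partial_deriv i \<phi>)) \<longlonglongrightarrow> u' \<bullet> L2_of (partial_deriv i \<phi>)" by (intro tendsto_intros u)
  moreover have "u n \<bullet> L2_of (partial_deriv i \<phi>) = - (w n \<bullet> L2_of \<phi>)" for n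
    using p[of n] \<phi> unfolding is_weak_partial_iff[OF i] by blast
  moreover have "(\<lambda>n. - (w n \<bullet> L2_of \<phi>)) \<longlonglongrightarrow> - (w' \<bullet> L2_of \<phi>)" by (intro tendsto_intros w)
  ultimately show "u' \<bullet> L2_of (partial_deriv i \<phi>) = - (w' \<bullet> L2_of \<phi>)" using LIMSEQ_unique by fastforce
qed

lemma H1_I: "u \<in> L2_on \<Omega> \<Longrightarrow> (\<And>i. i \<in> Basis \<Longrightarrow> is_weak_partial \<Omega> i u (w i)) \<Longrightarrow> u \<in> H1 \<Omega>"
  unfolding H1_def by blast

lemma H1_D:
  assumes "u \<in> H1 \<Omega>"
  shows "u \<in> L2_on \<Omega>" "i \<in> Basis \<Longrightarrow> is_weak_partial \<Omega> i u (weak_partial \<Omega> i u)"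
    "i \<in> Basis \<Longrightarrow> weak_partial \<Omega> i u \<in> L2_on \<Omega>"
proof -
  show "u \<in> L2_on \<Omega>" using assms unfolding H1_def by blast
  have *: "is_weak_partial \<Omega> i u (weak_partial \<Omega> i u)" if i: "i \<in> Basis"
  proof -
    obtain w where w: "is_weak_partial \<Omega> i u w" using assms i unfolding H1_def by blast
    then show ?thesis unfolding weak_partial_eq[OF i w] .
  qed
  then show "i \<in> Basis \<Longrightarrow> is_weak_partial \<Omega> i u (weak_partial \<Omega> i u)" .
  then show "i \<in> Basis \<Longrightarrow> weak_partial \<Omega> i u \<in> L2_on \<Omega>" unfolding is_weak_partial_def by blast
qed

lemma H1_add: "u \<in> H1 \<Omega> \<Longrightarrow> v \<in> H1 \<Omega> \<Longrightarrow> u + v \<in> H1 \<Omega>"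
  and weak_partial_add: "u \<in> H1 \<Omega> \<Longrightarrow> v \<in> H1 \<Omega> \<Longrightarrow> i \<in> Basis \<Longrightarrow>
    weak_partial \<Omega> i (u + v) = weak_partial \<Omega> i u + weak_partial \<Omega> i v"
proof -
  assume uv: "u \<in> H1 \<Omega>" "v \<in> H1 \<Omega>"
  have *: "is_weak_partial \<Omega> i (u + v) (weak_partial \<Omega> i u + weak_partial \<Omega> i v)" if "i \<in> Basis" for i
    by (rule is_weak_partial_add[OF that H1_D(2)[OF uv(1) that] H1_D(2)[OF uv(2) that]])
  show "u + v \<in> H1 \<Omega>" by (rule H1_I[OF subspace_add[OF subspace_L2_on H1_D(1)[OF uv(1)] H1_D(1)[OF uv(2)]] *])
  show "i \<in> Basis \<Longrightarrow> weak_partial \<Omega> i (u + v) = weak_partial \<Omega> i u + weak_partial \<Omega> i v"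
    by (rule weak_partial_eq[OF _ *])
qed

lemma H1_scaleR: "u \<in> H1 \<Omega> \<Longrightarrow> c *\<^sub>R u \<in> H1 \<Omega>"
  and weak_partial_scaleR: "u \<in> H1 \<Omega> \<Longrightarrow> i \<in> Basis \<Longrightarrow> weak_partial \<Omega> i (c *\<^sub>R u) = c *\<^sub>R weak_partial \<Omega> i u"
proof -
  assume u: "u \<in> H1 \<Omega>"
  have *: "is_weak_partial \<Omega> i (c *\<^sub>R u) (c *\<^sub>R weak_partial \<Omega> i u)" if "i \<in> Basis" for i
    by (rule is_weak_partial_scaleR[OF that H1_D(2)[OF u that]])
  show "c *\<^sub>R u \<in> H1 \<Omega>" by (rule H1_I[OF subspace_scale[OF subspace_L2_on H1_D(1)[OF u]] *])
  show "i \<in> Basis \<Longrightarrow> weak_partial \<Omega> i (c *\<^sub>R u) = c *\<^sub>R weak_partial \<Omega> i u"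
    by (rule weak_partial_eq[OF _ *])
qed

lemma H1_diff: "u \<in> H1 \<Omega> \<Longrightarrow> v \<in> H1 \<Omega> \<Longrightarrow> u - v \<in> H1 \<Omega>"
  using H1_add[OF _ H1_scaleR[of v "-1"], of u] by simp

lemma weak_partial_diff:
  "u \<in> H1 \<Omega> \<Longrightarrow> v \<in> H1 \<Omega> \<Longrightarrow> i \<in> Basis \<Longrightarrow> weak_partial \<Omega> i (u - v) = weak_partial \<Omega> i u - weak_partial \<Omega> i v"
  using weak_partial_add[OF _ H1_scaleR[of v "-1"], of u i] weak_partial_scaleR[of v i "-1"] by simp

definition grad_sq :: "'a L2 \<Rightarrow> real" where "grad_sq u = (\<Sum>i\<in>Basis. (norm (weak_partial \<Omega> i u))\<^sup>2)"

lemma grad_sq_nonneg: "0 \<le> grad_sq u" unfolding grad_sq_def by (intro sum_nonneg) simp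

lemma norm_H1_eq: "norm_H1 \<Omega> u = sqrt ((norm u)\<^sup>2 + grad_sq u)"
  unfolding norm_H1_def inner_H1_def grad_sq_def power2_norm_eq_inner ..

lemma grad_sq_add_le: "u \<in> H1 \<Omega> \<Longrightarrow> v \<in> H1 \<Omega> \<Longrightarrow> grad_sq (u + v) \<le> 2 * grad_sq u + 2 * grad_sq v"
proof -
  assume uv: "u \<in> H1 \<Omega>" "v \<in> H1 \<Omega>"
  have "grad_sq (u + v) \<le> (\<Sum>i\<in>Basis. 2 * (norm (weak_partial \<Omega> i u))\<^sup>2 + 2 * (norm (weak_partial \<Omega> i v))\<^sup>2)"
    unfolding grad_sq_def
  proof (rule sum_mono)
    fix i :: 'a assume i: "i \<in> Basis"
    show "(norm (weak_partial \<Omega> i (u + v)))\<^sup>2 \<le> 2 * (norm (weak_partial \<Omega> i u))\<^sup>2 + 2 * (norm (weak_partial \<Omega> i v))\<^sup>2"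
      unfolding weak_partial_add[OF uv i] by (rule norm_add_sq_le)
  qed
  then show ?thesis unfolding grad_sq_def by (simp add: sum.distrib sum_distrib_left)
qed

lemma grad_sq_minus_commute: "u \<in> H1 \<Omega> \<Longrightarrow> v \<in> H1 \<Omega> \<Longrightarrow> grad_sq (u - v) = grad_sq (v - u)"
  unfolding grad_sq_def by (rule sum.cong[OF refl]) (simp add: weak_partial_diff norm_minus_commute)

lemma H1_0_iff:
  "u \<in> H1_0 \<Omega> \<longleftrightarrow> u \<in> H1 \<Omega> \<and>
    (\<forall>e>0. \<exists>\<phi>\<in>test_functions \<Omega>. (norm (u - L2_of \<phi>))\<^sup>2 + grad_sq (u - L2_of \<phi>) < e)"
proof -
  have "(\<forall>e>0. \<exists>\<phi>\<in>test_functions \<Omega>. sqrt (N \<phi>) < e) \<longleftrightarrow> (\<forall>e>0. \<exists>\<phi>\<in>test_functions \<Omega>. N \<phi> < e)" for N :: "('a \<Rightarrow> real) \<Rightarrow> real"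
  proof (intro iffI allI impI)
    fix e :: real assume e: "e > 0"
    { assume "\<forall>e>0. \<exists>\<phi>\<in>test_functions \<Omega>. sqrt (N \<phi>) < e"
      then have "\<exists>\<phi>\<in>test_functions \<Omega>. sqrt (N \<phi>) < sqrt e" using e real_sqrt_gt_zero by blast
      then show "\<exists>\<phi>\<in>test_functions \<Omega>. N \<phi> < e" by (simp only: real_sqrt_less_iff) }
    { assume "\<forall>e>0. \<exists>\<phi>\<in>test_functions \<Omega>. N \<phi> < e"
      then obtain \<phi> where "\<phi> \<in> test_functions \<Omega>" "N \<phi> < e\<^sup>2" using e zero_less_power by blast
      moreover from this(2) have "sqrt (N \<phi>) < sqrt (e\<^sup>2)" by (rule real_sqrt_less_mono)
      ultimately show "\<exists>\<phi>\<in>test_functions \<Omega>. sqrt (N \<phi>) < e" using e by auto }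
  qed
  then show ?thesis unfolding H1_0_def norm_H1_eq by simp
qed

lemma test_function_H1: "\<phi> \<in> test_functions \<Omega> \<Longrightarrow> L2_of \<phi> \<in> H1 \<Omega>"
  by (rule H1_I[OF test_function_L2_on is_weak_partial_test_function])

lemma H1_0_subset_H1: "H1_0 \<Omega> \<subseteq> H1 \<Omega>" unfolding H1_0_def by blast

lemma H1_0_limit:
  assumes x: "\<And>n. x n \<in> H1_0 \<Omega>" and u: "u \<in> H1 \<Omega>"
    and lim: "(\<lambda>n. (norm (u - x n))\<^sup>2 + grad_sq (u - x n)) \<longlonglongrightarrow> 0"
  shows "u \<in> H1_0 \<Omega>"
  unfolding H1_0_iff
proof (intro conjI u allI impI)
  fix e :: real assume e: "e > 0"
  have "\<forall>\<^sub>F n in sequentially. (norm (u - x n))\<^sup>2 + grad_sq (u - x n) < e / 4"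
    using lim by (rule order_tendstoD) (use e in simp)
  then obtain n where n: "(norm (u - x n))\<^sup>2 + grad_sq (u - x n) < e / 4" unfolding eventually_sequentially by blast
  obtain \<phi> where \<phi>: "\<phi> \<in> test_functions \<Omega>" "(norm (x n - L2_of \<phi>))\<^sup>2 + grad_sq (x n - L2_of \<phi>) < e / 4"
    using x[of n] e unfolding H1_0_iff by (meson divide_pos_pos zero_less_numeral)
  have xn: "x n \<in> H1 \<Omega>" using x H1_0_subset_H1 by blast
  have "u - L2_of \<phi> = (u - x n) + (x n - L2_of \<phi>)" by simp
  then have "(norm (u - L2_of \<phi>))\<^sup>2 + grad_sq (u - L2_of \<phi>) < e"
    using norm_add_sq_le[of "u - x n" "x n - L2_of \<phi>"] n \<phi>(2) e
      grad_sq_add_le[OF H1_diff[OF u xn] H1_diff[OF xn test_function_H1[OF \<phi>(1)]]] by (simp only:)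
  then show "\<exists>\<phi>\<in>test_functions \<Omega>. (norm (u - L2_of \<phi>))\<^sup>2 + grad_sq (u - L2_of \<phi>) < e" using \<phi>(1) by blast
qed

lemma grad_sq_0: "grad_sq 0 = 0"
proof -
  have z: "(0 :: 'a L2) \<in> L2_on \<Omega>" by (rule subspace_0[OF subspace_L2_on])
  have "is_weak_partial \<Omega> i 0 0" if "i \<in> Basis" for i
    unfolding is_weak_partial_iff[OF that] using z by simp
  then show ?thesis unfolding grad_sq_def by (intro sum.neutral ballI) (simp add: weak_partial_eq)
qed

lemma grad_sq_scaleR: "u \<in> H1 \<Omega> \<Longrightarrow> grad_sq (c *\<^sub>R u) = c\<^sup>2 * grad_sq u"
  unfolding grad_sq_def sum_distrib_left
  by (rule sum.cong[OF refl]) (simp add: weak_partial_scaleR power_mult_distrib)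

lemma test_function_H1_0: "\<phi> \<in> test_functions \<Omega> \<Longrightarrow> L2_of \<phi> \<in> H1_0 \<Omega>"
  unfolding H1_0_iff using grad_sq_0 by (auto intro!: test_function_H1 bexI[of _ \<phi>])

lemma subspace_H1_0: "subspace (H1_0 \<Omega>)"
proof (rule subspaceI)
  have z: "(\<lambda>x. 0) \<in> test_functions \<Omega>" unfolding test_functions_def by (simp add: C_k_on_const)
  show "0 \<in> H1_0 \<Omega>" using test_function_H1_0[OF z] unfolding zero_L2_def .
  fix u v :: "'a L2" and c :: real
  assume u0: "u \<in> H1_0 \<Omega>"
  then have u: "u \<in> H1 \<Omega>" using H1_0_subset_H1 by blast
  show "c *\<^sub>R u \<in> H1_0 \<Omega>"
    unfolding H1_0_iff
  proof (intro conjI allI impI H1_scaleR[OF u])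
    fix e :: real assume e: "e > 0"
    obtain \<phi> where \<phi>: "\<phi> \<in> test_functions \<Omega>" "(norm (u - L2_of \<phi>))\<^sup>2 + grad_sq (u - L2_of \<phi>) < e / (c\<^sup>2 + 1)"
      using u0 e unfolding H1_0_iff by (meson divide_pos_pos zero_le_power2 add_nonneg_pos zero_less_one)
    have c1: "0 < c\<^sup>2 + 1" by (simp add: add_nonneg_pos)
    have eq: "c *\<^sub>R u - L2_of (\<lambda>x. c * \<phi> x) = c *\<^sub>R (u - L2_of \<phi>)"
      unfolding L2_of_scaleR[OF test_function_sq_integrable[OF \<phi>(1)], symmetric] by (simp add: scaleR_diff_right)
    have "(norm (c *\<^sub>R (u - L2_of \<phi>)))\<^sup>2 + grad_sq (c *\<^sub>R (u - L2_of \<phi>))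
        = c\<^sup>2 * ((norm (u - L2_of \<phi>))\<^sup>2 + grad_sq (u - L2_of \<phi>))"
      unfolding grad_sq_scaleR[OF H1_diff[OF u test_function_H1[OF \<phi>(1)]]] by (simp only: norm_scaleR power_mult_distrib distrib_left power2_abs)
    also have "\<dots> \<le> (c\<^sup>2 + 1) * ((norm (u - L2_of \<phi>))\<^sup>2 + grad_sq (u - L2_of \<phi>))"
      by (intro mult_right_mono add_nonneg_nonneg grad_sq_nonneg) auto
    also have "\<dots> < (c\<^sup>2 + 1) * (e / (c\<^sup>2 + 1))" by (rule mult_strict_left_mono[OF \<phi>(2) c1])
    also have "\<dots> = e" using c1 by simp
    finally show "\<exists>\<phi>\<in>test_functions \<Omega>. (norm (c *\<^sub>R u - L2_of \<phi>))\<^sup>2 + grad_sq (c *\<^sub>R u - L2_of \<phi>) < e"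
      unfolding eq[symmetric] using test_function_scale[OF \<phi>(1), of c] by blast
  qed
  assume v0: "v \<in> H1_0 \<Omega>"
  then have v: "v \<in> H1 \<Omega>" using H1_0_subset_H1 by blast
  show "u + v \<in> H1_0 \<Omega>"
    unfolding H1_0_iff
  proof (intro conjI allI impI H1_add[OF u v])
    fix e :: real assume e: "e > 0"
    have e4: "e / 4 > 0" using e by simp
    obtain \<phi> where \<phi>: "\<phi> \<in> test_functions \<Omega>" "(norm (u - L2_of \<phi>))\<^sup>2 + grad_sq (u - L2_of \<phi>) < e / 4"
      using u0 e4 unfolding H1_0_iff by blast
    obtain \<psi> where \<psi>: "\<psi> \<in> test_functions \<Omega>" "(norm (v - L2_of \<psi>))\<^sup>2 + grad_sq (v - L2_of \<psi>) < e / 4"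
      using v0 e4 unfolding H1_0_iff by blast
    have eq: "u + v - L2_of (\<lambda>x. \<phi> x + \<psi> x) = (u - L2_of \<phi>) + (v - L2_of \<psi>)"
      unfolding L2_of_add[OF test_function_sq_integrable[OF \<phi>(1)] test_function_sq_integrable[OF \<psi>(1)], symmetric] by simp
    have "(norm (u + v - L2_of (\<lambda>x. \<phi> x + \<psi> x)))\<^sup>2 + grad_sq (u + v - L2_of (\<lambda>x. \<phi> x + \<psi> x)) < e"
      unfolding eq using norm_add_sq_le[of "u - L2_of \<phi>" "v - L2_of \<psi>"] \<phi>(2) \<psi>(2) e
        grad_sq_add_le[OF H1_diff[OF u test_function_H1[OF \<phi>(1)]] H1_diff[OF v test_function_H1[OF \<psi>(1)]]] by linarith
    then show "\<exists>\<phi>\<in>test_functions \<Omega>. (norm (u + v - L2_of \<phi>))\<^sup>2 + grad_sq (u + v - L2_of \<phi>) < e"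
      using test_function_add[OF \<phi>(1) \<psi>(1)] by blast
  qed
qed

context
  fixes b :: "'a \<Rightarrow> real" and c0 c1 :: real
  assumes mb: "(\<lambda>x. indicator \<Omega> x * b x) \<in> borel_measurable lborel"
    and c0: "0 < c0" and b: "\<And>x. x \<in> \<Omega> \<Longrightarrow> c0 \<le> b x" "\<And>x. x \<in> \<Omega> \<Longrightarrow> b x \<le> c1" and c1: "0 \<le> c1"
begin

text \<open>\<open>b\<close> is controlled only inside the domain; its extension by zero is bounded
  and measurable on the whole space, as \<open>mulL\<close> requires.\<close>

private abbreviation (input) "\<beta> \<equiv> \<lambda>x. indicator \<Omega> x * b x"

private lemma \<beta>_bound: "\<bar>\<beta> x\<bar> \<le> c1"
  using b[of x] c0 c1 by (cases "x \<in> \<Omega>") auto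

lemma diffusion_op_eq: "diffusion_op \<Omega> b u v = (\<Sum>i\<in>Basis. mulL \<beta> (weak_partial \<Omega> i u) \<bullet> weak_partial \<Omega> i v)"
proof -
  have "diffusion_op \<Omega> b u v
    = (\<integral>x. (\<Sum>i\<in>Basis. \<beta> x * fun_of (weak_partial \<Omega> i u) x * fun_of (weak_partial \<Omega> i v) x) \<partial>lborel)"
    unfolding diffusion_op_def set_lebesgue_integral_def
    by (rule Bochner_Integration.integral_cong[OF refl]) (simp add: sum_distrib_left mult.assoc)
  also have "\<dots> = (\<Sum>i\<in>Basis. mulL \<beta> (weak_partial \<Omega> i u) \<bullet> weak_partial \<Omega> i v)"
    unfolding inner_mulL[OF mb \<beta>_bound]
    by (rule Bochner_Integration.integral_sum) (rule integrable_mulL[OF mb \<beta>_bound])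
  finally show ?thesis .
qed

lemma diffusion_op_bounds:
  assumes u: "u \<in> H1 \<Omega>"
  shows "c0 * grad_sq u \<le> diffusion_op \<Omega> b u u" "diffusion_op \<Omega> b u u \<le> c1 * grad_sq u"
  unfolding diffusion_op_eq grad_sq_def sum_distrib_left
  using b by (auto intro!: sum_mono mulL_bounds[OF mb \<beta>_bound H1_D(3)[OF u]])

text \<open>For completeness, the lower bound \<open>c0\<close> makes each weak partial derivative
  Cauchy, the limits are the derivatives of the limit, and the upper bound \<open>c1\<close> returns
  convergence for the form.\<close>

lemma closed_form_diffusion_op: "closed_form (H1_0 \<Omega>) (diffusion_op \<Omega> b)"
proof
  show "subspace (H1_0 \<Omega>)" by (rule subspace_H1_0)
  have H: "u \<in> H1_0 \<Omega> \<Longrightarrow> u \<in> H1 \<Omega>" for u using H1_0_subset_H1 by blast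
  show "diffusion_op \<Omega> b (u + v) w = diffusion_op \<Omega> b u w + diffusion_op \<Omega> b v w"
    if "u \<in> H1_0 \<Omega>" "v \<in> H1_0 \<Omega>" "w \<in> H1_0 \<Omega>" for u v w
    unfolding diffusion_op_eq sum.distrib[symmetric]
    by (rule sum.cong[OF refl]) (simp only: weak_partial_add[OF H[OF that(1)] H[OF that(2)]] mulL_add[OF mb \<beta>_bound])
  show "diffusion_op \<Omega> b (c *\<^sub>R u) v = c * diffusion_op \<Omega> b u v" if "u \<in> H1_0 \<Omega>" "v \<in> H1_0 \<Omega>" for u v c
    unfolding diffusion_op_eq sum_distrib_left
    by (rule sum.cong[OF refl]) (simp only: weak_partial_scaleR[OF H[OF that(1)]] mulL_scaleR[OF mb \<beta>_bound])
  show "diffusion_op \<Omega> b u v = diffusion_op \<Omega> b v u" for u v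
    unfolding diffusion_op_eq by (rule sum.cong[OF refl]) (rule mulL_sym[OF mb \<beta>_bound])
  show "0 \<le> diffusion_op \<Omega> b u u" if "u \<in> H1_0 \<Omega>" for u
    using diffusion_op_bounds(1)[OF H[OF that]] mult_nonneg_nonneg[OF less_imp_le[OF c0] grad_sq_nonneg] by (rule order_trans[rotated])
  fix x :: "nat \<Rightarrow> 'a L2"
  assume x: "\<And>n. x n \<in> H1_0 \<Omega>" and Cx: "Cauchy x"
    and ax: "\<And>e. 0 < e \<Longrightarrow> \<exists>N. \<forall>m\<ge>N. \<forall>n\<ge>N. diffusion_op \<Omega> b (x m - x n) (x m - x n) < e"
  obtain u where u: "x \<longlonglongrightarrow> u" using Cx Cauchy_convergent convergent_def by blast
  have xH: "x n \<in> H1 \<Omega>" for n by (rule H[OF x])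
  have "\<exists>w. (\<lambda>n. weak_partial \<Omega> i (x n)) \<longlonglongrightarrow> w" if i: "i \<in> Basis" for i
  proof -
    have "Cauchy (\<lambda>n. weak_partial \<Omega> i (x n))"
    proof (rule CauchyI)
      fix e :: real assume e: "e > 0"
      then obtain N where N: "\<And>m n. m \<ge> N \<Longrightarrow> n \<ge> N \<Longrightarrow> diffusion_op \<Omega> b (x m - x n) (x m - x n) < c0 * e\<^sup>2"
        using ax[of "c0 * e\<^sup>2"] c0 by auto
      have "norm (weak_partial \<Omega> i (x m) - weak_partial \<Omega> i (x n)) < e" if mn: "m \<ge> N" "n \<ge> N" for m n
      proof (rule power2_less_imp_less)
        have "(norm (weak_partial \<Omega> i (x m - x n)))\<^sup>2 \<le> grad_sq (x m - x n)"
          unfolding grad_sq_def by (rule member_le_sum[OF i]) auto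
        then have "c0 * (norm (weak_partial \<Omega> i (x m - x n)))\<^sup>2 \<le> c0 * grad_sq (x m - x n)"
          using c0 by (intro mult_left_mono) auto
        also have "\<dots> < c0 * e\<^sup>2"
          using diffusion_op_bounds(1)[OF H1_diff[OF xH xH], of m n] N[OF mn] by linarith
        finally show "(norm (weak_partial \<Omega> i (x m) - weak_partial \<Omega> i (x n)))\<^sup>2 < e\<^sup>2"
          using c0 unfolding weak_partial_diff[OF xH xH i] by simp
      qed (use e in simp)
      then show "\<exists>M. \<forall>m\<ge>M. \<forall>n\<ge>M. norm (weak_partial \<Omega> i (x m) - weak_partial \<Omega> i (x n)) < e" by blast
    qed
    then show ?thesis using Cauchy_convergent convergent_def by blast
  qed
  then obtain w where w: "\<And>i. i \<in> Basis \<Longrightarrow> (\<lambda>n. weak_partial \<Omega> i (x n)) \<longlonglongrightarrow> w i" by metis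
  have wp: "is_weak_partial \<Omega> i u (w i)" if "i \<in> Basis" for i
    by (rule is_weak_partial_limit[OF that H1_D(2)[OF xH that] u w[OF that]])
  have uL: "u \<in> L2_on \<Omega>" by (rule closed_sequentially[OF closed_L2_on _ u]) (rule H1_D(1)[OF xH])
  have uH: "u \<in> H1 \<Omega>" by (rule H1_I[OF uL wp])
  have g: "(\<lambda>n. grad_sq (x n - u)) \<longlonglongrightarrow> 0"
  proof -
    have "(\<lambda>n. \<Sum>i\<in>Basis. (norm (weak_partial \<Omega> i (x n) - w i))\<^sup>2) \<longlonglongrightarrow> (\<Sum>i\<in>Basis. (norm (w i - w i))\<^sup>2)"
      by (intro tendsto_sum tendsto_power tendsto_norm tendsto_diff w tendsto_const)
    moreover have "(\<Sum>i\<in>Basis. (norm (weak_partial \<Omega> i (x n) - w i))\<^sup>2) = grad_sq (x n - u)" for n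
      unfolding grad_sq_def
      by (rule sum.cong[OF refl]) (simp add: weak_partial_diff[OF xH uH] weak_partial_eq[OF _ wp])
    ultimately show ?thesis by simp
  qed
  have "(\<lambda>n. (norm (u - x n))\<^sup>2 + grad_sq (u - x n)) \<longlonglongrightarrow> (norm (u - u))\<^sup>2 + 0"
    unfolding grad_sq_minus_commute[OF uH xH] by (intro tendsto_add tendsto_power tendsto_norm tendsto_diff tendsto_const u g)
  then have "u \<in> H1_0 \<Omega>" by (intro H1_0_limit[OF x uH]) simp
  moreover have "(\<lambda>n. diffusion_op \<Omega> b (x n - u) (x n - u)) \<longlonglongrightarrow> 0"
  proof (rule Lim_null_comparison[OF always_eventually[OF allI]])
    show "norm (diffusion_op \<Omega> b (x n - u) (x n - u)) \<le> c1 * grad_sq (x n - u)" for n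
      using diffusion_op_bounds[OF H1_diff[OF xH uH], of n] mult_nonneg_nonneg[OF less_imp_le[OF c0] grad_sq_nonneg, of "x n - u"]
      unfolding real_norm_def by linarith
    show "(\<lambda>n. c1 * grad_sq (x n - u)) \<longlonglongrightarrow> 0" using tendsto_mult[OF tendsto_const g, of c1] by simp
  qed
  ultimately show "\<exists>l\<in>H1_0 \<Omega>. x \<longlonglongrightarrow> l \<and> (\<lambda>n. diffusion_op \<Omega> b (x n - l) (x n - l)) \<longlonglongrightarrow> 0" using u by blast
qed

text \<open>Density of \<open>V\<close> in L2 of the domain. An element minus its orthogonal
  projection onto the closure is orthogonal to all test functions, hence 0 by the fundamental
  lemma.\<close>

lemma closure_H1_0: "closure (H1_0 \<Omega>) = L2_on \<Omega>"
proof
  interpret closed_form "H1_0 \<Omega>" "diffusion_op \<Omega> b" by (rule closed_form_diffusion_op)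
  have "H1_0 \<Omega> \<subseteq> L2_on \<Omega>" using H1_0_subset_H1 H1_D(1) by blast
  then show sub: "closure (H1_0 \<Omega>) \<subseteq> L2_on \<Omega>" by (rule closure_minimal[OF _ closed_L2_on])
  \<comment> \<open>For the zero form on the closed subspace \<open>H\<close>,
    \<open>resolvent_exists\<close> is the projection theorem.\<close>
  interpret P: closed_form H "\<lambda>_ _. 0"
  proof
    show "subspace H" using H_add H_scaleR V_subset_H V_0 by (intro subspaceI) blast+
    show "\<exists>l\<in>H. x \<longlonglongrightarrow> l \<and> (\<lambda>n. 0) \<longlonglongrightarrow> (0 :: real)" if xH: "\<And>n. x n \<in> H" and Cx: "Cauchy x" for x
    proof -
      obtain l where "x \<longlonglongrightarrow> l" using Cx Cauchy_convergent convergent_def by blast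
      moreover from this have "l \<in> H" by (rule closed_sequentially[OF closed_H xH])
      ultimately show ?thesis by blast
    qed
  qed auto
  show "L2_on \<Omega> \<subseteq> closure (H1_0 \<Omega>)"
  proof
    fix h assume h: "h \<in> L2_on \<Omega>"
    obtain p where p: "p \<in> H" "\<And>v. v \<in> H \<Longrightarrow> p \<bullet> v = h \<bullet> v"
      using P.resolvent_exists[of 1 h] by auto
    have "h - p = 0"
    proof (rule L2_on_eq_0I[OF \<Omega>])
      show "h - p \<in> L2_on \<Omega>" using subspace_diff[OF subspace_L2_on h] sub p(1) unfolding H_def by blast
      fix \<phi> assume "\<phi> \<in> test_functions \<Omega>"
      then have "L2_of \<phi> \<in> H" using test_function_H1_0 V_subset_H by blast
      then show "(h - p) \<bullet> L2_of \<phi> = 0" using p(2) by (simp add: inner_diff_left)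
    qed
    then show "h \<in> closure (H1_0 \<Omega>)" using p(1) unfolding H_def by simp
  qed
qed

end

end

subsection \<open>Weak time derivatives\<close>

text \<open>The definitions use the measure restricted to the open interval, the calculus of
  \<open>ac\<close> uses half-open intervals. This and the three lemmas after it translate; the
  difference is the single point \<open>T\<close>.\<close>

lemma AE_lebesgue_on_Ioo_iff:
  "(AE t in lebesgue_on {0<..<T::real}. P t) \<longleftrightarrow> (AE t in lebesgue. t \<in> {0<..T} \<longrightarrow> P t)"
proof -
  have T: "AE t in lebesgue. t \<noteq> T" by (rule AE_completion[OF AE_lborel_singleton])
  have "(AE t in lebesgue_on {0<..<T}. P t) \<longleftrightarrow> (AE t in lebesgue. t \<in> {0<..<T} \<longrightarrow> P t)"
    by (rule AE_restrict_space_iff) simp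
  also have "\<dots> \<longleftrightarrow> (AE t in lebesgue. t \<in> {0<..T} \<longrightarrow> P t)"
  proof
    assume "AE t in lebesgue. t \<in> {0<..<T} \<longrightarrow> P t"
    with T show "AE t in lebesgue. t \<in> {0<..T} \<longrightarrow> P t" by eventually_elim auto
  next
    assume "AE t in lebesgue. t \<in> {0<..T} \<longrightarrow> P t"
    then show "AE t in lebesgue. t \<in> {0<..<T} \<longrightarrow> P t" by eventually_elim auto
  qed
  finally show ?thesis .
qed

lemma integrable_lebesgue_on_Ioo_iff:
  fixes f :: "real \<Rightarrow> 'b::{banach, second_countable_topology}"
  shows "integrable (lebesgue_on {0<..<T}) f \<longleftrightarrow> set_integrable lebesgue {0<..T} f"
proof -
  have "integrable (lebesgue_on {0<..<T}) f \<longleftrightarrow> set_integrable lebesgue {0<..<T} f"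
    unfolding set_integrable_def by (rule integrable_restrict_space) simp
  also have "\<dots> \<longleftrightarrow> set_integrable lebesgue {0<..T} f"
    by (rule set_integrable_discrete_difference[of "{T}"]) auto
  finally show ?thesis .
qed

lemma integral_lebesgue_on_Ioo:
  fixes f :: "real \<Rightarrow> 'b::{banach, second_countable_topology}"
  shows "integral\<^sup>L (lebesgue_on {0<..<T}) f = (LINT t:{0<..T}|lebesgue. f t)"
proof -
  have "integral\<^sup>L (lebesgue_on {0<..<T}) f = (LINT t:{0<..<T}|lebesgue. f t)"
    unfolding set_lebesgue_integral_def by (rule integral_restrict_space) simp
  also have "\<dots> = (LINT t:{0<..T}|lebesgue. f t)"
    by (rule set_integral_discrete_difference[of "{T}"]) auto
  finally show ?thesis .
qed

lemma borel_measurable_lebesgue_on_Ioo_iff: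
  fixes f :: "real \<Rightarrow> 'b::{real_normed_vector, second_countable_topology}"
  shows "f \<in> borel_measurable (lebesgue_on {0<..<T}) \<longleftrightarrow> set_borel_measurable lebesgue {0<..T} f"
proof -
  have r: "f \<in> borel_measurable (lebesgue_on {0<..<T}) \<longleftrightarrow> (\<lambda>t. indicator {0<..<T} t *\<^sub>R f t) \<in> borel_measurable lebesgue"
    by (rule borel_measurable_restrict_space_iff) simp
  show ?thesis unfolding r set_borel_measurable_def
  proof
    assume h: "(\<lambda>t. indicator {0<..<T} t *\<^sub>R f t) \<in> borel_measurable lebesgue"
    \<comment> \<open>The value at \<open>T\<close> is put back by hand; the intersection is empty
      when \<open>T\<close> is not positive.\<close>
    have "(\<lambda>t. indicator {0<..<T} t *\<^sub>R f t + indicator ({T} \<inter> {0<..T}) t *\<^sub>R f T) \<in> borel_measurable lebesgue"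
      by (rule borel_measurable_add[OF h]) (intro borel_measurable_scaleR borel_measurable_indicator borel_measurable_const, auto)
    also have "(\<lambda>t. indicator {0<..<T} t *\<^sub>R f t + indicator ({T} \<inter> {0<..T}) t *\<^sub>R f T) = (\<lambda>t. indicator {0<..T} t *\<^sub>R f t)"
      by (rule ext) (auto simp: indicator_def)
    finally show "(\<lambda>t. indicator {0<..T} t *\<^sub>R f t) \<in> borel_measurable lebesgue" .
  next
    assume h: "(\<lambda>t. indicator {0<..T} t *\<^sub>R f t) \<in> borel_measurable lebesgue"
    have "(\<lambda>t. indicator {0<..<T} t *\<^sub>R (indicator {0<..T} t *\<^sub>R f t)) \<in> borel_measurable lebesgue"
      by (rule borel_measurable_scaleR[OF borel_measurable_indicator h]) auto
    also have "(\<lambda>t. indicator {0<..<T} t *\<^sub>R (indicator {0<..T} t *\<^sub>R f t)) = (\<lambda>t. indicator {0<..<T} t *\<^sub>R f t)"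
      by (rule ext) (auto simp: indicator_def)
    finally show "(\<lambda>t. indicator {0<..<T} t *\<^sub>R f t) \<in> borel_measurable lebesgue" .
  qed
qed

lemma C_k_on_real_has_derivative:
  fixes \<phi> :: "real \<Rightarrow> real"
  assumes "C_k_on 1 \<phi> UNIV"
  shows "(\<phi> has_real_derivative deriv \<phi> t) (at t)" "continuous_on UNIV (deriv \<phi>)"
proof -
  have d: "\<phi> differentiable (at t)" for t using assms by simp
  then show *: "(\<phi> has_real_derivative deriv \<phi> t) (at t)" for t
    by (simp add: DERIV_deriv_iff_real_differentiable)
  have "partial_deriv 1 \<phi> = deriv \<phi>"
    using partial_deriv_eq[OF *[unfolded has_field_derivative_def], of 1] by auto
  then show "continuous_on UNIV (deriv \<phi>)" using assms by simp
qed

text \<open>The product rule for \<open>\<phi> t *\<^sub>R u t\<close>, integrated over the whole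
  interval; \<open>\<phi>\<close> vanishes at both ends.\<close>

lemma weak_time_deriv_of_ac:
  fixes u :: "real \<Rightarrow> 'b::{banach, second_countable_topology}"
  assumes T: "0 < T" and u: "ac T u u'"
  shows "weak_time_deriv T u u'"
  unfolding weak_time_deriv_def integrable_lebesgue_on_Ioo_iff integral_lebesgue_on_Ioo
proof (intro conjI ballI)
  show "set_integrable lebesgue {0<..T} u" by (rule set_integrable_Ioc_continuous[OF ac_continuous_on[OF u]])
  show "set_integrable lebesgue {0<..T} u'" by (rule ac_integrable[OF u])
  fix \<phi> :: "real \<Rightarrow> real" assume \<phi>: "\<phi> \<in> test_functions {0<..<T}"
  note d = C_k_on_real_has_derivative[OF test_functionD(1)[OF \<phi>]]
  have "ac T (\<lambda>t. \<phi> t *\<^sub>R u t) (\<lambda>t. deriv \<phi> t *\<^sub>R u t + \<phi> t *\<^sub>R u' t)"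
    by (rule ac_bilinear[OF bounded_bilinear_scaleR less_imp_le[OF T] ac_C1[OF d] u])
  from ac_eq[OF this, of T]
  have "\<phi> T *\<^sub>R u T = \<phi> 0 *\<^sub>R u 0 + (LINT t:{0<..T}|lebesgue. deriv \<phi> t *\<^sub>R u t + \<phi> t *\<^sub>R u' t)"
    using T by simp
  moreover have "\<phi> T = 0" "\<phi> 0 = 0" using test_functionD(6)[OF \<phi>, of T] test_functionD(6)[OF \<phi>, of 0] by auto
  moreover have "(LINT t:{0<..T}|lebesgue. deriv \<phi> t *\<^sub>R u t + \<phi> t *\<^sub>R u' t)
      = (LINT t:{0<..T}|lebesgue. deriv \<phi> t *\<^sub>R u t) + (LINT t:{0<..T}|lebesgue. \<phi> t *\<^sub>R u' t)"
  proof (rule set_integral_add(2))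
    show "set_integrable lebesgue {0<..T} (\<lambda>t. deriv \<phi> t *\<^sub>R u t)"
      by (rule set_integrable_bilinear[OF bounded_bilinear_scaleR continuous_on_subset[OF d(2)]
            set_integrable_Ioc_continuous[OF ac_continuous_on[OF u]]]) simp
    show "set_integrable lebesgue {0<..T} (\<lambda>t. \<phi> t *\<^sub>R u' t)"
      by (rule set_integrable_bilinear[OF bounded_bilinear_scaleR continuous_on_subset[OF test_functionD(5)[OF \<phi>]]
            ac_integrable[OF u]]) simp
  qed
  ultimately have "(LINT t:{0<..T}|lebesgue. deriv \<phi> t *\<^sub>R u t) + (LINT t:{0<..T}|lebesgue. \<phi> t *\<^sub>R u' t) = 0" by simp
  then show "(LINT t:{0<..T}|lebesgue. deriv \<phi> t *\<^sub>R u t) = - (LINT t:{0<..T}|lebesgue. \<phi> t *\<^sub>R u' t)"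
    by (simp only: eq_neg_iff_add_eq_0)
qed

text \<open>The normalised primitive of a bump supported in \<open>{0..1}\<close>, itself the
  product of two opposite one-sided bumps.\<close>

lemma smooth_step:
  "\<exists>\<rho> \<rho>' :: real \<Rightarrow> real. (\<forall>k. C_k_on k \<rho> UNIV) \<and> (\<forall>x. (\<rho> has_real_derivative \<rho>' x) (at x)) \<and>
    continuous_on UNIV \<rho>' \<and> (\<forall>x. 0 \<le> \<rho>' x) \<and> (\<forall>x. x \<notin> {0..1} \<longrightarrow> \<rho>' x = 0) \<and>
    (\<forall>x\<le>0. \<rho> x = 0) \<and> (\<forall>x\<ge>1. \<rho> x = 1)"
proof -
  define \<beta> where "\<beta> x = bump 0 x * bump 0 (1 + (-1) * (x \<bullet> 1))" for x :: real
  have C\<beta>: "C_k_on k \<beta> UNIV" for k unfolding \<beta>_def by (intro C_k_on_mult C_k_on_bump C_k_on_affine_comp)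
  have c\<beta>: "continuous_on S \<beta>" for S using C\<beta>[of 0] by (auto intro: continuous_on_subset)
  have \<beta>0: "0 \<le> \<beta> x" for x unfolding \<beta>_def by (intro mult_nonneg_nonneg bump_nonneg)
  have \<beta>z: "\<beta> x = 0 \<longleftrightarrow> x \<le> 0 \<or> 1 \<le> x" for x
    unfolding \<beta>_def using bump_pos_iff[of 0 x] bump_pos_iff[of 0 "1 + (-1) * (x \<bullet> 1)"] by auto
  \<comment> \<open>Integrating from -1 instead of 0 makes the origin an interior point of the
    interval, so the two-sided derivative exists there too.\<close>
  define c where "c = integral {-1..1} \<beta>"
  have "c \<noteq> 0"
  proof
    assume "c = 0"
    then have "\<forall>x\<in>{-1..1}. \<beta> x = 0"
      using integral_eq_0_iff[of "-1" 1 \<beta>, OF c\<beta> _ \<beta>0] unfolding c_def by simp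
    then have "\<beta> (1/2) = 0" by simp
    then show False unfolding \<beta>z by simp
  qed
  moreover have "0 \<le> c" unfolding c_def by (rule integral_nonneg[OF integrable_continuous_real[OF c\<beta>]]) (rule \<beta>0)
  ultimately have c: "0 < c" by simp
  have neg: "integral {-1..x} \<beta> = 0" if "x \<le> 0" for x
  proof -
    have "integral {-1..x} \<beta> = integral {-1..x} (\<lambda>_. 0)"
      by (rule Henstock_Kurzweil_Integration.integral_cong) (use that \<beta>z in auto)
    then show ?thesis by simp
  qed
  have pos: "integral {-1..x} \<beta> = c" if "1 \<le> x" for x
  proof -
    have "integral {-1..1} \<beta> + integral {1..x} \<beta> = integral {-1..x} \<beta>"
      by (rule Henstock_Kurzweil_Integration.integral_combine) (use that integrable_continuous_real[OF c\<beta>] in auto)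
    moreover have "integral {1..x} \<beta> = integral {1..x} (\<lambda>_. 0)"
      by (rule Henstock_Kurzweil_Integration.integral_cong) (use \<beta>z in auto)
    ultimately show ?thesis unfolding c_def by simp
  qed
  define \<rho> where "\<rho> x = (1 / c) * integral {-1..x} \<beta>" for x
  define \<rho>' where "\<rho>' x = (1 / c) * \<beta> x" for x
  have d: "(\<rho> has_real_derivative \<rho>' x) (at x)" for x
  proof (cases "x < 0")
    case True
    have "((\<lambda>x. 0) has_real_derivative \<rho>' x) (at x)" using \<beta>z[of x] True by (simp add: \<rho>'_def)
    then show ?thesis
      by (rule has_field_derivative_transform_within_open[of _ _ _ "{..<0}"]) (use True neg in \<open>auto simp: \<rho>_def\<close>)
  next
    case False
    have "((\<lambda>x. integral {-1..x} \<beta>) has_real_derivative \<beta> x) (at x within {-1..x+1})"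
      by (rule integral_has_real_derivative[OF c\<beta>]) (use False in auto)
    moreover have "at x within {-1..x+1} = at x" by (rule at_within_interior) (use False in auto)
    ultimately have "((\<lambda>x. integral {-1..x} \<beta>) has_real_derivative \<beta> x) (at x)" by simp
    then show ?thesis unfolding \<rho>_def[abs_def] \<rho>'_def by (rule DERIV_cmult)
  qed
  have C\<rho>': "C_k_on k \<rho>' UNIV" for k unfolding \<rho>'_def by (intro C_k_on_mult C_k_on_const C\<beta>)
  show ?thesis
  proof (rule exI[of _ \<rho>], rule exI[of _ \<rho>'], intro conjI allI impI)
    show "C_k_on k \<rho> UNIV" for k by (rule C_k_on_pred[OF C_k_on_real_SucI[OF d C\<rho>']])
    show "continuous_on UNIV \<rho>'" using C\<rho>'[of 0] by simp
    show "0 \<le> \<rho>' x" for x unfolding \<rho>'_def using c \<beta>0[of x] by simp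
    show "\<rho>' x = 0" if "x \<notin> {0..1}" for x unfolding \<rho>'_def using that \<beta>z[of x] by auto
    show "\<rho> x = 0" if "x \<le> 0" for x unfolding \<rho>_def neg[OF that] by simp
    show "\<rho> x = 1" if "1 \<le> x" for x unfolding \<rho>_def pos[OF that] using c by simp
  qed (rule d)
qed

text \<open>
  The test functions used are differences of smoothed Heaviside functions; their derivatives
  approximate a difference of two Dirac measures.
\<close>

lemma du_Bois_Reymond:
  fixes g :: "real \<Rightarrow> 'b::{banach, second_countable_topology}"
  assumes T: "0 < T" and g: "continuous_on {0..T} g"
    and zero: "\<And>\<phi>. \<phi> \<in> test_functions {0<..<T} \<Longrightarrow> (LINT t:{0<..T}|lebesgue. deriv \<phi> t *\<^sub>R g t) = 0"
    and t: "t \<in> {0..T}"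
  shows "g t = g 0"
proof -
  obtain \<rho> \<rho>' :: "real \<Rightarrow> real" where \<rho>: "\<And>k. C_k_on k \<rho> UNIV" "\<And>x. (\<rho> has_real_derivative \<rho>' x) (at x)"
    "continuous_on UNIV \<rho>'" "\<And>x. 0 \<le> \<rho>' x" "\<And>x. x \<notin> {0..1} \<Longrightarrow> \<rho>' x = 0" "\<And>x. x \<le> 0 \<Longrightarrow> \<rho> x = 0" "\<And>x. 1 \<le> x \<Longrightarrow> \<rho> x = 1"
    using smooth_step by metis
  define N where "N n = real (Suc n)" for n
  have N0: "0 < N n" for n unfolding N_def by simp
  \<comment> \<open>A step rising from 0 to 1 on \<open>{p..p + 1 / N n}\<close>. Its derivative
    \<open>h n p\<close> is a nonnegative kernel of mass 1 concentrated there.\<close>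
  define H where "H n p x = \<rho> (- N n * p + N n * (x \<bullet> 1))" for n and p x :: real
  define h where "h n p x = N n * \<rho>' (- N n * p + N n * x)" for n p x
  have dH: "(H n p has_real_derivative h n p x) (at x)" for n p x
    unfolding H_def h_def
    by (rule DERIV_cong[OF DERIV_chain2[OF \<rho>(2), where g = "\<lambda>x. - N n * p + N n * (x \<bullet> 1)" and Db = "N n"]])
      (auto intro!: derivative_eq_intros)
  have ch: "continuous_on S (h n p)" for S n p
    unfolding h_def by (intro continuous_intros continuous_on_compose2[OF \<rho>(3)]) auto
  have near: "norm ((LINT x:{0<..T}|lebesgue. h n p x *\<^sub>R g x) - g p) \<le> \<delta>"
    if p: "0 < p" "p + 1 / N n < T" and \<delta>: "\<And>x. x \<in> {p..p + 1 / N n} \<Longrightarrow> norm (g x - g p) \<le> \<delta>" for n p \<delta>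
  proof -
    have pT: "1 \<le> N n * (T - p)" using p(2) N0[of n] by (simp add: field_simps)
    have "H n p T = 1" unfolding H_def by (rule \<rho>(7)) (use pT in \<open>simp add: algebra_simps\<close>)
    moreover have "H n p 0 = 0" unfolding H_def by (rule \<rho>(6)) (use p(1) N0[of n] in simp)
    ultimately have one: "(LINT x:{0<..T}|lebesgue. h n p x) = 1"
      using ac_eq[OF ac_C1[OF dH ch], of T T n p] T by simp
    have ih: "set_integrable lebesgue {0<..T} (h n p)" by (rule set_integrable_Ioc_continuous[OF ch])
    have i1: "set_integrable lebesgue {0<..T} (\<lambda>x. h n p x *\<^sub>R g x)"
      by (intro set_integrable_Ioc_continuous continuous_on_scaleR ch g)
    have i2: "set_integrable lebesgue {0<..T} (\<lambda>x. h n p x *\<^sub>R g p)"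
      by (intro set_integrable_Ioc_continuous continuous_on_scaleR ch continuous_on_const)
    have "(LINT x:{0<..T}|lebesgue. h n p x *\<^sub>R g p) = g p"
      using set_integral_bounded_linear(2)[OF bounded_linear_scaleR_left ih, of "g p"] unfolding one by simp
    then have "(LINT x:{0<..T}|lebesgue. h n p x *\<^sub>R g x) - g p = (LINT x:{0<..T}|lebesgue. h n p x *\<^sub>R g x - h n p x *\<^sub>R g p)"
      using set_integral_diff(2)[OF i1 i2] by simp
    also have "norm \<dots> \<le> (LINT x:{0<..T}|lebesgue. \<delta> * h n p x)"
    proof (rule set_integral_norm_le[OF set_integral_diff(1)[OF i1 i2] set_integrable_mult_right[OF ih]])
      fix x
      have h0: "0 \<le> h n p x" unfolding h_def using \<rho>(4) N0[of n] by (simp add: less_imp_le)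
      show "norm (h n p x *\<^sub>R g x - h n p x *\<^sub>R g p) \<le> \<delta> * h n p x"
      proof (cases "x \<in> {p..p + 1 / N n}")
        case True
        have "norm (h n p x *\<^sub>R g x - h n p x *\<^sub>R g p) = h n p x * norm (g x - g p)"
          using h0 by (simp add: scaleR_diff_right[symmetric])
        also have "\<dots> \<le> h n p x * \<delta>" by (rule mult_left_mono[OF \<delta>[OF True] h0])
        finally show ?thesis by (simp add: mult.commute)
      next
        case False
        have "- N n * p + N n * x \<notin> {0..1}"
        proof
          assume "- N n * p + N n * x \<in> {0..1}"
          then have "0 \<le> N n * (x - p)" "N n * (x - p) \<le> 1" by (auto simp: algebra_simps)
          then have "x \<in> {p..p + 1 / N n}" using N0[of n] by (auto simp: zero_le_mult_iff field_simps)
          then show False using False by blast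
        qed
        then have "h n p x = 0" unfolding h_def using \<rho>(5) by simp
        then show ?thesis by simp
      qed
    qed
    also have "\<dots> = \<delta>" unfolding set_integral_mult_right one by simp
    finally show ?thesis .
  qed
  have const: "g s = g r" if sr: "0 < s" "s < r" "r < T" for s r
  proof -
    have le: "norm (g s - g r) \<le> e" if e: "e > 0" for e
    proof -
      have cont: "\<exists>d>0. \<forall>x\<in>{0..T}. dist x p < d \<longrightarrow> dist (g x) (g p) < e / 2" if "p \<in> {0..T}" for p
        using g[unfolded continuous_on_iff, THEN bspec, OF that, THEN spec, of "e / 2"] e by simp
      obtain d1 where d1: "d1 > 0" "\<And>x. x \<in> {0..T} \<Longrightarrow> dist x s < d1 \<Longrightarrow> dist (g x) (g s) < e / 2"
        using cont[of s] sr by auto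
      obtain d2 where d2: "d2 > 0" "\<And>x. x \<in> {0..T} \<Longrightarrow> dist x r < d2 \<Longrightarrow> dist (g x) (g r) < e / 2"
        using cont[of r] sr by auto
      have "0 < min (min d1 d2) (T - r)" using d1(1) d2(1) sr by simp
      then obtain n where n: "inverse (real (Suc n)) < min (min d1 d2) (T - r)" using reals_Archimedean by blast
      then have n: "1 / N n < d1" "1 / N n < d2" "r + 1 / N n < T" unfolding N_def by (auto simp: inverse_eq_divide)
      have Ni: "0 < 1 / N n" using N0[of n] by simp
      have 1: "norm ((LINT x:{0<..T}|lebesgue. h n s x *\<^sub>R g x) - g s) \<le> e / 2"
      proof (rule near)
        fix x assume "x \<in> {s..s + 1 / N n}"
        then have "x \<in> {0..T}" "dist x s < d1" using sr n by (auto simp: dist_real_def)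
        then show "norm (g x - g s) \<le> e / 2" using d1(2) by (simp add: dist_norm less_imp_le)
      qed (use sr n in auto)
      have 2: "norm ((LINT x:{0<..T}|lebesgue. h n r x *\<^sub>R g x) - g r) \<le> e / 2"
      proof (rule near)
        fix x assume "x \<in> {r..r + 1 / N n}"
        then have "x \<in> {0..T}" "dist x r < d2" using sr n by (auto simp: dist_real_def)
        then show "norm (g x - g r) \<le> e / 2" using d2(2) by (simp add: dist_norm less_imp_le)
      qed (use sr n in auto)
      \<comment> \<open>Both steps equal 1 to the right of \<open>r + 1 / N n\<close> and cancel, so
        the support is compact inside the open interval.\<close>
      define \<phi> where "\<phi> x = H n s x + (-1) * H n r x" for x
      have "\<phi> \<in> test_functions {0<..<T}"
      proof -
        have "\<phi> x = 0" if "x \<notin> {s..r + 1 / N n}" for x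
        proof (cases "x < s")
          case True
          have "H n p x = 0" if "s \<le> p" for p
          proof -
            have "N n * (x - p) \<le> 0" using True that N0[of n] by (simp add: mult_le_0_iff)
            then show ?thesis unfolding H_def by (intro \<rho>(6)) (simp add: algebra_simps)
          qed
          then show ?thesis unfolding \<phi>_def using sr by simp
        next
          case False
          then have x: "r + 1 / N n < x" using that by simp
          have "H n p x = 1" if "p \<le> r" for p
          proof -
            have "1 / N n \<le> x - p" using x that by simp
            then have "1 \<le> N n * (x - p)" using N0[of n] by (simp add: field_simps)
            then show ?thesis unfolding H_def by (intro \<rho>(7)) (simp add: algebra_simps)
          qed
          then show ?thesis unfolding \<phi>_def using sr by simp
        qed
        then have "{x. \<phi> x \<noteq> 0} \<subseteq> {s..r + 1 / N n}" by blast
        then have sub: "closure {x. \<phi> x \<noteq> 0} \<subseteq> {s..r + 1 / N n}" by (rule closure_minimal) simp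
        then have "compact (closure {x. \<phi> x \<noteq> 0})"
          by (meson bounded_closed_interval bounded_subset closed_closure compact_eq_bounded_closed)
        moreover have "C_k_on k \<phi> UNIV" for k
          unfolding \<phi>_def H_def by (intro C_k_on_add C_k_on_mult C_k_on_const C_k_on_affine_comp \<rho>(1))
        moreover have "{s..r + 1 / N n} \<subseteq> {0<..<T}" using sr n by auto
        ultimately show ?thesis using sub unfolding test_functions_def by blast
      qed
      moreover have "deriv \<phi> = (\<lambda>x. h n s x - h n r x)"
      proof
        fix x
        have "(\<phi> has_real_derivative h n s x + (-1) * h n r x) (at x)"
          unfolding \<phi>_def by (intro DERIV_add DERIV_cmult dH)
        from DERIV_imp_deriv[OF this] show "deriv \<phi> x = h n s x - h n r x" by simp
      qed
      ultimately have "(LINT x:{0<..T}|lebesgue. (h n s x - h n r x) *\<^sub>R g x) = 0" using zero[of \<phi>] by simp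
      moreover have "(LINT x:{0<..T}|lebesgue. (h n s x - h n r x) *\<^sub>R g x)
          = (LINT x:{0<..T}|lebesgue. h n s x *\<^sub>R g x) - (LINT x:{0<..T}|lebesgue. h n r x *\<^sub>R g x)"
        unfolding scaleR_diff_left
        by (intro set_integral_diff(2) set_integrable_Ioc_continuous continuous_on_scaleR ch g)
      ultimately have "g s - g r = ((LINT x:{0<..T}|lebesgue. h n r x *\<^sub>R g x) - g r) - ((LINT x:{0<..T}|lebesgue. h n s x *\<^sub>R g x) - g s)"
        by simp
      then have "norm (g s - g r) \<le> norm ((LINT x:{0<..T}|lebesgue. h n r x *\<^sub>R g x) - g r) + norm ((LINT x:{0<..T}|lebesgue. h n s x *\<^sub>R g x) - g s)"
        by (simp only: norm_triangle_ineq4)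
      then show ?thesis using 1 2 by linarith
    qed
    have "norm (g s - g r) \<le> 0" using le[of "norm (g s - g r) / 2"] norm_ge_zero[of "g s - g r"] by argo
    then show ?thesis by simp
  qed
  \<comment> \<open>Interior points are compared with the midpoint; the endpoints, which test
    functions do not see, follow by continuity.\<close>
  have c: "g s = g (T / 2)" if "s \<in> {0<..<T}" for s
  proof (cases s "T / 2" rule: linorder_cases)
    case less
    show ?thesis by (rule const) (use less that T in auto)
  next
    case greater
    show ?thesis by (rule const[symmetric]) (use greater that T in auto)
  next
    case equal
    then show ?thesis by (rule arg_cong)
  qed
  have cl: "closure {0<..<T} = {0..T}" using T by simp
  have cgc: "continuous_on (closure {0<..<T}) g" unfolding cl by (rule g)
  have all: "g s = g (T / 2)" if "s \<in> {0..T}" for s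
    by (rule continuous_constant_on_closure[OF cgc c]) (simp_all only: cl that)
  show ?thesis using all[OF t] all[of 0] T by simp
qed

text \<open>\<open>v\<close> minus the primitive of \<open>w\<close> is continuous with vanishing
  weak derivative and value 0 at time 0, so it is 0 by \<open>du_Bois_Reymond\<close>.\<close>

lemma ac_of_weak_time_deriv:
  fixes u v w :: "real \<Rightarrow> 'b::{banach, second_countable_topology}"
  assumes T: "0 < T" and u: "weak_time_deriv T u w" and v: "continuous_on {0..T} v"
    and vu: "AE t in lebesgue_on {0<..<T}. v t = u t"
  shows "ac T v w"
proof -
  note u' = u[unfolded weak_time_deriv_def integrable_lebesgue_on_Ioo_iff integral_lebesgue_on_Ioo]
  define W where "W t = v 0 + (LINT r:{0<..t}|lebesgue. w r)" for t
  have W: "ac T W w" unfolding W_def by (rule ac_primitive) (use u' in blast)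
  note W' = weak_time_deriv_of_ac[OF T W, unfolded weak_time_deriv_def integrable_lebesgue_on_Ioo_iff integral_lebesgue_on_Ioo]
  define g where "g t = v t - W t" for t
  have cg: "continuous_on {0..T} g" unfolding g_def by (intro continuous_on_diff v ac_continuous_on[OF W])
  have "g t = g 0" if "t \<in> {0..T}" for t
  proof (rule du_Bois_Reymond[OF T cg _ that])
    fix \<phi> :: "real \<Rightarrow> real" assume \<phi>: "\<phi> \<in> test_functions {0<..<T}"
    note d = C_k_on_real_has_derivative[OF test_functionD(1)[OF \<phi>]]
    have i: "set_integrable lebesgue {0<..T} (\<lambda>t. deriv \<phi> t *\<^sub>R x t)" if "set_integrable lebesgue {0<..T} x" for x :: "real \<Rightarrow> 'b"
      by (rule set_integrable_bilinear[OF bounded_bilinear_scaleR continuous_on_subset[OF d(2)] that]) simp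
    have iv: "set_integrable lebesgue {0<..T} v" by (rule set_integrable_Ioc_continuous[OF v])
    have iW: "set_integrable lebesgue {0<..T} W" by (rule set_integrable_Ioc_continuous[OF ac_continuous_on[OF W]])
    have "(LINT t:{0<..T}|lebesgue. deriv \<phi> t *\<^sub>R v t) = (LINT t:{0<..T}|lebesgue. deriv \<phi> t *\<^sub>R u t)"
      unfolding set_lebesgue_integral_def
    proof (rule integral_cong_AE)
      show "AE t in lebesgue. indicator {0<..T} t *\<^sub>R (deriv \<phi> t *\<^sub>R v t) = indicator {0<..T} t *\<^sub>R (deriv \<phi> t *\<^sub>R u t)"
        using vu unfolding AE_lebesgue_on_Ioo_iff by eventually_elim (simp add: indicator_def)
      show "(\<lambda>t. indicator {0<..T} t *\<^sub>R (deriv \<phi> t *\<^sub>R v t)) \<in> borel_measurable lebesgue"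
        using i[OF iv] unfolding set_integrable_def by (rule borel_measurable_integrable)
      show "(\<lambda>t. indicator {0<..T} t *\<^sub>R (deriv \<phi> t *\<^sub>R u t)) \<in> borel_measurable lebesgue"
        using i[OF conjunct1[OF u']] unfolding set_integrable_def by (rule borel_measurable_integrable)
    qed
    also have "\<dots> = - (LINT t:{0<..T}|lebesgue. \<phi> t *\<^sub>R w t)" using u' \<phi> by blast
    also have "\<dots> = (LINT t:{0<..T}|lebesgue. deriv \<phi> t *\<^sub>R W t)" using W' \<phi> by metis
    finally show "(LINT t:{0<..T}|lebesgue. deriv \<phi> t *\<^sub>R g t) = 0"
      unfolding g_def scaleR_diff_right set_integral_diff(2)[OF i[OF iv] i[OF iW]] by simp
  qed
  moreover have "g 0 = 0" unfolding g_def W_def by (simp add: set_lebesgue_integral_def)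
  ultimately have vW: "v t = W t" if "t \<in> {0..T}" for t using that unfolding g_def by (metis eq_iff_diff_eq_0)
  show ?thesis unfolding ac_iff
  proof (intro conjI ballI)
    show "set_integrable lebesgue {0<..T} w" by (rule ac_integrable[OF W])
    fix t assume "t \<in> {0..T}"
    then show "v t = v 0 + (LINT r:{0<..t}|lebesgue. w r)" using vW unfolding W_def by blast
  qed
qed

lemma C0_time_norm_continuous_on:
  "C0_time T X norm v \<Longrightarrow> continuous_on {0..T} (v :: real \<Rightarrow> 'b::real_normed_vector)"
  unfolding C0_time_def continuous_on_def by (blast intro: LIM_zero_cancel tendsto_norm_zero_cancel)

section \<open>Translation between the Bochner formulation and strong solutions\<close>

context closed_form
begin

abbreviation norm_D :: "'h \<Rightarrow> real" where "norm_D v \<equiv> norm (A v)"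

text \<open>Measurability yields simple functions with values in the whole type. Applying
  \<open>Jn k\<close> to the k-th one moves the values into \<open>H\<close>; being a contraction,
  it does not spoil convergence, and \<open>Jn k (w t)\<close> tends to \<open>w t\<close>.\<close>

lemma L2_time_H:
  assumes w: "sqi T w" and H: "AE t in lebesgue. t \<in> {0<..T} \<longrightarrow> w t \<in> H"
  shows "\<exists>s. (\<forall>k. simple_function (lebesgue_on {0<..<T}) (s k) \<and> s k ` {0<..<T} \<subseteq> H) \<and>
      (AE t in lebesgue_on {0<..<T}. w t \<in> H \<and> (\<lambda>k. s k t) \<longlonglongrightarrow> w t)" (is ?ex)
    and "L2_time T H norm w"
proof -
  have m: "w \<in> borel_measurable (lebesgue_on {0<..<T})"
    unfolding borel_measurable_lebesgue_on_Ioo_iff by (rule sqi_measurable[OF w])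
  obtain s where s: "\<And>k. simple_function (lebesgue_on {0<..<T}) (s k)"
    "\<And>t. t \<in> space (lebesgue_on {0<..<T}) \<Longrightarrow> (\<lambda>k. s k t) \<longlonglongrightarrow> w t"
    using borel_measurable_implies_sequence_metric[OF m, of 0] by blast
  define s' where "s' k = Jn k \<circ> s k" for k
  have lim: "(\<lambda>k. s' k t) \<longlonglongrightarrow> w t" if t: "t \<in> {0<..<T}" and wH: "w t \<in> H" for t
  proof -
    have "(\<lambda>k. s k t) \<longlonglongrightarrow> w t" by (rule s(2)) (use t in simp)
    then have z: "(\<lambda>k. norm (s k t - w t)) \<longlonglongrightarrow> 0" by (simp add: LIM_zero tendsto_norm_zero)
    have "(\<lambda>k. Jn k (s k t - w t)) \<longlonglongrightarrow> 0"
      by (rule Lim_null_comparison[OF always_eventually[OF allI] z]) (rule norm_J_le[OF eps_pos])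
    then have "(\<lambda>k. Jn k (s k t - w t) + Jn k (w t)) \<longlonglongrightarrow> 0 + w t" by (intro tendsto_add Jn_tendsto wH)
    moreover have "Jn k (s k t - w t) + Jn k (w t) = s' k t" for k unfolding s'_def J_diff[OF eps_pos] by simp
    ultimately show ?thesis by simp
  qed
  have AEH: "AE t in lebesgue_on {0<..<T}. t \<in> {0<..<T} \<and> w t \<in> H"
    unfolding AE_lebesgue_on_Ioo_iff
    using H AE_completion[OF AE_lborel_singleton, of T] by eventually_elim auto
  then have A: "AE t in lebesgue_on {0<..<T}. w t \<in> H \<and> (\<lambda>k. s' k t) \<longlonglongrightarrow> w t"
    by eventually_elim (use lim in blast)
  have S: "simple_function (lebesgue_on {0<..<T}) (s' k) \<and> s' k ` {0<..<T} \<subseteq> H" for k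
    unfolding s'_def using s(1) J_in_H[OF eps_pos] by auto
  show ?ex using A S by blast
  have "AE t in lebesgue_on {0<..<T}. w t \<in> H \<and> (\<lambda>k. norm (s' k t - w t)) \<longlonglongrightarrow> 0"
    using A by eventually_elim (simp add: LIM_zero tendsto_norm_zero)
  then show "L2_time T H norm w"
    unfolding L2_time_def integrable_lebesgue_on_Ioo_iff using S sqi_norm[OF w] by blast
qed

text \<open>Strong measurability in the norm of the domain: approximate \<open>u + A u\<close> in
  \<open>H\<close> by simple functions and apply \<open>J 1\<close>, which returns \<open>u\<close>
  in the limit. The operator composed with \<open>J 1\<close> is \<open>Y 1\<close>, hence
  continuous.\<close>

lemma L2_time_dom:
  assumes u: "sqi T u" and y: "sqi T y" and d: "AE t in lebesgue. t \<in> {0<..T} \<longrightarrow> u t \<in> dom \<and> A (u t) = y t"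
  shows "L2_time T dom norm_D u"
proof -
  have uy: "AE t in lebesgue. t \<in> {0<..T} \<longrightarrow> u t + y t \<in> H"
    using d
  proof eventually_elim
    case (elim t)
    then show ?case using H_add V_subset_H domD(1,2)[of "u t"] by (metis subsetD)
  qed
  obtain s where s: "\<And>k. simple_function (lebesgue_on {0<..<T}) (s k)" "\<And>k. s k ` {0<..<T} \<subseteq> H"
    "AE t in lebesgue_on {0<..<T}. u t + y t \<in> H \<and> (\<lambda>k. s k t) \<longlonglongrightarrow> u t + y t"
    using L2_time_H(1)[OF sqi_add[OF u y] uy] by blast
  define s' where "s' k = J 1 \<circ> s k" for k
  have S: "simple_function (lebesgue_on {0<..<T}) (s' k) \<and> s' k ` {0<..<T} \<subseteq> dom" for k
    unfolding s'_def using s(1,2) J_in_dom[of 1] by auto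
  have AEd: "AE t in lebesgue_on {0<..<T}. t \<in> {0<..<T} \<and> u t \<in> dom \<and> A (u t) = y t"
    unfolding AE_lebesgue_on_Ioo_iff
    using d AE_completion[OF AE_lborel_singleton, of T] by eventually_elim auto
  have "AE t in lebesgue_on {0<..<T}. u t \<in> dom \<and> (\<lambda>k. norm_D (s' k t - u t)) \<longlonglongrightarrow> 0"
    using s(3) AEd
  proof eventually_elim
    case (elim t)
    then have ud: "u t \<in> dom" "A (u t) = y t" and lim: "(\<lambda>k. s k t) \<longlonglongrightarrow> u t + y t" and t: "t \<in> {0<..<T}" by blast+
    have sH: "s k t \<in> H" for k using s(2) t by blast
    have "A (s' k t - u t) = (s k t - J 1 (s k t)) - y t" for k
    proof -
      have "A (s' k t - u t) = A (J 1 (s k t)) - A (u t)"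
        unfolding s'_def comp_def by (rule A_diff[OF J_in_dom[OF zero_less_one sH] ud(1)])
      also have "A (J 1 (s k t)) = Y 1 (s k t)" by (rule A_J[OF zero_less_one sH])
      finally show ?thesis unfolding ud(2) by (simp add: Y_def)
    qed
    moreover have "(\<lambda>k. norm ((s k t - J 1 (s k t)) - y t)) \<longlonglongrightarrow> norm (((u t + y t) - J 1 (u t + y t)) - y t)"
      by (intro tendsto_norm tendsto_diff lim tendsto_const bounded_linear.tendsto[OF bounded_linear_J[OF zero_less_one]])
    moreover have "J 1 (u t + y t) = u t" using J_A[OF ud(1)] unfolding ud(2) .
    ultimately show ?case using ud(1) by simp
  qed
  moreover have "set_integrable lebesgue {0<..T} (\<lambda>t. (norm_D (u t))\<^sup>2)"
  proof -
    have i: "integrable lebesgue (\<lambda>t. indicator {0<..T} t *\<^sub>R (norm (y t))\<^sup>2)"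
      using sqi_norm[OF y] unfolding set_integrable_def .
    have ae: "AE t in lebesgue. indicator {0<..T} t *\<^sub>R (norm (y t))\<^sup>2 = indicator {0<..T} t *\<^sub>R (norm_D (u t))\<^sup>2"
      using d by eventually_elim (auto simp: indicator_def)
    show ?thesis unfolding set_integrable_def
      by (rule integrable_cong_AE_imp[OF i borel_measurable_AE[OF borel_measurable_integrable[OF i] ae] ae])
  qed
  ultimately show ?thesis unfolding L2_time_def integrable_lebesgue_on_Ioo_iff using S by blast
qed

text \<open>\<open>A\<close> is isometric from \<open>norm_D\<close> to the norm, so the images of
  the simple functions converge almost everywhere; their limit is a measurable version of
  \<open>A u\<close>.\<close>

lemma L2_time_domD:
  assumes u: "L2_time T dom norm_D u"
  shows "\<exists>y. sqi T y \<and> (AE t in lebesgue. t \<in> {0<..T} \<longrightarrow> u t \<in> dom \<and> A (u t) = y t)"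
proof -
  let ?M = "lebesgue_on {0<..<T}"
  obtain s where s: "\<And>k. simple_function ?M (s k)" "\<And>k. s k ` {0<..<T} \<subseteq> dom"
    "AE t in ?M. u t \<in> dom \<and> (\<lambda>k. norm_D (s k t - u t)) \<longlonglongrightarrow> 0" "integrable ?M (\<lambda>t. (norm_D (u t))\<^sup>2)"
    using u unfolding L2_time_def by blast
  define y where "y t = lim (\<lambda>k. A (s k t))" for t
  have "(\<lambda>t. A (s k t)) \<in> borel_measurable ?M" for k
    using borel_measurable_simple_function[OF simple_function_compose[OF s(1), of A k]] unfolding comp_def .
  then have ym: "y \<in> borel_measurable ?M" unfolding y_def by (rule borel_measurable_lim_metric)
  have AEd: "AE t in ?M. t \<in> {0<..<T} \<and> u t \<in> dom \<and> (\<lambda>k. norm_D (s k t - u t)) \<longlonglongrightarrow> 0"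
    using s(3) unfolding AE_lebesgue_on_Ioo_iff
    using AE_completion[OF AE_lborel_singleton, of T] by eventually_elim auto
  then have eq: "AE t in ?M. u t \<in> dom \<and> A (u t) = y t"
  proof eventually_elim
    case (elim t)
    then have ud: "u t \<in> dom" and sd: "s k t \<in> dom" for k using s(2) by blast+
    have "(\<lambda>k. norm (A (s k t) - A (u t))) \<longlonglongrightarrow> 0" using elim unfolding A_diff[OF sd ud] by blast
    then have "(\<lambda>k. A (s k t)) \<longlonglongrightarrow> A (u t)"
      by (rule LIM_zero_cancel[OF tendsto_norm_zero_cancel])
    then have "y t = A (u t)" unfolding y_def by (rule limI)
    with ud show ?case by (intro conjI sym[of "y t"])
  qed
  have "integrable ?M (\<lambda>t. (norm (y t))\<^sup>2)"
  proof (rule integrable_cong_AE_imp[OF s(4)])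
    show "(\<lambda>t. (norm (y t))\<^sup>2) \<in> borel_measurable ?M" using ym by measurable
    show "AE t in ?M. (norm_D (u t))\<^sup>2 = (norm (y t))\<^sup>2"
      using eq
    proof eventually_elim
      case (elim t)
      then have "A (u t) = y t" by blast
      then show ?case by (rule arg_cong)
    qed
  qed
  then have "sqi T y"
    using ym unfolding sqi_def integrable_lebesgue_on_Ioo_iff borel_measurable_lebesgue_on_Ioo_iff by (intro conjI)
  with eq[unfolded AE_lebesgue_on_Ioo_iff] show ?thesis by (intro exI[of _ y] conjI)
qed

text \<open>Moves the equation from the a.e. class of \<open>u\<close> to its continuous
  representative \<open>v\<close>, which becomes an honest primitive of \<open>u'\<close>.\<close>

lemma strong_solution_of_weak:
  assumes T: "0 < T" and u: "L2_time T dom norm_D u" and u': "weak_time_deriv T u u'" "L2_time T H norm u'"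
    and eq: "AE t in lebesgue_on {0<..<T}. u' t + A (u t) = F (u t)"
    and v: "C0_time T X norm v" "AE t in lebesgue_on {0<..<T}. v t = u t"
  shows "\<exists>y. strong_solution T F v u' y"
proof -
  obtain y where y: "sqi T y" "AE t in lebesgue. t \<in> {0<..T} \<longrightarrow> u t \<in> dom \<and> A (u t) = y t"
    using L2_time_domD[OF u] by blast
  have "ac T v u'" by (rule ac_of_weak_time_deriv[OF T u'(1) C0_time_norm_continuous_on[OF v(1)] v(2)])
  moreover have "sqi T u'"
    unfolding sqi_def
  proof
    show "set_borel_measurable lebesgue {0<..T} u'"
      using u'(1) unfolding weak_time_deriv_def integrable_lebesgue_on_Ioo_iff
      by (intro set_integrable_imp_set_borel_measurable) blast
    show "set_integrable lebesgue {0<..T} (\<lambda>t. (norm (u' t))\<^sup>2)"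
      using u'(2) unfolding L2_time_def integrable_lebesgue_on_Ioo_iff by blast
  qed
  moreover have "AE t in lebesgue. t \<in> {0<..T} \<longrightarrow> v t \<in> dom \<and> A (v t) = y t \<and> u' t = F (v t) - y t"
    using y(2) eq[unfolded AE_lebesgue_on_Ioo_iff] v(2)[unfolded AE_lebesgue_on_Ioo_iff]
    by eventually_elim (metis add_diff_cancel_right')
  ultimately show ?thesis using y(1) unfolding strong_solution_def by blast
qed

lemma strong_solution_imp_weak:
  assumes T: "0 < T" and F: "F ` H \<subseteq> H" and u: "strong_solution T F u u' y" and u0: "u 0 \<in> V"
  shows "L2_time T dom norm_D u" "weak_time_deriv T u u'" "L2_time T H norm u'"
    "AE t in lebesgue_on {0<..<T}. u' t + A (u t) = F (u t)"
    and "\<And>t. t \<in> {0..T} \<Longrightarrow> u t \<in> V"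
    and "\<And>t. t \<in> {0..T} \<Longrightarrow> ((\<lambda>s. norm (u s - u t)) \<longlongrightarrow> 0) (at t within {0..T})"
    and "\<And>t. t \<in> {0..T} \<Longrightarrow> ((\<lambda>s. a (u s - u t) (u s - u t)) \<longlongrightarrow> 0) (at t within {0..T})"
proof -
  have ac: "ac T u u'" and su': "sqi T u'" and sy: "sqi T y"
    and eq: "AE t in lebesgue. t \<in> {0<..T} \<longrightarrow> u t \<in> dom \<and> A (u t) = y t \<and> u' t = F (u t) - y t"
    using u unfolding strong_solution_def by blast+
  note cu = ac_continuous_on[OF ac]
  have eqd: "AE t in lebesgue. t \<in> {0<..T} \<longrightarrow> u t \<in> dom \<and> A (u t) = y t"
    using eq by eventually_elim blast
  have eqH: "AE t in lebesgue. t \<in> {0<..T} \<longrightarrow> u t \<in> dom \<and> A (u t) = y t \<and> u' t \<in> H"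
    using eq
  proof eventually_elim
    case (elim t)
    show ?case
    proof
      assume "t \<in> {0<..T}"
      then have *: "u t \<in> dom" "A (u t) = y t" "u' t = F (u t) - y t" using elim by blast+
      have "u t \<in> H" "y t \<in> H" using domD(1,2)[OF *(1)] V_subset_H unfolding *(2) by blast+
      then have "u' t \<in> H" unfolding *(3) using F by (intro H_diff) blast+
      with * show "u t \<in> dom \<and> A (u t) = y t \<and> u' t \<in> H" by blast
    qed
  qed
  have eqH': "AE t in lebesgue. t \<in> {0<..T} \<longrightarrow> u' t \<in> H" using eqH by eventually_elim blast
  show "L2_time T dom norm_D u" by (rule L2_time_dom[OF sqi_continuous[OF cu] sy eqd])
  show "weak_time_deriv T u u'" by (rule weak_time_deriv_of_ac[OF T ac])
  show "L2_time T H norm u'" by (rule L2_time_H(2)[OF su' eqH'])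
  show "AE t in lebesgue_on {0<..<T}. u' t + A (u t) = F (u t)"
    unfolding AE_lebesgue_on_Ioo_iff using eq by eventually_elim simp
  note reg = less_imp_le[OF T] ac su' sy eqH u0
  fix t assume t: "t \<in> {0..T}"
  show "u t \<in> V" by (rule path_in_V[OF reg t])
  show "((\<lambda>s. a (u s - u t) (u s - u t)) \<longlongrightarrow> 0) (at t within {0..T})" by (rule path_V_continuous[OF reg t])
  show "((\<lambda>s. norm (u s - u t)) \<longlongrightarrow> 0) (at t within {0..T})"
    using cu t unfolding continuous_on_def by (intro tendsto_norm_zero[OF LIM_zero]) blast
qed

end

lemma ac_zero_constant: "ac T x (\<lambda>_. 0) \<Longrightarrow> t \<in> {0..T} \<Longrightarrow> x t = x 0"
  using ac_eq[of T x "\<lambda>_. 0" t] by simp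

lemma AE_lebesgue_on_Ioo_exists:
  assumes T: "0 < (T::real)" and P: "AE t in lebesgue_on {0<..<T}. P t"
  shows "\<exists>t\<in>{0<..<T}. P t"
proof (rule ccontr)
  assume n: "\<not> (\<exists>t\<in>{0<..<T}. P t)"
  have "AE t in lebesgue. t \<in> {0<..<T} \<longrightarrow> P t" using P by (subst (asm) AE_restrict_space_iff) simp_all
  then have "AE t in lebesgue. t \<notin> {0<..<T}" by eventually_elim (use n in blast)
  then have "{0<..<T} \<in> null_sets lebesgue" by (subst (asm) AE_iff_null_sets[symmetric]) auto
  then show False using T by (auto simp: null_sets_def)
qed

text \<open>In the second conjunct \<open>U\<close> is any selection of solutions continuous into
  \<open>V\<close>, so no particular solution operator is fixed. That \<open>U\<close> takes the
  prescribed value at time 0 is not assumed but follows from continuity.\<close>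

theorem theorem4p2:
  fixes \<Omega> \<Omega>\<^sub>1 \<Omega>\<^sub>2 \<Gamma> S :: "(real ^ 'n) set"
    and b :: "real ^ 'n \<Rightarrow> real" and b\<^sub>1 b\<^sub>2 K T :: real
    and f :: "(real ^ 'n) L2 \<Rightarrow> (real ^ 'n) L2"
  assumes "CARD('n) \<ge> 2"
    and "open \<Omega>" "connected \<Omega>" "\<Omega> \<noteq> {}" "compact (closure \<Omega>)" "S = frontier \<Omega>"
    and "open \<Omega>\<^sub>1" "connected \<Omega>\<^sub>1" "\<Omega>\<^sub>1 \<noteq> {}"
    and "open \<Omega>\<^sub>2" "connected \<Omega>\<^sub>2" "\<Omega>\<^sub>2 \<noteq> {}"
    and "\<Gamma> \<subseteq> \<Omega>" "\<Gamma> = closure \<Omega>\<^sub>1 \<inter> closure \<Omega>\<^sub>2" "\<Omega> = \<Omega>\<^sub>1 \<union> \<Omega>\<^sub>2 \<union> \<Gamma>"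
    and "frontier \<Omega>\<^sub>1 = \<Gamma>" "frontier \<Omega>\<^sub>2 = S \<union> \<Gamma>"
    and "C2_hypersurface S" "C2_hypersurface \<Gamma>"
    and "b\<^sub>1 > 0" "b\<^sub>2 > 0"
    and "\<forall>x\<in>closure \<Omega>\<^sub>1. b x = b\<^sub>1" "\<forall>x\<in>\<Omega>\<^sub>2. b x = b\<^sub>2"
    and "f ` L2_on \<Omega> \<subseteq> L2_on \<Omega>" "\<exists>L. L-lipschitz_on (L2_on \<Omega>) f"
    and "K > 0" "\<forall>u\<in>L2_on \<Omega>. u \<bullet> f u \<le> K \<and> norm (f u) \<le> K"
    and "T > 0"
  shows "(\<forall>u\<^sub>0\<in>H1_0 \<Omega>. \<exists>u. is_solution \<Omega> b f T u\<^sub>0 u \<and>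
            C0_time T (H1_0 \<Omega>) (norm_H1 \<Omega>) u \<and> u 0 = u\<^sub>0 \<and>
            (\<forall>v. is_solution \<Omega> b f T u\<^sub>0 v \<longrightarrow> (AE t in lebesgue_on {0<..<T}. v t = u t)))
       \<and> (\<forall>U. (\<forall>u\<^sub>0\<in>H1_0 \<Omega>. is_solution \<Omega> b f T u\<^sub>0 (U u\<^sub>0) \<and>
                 C0_time T (H1_0 \<Omega>) (norm_H1 \<Omega>) (U u\<^sub>0))
            \<longrightarrow> (\<forall>t\<in>{0..T}. continuous_self_map (H1_0 \<Omega>) (norm_H1 \<Omega>) (\<lambda>u\<^sub>0. U u\<^sub>0 t)))"
proof -
  note \<Omega> = assms(2) and T = assms(28)
  define c0 where "c0 = min b\<^sub>1 b\<^sub>2"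
  define c1 where "c1 = max b\<^sub>1 b\<^sub>2"
  have c0: "0 < c0" and c1: "0 \<le> c1" unfolding c0_def c1_def using assms(20,21) by auto
  \<comment> \<open>The interface lies in the closure of the inner domain, so on it \<open>b\<close>
    has the value of that side.\<close>
  have bx: "b x = (if x \<in> closure \<Omega>\<^sub>1 then b\<^sub>1 else b\<^sub>2)" if "x \<in> \<Omega>" for x
  proof -
    have "x \<in> closure \<Omega>\<^sub>1 \<or> x \<in> \<Omega>\<^sub>2" using that assms(14,15) closure_subset[of \<Omega>\<^sub>1] by blast
    then show ?thesis using assms(22,23) by auto
  qed
  have b0: "c0 \<le> b x" and b1: "b x \<le> c1" if "x \<in> \<Omega>" for x
    using bx[OF that] unfolding c0_def c1_def by auto
  have "(\<lambda>x. indicator \<Omega> x * b x) = (\<lambda>x. indicator \<Omega> x * (b\<^sub>1 * indicator (closure \<Omega>\<^sub>1) x + b\<^sub>2 * indicator (- closure \<Omega>\<^sub>1) x))"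
    by (rule ext) (auto simp: indicator_def bx)
  also have "\<dots> \<in> borel_measurable lborel"
    using \<Omega> by (intro borel_measurable_times borel_measurable_add borel_measurable_const borel_measurable_indicator) auto
  finally have mb: "(\<lambda>x. indicator \<Omega> x * b x) \<in> borel_measurable lborel" .
  note form = \<Omega> mb c0 b0 b1 c1
  interpret closed_form "H1_0 \<Omega>" "diffusion_op \<Omega> b" by (rule closed_form_diffusion_op[OF form])
  let ?V = "H1_0 \<Omega>" and ?a = "diffusion_op \<Omega> b" and ?n = "norm_H1 \<Omega>"
  have H: "L2_on \<Omega> = H" unfolding H_def by (rule closure_H1_0[OF form, symmetric])
  have dom: "domain_A \<Omega> b = dom" unfolding domain_A_def dom_def represents_def H by blast
  have op: "op_A \<Omega> b = A" unfolding op_A_def[abs_def] A_def[abs_def] represents_def H ..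
  have nD: "norm_DA \<Omega> b = (\<lambda>v. norm (A v))" unfolding norm_DA_def[abs_def] op norm_eq_sqrt_inner ..
  obtain L where L: "L-lipschitz_on H f" using assms(25) unfolding H by blast
  have fH: "f ` H \<subseteq> H" using assms(24) unfolding H .
  have fK: "norm (f h) \<le> K" if "h \<in> H" for h using assms(27) that unfolding H by blast
  have T0: "0 \<le> T" using T by simp
  have grad: "c0 * grad_sq \<Omega> v \<le> ?a v v" "?a v v \<le> c1 * grad_sq \<Omega> v" if "v \<in> H1 \<Omega>" for v
    by (rule diffusion_op_bounds[OF form that]; assumption)+
  have VH1: "v \<in> H1 \<Omega>" if "v \<in> ?V" for v using that H1_0_subset_H1[OF \<Omega>] by blast
  have nsq: "?n v = sqrt ((norm v)\<^sup>2 + grad_sq \<Omega> v)" for v by (rule norm_H1_eq[OF \<Omega>])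
  have ga: "grad_sq \<Omega> v \<le> ?a v v / c0" if "v \<in> ?V" for v
    using grad(1)[OF VH1[OF that]] c0 by (simp add: pos_le_divide_eq mult.commute)
  have n_ge: "norm v \<le> ?n v" for v
    unfolding nsq by (rule real_le_rsqrt) (simp add: grad_sq_nonneg[OF \<Omega>])
  have C0V: "C0_time T ?V ?n u"
    if "\<And>t. t \<in> {0..T} \<Longrightarrow> u t \<in> ?V" "\<And>t. t \<in> {0..T} \<Longrightarrow> ((\<lambda>s. norm (u s - u t)) \<longlongrightarrow> 0) (at t within {0..T})"
      "\<And>t. t \<in> {0..T} \<Longrightarrow> ((\<lambda>s. ?a (u s - u t) (u s - u t)) \<longlongrightarrow> 0) (at t within {0..T})" for u
    unfolding C0_time_def
  proof (intro ballI conjI that(1))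
    fix t assume t: "t \<in> {0..T}"
    show "((\<lambda>s. ?n (u s - u t)) \<longlongrightarrow> 0) (at t within {0..T})"
    proof (rule Lim_null_comparison)
      show "\<forall>\<^sub>F s in at t within {0..T}. norm (?n (u s - u t)) \<le> sqrt ((norm (u s - u t))\<^sup>2 + ?a (u s - u t) (u s - u t) / c0)"
        unfolding eventually_at_filter
      proof (intro always_eventually allI impI)
        fix s assume s: "s \<in> {0..T}"
        have "?n (u s - u t) \<le> sqrt ((norm (u s - u t))\<^sup>2 + ?a (u s - u t) (u s - u t) / c0)"
          unfolding nsq by (intro real_sqrt_le_mono add_left_mono ga V_diff that(1) s t)
        then show "norm (?n (u s - u t)) \<le> sqrt ((norm (u s - u t))\<^sup>2 + ?a (u s - u t) (u s - u t) / c0)"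
          using order_trans[OF norm_ge_zero n_ge, of "u s - u t"] by simp
      qed
      have "((\<lambda>s. sqrt ((norm (u s - u t))\<^sup>2 + ?a (u s - u t) (u s - u t) / c0)) \<longlongrightarrow> sqrt (0\<^sup>2 + 0 / c0)) (at t within {0..T})"
        by (intro tendsto_real_sqrt tendsto_add tendsto_power tendsto_divide tendsto_const that(2,3) t) (use c0 in simp)
      then show "((\<lambda>s. sqrt ((norm (u s - u t))\<^sup>2 + ?a (u s - u t) (u s - u t) / c0)) \<longlongrightarrow> 0) (at t within {0..T})" by simp
    qed
  qed
  have C0H: "C0_time T H norm u" if "C0_time T ?V ?n u" for u
    unfolding C0_time_def
  proof (intro ballI conjI)
    fix t assume t: "t \<in> {0..T}"
    show "u t \<in> H" using that t V_subset_H unfolding C0_time_def by blast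
    have "((\<lambda>s. ?n (u s - u t)) \<longlongrightarrow> 0) (at t within {0..T})" using that t unfolding C0_time_def by blast
    then show "((\<lambda>s. norm (u s - u t)) \<longlongrightarrow> 0) (at t within {0..T})"
      by (rule Lim_null_comparison[rotated]) (intro always_eventually allI, simp add: n_ge)
  qed
  have sol: "is_solution \<Omega> b f T u0 u \<longleftrightarrow> L2_time T dom norm_D u \<and>
     (\<exists>u'. weak_time_deriv T u u' \<and> L2_time T H norm u' \<and> (AE t in lebesgue_on {0<..<T}. u' t + A (u t) = f (u t))) \<and>
     (\<exists>v. C0_time T H norm v \<and> (AE t in lebesgue_on {0<..<T}. v t = u t) \<and> v 0 = u0)" for u0 u
    unfolding is_solution_def dom op nD H ..
  have rep: "\<exists>v u' y. strong_solution T f v u' y \<and> v 0 = u0 \<and> (AE t in lebesgue_on {0<..<T}. v t = u t)"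
    if "is_solution \<Omega> b f T u0 u" for u0 u
  proof -
    obtain u' v where "L2_time T dom norm_D u" "weak_time_deriv T u u'" "L2_time T H norm u'"
      "AE t in lebesgue_on {0<..<T}. u' t + A (u t) = f (u t)"
      and v: "C0_time T H norm v" "AE t in lebesgue_on {0<..<T}. v t = u t" "v 0 = u0"
      using \<open>is_solution \<Omega> b f T u0 u\<close> unfolding sol by blast
    from strong_solution_of_weak[OF T this(1-4) v(1,2)] v(2,3) show ?thesis by blast
  qed
  \<comment> \<open>The initial condition in \<open>is_solution\<close> concerns some representative
    \<open>v\<close>. Both \<open>u\<close> and \<open>v\<close> are primitives of
    \<open>u'\<close>, so they differ by a constant, and one time at which they agree makes it
    0.\<close>
  have rep_V: "\<exists>u' y. strong_solution T f u u' y \<and> u 0 = u0"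
    if s: "is_solution \<Omega> b f T u0 u" and c: "C0_time T ?V ?n u" for u0 u
  proof -
    obtain u' v where u: "L2_time T dom norm_D u" "weak_time_deriv T u u'" "L2_time T H norm u'"
      "AE t in lebesgue_on {0<..<T}. u' t + A (u t) = f (u t)"
      and v: "C0_time T H norm v" "AE t in lebesgue_on {0<..<T}. v t = u t" "v 0 = u0"
      using s unfolding sol by blast
    obtain y where y: "strong_solution T f u u' y" using strong_solution_of_weak[OF T u C0H[OF c]] by auto
    obtain z where z: "strong_solution T f v u' z" using strong_solution_of_weak[OF T u v(1,2)] by blast
    have "ac T (\<lambda>t. v t - u t) (\<lambda>t. u' t - u' t)" using y z unfolding strong_solution_def by (blast intro: ac_diff)
    then have "ac T (\<lambda>t. v t - u t) (\<lambda>t. 0)" by simp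
    note const = ac_zero_constant[OF this]
    obtain t where t: "t \<in> {0<..<T}" "v t = u t" using AE_lebesgue_on_Ioo_exists[OF T v(2)] by blast
    have "v 0 - u 0 = v t - u t" using const[of t] t(1) by simp
    then show ?thesis using y v(3) t(2) by auto
  qed
  have sol_weak: "is_solution \<Omega> b f T u0 u \<and> C0_time T ?V ?n u"
    if s: "strong_solution T f u u' y" and u0: "u 0 = u0" "u0 \<in> ?V" for u0 u u' y
  proof -
    note w = strong_solution_imp_weak[OF T fH s] u0
    have cV: "C0_time T ?V ?n u" by (rule C0V) (use w in simp_all)
    then show ?thesis unfolding sol using w C0H[OF cV] by auto
  qed
  show ?thesis
  proof (intro conjI ballI allI impI)
    fix u0 assume u0: "u0 \<in> ?V"
    obtain u u' y where u: "strong_solution T f u u' y" "u 0 = u0"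
      using strong_solution_exists[OF T0 L fH fK u0] by blast
    have "AE t in lebesgue_on {0<..<T}. v t = u t" if "is_solution \<Omega> b f T u0 v" for v
    proof -
      obtain w w' z where w: "strong_solution T f w w' z" "w 0 = u0" "AE t in lebesgue_on {0<..<T}. w t = v t"
        using rep[OF \<open>is_solution \<Omega> b f T u0 v\<close>] by blast
      have uw: "u t = w t" if "t \<in> {0..T}" for t
        using strong_solution_difference(1)[OF T0 L fH u(1) _ w(1) _ that] u0 unfolding u(2) w(2) by simp
      show ?thesis
        using w(3) unfolding AE_lebesgue_on_Ioo_iff by eventually_elim (use uw in auto)
    qed
    then show "\<exists>u. is_solution \<Omega> b f T u0 u \<and> C0_time T ?V ?n u \<and> u 0 = u0 \<and>
        (\<forall>v. is_solution \<Omega> b f T u0 v \<longrightarrow> (AE t in lebesgue_on {0<..<T}. v t = u t))"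
      using sol_weak[OF u u0] u(2) by blast
  next
    fix U t
    assume U: "\<forall>u0\<in>?V. is_solution \<Omega> b f T u0 (U u0) \<and> C0_time T ?V ?n (U u0)" and t: "t \<in> {0..T}"
    define E where "E = exp (2 * L * T)"
    \<comment> \<open>\<open>E\<close> comes from the estimate in norm. The fraction comes from the
      estimate of the form: \<open>c1\<close> bounds the initial form by the gradient, and division
      by \<open>c0\<close> returns from the form to the gradient.\<close>
    define C where "C = E + (c1 + T * L\<^sup>2 * E) / c0"
    have E0: "0 < E" unfolding E_def by simp
    have "0 \<le> (c1 + T * L\<^sup>2 * E) / c0" using c0 c1 T0 E0 by (intro divide_nonneg_pos add_nonneg_nonneg mult_nonneg_nonneg) auto
    then have C0: "0 < C" unfolding C_def using E0 by linarith
    have est: "?n (U v t - U u t) \<le> sqrt C * ?n (v - u)" if uv: "u \<in> ?V" "v \<in> ?V" for u v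
    proof -
      obtain u' y where u: "strong_solution T f (U u) u' y" "U u 0 = u" using rep_V U uv(1) by blast
      obtain v' z where v: "strong_solution T f (U v) v' z" "U v 0 = v" using rep_V U uv(2) by blast
      have 0: "U u 0 \<in> ?V" "U v 0 \<in> ?V" using uv u(2) v(2) by auto
      let ?w = "U v t - U u t" and ?z = "v - u"
      have w: "?w \<in> ?V" using U uv t unfolding C0_time_def by (blast intro: V_diff)
      note d = strong_solution_difference[OF T0 L fH v(1) 0(2) u(1) 0(1) t, unfolded u(2) v(2), folded E_def]
      have g0: "0 \<le> grad_sq \<Omega> ?z" by (rule grad_sq_nonneg[OF \<Omega>])
      have "?a ?w ?w \<le> c1 * grad_sq \<Omega> ?z + T * L\<^sup>2 * E * (norm ?z)\<^sup>2"
        using d(2) grad(2)[OF VH1[OF V_diff[OF uv(2,1)]]] by linarith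
      also have "\<dots> \<le> (c1 + T * L\<^sup>2 * E) * ((norm ?z)\<^sup>2 + grad_sq \<Omega> ?z)"
      proof -
        have "0 \<le> c1 * (norm ?z)\<^sup>2" "0 \<le> T * L\<^sup>2 * E * grad_sq \<Omega> ?z"
          using c1 T0 E0 g0 by (auto intro!: mult_nonneg_nonneg)
        then show ?thesis by (simp add: algebra_simps)
      qed
      finally have "?a ?w ?w / c0 \<le> (c1 + T * L\<^sup>2 * E) * ((norm ?z)\<^sup>2 + grad_sq \<Omega> ?z) / c0"
        using c0 by (intro divide_right_mono) auto
      then have "(norm ?w)\<^sup>2 + grad_sq \<Omega> ?w \<le> E * (norm ?z)\<^sup>2 + (c1 + T * L\<^sup>2 * E) / c0 * ((norm ?z)\<^sup>2 + grad_sq \<Omega> ?z)"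
        using d(1) ga[OF w] by simp
      also have "E * (norm ?z)\<^sup>2 \<le> E * ((norm ?z)\<^sup>2 + grad_sq \<Omega> ?z)"
        using E0 g0 by (intro mult_left_mono) auto
      finally have "(norm ?w)\<^sup>2 + grad_sq \<Omega> ?w \<le> C * ((norm ?z)\<^sup>2 + grad_sq \<Omega> ?z)"
        unfolding C_def by (simp add: distrib_right)
      then show ?thesis unfolding nsq real_sqrt_mult[symmetric] by (rule real_sqrt_le_mono)
    qed
    show "continuous_self_map ?V ?n (\<lambda>u0. U u0 t)"
      unfolding continuous_self_map_def
    proof (intro ballI conjI allI impI)
      fix u assume u: "u \<in> ?V"
      show "U u t \<in> ?V" using U u t unfolding C0_time_def by blast
      fix e :: real assume e: "e > 0"
      show "\<exists>d>0. \<forall>v\<in>?V. ?n (v - u) < d \<longrightarrow> ?n (U v t - U u t) < e"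
      proof (intro exI[of _ "e / sqrt C"] conjI ballI impI)
        show "0 < e / sqrt C" using e C0 by simp
        fix v assume v: "v \<in> ?V" "?n (v - u) < e / sqrt C"
        have "sqrt C * ?n (v - u) < sqrt C * (e / sqrt C)" by (rule mult_strict_left_mono[OF v(2)]) (use C0 in simp)
        also have "\<dots> = e" using C0 by simp
        finally show "?n (U v t - U u t) < e" using est[OF u v(1)] by linarith
      qed
    qed
  qed
qed

end
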